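(* Let $G$ be a graph with labeled vertices $0,1,z$ and $G_1$ obtained by making the vertex $z$ internal and attaching a new vertex $z$ to it by an edge. Assume: $f^{(1)}_{G_1}$ is real analytic on $\mathbb{C}\setminus\{0,1\}$; as functions on $\mathbb{R}^4$, both $z\mapsto f^{(1)}_{G_1}(z)$ and $z\mapsto f^{(1)}_{G_1}(e_1-z)$ lie in $\mathcal{C}^{(1)}_{1,1}$; and $$f^{(1)}_G(z)=\sum_{a,b\in\{0,1\}}\frac{g_{a,b}(z)}{(z-a)(\bar z-b)(z-\bar z)}$$ with $g_{a,b}\in\mathcal{P}$, and $f^{(1)}_G\in\mathcal{B}$. Then $$f^{(1)}_{G_1}(z)=-\frac{1}{2(z-\bar z)}\Big(\int_0dz\int_0d\bar z+\int_0d\bar z\int_0dz\Big)(z-\bar z)f^{(1)}_G(z),$$ and $f^{(1)}_{G_1}$ is the unique element of $\mathcal{B}^0$ solving $-\frac{1}{z-\bar z}\partial_z\partial_{\bar z}(z-\bar z)F=f^{(1)}_G$.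
   Context: Four-dimensional graphical function: $f^{(1)}_G(z)=\prod_{v\notin\{0,1,z\}}\int_{\mathbb{R}^4}\frac{d^4x_v}{\pi^2}\prod_e\|x_e-y_e\|^{-2}$, with $0$ the origin, $1$ a unit vector $e_1$, regarded as function of $z\in\mathbb{C}$ ($e_1\leftrightarrow1$). Gegenbauer polynomials: $(1-2xt+t^2)^{-\lambda}=\sum_nC^{(\lambda)}_n(x)t^n$. For $p,q\in\mathbb{Z}$, $\mathcal{C}^{(\lambda)}_{p,q}$ is the class of $f:\mathbb{R}^d\to\mathbb{R}$ such that for some $L\in\mathbb{N}$, $A,B,\alpha,\beta>0$: $f(z)=\sum_{\ell=0}^L\sum_{m\ge0}\sum_{n=0}^ma_{\ell,m,n}(\ln\|z\|)^\ell\|z\|^{m-p}C^{(\lambda)}_n(\cos\angle(z,e_1))$ for $\|z\|<1$ and $f(z)=\sum_{\ell=0}^L\sum_{m\ge0}\sum_{n=0}^mb_{\ell,m,n}(\ln\|z\|)^\ell\|z\|^{-m-q}C^{(\lambda)}_n(\cos\angle(z,e_1))$ for $\|z\|>1$, with $|a_{\ell,m,n}|\le Am^\alpha$, $|b_{\ell,m,n}|\le Bm^\beta$. $\mathcal{P}$ is the $\mathbb{C}$-span of Brown's single-valued multiple polylogarithms $P_w$ (single-valued functions on $\mathbb{C}\setminus\{0,1\}$, linear combinations of $L_u(\bar z)L_v(z)$, with $\partial_zP_{wa}=P_w/(z-a)$, $P_\emptyset=1$, $P_{0^{\{n\}}}=(\ln z\bar z)^n/n!$, $P_w\to0$ at $0$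 for $w\ne0^{\{n\}}$), and $\mathcal{A}=\mathbb{C}[z,\frac1z,\frac1{z-1},\bar z,\frac1{\bar z},\frac1{\bar z-1}]\mathcal{P}$. $\mathcal{B}$ (resp. $\mathcal{B}^0$) is the set of functions $g(z)/(z-\bar z)$ with $g\in\mathcal{A}$ (resp. $g\in\mathcal{P}$) and $g(\bar z)=-g(z)$. $\int_0dz$ and $\int_0d\bar z$ denote the primitives in $\mathcal{A}$ w.r.t. $z$ resp. $\bar z$ whose regularized value at $0$ vanishes (for $\frac{P}{z-a}$, $P\in\mathcal{P}$, the unique primitive in the span of $P_w$, $|w|\ge1$; extended to $\mathcal{A}$ by partial fractions). *)

theory Defs
  imports "HOL-Analysis.Analysis"
begin

definition wirt_dz :: "(complex \<Rightarrow> complex) \<Rightarrow> complex \<Rightarrow> complex" where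
  "wirt_dz h z = (vector_derivative (\<lambda>t::real. h (z + of_real t)) (at 0)
                  - \<i> * vector_derivative (\<lambda>t::real. h (z + \<i> * of_real t)) (at 0)) / 2"

definition wirt_dzb :: "(complex \<Rightarrow> complex) \<Rightarrow> complex \<Rightarrow> complex" where
  "wirt_dzb h z = (vector_derivative (\<lambda>t::real. h (z + of_real t)) (at 0)
                  + \<i> * vector_derivative (\<lambda>t::real. h (z + \<i> * of_real t)) (at 0)) / 2"

section \<open>Multiple polylogarithms L_w (letters in {0,1}, last letter differentiated)\<close>

text \<open>The slit plane C minus ((-inf,0] union [1,inf)) on which the principal branches live.\<close>
definition slit :: "complex set" where
  "slit = - ({x. Im x = 0 \<and> Re x \<le> 0} \<union> {x. Im x = 0 \<and> Re x \<ge> 1})"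

text \<open>Lr operates on reversed words: Lr (a # w) is L of the word (rev w) @ [a].
  L of 0^n is (log z)^n/n!, otherwise L_{w a}(z) is the integral from 0 to z of L_w(t)/(t-a) dt
  (along the straight segment), so that d/dz L_{wa} = L_w/(z-a) and L_w vanishes at 0.\<close>
fun Lr :: "complex list \<Rightarrow> complex \<Rightarrow> complex" where
  "Lr [] z = 1"
| "Lr (a # w) z =
     (if (\<forall>b\<in>set (a # w). b = 0) then (Ln z) ^ (Suc (length w)) / of_nat (fact (Suc (length w)))
      else integral {0..1} (\<lambda>t::real. Lr w (of_real t * z) * z / (of_real t * z - a)))"

definition mpl :: "complex list \<Rightarrow> complex \<Rightarrow> complex" where
  "mpl w z = Lr (rev w) z"

definition svmpl_family :: "(complex list \<Rightarrow> complex \<Rightarrow> complex) \<Rightarrow> bool" where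
  "svmpl_family P \<longleftrightarrow>
     (\<forall>w. \<not> set w \<subseteq> {0,1} \<longrightarrow> P w = (\<lambda>_. 0))
   \<and> (\<forall>w z. z \<in> {0,1} \<longrightarrow> P w z = 0)
   \<and> (\<forall>w. set w \<subseteq> {0,1} \<longrightarrow>
         continuous_on (- {0,1}) (P w) \<and> (\<forall>z. z \<notin> {0,1} \<longrightarrow> P w differentiable (at z)))
   \<and> (\<forall>w. set w \<subseteq> {0,1} \<longrightarrow>
         (\<exists>S c. finite S \<and> (\<forall>(u,v)\<in>S. set u \<subseteq> {0,1} \<and> set v \<subseteq> {0,1}) \<and>
            (\<forall>z\<in>slit. P w z = (\<Sum>(u,v)\<in>S. c (u,v) * mpl u (cnj z) * mpl v z))))
   \<and> (\<forall>z. z \<notin> {0,1} \<longrightarrow> P [] z = 1)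
   \<and> (\<forall>n z. z \<notin> {0,1} \<longrightarrow>
         P (replicate n 0) z = complex_of_real ((ln ((cmod z)\<^sup>2)) ^ n / fact n))
   \<and> (\<forall>w a. set w \<subseteq> {0,1} \<longrightarrow> a \<in> {0,1} \<longrightarrow>
         (\<forall>z. z \<notin> {0,1} \<longrightarrow> wirt_dz (P (w @ [a])) z = P w z / (z - a)))
   \<and> (\<forall>w. set w \<subseteq> {0,1} \<longrightarrow> \<not> (\<forall>b\<in>set w. b = 0) \<longrightarrow> (P w \<longlongrightarrow> 0) (at 0))"

definition svmpl :: "complex list \<Rightarrow> complex \<Rightarrow> complex" where
  "svmpl = (THE P. svmpl_family P)"

definition svP :: "(complex \<Rightarrow> complex) set" where
  "svP = {f. \<exists>S c. finite S \<and> (\<forall>w\<in>S. set w \<subseteq> {0,1}) \<and>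
                (\<forall>z. z \<notin> {0,1} \<longrightarrow> f z = (\<Sum>w\<in>S. c w * svmpl w z))}"

definition svP_pos :: "(complex \<Rightarrow> complex) set" where
  "svP_pos = {f. \<exists>S c. finite S \<and> (\<forall>w\<in>S. w \<noteq> [] \<and> set w \<subseteq> {0,1}) \<and>
                f = (\<lambda>z. \<Sum>w\<in>S. c w * svmpl w z)}"

definition svA :: "(complex \<Rightarrow> complex) set" where
  "svA = {f. \<exists>(n::nat) (ka::nat\<Rightarrow>int) (kb::nat\<Rightarrow>int) (kc::nat\<Rightarrow>int) (kd::nat\<Rightarrow>int) p. (\<forall>i<n. p i \<in> svP) \<and>
            (\<forall>z. z \<notin> {0,1} \<longrightarrow> f z = (\<Sum>i<n. z powi ka i * (z - 1) powi kb i
                   * cnj z powi kc i * (cnj z - 1) powi kd i * p i z))}"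

definition svB :: "(complex \<Rightarrow> complex) set" where
  "svB = {F. \<exists>g\<in>svA. (\<forall>z. z \<notin> {0,1} \<longrightarrow> g (cnj z) = - g z) \<and>
               (\<forall>z. Im z \<noteq> 0 \<longrightarrow> F z = g z / (z - cnj z))}"

definition svB0 :: "(complex \<Rightarrow> complex) set" where
  "svB0 = {F. \<exists>g\<in>svP. (\<forall>z. z \<notin> {0,1} \<longrightarrow> g (cnj z) = - g z) \<and>
               (\<forall>z. Im z \<noteq> 0 \<longrightarrow> F z = g z / (z - cnj z))}"

text \<open>Primitives: int_0 dz of p/(z-a) and int_0 dzbar of p/(zbar-b), p in P:
  the unique primitive in the span of the P_w with |w| >= 1.\<close>
definition prim_z :: "complex \<Rightarrow> (complex \<Rightarrow> complex) \<Rightarrow> complex \<Rightarrow> complex" where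
  "prim_z a p = (THE F. F \<in> svP_pos \<and> (\<forall>z. z \<notin> {0,1} \<longrightarrow> wirt_dz F z = p z / (z - a)))"

definition prim_zb :: "complex \<Rightarrow> (complex \<Rightarrow> complex) \<Rightarrow> complex \<Rightarrow> complex" where
  "prim_zb b p = (THE F. F \<in> svP_pos \<and> (\<forall>z. z \<notin> {0,1} \<longrightarrow> wirt_dzb F z = p z / (cnj z - b)))"

definition pde_op :: "(complex \<Rightarrow> complex) \<Rightarrow> complex \<Rightarrow> complex" where
  "pde_op F z = - (1 / (z - cnj z)) * wirt_dz (wirt_dzb (\<lambda>u. (u - cnj u) * F u)) z"

definition e1 :: "real^4" where "e1 = axis 1 1"

definition embC :: "complex \<Rightarrow> real^4" where
  "embC z = (\<chi> i. if i = 1 then Re z else if i = 2 then Im z else 0)"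

definition vpos :: "'v \<Rightarrow> 'v \<Rightarrow> 'v \<Rightarrow> real^4 \<Rightarrow> ('v \<Rightarrow> real^4) \<Rightarrow> 'v \<Rightarrow> real^4" where
  "vpos v0 v1 vz y x v = (if v = v0 then 0 else if v = v1 then e1 else if v = vz then y else x v)"

text \<open>Graph: vertex set V, edge list E (multi-edges allowed), external vertices v0, v1, vz;
  the external vertex vz is placed at y in R^4.\<close>
definition gf_nn :: "'v set \<Rightarrow> ('v \<times> 'v) list \<Rightarrow> 'v \<Rightarrow> 'v \<Rightarrow> 'v \<Rightarrow> real^4 \<Rightarrow> ennreal" where
  "gf_nn V E v0 v1 vz y =
     ennreal ((1 / pi\<^sup>2) ^ card (V - {v0, v1, vz})) *
     (\<integral>\<^sup>+ x. prod_list (map (\<lambda>e. ennreal (1 / (norm (vpos v0 v1 vz y x (fst e) - vpos v0 v1 vz y x (snd e)))\<^sup>2)) E)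
        \<partial>(PiM (V - {v0, v1, vz}) (\<lambda>_. lborel)))"

definition gf :: "'v set \<Rightarrow> ('v \<times> 'v) list \<Rightarrow> 'v \<Rightarrow> 'v \<Rightarrow> 'v \<Rightarrow> real^4 \<Rightarrow> real" where
  "gf V E v0 v1 vz y = enn2real (gf_nn V E v0 v1 vz y)"

definition gfC :: "'v set \<Rightarrow> ('v \<times> 'v) list \<Rightarrow> 'v \<Rightarrow> 'v \<Rightarrow> 'v \<Rightarrow> complex \<Rightarrow> complex" where
  "gfC V E v0 v1 vz z = complex_of_real (gf V E v0 v1 vz (embC z))"

definition real_analytic_on_C :: "(complex \<Rightarrow> real) \<Rightarrow> complex set \<Rightarrow> bool" where
  "real_analytic_on_C f S \<longleftrightarrow> (\<forall>z0\<in>S. \<exists>r>0. \<exists>c :: nat \<Rightarrow> nat \<Rightarrow> real.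
      \<forall>z. cmod (z - z0) < r \<longrightarrow>
        ((\<lambda>(i,j). c i j * (Re z - Re z0) ^ i * (Im z - Im z0) ^ j) has_sum f z) UNIV)"

definition gegenbauer :: "real \<Rightarrow> nat \<Rightarrow> real \<Rightarrow> real" where
  "gegenbauer lam n x = (deriv ^^ n) (\<lambda>t. (1 - 2 * x * t + t\<^sup>2) powr (- lam)) 0 / fact n"

definition cosang :: "real^4 \<Rightarrow> real" where
  "cosang z = inner z e1 / norm z"

definition classC :: "real \<Rightarrow> int \<Rightarrow> int \<Rightarrow> (real^4 \<Rightarrow> real) \<Rightarrow> bool" where
  "classC lam p q f \<longleftrightarrow> (\<exists>(L::nat) (A::real) (B::real) (\<alpha>::real) (\<beta>::real)
       (a :: nat \<Rightarrow> nat \<Rightarrow> nat \<Rightarrow> real) (b :: nat \<Rightarrow> nat \<Rightarrow> nat \<Rightarrow> real).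
     A > 0 \<and> B > 0 \<and> \<alpha> > 0 \<and> \<beta> > 0 \<and>
     (\<forall>l m n. m \<ge> 1 \<longrightarrow> \<bar>a l m n\<bar> \<le> A * real m powr \<alpha>) \<and>
     (\<forall>l m n. m \<ge> 1 \<longrightarrow> \<bar>b l m n\<bar> \<le> B * real m powr \<beta>) \<and>
     (\<forall>z. 0 < norm z \<and> norm z < 1 \<longrightarrow>
        (\<lambda>m. \<Sum>l\<le>L. \<Sum>n\<le>m. a l m n * (ln (norm z)) ^ l * norm z powr (real m - of_int p)
               * gegenbauer lam n (cosang z)) sums f z) \<and>
     (\<forall>z. norm z > 1 \<longrightarrow>
        (\<lambda>m. \<Sum>l\<le>L. \<Sum>n\<le>m. b l m n * (ln (norm z)) ^ l * norm z powr (- real m - of_int q)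
               * gegenbauer lam n (cosang z)) sums f z))"

end

theory Submission
  imports Defs "HOL-Complex_Analysis.Complex_Analysis" "HOL-Probability.Distributions" "HOL-Real_Asymp.Real_Asymp"
begin

text \<open>
  A function in \<open>svP\<close> is a finite sum of \<open>c u v * L_u(cnj z) * L_v(z)\<close> whose coefficients
  satisfy linear conditions expressing single-valuedness around \<open>0\<close> and \<open>1\<close>. By the linear
  independence of the \<open>L_w\<close> over rational functions, these coefficients are determined by the function,
  and for such families one can integrate formally: prepending a letter to \<open>v\<close> (or \<open>u\<close>) and
  solving for the terms with \<open>v = []\<close> (or \<open>u = []\<close>) yields the primitives.
  Hence half the sum over both orders of integration of \<open>(z - cnj z) f_G\<close> is, up to sign, an
  antisymmetric \<open>Q \<in> svP\<close> with \<open>\<partial>\<close> \<open>cnj \<partial>\<close> \<open>Q = - (z - cnj z) f_G\<close>.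

  On the other side, \<open>f_G1\<close> is the Newtonian potential of \<open>f_G\<close> on four-space. Smoothing it with a
  Gaussian of variance tending to zero gives Poisson's equation pointwise, without differentiating
  under the integral. In terms of the axial coordinate \<open>z\<close> it says that \<open>H = (z - cnj z) f_G1\<close>
  satisfies the same equation as \<open>Q\<close>.

  Thus \<open>D = H - Q\<close> is harmonic off the real axis, of class \<open>C^1\<close> on the real axis minus \<open>{0,1}\<close> and
  antisymmetric under conjugation. The Gegenbauer expansions bound \<open>H\<close>, and the logarithmic growth of
  the \<open>L_w\<close> bounds \<open>Q\<close>, by fractional powers at \<open>0\<close>, \<open>1\<close> and infinity; a Liouville argument forces \<open>D = 0\<close>.
  The same argument gives uniqueness in \<open>svB0\<close>.
\<close>

section \<open>Iterated primitives\<close>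

text \<open>Continuing \<open>Lr\<close> across a cut changes it by a deconcatenation with constants
  \<open>monok\<close>. Besides \<open>monok i [] = 1\<close>, all that enters about these constants
  is \<open>monok i [i] \<noteq> 0\<close>, \<open>monok i [1 - i] = 0\<close> and the vanishing of
  \<open>monok 0\<close> on words with a letter 1. This triangularity makes the equations for the
  missing terms solvable by descent on the word length, the last letter selecting the cut;
  associators never appear. Both orders of integration occur because conjugation exchanges them, so
  that only their mean is antisymmetric. Poisson's equation lives on four-space, the regularity of
  \<open>f_G1\<close> on a plane. Axial symmetry links the two: the Laplacian becomes F_xx + F_yy +
  (2/y) F_y, and the factor \<open>z - cnj z\<close> removes the first-order term. In the Liouville
  step \<open>D\<close> is O(r^(-1/4)) at 0 and 1, so its gradient is O(r^(-5/4)), and z (z - 1)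
  times the holomorphic derivative of \<open>D\<close> is a polynomial of degree at most one. Simple
  poles at 0 and 1 survive all growth bounds; they correspond to the arguments of z and of 1 - z,
  and are excluded because \<open>D\<close> is single valued and vanishes on the real axis.\<close>

definition words :: "complex list set" where
  "words = {w. set w \<subseteq> {0,1}}"

lemma words_Nil [simp]: "[] \<in> words" and words_Cons [simp]: "a # w \<in> words \<longleftrightarrow> a \<in> {0,1} \<and> w \<in> words"
  and words_append [simp]: "u @ v \<in> words \<longleftrightarrow> u \<in> words \<and> v \<in> words"
  and words_rev [simp]: "rev w \<in> words \<longleftrightarrow> w \<in> words"
  by (auto simp: words_def)

lemma words_take: "w \<in> words \<Longrightarrow> take j w \<in> words" and words_drop: "w \<in> words \<Longrightarrow> drop j w \<in> words"
  using set_take_subset[of j w] set_drop_subset[of j w] by (auto simp: words_def)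

text \<open>Words are read in reverse, as in \<^const>\<open>Lr\<close>; the branch of the logarithm is a parameter, so that
  the same recursion describes the continuation across the negative axis.\<close>
fun Lg :: "(complex \<Rightarrow> complex) \<Rightarrow> complex list \<Rightarrow> complex \<Rightarrow> complex" where
  "Lg l [] z = 1"
| "Lg l (a # w) z =
     (if (\<forall>b\<in>set (a # w). b = 0) then (l z) ^ (Suc (length w)) / of_nat (fact (Suc (length w)))
      else integral {0..1} (\<lambda>t::real. Lg l w (of_real t * z) * z / (of_real t * z - a)))"

lemma Lr_eq_Lg: "Lr w z = Lg Ln w z"
  by (induction w arbitrary: z) auto

text \<open>Two star conditions with different roles: \<open>starlike_D\<close> has its centre
  inside \<open>D\<close> and yields primitives, while \<open>scale_D\<close> concerns the rays from
  the boundary point 0 along which \<open>Lg\<close> integrates.\<close>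

locale log_domain =
  fixes D :: "complex set" and l :: "complex \<Rightarrow> complex"
  assumes open_D: "open D" and starlike_D: "starlike D"
    and zero_notin: "0 \<notin> D" and one_notin: "1 \<notin> D"
    and scale_D: "\<And>z t. z \<in> D \<Longrightarrow> 0 < t \<Longrightarrow> t \<le> 1 \<Longrightarrow> complex_of_real t * z \<in> D"
    and l_deriv: "\<And>z. z \<in> D \<Longrightarrow> (l has_field_derivative 1 / z) (at z)"
    and l_bound: "\<exists>B. \<forall>z\<in>D. cmod (l z) \<le> \<bar>ln (cmod z)\<bar> + B"
begin

text \<open>The substitution t = s^2 turns the singularity |z|^(-1/2) of \<open>\<phi>\<close> at 0
  into a bounded derivative, so \<open>\<Psi>\<close> is Lipschitz in s along the ray and has a
  limit at 0. This limit stands in for the missing boundary value in the fundamental theorem of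
  calculus.\<close>

lemma ray_limit:
  assumes phi: "\<phi> holomorphic_on D" and Psi: "\<And>z. z \<in> D \<Longrightarrow> (\<Psi> has_field_derivative \<phi> z) (at z)"
    and bd: "\<And>z. z \<in> D \<Longrightarrow> cmod z \<le> 1/2 \<Longrightarrow> cmod (\<phi> z) \<le> C * cmod z powr (-1/2)"
    and z: "z \<in> D"
  obtains L where "((\<lambda>t. \<Psi> (of_real t * z)) \<longlongrightarrow> L) (at_right 0)"
    and "((\<lambda>t. \<phi> (of_real t * z) * z) has_integral (\<Psi> z - L)) {0..1}"
    and "cmod z \<le> 1/2 \<Longrightarrow> cmod (\<Psi> z - L) \<le> 2 * C * cmod z powr (1/2)"
proof -
  have z0: "cmod z > 0" using z zero_notin by auto
  \<comment> \<open>Up to \<open>s0\<close> the point s^2 z has modulus at most 1/2, where the bound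
    on \<open>\<phi>\<close> is available.\<close>
  define s0 where "s0 = min 1 (sqrt (1 / (2 * cmod z)))"
  have s0: "s0 > 0" "s0 \<le> 1" using z0 by (auto simp: s0_def)
  have s0z: "s^2 * cmod z \<le> 1/2" if "0 < s" "s \<le> s0" for s
  proof -
    have "s\<^sup>2 \<le> (sqrt (1 / (2 * cmod z)))\<^sup>2"
      using that s0 by (intro power_mono) (auto simp: s0_def)
    also have "\<dots> = 1 / (2 * cmod z)" using z0 by simp
    finally show ?thesis using z0 by (simp add: field_simps)
  qed
  define K where "K = 2 * C * cmod z powr (1/2)"
  define g where "g s = \<Psi> (of_real (s^2) * z)" for s :: real
  have inD: "of_real (s^2) * z \<in> D" if "0 < s" "s \<le> 1" for s :: real
    using scale_D[OF z, of "s^2"] that by (auto simp: power_le_one)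
  have gd: "(g has_vector_derivative (of_real (2 * s) * z * \<phi> (of_real (s^2) * z))) (at s within S)"
    if "0 < s" "s \<le> 1" for s :: real and S
  proof -
    have "((\<lambda>s::real. s^2) has_real_derivative 2 * s) (at s within S)"
      by (auto intro!: derivative_eq_intros)
    from has_vector_derivative_mult_left[OF has_vector_derivative_of_real[OF this], of z]
    have "((\<lambda>s::real. of_real (s^2) * z) has_vector_derivative (of_real (2 * s) * z)) (at s within S)" .
    from field_vector_diff_chain_within[OF this, of \<Psi>] Psi[OF inD[OF that]]
    show ?thesis unfolding g_def o_def by (auto intro: has_field_derivative_at_within)
  qed
  have gK: "cmod (of_real (2 * s) * z * \<phi> (of_real (s^2) * z)) \<le> K" if "0 < s" "s \<le> s0" for s
  proof -
    have "cmod (of_real (s^2) * z) \<le> 1/2" using s0z[OF that] by (simp add: norm_mult norm_power)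
    from bd[OF inD this] that s0 have "cmod (\<phi> (of_real (s^2) * z)) \<le> C * (s^2 * cmod z) powr (-1/2)"
      by (simp add: norm_mult norm_power)
    also have "(s^2 * cmod z) powr (-1/2) = 1 / s * cmod z powr (-1/2)"
    proof -
      have "(s^2) powr (-1/2) = (s powr 2) powr (-1/2)" using that by simp
      also have "\<dots> = 1 / s" unfolding powr_powr using that by (simp add: powr_minus_divide)
      finally show ?thesis using z0 by (simp add: powr_mult)
    qed
    finally have "2 * s * cmod z * cmod (\<phi> (of_real (s^2) * z)) \<le> 2 * s * cmod z * (C * (1 / s * cmod z powr (-1/2)))"
      using that by (intro mult_left_mono) auto
    also have "\<dots> = 2 * C * (cmod z powr 1 * cmod z powr (-1/2))" using that z0 by (simp add: field_simps)
    also have "\<dots> = K" unfolding K_def powr_add[symmetric] by simp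
    finally show ?thesis using that by (simp add: norm_mult)
  qed
  have K0: "K \<ge> 0" using gK[of s0] s0 norm_ge_zero order_trans by blast
  have lip: "cmod (g s - g t) \<le> K * \<bar>s - t\<bar>" if "s \<in> {0<..s0}" "t \<in> {0<..s0}" for s t
  proof -
    have "cmod (g s - g t) \<le> K * norm (s - t)"
    proof (rule differentiable_bound[of "{0<..s0}" g])
      fix x assume "x \<in> {0<..s0}"
      then show "(g has_derivative (\<lambda>h. h *\<^sub>R (of_real (2 * x) * z * \<phi> (of_real (x^2) * z)))) (at x within {0<..s0})"
        using gd[of x] s0 by (auto simp: has_vector_derivative_def)
      show "onorm (\<lambda>h. h *\<^sub>R (of_real (2 * x) * z * \<phi> (of_real (x^2) * z))) \<le> K"
        using gK[of x] \<open>x \<in> _\<close>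
        by (intro onorm_le, unfold norm_scaleR real_norm_def, subst mult.commute, intro mult_right_mono) auto
    qed (use that in auto)
    then show ?thesis by simp
  qed
  have uc: "uniformly_continuous_on {0<..s0} g"
    unfolding uniformly_continuous_on_def
  proof (intro allI impI)
    fix e :: real assume e: "e > 0"
    show "\<exists>d>0. \<forall>x\<in>{0<..s0}. \<forall>x'\<in>{0<..s0}. dist x' x < d \<longrightarrow> dist (g x') (g x) < e"
    proof (intro exI[of _ "e / (K + 1)"] conjI ballI impI)
      fix x y assume xy: "x \<in> {0<..s0}" "y \<in> {0<..s0}" "dist y x < e / (K + 1)"
      have "dist (g y) (g x) \<le> K * \<bar>y - x\<bar>" using lip[OF xy(2,1)] by (simp add: dist_norm)
      also have "\<dots> \<le> (K + 1) * \<bar>y - x\<bar>" by (intro mult_right_mono) auto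
      also have "\<dots> < e" using xy(3) K0 by (simp add: dist_real_def field_simps)
      finally show "dist (g y) (g x) < e" .
    qed (use e K0 in auto)
  qed
  have "0 \<in> closure {0<..s0}" using s0 by simp
  then obtain L where L: "(g \<longlongrightarrow> L) (at 0 within {0<..s0})"
    using uniformly_continuous_on_extension_at_closure[OF uc] by blast
  have atr: "at 0 within {0<..s0} = at_right (0::real)"
    using s0 by (intro at_within_nhd[of _ "{..<s0}"]) auto
  have L0: "(g \<longlongrightarrow> L) (at_right 0)" using L atr by simp
  have "((\<lambda>t. g (sqrt t)) \<longlongrightarrow> L) (at_right 0)"
  proof (rule filterlim_compose[OF L0])
    show "filterlim sqrt (at_right 0) (at_right (0::real))"
      unfolding filterlim_at
      by (auto simp: eventually_at_right_less intro!: tendsto_eq_intros eventually_mono[OF eventually_at_right_less[of 0]])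
  qed
  moreover have "\<forall>\<^sub>F t in at_right 0. g (sqrt t) = \<Psi> (of_real t * z)"
    using eventually_at_right_less[of 0] by eventually_elim (simp add: g_def)
  ultimately have L1: "((\<lambda>t. \<Psi> (of_real t * z)) \<longlongrightarrow> L) (at_right 0)"
    using tendsto_cong by fastforce
  show ?thesis
  proof (rule that[OF L1])
    define G where "G t = (if t = 0 then L else \<Psi> (of_real t * z))" for t :: real
    have tz: "of_real t * z \<in> D" if "0 < t" "t \<le> 1" for t using scale_D[OF z] that by auto
    have Gd: "(G has_vector_derivative (\<phi> (of_real t * z) * z)) (at t)" if "0 < t" "t \<le> 1" for t
    proof -
      have "((\<lambda>s::real. of_real s * z) has_vector_derivative z) (at t)"
        by (auto intro!: derivative_eq_intros simp: has_real_derivative_iff_has_vector_derivative[symmetric])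
      from field_vector_diff_chain_at[OF this] Psi[OF tz[OF that]]
      have "((\<lambda>s. \<Psi> (of_real s * z)) has_vector_derivative (z * \<phi> (of_real t * z))) (at t)"
        unfolding o_def by blast
      then show ?thesis
        using that by (subst has_vector_derivative_transform_within_open[of _ _ _ "{0<..}" G])
           (auto simp: G_def mult.commute has_vector_derivative_transform_within_open)
    qed
    have "continuous_on {0..1} G"
    proof (rule continuous_on_eq_continuous_within[THEN iffD2, rule_format])
      fix t :: real assume t: "t \<in> {0..1}"
      show "continuous (at t within {0..1}) G"
      proof (cases "t = 0")
        case False
        then have "isCont G t" using has_vector_derivative_continuous[OF Gd[of t]] t by auto
        then show ?thesis by (rule continuous_at_imp_continuous_at_within)
      next
        case True
        have "(G \<longlongrightarrow> L) (at_right 0)"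
          using L1 by (rule Lim_transform_eventually) (use eventually_at_right_less[of "0::real"] in \<open>eventually_elim, auto simp: G_def\<close>)
        moreover have "at 0 within {0..1} = at_right (0::real)"
          by (simp add: at_within_Icc_at_right)
        ultimately show ?thesis using True by (simp add: continuous_within G_def)
      qed
    qed
    then have "((\<lambda>t. \<phi> (of_real t * z) * z) has_integral (G 1 - G 0)) {0..1}"
      by (intro fundamental_theorem_of_calculus_interior) (auto intro: Gd)
    then show "((\<lambda>t. \<phi> (of_real t * z) * z) has_integral (\<Psi> z - L)) {0..1}" by (simp add: G_def)
    assume zh: "cmod z \<le> 1/2"
    then have "1 \<le> 1 / (2 * cmod z)" using z0 by (simp add: field_simps)
    then have s01: "s0 = 1" by (simp add: s0_def)
    have "((\<lambda>s. cmod (g 1 - g s)) \<longlongrightarrow> cmod (g 1 - L)) (at_right 0)" by (intro tendsto_intros L0)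
    moreover have "\<forall>\<^sub>F s in at_right 0. cmod (g 1 - g s) \<le> K"
    proof -
      have "\<forall>\<^sub>F s in at_right 0. s < (1::real)" by (auto simp: eventually_at_right_field intro: exI[of _ 1])
      then show ?thesis using eventually_at_right_less[of "0::real"]
      proof eventually_elim
        case (elim s)
        have "cmod (g 1 - g s) \<le> K * \<bar>1 - s\<bar>" using lip[of 1 s] elim s01 by simp
        also have "\<dots> \<le> K * 1" using elim K0 by (intro mult_left_mono) auto
        finally show ?case by simp
      qed
    qed
    ultimately have "cmod (g 1 - L) \<le> K"
      by (intro tendsto_upperbound[of _ _ "at_right 0"]) auto
    then show "cmod (\<Psi> z - L) \<le> 2 * C * cmod z powr (1/2)" by (simp add: g_def K_def)
  qed
qed

text \<open>The integral from 0 is \<open>\<Psi>\<close> minus its limit along the ray, so the point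
  is that this limit is locally constant. Neighbouring rays at parameter t are O(t) apart while
  \<open>\<phi>\<close> is O(t^(-1/2)) between them; hence the values of \<open>\<Psi>\<close>
  differ by O(sqrt t).\<close>

lemma ray_primitive:
  assumes phi: "\<phi> holomorphic_on D"
    and bd: "\<And>z. z \<in> D \<Longrightarrow> cmod z \<le> 1/2 \<Longrightarrow> cmod (\<phi> z) \<le> C * cmod z powr (-1/2)"
    and z: "z \<in> D"
  shows "((\<lambda>z. integral {0..1} (\<lambda>t::real. \<phi> (of_real t * z) * z)) has_field_derivative \<phi> z) (at z)" (is "(?I has_field_derivative _) _")
    and "cmod z \<le> 1/2 \<Longrightarrow> cmod (integral {0..1} (\<lambda>t::real. \<phi> (of_real t * z) * z)) \<le> 2 * C * cmod z powr (1/2)"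
proof -
  obtain \<Psi> where Psi: "\<And>z. z \<in> D \<Longrightarrow> (\<Psi> has_field_derivative \<phi> z) (at z)"
    using holomorphic_starlike_primitive[OF holomorphic_on_imp_continuous_on[OF phi] starlike_D open_D, of "{}"]
      phi open_D holomorphic_on_imp_differentiable_at by blast
  define L where "L z = Lim (at_right 0) (\<lambda>t. \<Psi> (complex_of_real t * z))" for z
  note R = ray_limit[OF phi Psi bd]
  have L: "((\<lambda>t. \<Psi> (complex_of_real t * z)) \<longlongrightarrow> L z) (at_right 0)" if "z \<in> D" for z
    using R[OF _ _ _ that] tendsto_Lim[OF trivial_limit_at_right_real] unfolding L_def by metis
  have I: "?I z = \<Psi> z - L z" if "z \<in> D" for z
    using R[OF _ _ _ that] tendsto_unique[OF trivial_limit_at_right_real _ L[OF that]]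
    by (metis integral_unique)
  have "cmod (\<Psi> z - L z) \<le> 2 * C * cmod z powr (1/2)" if "cmod z \<le> 1/2"
    using R[OF _ _ _ z] tendsto_unique[OF trivial_limit_at_right_real _ L[OF z]] that by metis
  then show "cmod z \<le> 1/2 \<Longrightarrow> cmod (?I z) \<le> 2 * C * cmod z powr (1/2)" using I z by simp
  obtain e where e: "e > 0" "cball z e \<subseteq> D" using open_D z open_contains_cball by blast
  have z0: "cmod z > 0" using z zero_notin by auto
  define d where "d = min e (cmod z / 2)"
  have d: "d > 0" "ball z d \<subseteq> D" using e z0 by (auto simp: d_def subset_iff)
  have Lc: "L w = L z" if w: "w \<in> ball z d" for w
  proof -
    have wD: "w \<in> D" using w d by auto
    have C0: "C \<ge> 0"
    proof -
      define t where "t = min 1 (1 / (2 * cmod z))"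
      have t: "t > 0" "t \<le> 1" "t * cmod z \<le> 1/2" using z0 by (auto simp: t_def min_def field_simps)
      have "0 \<le> C * cmod (of_real t * z) powr (-1/2)"
        using order_trans[OF norm_ge_zero bd[OF scale_D[OF z t(1,2)]]] t by (simp add: norm_mult)
      then show ?thesis using t z0 by (auto simp: zero_le_mult_iff norm_mult)
    qed
    have "\<forall>\<^sub>F t in at_right 0. norm (\<Psi> (of_real t * w) - \<Psi> (of_real t * z)) \<le> (C * (cmod z / 2) powr (-1/2) * d) * sqrt t"
    proof -
      have "0 < 1 / (4 * cmod z)" using z0 by simp
      then have "\<forall>\<^sub>F t in at_right 0. t < 1 / (4 * cmod z)" unfolding eventually_at_right_field using z0 by (intro exI[of _ "1 / (4 * cmod z)"]) auto
      moreover have "\<forall>\<^sub>F t in at_right 0. t < (1::real)" by (auto simp: eventually_at_right_field intro: exI[of _ 1])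
      ultimately show ?thesis using eventually_at_right_less[of "0::real"]
      proof eventually_elim
        case (elim t)
        \<comment> \<open>Scaling keeps the ball convex, and its points have modulus between t |z| /
          2 and 1/2, so the mean value inequality applies with the bound on \<open>\<phi>\<close> at
          the smallest modulus.\<close>
        define S where "S = (\<lambda>x. of_real t * x) ` ball z d"
        have cS: "convex S" unfolding S_def by (intro convex_linear_image) (auto intro: linear_times)
        have "norm (\<Psi> (of_real t * w) - \<Psi> (of_real t * z)) \<le> (C * (t * (cmod z / 2)) powr (-1/2)) * norm (of_real t * w - of_real t * z)"
        proof (rule field_differentiable_bound[OF cS])
          fix x assume "x \<in> S"
          then obtain y where y: "y \<in> ball z d" "x = of_real t * y" by (auto simp: S_def)
          have yD: "y \<in> D" using y d by auto
          have xD: "x \<in> D" using y scale_D[OF yD] elim by auto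
          have y1: "cmod y \<ge> cmod z / 2" using y(1) norm_triangle_ineq2[of z "z - y"] by (auto simp: d_def dist_norm)
          have y2: "cmod y \<le> 2 * cmod z" using y(1) norm_triangle_ineq2[of y z] norm_ge_zero[of z]
            by (simp add: d_def dist_norm norm_minus_commute del: norm_ge_zero)
          show "(\<Psi> has_field_derivative \<phi> x) (at x within S)"
            using Psi[OF xD] has_field_derivative_at_within by blast
          have "cmod x \<le> t * (2 * cmod z)" using y(2) y2 elim by (simp add: norm_mult)
          also have "\<dots> \<le> 1/2" using elim z0 by (simp add: field_simps)
          finally have "cmod (\<phi> x) \<le> C * cmod x powr (-1/2)" using bd xD by blast
          also have "\<dots> \<le> C * (t * (cmod z / 2)) powr (-1/2)"
            using y1 elim z0 C0 y(2) by (intro mult_left_mono powr_mono2') (auto simp: norm_mult)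
          finally show "cmod (\<phi> x) \<le> C * (t * (cmod z / 2)) powr (-1/2)" .
        qed (use w d in \<open>auto simp: S_def\<close>)
        also have "norm (of_real t * w - of_real t * z) \<le> t * d"
          using w elim by (simp add: right_diff_distrib[symmetric] norm_mult dist_norm norm_minus_commute)
        also have "(C * (t * (cmod z / 2)) powr (-1/2)) * (t * d) = C * (cmod z / 2) powr (-1/2) * d * (t powr (-1/2) * t powr 1)"
          using elim z0 by (subst powr_mult) auto
        also have "t powr (-1/2) * t powr 1 = sqrt t" unfolding powr_add[symmetric] using elim by (simp add: powr_half_sqrt)
        finally show ?case using C0 by (simp add: mult_left_mono)
      qed
    qed
    moreover have "((\<lambda>t. (C * (cmod z / 2) powr (-1/2) * d) * sqrt t) \<longlongrightarrow> 0) (at_right 0)"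
      by (auto intro!: tendsto_eq_intros)
    ultimately have "((\<lambda>t. \<Psi> (of_real t * w) - \<Psi> (of_real t * z)) \<longlongrightarrow> 0) (at_right 0)"
      by (rule Lim_null_comparison)
    moreover have "((\<lambda>t. \<Psi> (of_real t * w) - \<Psi> (of_real t * z)) \<longlongrightarrow> L w - L z) (at_right 0)"
      using L[OF wD] L[OF z] by (intro tendsto_intros)
    ultimately show ?thesis using tendsto_unique[OF trivial_limit_at_right_real] by fastforce
  qed
  have "((\<lambda>w. \<Psi> w - L z) has_field_derivative \<phi> z) (at z)"
    using Psi[OF z] by (auto intro!: derivative_eq_intros)
  then show "(?I has_field_derivative \<phi> z) (at z)"
  proof (rule has_field_derivative_transform_within_open)
    show "open (ball z d)" "z \<in> ball z d" using d by auto
    fix w assume "w \<in> ball z d"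
    then show "\<Psi> w - L z = ?I w" using I[of w] Lc[of w] d(2) by auto
  qed
qed

definition nonzero_word :: "complex list \<Rightarrow> bool" where
  "nonzero_word w \<longleftrightarrow> (\<exists>b\<in>set w. b \<noteq> 0)"

lemma l_powr_bound:
  assumes "e > 0"
  shows "\<exists>C\<ge>0. \<forall>z\<in>D. cmod z \<le> 1/2 \<longrightarrow> cmod (l z ^ n) \<le> C * cmod z powr (-e)"
proof -
  obtain B where B: "\<forall>z\<in>D. cmod (l z) \<le> \<bar>ln (cmod z)\<bar> + B" using l_bound by blast
  \<comment> \<open>Each of the \<open>n\<close> logarithms is charged the power \<open>d\<close>;
    the \<open>+ 1\<close> covers \<open>n = 0\<close>.\<close>
  define d where "d = e / (n + 1)"
  have d: "d > 0" using assms by (simp add: d_def)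
  define C where "C = 1 / d + \<bar>B\<bar>"
  have C0: "C \<ge> 0" using d by (simp add: C_def)
  have "cmod (l z ^ n) \<le> C ^ n * cmod z powr (-e)" if z: "z \<in> D" "cmod z \<le> 1/2" for z
  proof -
    have z0: "cmod z > 0" using z zero_notin by auto
    have p1: "cmod z powr (-d) \<ge> 1" using z z0 d by (simp add: powr_minus one_le_inverse powr_le1)
    have "ln (1 / cmod z) \<le> (1 / cmod z) powr d / d" using z z0 d by (intro ln_powr_bound) auto
    then have "\<bar>ln (cmod z)\<bar> \<le> cmod z powr (-d) / d" using z z0 by (simp add: ln_div powr_minus_divide powr_divide abs_if)
    then have "cmod (l z) \<le> cmod z powr (-d) / d + \<bar>B\<bar> * 1" using B z by fastforce
    also have "\<dots> \<le> cmod z powr (-d) / d + \<bar>B\<bar> * cmod z powr (-d)" using p1 by (intro add_left_mono mult_left_mono) auto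
    also have "\<dots> = C * cmod z powr (-d)" by (simp add: C_def field_simps)
    finally have "cmod (l z) \<le> C * cmod z powr (-d)" .
    then have "cmod (l z ^ n) \<le> (C * cmod z powr (-d)) ^ n" unfolding norm_power by (intro power_mono) auto
    also have "\<dots> = C ^ n * cmod z powr (-d * n)" using z0 by (simp add: power_mult_distrib powr_power mult.commute)
    also have "\<dots> \<le> C ^ n * cmod z powr (-e)"
    proof (intro mult_left_mono powr_mono')
      show "-e \<le> -d * real n" using assms by (simp add: d_def field_simps)
    qed (use z z0 C0 in auto)
    finally show ?thesis .
  qed
  then show ?thesis using C0 by (intro exI[of _ "C ^ n"]) auto
qed

lemma all_zero_conv: "\<not> nonzero_word w \<longleftrightarrow> w = replicate (length w) 0"
  unfolding nonzero_word_def by (metis in_set_replicate replicate_length_same)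

lemma Lg_zero: "Lg l (replicate n 0) z = l z ^ n / fact n"
  by (cases n) (auto simp del: fact_Suc of_nat_mult)

text \<open>The three claims feed each other: differentiating \<open>Lg l (a # w)\<close> needs the
  growth of \<open>Lg l w\<close> at 0, and holomorphy of \<open>Lg l w\<close> comes from the
  derivative formula for its tail. The exponent 1/2 reproduces itself: division by z - a lowers it
  to -1/2 at worst, and \<open>ray_primitive\<close> raises it again. Words of zeros are powers of
  \<open>l\<close> and cannot satisfy the bound.\<close>

lemma Lg_props:
  assumes "w \<in> words"
  shows "Lg l w holomorphic_on D
     \<and> (nonzero_word w \<longrightarrow> (\<exists>C. \<forall>z\<in>D. cmod z \<le> 1/2 \<longrightarrow> cmod (Lg l w z) \<le> C * cmod z powr (1/2)))
     \<and> (\<forall>a\<in>{0,1}. \<forall>z\<in>D. (Lg l (a # w) has_field_derivative Lg l w z / (z - a)) (at z))"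
  using assms
proof (induction w rule: length_induct)
  case (1 w)
  have IH: "Lg l v holomorphic_on D"
     "nonzero_word v \<Longrightarrow> \<exists>C. \<forall>z\<in>D. cmod z \<le> 1/2 \<longrightarrow> cmod (Lg l v z) \<le> C * cmod z powr (1/2)"
     "a \<in> {0,1} \<Longrightarrow> z \<in> D \<Longrightarrow> (Lg l (a # v) has_field_derivative Lg l v z / (z - a)) (at z)"
    if wv: "w = b # v" for b v a z
  proof -
    have v: "v \<in> words" "length v < length w" using 1(2) wv by auto
    note I = 1(1)[rule_format, OF v(2,1)]
    show "Lg l v holomorphic_on D" using I by blast
    show "nonzero_word v \<Longrightarrow> \<exists>C. \<forall>z\<in>D. cmod z \<le> 1/2 \<longrightarrow> cmod (Lg l v z) \<le> C * cmod z powr (1/2)"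
      using I by blast
    show "a \<in> {0,1} \<Longrightarrow> z \<in> D \<Longrightarrow> (Lg l (a # v) has_field_derivative Lg l v z / (z - a)) (at z)"
      using I by blast
  qed
  \<comment> \<open>Stated for an arbitrary tail \<open>v\<close> because it serves twice: for the
    tail of \<open>w\<close>, to bound \<open>Lg l w\<close>, and for \<open>w\<close> itself, to
    differentiate the next longer word.\<close>
  have step: "((Lg l (a # v) has_field_derivative Lg l v z / (z - a)) (at z)) \<and> 
     (nonzero_word (a # v) \<longrightarrow> (\<exists>C. \<forall>z\<in>D. cmod z \<le> 1/2 \<longrightarrow> cmod (Lg l (a # v) z) \<le> C * cmod z powr (1/2)))"
    if hol: "Lg l v holomorphic_on D" and a: "a \<in> {0,1}" and z: "z \<in> D"
     and bdv: "nonzero_word v \<Longrightarrow> \<exists>C. \<forall>z\<in>D. cmod z \<le> 1/2 \<longrightarrow> cmod (Lg l v z) \<le> C * cmod z powr (1/2)" for a v z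
  proof (cases "nonzero_word (a # v)")
    case False
    then have av: "a = 0" "\<not> nonzero_word v" by (auto simp: nonzero_word_def)
    then have vr: "v = replicate (length v) 0" using all_zero_conv by blast
    define n where "n = length v"
    have "Lg l (a # v) = (\<lambda>z. l z ^ Suc n / fact (Suc n))"
      using Lg_zero[of "Suc n"] vr av by (auto simp: n_def fun_eq_iff)
    moreover have "Lg l v = (\<lambda>z. l z ^ n / fact n)" using Lg_zero[of n] vr by (auto simp: n_def fun_eq_iff)
    moreover have "((\<lambda>z. l z ^ Suc n / fact (Suc n)) has_field_derivative (l z ^ n / fact n) / z) (at z)"
    proof -
      have "((\<lambda>z. l z ^ Suc n / fact (Suc n)) has_field_derivative ((1 + of_nat n) * (1 / z * l z ^ n)) / fact (Suc n)) (at z)"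
        by (intro DERIV_cdivide DERIV_power_Suc l_deriv[OF z])
      moreover have "((1 + of_nat n) * (1 / z * l z ^ n)) / fact (Suc n) = (l z ^ n / fact n) / z"
      proof -
        have "fact (Suc n) = (1 + of_nat n) * (fact n :: complex)" by (simp add: fact_Suc)
        then show ?thesis
          by (simp only:) (subst mult_divide_mult_cancel_left, auto simp: of_nat_Suc[symmetric] simp del: of_nat_Suc)
      qed
      ultimately show ?thesis by simp
    qed
    ultimately show ?thesis using False av by simp
  next
    case True
    define \<phi> where "\<phi> z = Lg l v z / (z - a)" for z
    have aD: "z \<noteq> a" if "z \<in> D" for z using that a zero_notin one_notin by auto
    have hphi: "\<phi> holomorphic_on D" unfolding \<phi>_def using aD by (auto intro!: holomorphic_intros hol)
    have eq: "Lg l (a # v) = (\<lambda>z. integral {0..1} (\<lambda>t::real. \<phi> (of_real t * z) * z))"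
      using True by (auto simp: nonzero_word_def \<phi>_def fun_eq_iff field_simps)
    have "\<exists>C. \<forall>z\<in>D. cmod z \<le> 1/2 \<longrightarrow> cmod (\<phi> z) \<le> C * cmod z powr (-1/2)"
    proof (cases "nonzero_word v")
      case True
      from bdv[OF this] obtain C where C: "\<forall>z\<in>D. cmod z \<le> 1/2 \<longrightarrow> cmod (Lg l v z) \<le> C * cmod z powr (1/2)" by blast
      have "cmod (\<phi> z) \<le> \<bar>C\<bar> * cmod z powr (-1/2)" if z: "z \<in> D" "cmod z \<le> 1/2" for z
      proof -
        have z0: "cmod z > 0" using z zero_notin by auto
        have za: "cmod (z - a) \<ge> cmod z" using a z norm_triangle_ineq2[of 1 z] by (auto simp: norm_minus_commute)
        have "cmod (Lg l v z) \<le> C * cmod z powr (1/2)" using C z by blast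
        also have "\<dots> \<le> \<bar>C\<bar> * cmod z powr (1/2)" by (intro mult_right_mono) auto
        finally have "cmod (\<phi> z) \<le> (\<bar>C\<bar> * cmod z powr (1/2)) / cmod z"
          unfolding \<phi>_def norm_divide using za z0 by (intro frac_le) auto
        moreover have "cmod z powr (1/2) / cmod z = cmod z powr (-1/2)"
          using z0 powr_diff[of "cmod z" "1/2" 1] by simp
        ultimately show ?thesis by (simp flip: times_divide_eq_right)
      qed
      then show ?thesis by blast
    next
      case False
      \<comment> \<open>The denominator z - 1 stays away from 0 here, so only a power of the
        logarithm remains to be absorbed by |z|^(-1/2).\<close>
      then have a1: "a = 1" using True a by (auto simp: nonzero_word_def)
      have vr: "v = replicate (length v) 0" using all_zero_conv False by blast
      obtain C where C: "C \<ge> 0" "\<forall>z\<in>D. cmod z \<le> 1/2 \<longrightarrow> cmod (l z ^ length v) \<le> C * cmod z powr (-1/2)"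
        using l_powr_bound[of "1/2" "length v"] by auto
      have "cmod (\<phi> z) \<le> (2 * C) * cmod z powr (-1/2)" if z: "z \<in> D" "cmod z \<le> 1/2" for z
      proof -
        have za: "cmod (z - 1) \<ge> 1/2" using z norm_triangle_ineq2[of 1 z] by (auto simp: norm_minus_commute)
        have "cmod (Lg l v z) = cmod (l z ^ length v) / fact (length v)"
          by (subst vr, subst Lg_zero) (simp add: norm_divide)
        also have "\<dots> \<le> cmod (l z ^ length v) / 1" by (intro divide_left_mono) auto
        finally have "cmod (Lg l v z) \<le> C * cmod z powr (-1/2)" using C z by fastforce
        then have "cmod (\<phi> z) \<le> (C * cmod z powr (-1/2)) / (1/2)"
          unfolding \<phi>_def norm_divide a1 using za C by (intro frac_le) auto
        then show ?thesis by (simp add: mult.assoc)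
      qed
      then show ?thesis by blast
    qed
    then obtain C where C: "\<And>z. z \<in> D \<Longrightarrow> cmod z \<le> 1/2 \<Longrightarrow> cmod (\<phi> z) \<le> C * cmod z powr (-1/2)" by blast
    have "\<forall>z\<in>D. cmod z \<le> 1/2 \<longrightarrow> cmod (Lg l (a # v) z) \<le> (2 * C) * cmod z powr (1/2)"
      unfolding eq using ray_primitive(2)[OF hphi C] by auto
    then show ?thesis unfolding eq using ray_primitive(1)[OF hphi C z] by (auto simp: \<phi>_def)
  qed
  have hw: "Lg l w holomorphic_on D"
  proof (cases w)
    case (Cons b v)
    then show ?thesis using IH(3)[OF Cons] 1(2) open_D
      by (auto simp: holomorphic_on_open)
  next
    case Nil
    then have "Lg l w = (\<lambda>z. 1)" by auto
    then show ?thesis by simp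
  qed
  have bw: "nonzero_word w \<Longrightarrow> \<exists>C. \<forall>z\<in>D. cmod z \<le> 1/2 \<longrightarrow> cmod (Lg l w z) \<le> C * cmod z powr (1/2)"
  proof (cases w)
    case Nil then show "nonzero_word w \<Longrightarrow> ?thesis" by (simp add: nonzero_word_def)
  next
    case (Cons b v)
    obtain z0 where "z0 \<in> D" using starlike_D unfolding starlike_def by blast
    assume "nonzero_word w"
    then show ?thesis using step[OF IH(1)[OF Cons] _ \<open>z0 \<in> D\<close> IH(2)[OF Cons], of b] Cons 1(2) by auto
  qed
  show ?case using hw bw step[OF hw _ _ bw] by blast
qed

end

text \<open>The differential equations of the iterated integrals with the constants of integration
  left free except at the empty word. Continuations across a cut satisfy them too, and the remaining
  freedom is the choice of constants in \<open>conv\<close>.\<close>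

definition polysys :: "complex set \<Rightarrow> (complex list \<Rightarrow> complex \<Rightarrow> complex) \<Rightarrow> bool" where
  "polysys U A \<longleftrightarrow> (\<forall>z\<in>U. A [] z = 1) \<and>
     (\<forall>w\<in>words. \<forall>a\<in>{0,1}. \<forall>z\<in>U. (A (a # w) has_field_derivative A w z / (z - a)) (at z))"

lemma polysysD:
  assumes "polysys U A"
  shows "z \<in> U \<Longrightarrow> A [] z = 1"
    and "w \<in> words \<Longrightarrow> a \<in> {0,1} \<Longrightarrow> z \<in> U \<Longrightarrow> (A (a # w) has_field_derivative A w z / (z - a)) (at z)"
  using assms unfolding polysys_def by blast+

lemma polysys_subset: "polysys U A \<Longrightarrow> U' \<subseteq> U \<Longrightarrow> polysys U' A"
  unfolding polysys_def by blast

lemma polysys_holomorphic: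
  assumes "open U" "polysys U A" "w \<in> words"
  shows "A w holomorphic_on U"
proof (cases w)
  case Nil
  have "(\<lambda>z. 1) holomorphic_on U" by simp
  then show ?thesis
    by (rule holomorphic_transform) (use polysysD(1)[OF assms(2)] Nil in auto)
next
  case (Cons a v)
  then show ?thesis using polysysD(2)[OF assms(2), of v a] assms(1,3) unfolding holomorphic_on_open[OF assms(1)] by auto
qed

lemma deriv_zero_imp_eq:
  fixes f :: "complex \<Rightarrow> complex"
  assumes "open U" "connected U" "\<And>z. z \<in> U \<Longrightarrow> (f has_field_derivative 0) (at z)" "z \<in> U" "p \<in> U"
  shows "f z = f p"
proof -
  have "continuous_on U f"
    using assms(3) by (meson DERIV_isCont continuous_at_imp_continuous_on)
  then obtain c where "\<And>x. x \<in> U \<Longrightarrow> f x = c"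
    using DERIV_zero_connected_constant[of U "{}" f] assms by auto
  then show ?thesis using assms by simp
qed

lemma polysys_eq:
  assumes U: "open U" "connected U" and A: "polysys U A" and B: "polysys U B"
    and p: "p \<in> U" "\<And>w. w \<in> words \<Longrightarrow> A w p = B w p" and w: "w \<in> words" and z: "z \<in> U"
  shows "A w z = B w z"
  using w z
proof (induction w arbitrary: z)
  case Nil then show ?case using polysysD(1)[OF A] polysysD(1)[OF B] by simp
next
  case (Cons a w)
  have "A (a # w) z - B (a # w) z = A (a # w) p - B (a # w) p"
  proof (rule deriv_zero_imp_eq[OF U _ Cons(3) p(1)])
    fix x assume x: "x \<in> U"
    have "((\<lambda>z. A (a # w) z - B (a # w) z) has_field_derivative (A w x / (x - a) - B w x / (x - a))) (at x)"
      using Cons x by (intro derivative_intros polysysD(2)[OF A] polysysD(2)[OF B]) auto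
    then show "((\<lambda>z. A (a # w) z - B (a # w) z) has_field_derivative 0) (at x)"
      using Cons x by simp
  qed
  then show ?case using p(2)[OF Cons(2)] by simp
qed

text \<open>Two systems of iterated primitives differ by the constants \<open>k\<close> of a deconcatenation:
  \<open>A_w\<close> is the sum of \<open>k_x B_y\<close> over all factorisations \<open>w = y @ x\<close>.\<close>
definition conv :: "(complex list \<Rightarrow> complex) \<Rightarrow> (complex list \<Rightarrow> complex \<Rightarrow> complex) \<Rightarrow> complex list \<Rightarrow> complex \<Rightarrow> complex" where
  "conv k B w z = (\<Sum>j\<le>length w. k (drop j w) * B (take j w) z)"

lemma conv_Nil [simp]: "conv k B [] z = k [] * B [] z"
  by (simp add: conv_def)

lemma conv_Cons: "conv k B (a # w) z = k (a # w) * B [] z + (\<Sum>j\<le>length w. k (drop j w) * B (a # take j w) z)"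
  by (simp add: conv_def sum.atMost_Suc_shift del: sum.atMost_Suc)

lemma conv_tail_deriv:
  assumes "polysys U B" "w \<in> words" "a \<in> {0,1}" "z \<in> U"
  shows "((\<lambda>z. \<Sum>j\<le>length w. k (drop j w) * B (a # take j w) z) has_field_derivative conv k B w z / (z - a)) (at z)"
proof -
  have "((\<lambda>z. \<Sum>j\<le>length w. k (drop j w) * B (a # take j w) z) has_field_derivative
      (\<Sum>j\<le>length w. k (drop j w) * (B (take j w) z / (z - a)))) (at z)"
    using assms by (intro DERIV_sum DERIV_cmult polysysD(2)[OF assms(1)] words_take) auto
  then show ?thesis by (simp add: conv_def sum_divide_distrib)
qed

lemma polysys_conv:
  assumes B: "polysys U B" and U: "open U" and k: "k [] = 1"
  shows "polysys U (conv k B)"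
  unfolding polysys_def
proof (intro conjI ballI)
  show "conv k B [] z = 1" if "z \<in> U" for z using polysysD(1)[OF B that] k by simp
next
  fix w a z assume w: "w \<in> words" and a: "a \<in> {0,1::complex}" and z: "z \<in> U"
  have "((\<lambda>z. k (a # w) * 1 + (\<Sum>j\<le>length w. k (drop j w) * B (a # take j w) z)) has_field_derivative
         0 + conv k B w z / (z - a)) (at z)"
    by (intro DERIV_add DERIV_const conv_tail_deriv[OF B w a z])
  then have "((\<lambda>z. k (a # w) * 1 + (\<Sum>j\<le>length w. k (drop j w) * B (a # take j w) z)) has_field_derivative
         conv k B w z / (z - a)) (at z)" by simp
  then show "(conv k B (a # w) has_field_derivative conv k B w z / (z - a)) (at z)"
  proof (rule has_field_derivative_transform_within_open[OF _ U z])
    fix x assume "x \<in> U"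
    then show "k (a # w) * 1 + (\<Sum>j\<le>length w. k (drop j w) * B (a # take j w) x) = conv k B (a # w) x"
      using polysysD(1)[OF B] by (simp add: conv_Cons)
  qed
qed

text \<open>Solves \<open>A = conv k B\<close> at one point for \<open>k\<close>: since
  \<open>B []\<close> is 1 there, the term with \<open>j = 0\<close> is the unknown
  \<open>k w\<close>, and all other terms involve strictly shorter suffixes.\<close>

function kc :: "(complex list \<Rightarrow> complex) \<Rightarrow> (complex list \<Rightarrow> complex) \<Rightarrow> complex list \<Rightarrow> complex" where
  "kc A B w = A w - (\<Sum>j\<in>{1..length w}. kc A B (drop j w) * B (take j w))"
  by auto
termination by (relation "Wellfounded.measure (\<lambda>(A, B, w). length w)") auto

declare kc.simps [simp del]

lemma kc_Nil: "kc A B [] = A []"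
  by (subst kc.simps) simp

text \<open>The constants \<open>kc\<close> are chosen to give agreement at \<open>p\<close>, and
  \<open>polysys_eq\<close> spreads it over the connected set \<open>U\<close>.\<close>

lemma polysys_compare:
  assumes U: "open U" "connected U" and A: "polysys U A" and B: "polysys U B" and p: "p \<in> U"
    and w: "w \<in> words" and z: "z \<in> U"
  shows "A w z = conv (kc (\<lambda>w. A w p) (\<lambda>w. B w p)) B w z"
proof (rule polysys_eq[OF U A _ p _ w z])
  let ?k = "kc (\<lambda>w. A w p) (\<lambda>w. B w p)"
  show "polysys U (conv ?k B)"
    by (rule polysys_conv[OF B U(1)]) (simp add: kc_Nil polysysD(1)[OF A p])
  fix w :: "complex list"
  have s: "{..length w} = insert 0 {1..length w}" by auto
  have "conv ?k B w p = ?k w * B [] p + (\<Sum>j\<in>{1..length w}. ?k (drop j w) * B (take j w) p)"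
    unfolding conv_def s by (subst sum.insert) auto
  then show "A w p = conv ?k B w p"
    using kc.simps[of "\<lambda>w. A w p" "\<lambda>w. B w p" w] polysysD(1)[OF B p] by simp
qed

text \<open>Continuation without paths: a solution \<open>B\<close> that already lives on the larger
  set is corrected by constants until it agrees with \<open>A\<close> on \<open>U\<close>.\<close>

lemma polysys_extend:
  assumes U: "open U" "connected U" "p \<in> U" and "open U'" "U \<subseteq> U'"
    and A: "polysys U A" and B: "polysys U' B"
  obtains A' where "polysys U' A'" "\<And>w z. w \<in> words \<Longrightarrow> z \<in> U \<Longrightarrow> A' w z = A w z"
proof
  let ?k = "kc (\<lambda>w. A w p) (\<lambda>w. B w p)"
  show "polysys U' (conv ?k B)"
    by (rule polysys_conv[OF B]) (simp_all add: kc_Nil polysysD(1)[OF A U(3)] assms)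
  show "conv ?k B w z = A w z" if "w \<in> words" "z \<in> U" for w z
    using polysys_compare[OF U(1,2) A polysys_subset[OF B] U(3) that] assms by simp
qed

section \<open>Half planes, cut planes and the principal branch\<close>

definition Hup :: "complex set" where "Hup = {z. Im z > 0}"
definition Hlo :: "complex set" where "Hlo = {z. Im z < 0}"

text \<open>The plane cut so that one can cross the negative axis (\<open>i = 0\<close>) resp. the ray beyond 1 (\<open>i = 1\<close>).\<close>
definition Dm :: "complex \<Rightarrow> complex set" where
  "Dm i = (if i = 0 then - {z. Im z = 0 \<and> Re z \<ge> 0} else - {z. Im z = 0 \<and> Re z \<le> 1})"

lemma open_Hup: "open Hup" and open_Hlo: "open Hlo"
  unfolding Hup_def Hlo_def by (auto intro: open_halfspace_Im_gt open_halfspace_Im_lt)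

lemma connected_Hup: "connected Hup" and connected_Hlo: "connected Hlo"
  unfolding Hup_def Hlo_def
  by (auto intro!: convex_connected convex_halfspace_Im_gt convex_halfspace_Im_lt)

lemma open_slit: "open slit"
proof -
  have "closed ({x. Im x = 0 \<and> Re x \<le> 0} \<union> {x. Im x = 0 \<and> Re x \<ge> 1})"
    by (intro closed_Un closed_Collect_conj closed_Collect_eq closed_Collect_le continuous_intros)
  then show ?thesis unfolding slit_def by (rule open_Compl)
qed

lemma open_Dm: "open (Dm i)"
proof -
  have "closed {x. Im x = 0 \<and> Re x \<ge> 0}" "closed {x. Im x = 0 \<and> Re x \<le> 1}"
    by (intro closed_Collect_conj closed_Collect_eq closed_Collect_le continuous_intros)+
  then show ?thesis unfolding Dm_def by auto
qed

lemma starlike_slit: "starlike slit"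
  unfolding starlike_def
proof (intro bexI ballI subsetI)
  show "1/2 \<in> slit" by (simp add: slit_def)
  fix z w assume z: "z \<in> slit" and "w \<in> closed_segment (1/2) z"
  then obtain u where u: "0 \<le> u" "u \<le> 1" "w = (1 - u) *\<^sub>R (1/2) + u *\<^sub>R z" unfolding closed_segment_def by auto
  have iw: "Im w = u * Im z" and rw: "Re w = (1 - u) / 2 + u * Re z" using u by auto
  show "w \<in> slit"
  proof (cases "u = 0 \<or> Im z \<noteq> 0")
    case True then show ?thesis using iw rw by (auto simp: slit_def)
  next
    case False
    then have "0 < Re z" "Re z < 1" "u > 0" using z u by (auto simp: slit_def)
    then have "0 < u * Re z" "u * Re z < u * 1" by (auto intro: mult_strict_left_mono)
    then have "0 < Re w" using rw u by (simp add: add_nonneg_pos)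
    moreover have "2 * Re w = 1 - u + 2 * (u * Re z)" using rw by (simp add: field_simps)
    then have "Re w < 1" using u(2) \<open>u * Re z < u * 1\<close> by simp
    ultimately show ?thesis by (simp add: slit_def)
  qed
qed

lemma starlike_Dm: "starlike (Dm i)"
proof (cases "i = 0")
  case True
  show ?thesis unfolding starlike_def
  proof (intro bexI ballI subsetI)
    show "-1 \<in> Dm i" using True by (simp add: Dm_def)
    fix z w assume z: "z \<in> Dm i" and "w \<in> closed_segment (-1) z"
    then obtain u where u: "0 \<le> u" "u \<le> 1" "w = (1 - u) *\<^sub>R (-1) + u *\<^sub>R z" unfolding closed_segment_def by auto
    have iw: "Im w = u * Im z" and rw: "Re w = - (1 - u) + u * Re z" using u by auto
    show "w \<in> Dm i"
    proof (cases "u = 0 \<or> Im z \<noteq> 0")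
      case True then show ?thesis using iw rw \<open>i = 0\<close> by (auto simp: Dm_def)
    next
      case False
      then have "Re z < 0" "u > 0" using z u True by (auto simp: Dm_def)
      then have "u * Re z < 0" by (auto simp: mult_pos_neg)
      then show ?thesis using rw u True by (auto simp: Dm_def)
    qed
  qed
next
  case False
  show ?thesis unfolding starlike_def
  proof (intro bexI ballI subsetI)
    show "2 \<in> Dm i" using False by (simp add: Dm_def)
    fix z w assume z: "z \<in> Dm i" and "w \<in> closed_segment 2 z"
    then obtain u where u: "0 \<le> u" "u \<le> 1" "w = (1 - u) *\<^sub>R 2 + u *\<^sub>R z" unfolding closed_segment_def by auto
    have iw: "Im w = u * Im z" and rw: "Re w = (1 - u) * 2 + u * Re z" using u by auto
    show "w \<in> Dm i"
    proof (cases "u = 0 \<or> Im z \<noteq> 0")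
      case True then show ?thesis using iw rw False by (auto simp: Dm_def)
    next
      case F: False
      then have "Re z > 1" "u > 0" using z u False by (auto simp: Dm_def)
      then have "u * Re z > u * 1" by (intro mult_strict_left_mono) auto
      then show ?thesis using rw u False by (auto simp: Dm_def)
    qed
  qed
qed

lemma connected_slit: "connected slit" and connected_Dm: "connected (Dm i)"
  using starlike_slit starlike_Dm starlike_imp_connected by blast+

lemma Hup_subset: "Hup \<subseteq> slit" "Hup \<subseteq> Dm i" and Hlo_subset: "Hlo \<subseteq> slit" "Hlo \<subseteq> Dm i"
  by (auto simp: Hup_def Hlo_def slit_def Dm_def)

lemma cnj_slit [simp]: "cnj z \<in> slit \<longleftrightarrow> z \<in> slit" and cnj_Dm [simp]: "cnj z \<in> Dm i \<longleftrightarrow> z \<in> Dm i"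
  and cnj_Hup [simp]: "cnj z \<in> Hup \<longleftrightarrow> z \<in> Hlo" and cnj_Hlo [simp]: "cnj z \<in> Hlo \<longleftrightarrow> z \<in> Hup"
  by (auto simp: slit_def Dm_def Hup_def Hlo_def)

lemma cover: "z \<notin> {0,1} \<Longrightarrow> z \<in> slit \<or> z \<in> Dm 0 \<or> z \<in> Dm 1"
  by (auto simp: slit_def Dm_def complex_eq_iff)

lemma notin_01: "z \<in> slit \<Longrightarrow> z \<notin> {0,1}" "z \<in> Dm i \<Longrightarrow> z \<notin> {0,1}"
  by (auto simp: slit_def Dm_def split: if_splits)

lemma cmod_Ln_le: "z \<noteq> 0 \<Longrightarrow> cmod (Ln z) \<le> \<bar>ln (cmod z)\<bar> + pi"
  using cmod_le[of "Ln z"] mpi_less_Im_Ln[of z] Im_Ln_le_pi[of z] by (auto simp: abs_le_iff)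

interpretation slit_log: log_domain slit Ln
proof
  show "open slit" "starlike slit" by (rule open_slit starlike_slit)+
  show "0 \<notin> slit" "1 \<notin> slit" by (auto simp: slit_def)
  show "complex_of_real t * z \<in> slit" if "z \<in> slit" "0 < t" "t \<le> 1" for z t
  proof (cases "Im z = 0")
    case True
    then have "0 < Re z" "Re z < 1" using that by (auto simp: slit_def)
    then have "0 < t * Re z" "t * Re z \<le> 1 * Re z" using that by (auto intro!: mult_right_mono)
    then show ?thesis using \<open>Re z < 1\<close> by (auto simp: slit_def)
  qed (use that in \<open>auto simp: slit_def\<close>)
  show "(Ln has_field_derivative 1 / z) (at z)" if "z \<in> slit" for z
    using has_field_derivative_Ln[of z] that by (auto simp: slit_def complex_nonpos_Reals_iff inverse_eq_divide)
  show "\<exists>B. \<forall>z\<in>slit. cmod (Ln z) \<le> \<bar>ln (cmod z)\<bar> + B"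
    using cmod_Ln_le notin_01(1) by (intro exI[of _ pi]) auto
qed

text \<open>The constant \<open>c\<close> leaves room for the two branches that extend
  \<open>Ln\<close> across the negative axis, one from the upper and one from the lower half
  plane.\<close>

lemma log_domain_Dm0: "log_domain (Dm 0) (\<lambda>z. Ln (-z) + c)"
proof
  show "open (Dm 0)" "starlike (Dm 0)" by (rule open_Dm starlike_Dm)+
  show "0 \<notin> Dm 0" "1 \<notin> Dm 0" by (auto simp: Dm_def)
  show "complex_of_real t * z \<in> Dm 0" if "z \<in> Dm 0" "0 < t" "t \<le> 1" for z t
    using that by (auto simp: Dm_def zero_le_mult_iff)
  show "((\<lambda>z. Ln (-z) + c) has_field_derivative 1 / z) (at z)" if "z \<in> Dm 0" for z
  proof -
    have "-z \<notin> \<real>\<^sub>\<le>\<^sub>0" using that by (auto simp: Dm_def complex_nonpos_Reals_iff)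
    then show ?thesis by (auto intro!: derivative_eq_intros simp: field_simps)
  qed
  have "cmod (Ln (-z) + c) \<le> \<bar>ln (cmod z)\<bar> + (pi + cmod c)" if "z \<in> Dm 0" for z
    using cmod_Ln_le[of "-z"] norm_triangle_ineq[of "Ln (-z)" c] notin_01(2)[OF that] by auto
  then show "\<exists>B. \<forall>z\<in>Dm 0. cmod (Ln (-z) + c) \<le> \<bar>ln (cmod z)\<bar> + B" by blast
qed

section \<open>Continuation across the two cuts and its monodromy constants\<close>

lemma polysys_log_domain: "log_domain D l \<Longrightarrow> polysys D (Lg l)"
  unfolding polysys_def using log_domain.Lg_props by fastforce

lemma polysys_Lr: "polysys slit Lr"
  using polysys_log_domain[OF slit_log.log_domain_axioms] unfolding Lr_eq_Lg[abs_def] .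

lemma Lg_cong:
  assumes "\<And>z t. z \<in> S \<Longrightarrow> 0 < t \<Longrightarrow> t \<le> 1 \<Longrightarrow> complex_of_real t * z \<in> S" "\<And>z. z \<in> S \<Longrightarrow> l z = l' z" "z \<in> S"
  shows "Lg l w z = Lg l' w z"
  using assms(3)
proof (induction w arbitrary: z)
  case (Cons a w)
  have "integral {0..1} (\<lambda>t::real. Lg l w (of_real t * z) * z / (of_real t * z - a)) =
        integral {0..1} (\<lambda>t::real. Lg l' w (of_real t * z) * z / (of_real t * z - a))"
  proof (rule integral_spike[of "{0}"])
    fix t assume "t \<in> {0..1} - {0::real}"
    then show "Lg l' w (of_real t * z) * z / (of_real t * z - a) = Lg l w (of_real t * z) * z / (of_real t * z - a)"
      using Cons.IH[OF assms(1)[OF Cons.prems, of t]] by auto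
  qed auto
  then show ?case using assms(2)[OF Cons.prems] by simp
qed simp

text \<open>\<open>X\<close> continues \<open>Lr\<close> from the upper half plane across the cut
  \<open>i\<close>, and \<open>Y\<close> from the lower one, so \<open>k\<close> holds the monodromy
  constants around the point \<open>i\<close>. The conditions on one-letter words say that only the
  logarithm belonging to the point \<open>i\<close> jumps. The last clause reflects that functions
  whose word has a letter 1 vanish at 0 and hence contribute no constants around 0.\<close>

definition mono_data :: "complex \<Rightarrow> (complex list \<Rightarrow> complex \<Rightarrow> complex) \<Rightarrow> (complex list \<Rightarrow> complex \<Rightarrow> complex) \<Rightarrow> (complex list \<Rightarrow> complex) \<Rightarrow> bool" where
  "mono_data i X Y k \<longleftrightarrow> polysys (Dm i) X \<and> polysys (Dm i) Y
     \<and> (\<forall>w\<in>words. \<forall>z\<in>Hup. X w z = Lr w z) \<and> (\<forall>w\<in>words. \<forall>z\<in>Hlo. Y w z = Lr w z)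
     \<and> (\<forall>w\<in>words. \<forall>z\<in>Dm i. X w z = conv k Y w z)
     \<and> k [] = 1 \<and> k [i] \<noteq> 0 \<and> k [1 - i] = 0
     \<and> (i = 0 \<longrightarrow> (\<forall>x\<in>words. 1 \<in> set x \<longrightarrow> k x = 0))"

lemma Ln_minus_upper: "Im z > 0 \<Longrightarrow> Ln (-z) = Ln z - \<i> * pi" and Ln_minus_lower: "Im z < 0 \<Longrightarrow> Ln (-z) = Ln z + \<i> * pi"
  using Ln_minus[of z] by (cases "z = 0"; auto)+

text \<open>The rays from 0 lie in \<open>Dm 0\<close>, so the recursion \<open>Lg\<close> itself
  gives both continuations once \<open>Ln\<close> is replaced by \<open>Ln (- z)\<close> shifted by
  plus or minus \<open>\<i> * pi\<close>.\<close>

lemma mono_data_0: "\<exists>X Y k. mono_data 0 X Y k"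
proof -
  define lX lY where "lX z = Ln (-z) + \<i> * pi" and "lY z = Ln (-z) + (- \<i> * pi)" for z
  define X Y where "X = Lg lX" and "Y = Lg lY"
  interpret lx: log_domain "Dm 0" lX unfolding lX_def by (rule log_domain_Dm0)
  interpret ly: log_domain "Dm 0" lY unfolding lY_def by (rule log_domain_Dm0)
  have X: "polysys (Dm 0) X" unfolding X_def by (rule polysys_log_domain) (rule lx.log_domain_axioms)
  have Y: "polysys (Dm 0) Y" unfolding Y_def by (rule polysys_log_domain) (rule ly.log_domain_axioms)
  have Xu: "X w z = Lr w z" if "z \<in> Hup" for w z
    unfolding X_def Lr_eq_Lg
  proof (rule Lg_cong[where S = Hup])
    show "lX x = Ln x" if "x \<in> Hup" for x
      using Ln_minus_upper[of x] that by (auto simp: lX_def Hup_def)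
  qed (use that in \<open>auto simp: Hup_def\<close>)
  have Yl: "Y w z = Lr w z" if "z \<in> Hlo" for w z
    unfolding Y_def Lr_eq_Lg
  proof (rule Lg_cong[where S = Hlo])
    show "lY x = Ln x" if "x \<in> Hlo" for x
      using Ln_minus_lower[of x] that by (auto simp: lY_def Hlo_def)
  qed (use that in \<open>auto simp: Hlo_def mult_pos_neg\<close>)
  have p: "-1 \<in> Dm 0" by (simp add: Dm_def)
  define k where "k = kc (\<lambda>w. X w (-1)) (\<lambda>w. Y w (-1))"
  have XY: "X w z = conv k Y w z" if "w \<in> words" "z \<in> Dm 0" for w z
    unfolding k_def by (rule polysys_compare[OF open_Dm connected_Dm X Y p that])
  have k_nil: "k [] = 1" using polysysD(1)[OF X p] by (simp add: k_def kc_Nil)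
  have "k [0] = 2 * \<i> * pi"
  proof -
    have "X [0] (-1) = k [0] + Y [0] (-1)"
      using XY[of "[0]" "-1"] p k_nil polysysD(1)[OF Y p] by (simp add: conv_def)
    then have "k [0] = X [0] (-1) - Y [0] (-1)" by simp
    also have "\<dots> = 2 * \<i> * pi" by (simp add: X_def Y_def lX_def lY_def)
    finally show ?thesis .
  qed
  then have k0: "k [0] \<noteq> 0" by simp
  have lim0: "((\<lambda>t. Lg l w (- of_real t)) \<longlongrightarrow> 0) (at_right 0)"
    if "log_domain (Dm 0) l" "w \<in> words" "1 \<in> set w" for l w
  proof -
    interpret log_domain "Dm 0" l by fact
    have "nonzero_word w" using that by (auto simp: nonzero_word_def intro: bexI[of _ 1])
    then obtain C where C: "\<forall>z\<in>Dm 0. cmod z \<le> 1/2 \<longrightarrow> cmod (Lg l w z) \<le> C * cmod z powr (1/2)"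
      using Lg_props[OF \<open>w \<in> words\<close>] by blast
    have "\<forall>\<^sub>F t in at_right 0. norm (Lg l w (- of_real t)) \<le> C * sqrt t"
      unfolding eventually_at_right_field
    proof (intro exI[of _ "1/2"] conjI allI impI)
      fix t :: real assume t: "0 < t" "t < 1/2"
      then have "- of_real t \<in> Dm 0" by (simp add: Dm_def)
      then show "norm (Lg l w (- of_real t)) \<le> C * sqrt t" using C t by (force simp: powr_half_sqrt)
    qed auto
    moreover have "((\<lambda>t. C * sqrt t) \<longlongrightarrow> 0) (at_right 0)" by (auto intro!: tendsto_eq_intros)
    ultimately show ?thesis by (rule Lim_null_comparison)
  qed
  \<comment> \<open>Solve the deconcatenation for \<open>k x\<close> and let z tend to 0 along the
    negative axis. In each other term the letter 1 lies in the suffix, where \<open>k\<close>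
    vanishes by induction, or in the prefix, where \<open>Y\<close> tends to 0.\<close>
  have kz: "k x = 0" if "x \<in> words" "1 \<in> set x" for x
    using that
  proof (induction x rule: length_induct)
    case (1 x)
    let ?R = "\<lambda>t. X x (- complex_of_real t) - (\<Sum>j\<in>{1..length x}. k (drop j x) * Y (take j x) (- of_real t))"
    have "(?R \<longlongrightarrow> 0 - (\<Sum>j\<in>{1..length x}. 0)) (at_right 0)"
    proof (intro tendsto_diff tendsto_sum)
      show "((\<lambda>t. X x (- of_real t)) \<longlongrightarrow> 0) (at_right 0)" unfolding X_def
        by (rule lim0) (use lx.log_domain_axioms 1 in auto)
      fix j assume j: "j \<in> {1..length x}"
      show "((\<lambda>t. k (drop j x) * Y (take j x) (- of_real t)) \<longlongrightarrow> 0) (at_right 0)"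
      proof (cases "1 \<in> set (drop j x)")
        case True
        then have "k (drop j x) = 0" using 1 j words_drop[of x j] by auto
        then show ?thesis by simp
      next
        case False
        have "set x = set (take j x) \<union> set (drop j x)" by (metis append_take_drop_id set_append)
        then have "1 \<in> set (take j x)" using 1 False by auto
        then have "((\<lambda>t. Y (take j x) (- of_real t)) \<longlongrightarrow> 0) (at_right 0)" unfolding Y_def
          by (intro lim0 ly.log_domain_axioms words_take 1)
        then show ?thesis by (rule tendsto_mult_right_zero)
      qed
    qed
    moreover have "\<forall>\<^sub>F t in at_right 0. ?R t = k x"
      using eventually_at_right_less[of 0]
    proof eventually_elim
      case (elim t)
      then have m: "- complex_of_real t \<in> Dm 0" by (simp add: Dm_def)
      have s: "{..length x} = insert 0 {1..length x}" by auto
      show ?case using XY[OF _ m, of x] 1 polysysD(1)[OF Y m] unfolding conv_def s by simp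
    qed
    ultimately have "((\<lambda>t::real. k x) \<longlongrightarrow> 0) (at_right 0)" using tendsto_cong by fastforce
    then show ?case by (simp add: tendsto_const_iff)
  qed
  show ?thesis
    unfolding mono_data_def using X Y Xu Yl XY k_nil k0 kz by (intro exI[of _ X] exI[of _ Y] exI[of _ k]) auto
qed

text \<open>Rays from 0 to points beyond 1 leave \<open>Dm 1\<close>, so \<open>Lg\<close> cannot be
  used directly. The map z -> 1 - z carries \<open>Dm 1\<close> to \<open>Dm 0\<close> and exchanges
  the letters; the transported solution \<open>B\<close> has arbitrary constants, which
  \<open>polysys_extend\<close> adjusts. Only the one-letter words are then computed, by comparison
  with explicit logarithms.\<close>

lemma mono_data_1: "\<exists>X Y k. mono_data 1 X Y k"
proof -
  define l0 where "l0 z = Ln (-z) + 0" for z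
  have l0: "log_domain (Dm 0) l0" unfolding l0_def by (rule log_domain_Dm0)
  define B where "B w z = Lg l0 (map (\<lambda>a. 1 - a) w) (1 - z)" for w z
  have B: "polysys (Dm 1) B"
    unfolding polysys_def
  proof (intro conjI ballI)
    fix w a z assume w: "w \<in> words" and a: "a \<in> {0,1::complex}" and z: "z \<in> Dm 1"
    have w': "map (\<lambda>a. 1 - a) w \<in> words" using w by (auto simp: words_def)
    have "1 - z \<in> Dm 0" using z by (auto simp: Dm_def)
    from polysysD(2)[OF polysys_log_domain[OF l0] w' _ this, of "1 - a"] a
    have "(Lg l0 (map (\<lambda>a. 1 - a) (a # w)) has_field_derivative B w z / ((1 - z) - (1 - a))) (at (1 - z))"
      by (auto simp: B_def simp del: Lg.simps)
    moreover have "((\<lambda>z. 1 - z) has_field_derivative -1) (at z)" by (auto intro!: derivative_eq_intros)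
    ultimately
    have "(B (a # w) has_field_derivative B w z / ((1 - z) - (1 - a)) * (-1)) (at z)"
      unfolding B_def[abs_def] by (rule DERIV_chain2)
    also have "B w z / ((1 - z) - (1 - a)) * (-1) = B w z / (z - a)"
      using minus_divide_right[of "B w z" "a - z"] by simp
    finally show "(B (a # w) has_field_derivative B w z / (z - a)) (at z)" .
  qed (simp add: B_def)
  have iu: "\<i> \<in> Hup" "-\<i> \<in> Hlo" by (auto simp: Hup_def Hlo_def)
  obtain X where X: "polysys (Dm 1) X" "\<And>w z. w \<in> words \<Longrightarrow> z \<in> Hup \<Longrightarrow> X w z = Lr w z"
    using polysys_extend[OF open_Hup connected_Hup iu(1) open_Dm Hup_subset(2) polysys_subset[OF polysys_Lr Hup_subset(1)] B] by blast
  obtain Y where Y: "polysys (Dm 1) Y" "\<And>w z. w \<in> words \<Longrightarrow> z \<in> Hlo \<Longrightarrow> Y w z = Lr w z"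
    using polysys_extend[OF open_Hlo connected_Hlo iu(2) open_Dm Hlo_subset(2) polysys_subset[OF polysys_Lr Hlo_subset(1)] B] by blast
  have p: "2 \<in> Dm 1" by (simp add: Dm_def)
  define k where "k = kc (\<lambda>w. X w 2) (\<lambda>w. Y w 2)"
  have XY: "X w z = conv k Y w z" if "w \<in> words" "z \<in> Dm 1" for w z
    unfolding k_def by (rule polysys_compare[OF open_Dm connected_Dm X(1) Y(1) p that])
  have k_nil: "k [] = 1" using polysysD(1)[OF X(1) p] by (simp add: k_def kc_Nil)
  have ks: "X [a] z = k [a] + Y [a] z" if "a \<in> {0,1}" "z \<in> Dm 1" for a z
    using XY[of "[a]" z] that k_nil polysysD(1)[OF Y(1) that(2)] by (auto simp: conv_def)
  have cmp: "\<exists>c. \<forall>z\<in>S. A [a] z = f z + c"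
    if "polysys S A" "a \<in> {0,1}" "open S" "connected S" "q \<in> S" "\<And>z. z \<in> S \<Longrightarrow> (f has_field_derivative 1 / (z - a)) (at z)" for S A a f q
  proof (intro exI[of _ "A [a] q - f q"] ballI)
    fix z assume z: "z \<in> S"
    have "A [a] z - f z = A [a] q - f q"
    proof (rule deriv_zero_imp_eq[OF that(3,4) _ z that(5)])
      fix x assume x: "x \<in> S"
      have "((\<lambda>x. A [a] x - f x) has_field_derivative (A [] x / (x - a) - 1 / (x - a))) (at x)"
        using polysysD(2)[OF that(1) words_Nil that(2) x] that(6)[OF x] by (intro derivative_intros)
      then show "((\<lambda>x. A [a] x - f x) has_field_derivative 0) (at x)" using polysysD(1)[OF that(1) x] by simp
    qed
    then show "A [a] z = f z + (A [a] q - f q)" by (simp add: algebra_simps)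
  qed
  have LnD: "(Ln has_field_derivative 1 / (z - 0)) (at z)" if "z \<in> Dm 1" for z
    using has_field_derivative_Ln[of z] that by (auto simp: Dm_def complex_nonpos_Reals_iff inverse_eq_divide)
  have Ln1D: "((\<lambda>z. Ln (z - 1)) has_field_derivative 1 / (z - 1)) (at z)" if "z \<in> Dm 1" for z
  proof -
    have "z - 1 \<notin> \<real>\<^sub>\<le>\<^sub>0" using that by (auto simp: Dm_def complex_nonpos_Reals_iff)
    then show ?thesis by (auto intro!: derivative_eq_intros simp: inverse_eq_divide)
  qed
  have LnS: "((\<lambda>z. Ln (1 - z)) has_field_derivative 1 / (z - 1)) (at z)" if "z \<in> slit" for z
  proof -
    have z: "1 - z \<notin> \<real>\<^sub>\<le>\<^sub>0" using that by (auto simp: slit_def complex_nonpos_Reals_iff)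
    have "((\<lambda>z. Ln (1 - z)) has_field_derivative 1 / (1 - z) * (-1)) (at z)"
      using z by (auto intro!: derivative_eq_intros simp: inverse_eq_divide)
    also have "1 / (1 - z) * (-1) = 1 / (z - 1)" using minus_divide_right[of 1 "1 - z"] by simp
    finally show ?thesis .
  qed
  have LnSD: "(Ln has_field_derivative 1 / (z - 0)) (at z)" if "z \<in> slit" for z
    using slit_log.l_deriv[OF that] by simp
  have half: "1/2 \<in> slit" by (simp add: slit_def)
  obtain c0 where c0: "\<forall>z\<in>slit. Lr [0] z = Ln z + c0" using cmp[OF polysys_Lr _ open_slit connected_slit half LnSD] by auto
  obtain c1 where c1: "\<forall>z\<in>slit. Lr [1] z = Ln (1 - z) + c1" using cmp[OF polysys_Lr _ open_slit connected_slit half LnS] by auto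
  obtain x0 where x0: "\<forall>z\<in>Dm 1. X [0] z = Ln z + x0" using cmp[OF X(1) _ open_Dm connected_Dm p LnD] by auto
  obtain y0 where y0: "\<forall>z\<in>Dm 1. Y [0] z = Ln z + y0" using cmp[OF Y(1) _ open_Dm connected_Dm p LnD] by auto
  obtain x1 where x1: "\<forall>z\<in>Dm 1. X [1] z = Ln (z - 1) + x1" using cmp[OF X(1) _ open_Dm connected_Dm p Ln1D] by auto
  obtain y1 where y1: "\<forall>z\<in>Dm 1. Y [1] z = Ln (z - 1) + y1" using cmp[OF Y(1) _ open_Dm connected_Dm p Ln1D] by auto
  \<comment> \<open>At these two points 1 - z and z - 1 are \<open>\<i>\<close> and
    \<open>- \<i>\<close> in some order, so the constants are compared through the single value
    \<open>Ln (- \<i>)\<close>.\<close>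
  have q: "1 + \<i> \<in> Hup" "1 - \<i> \<in> Hlo" by (auto simp: Hup_def Hlo_def)
  have qs: "1 + \<i> \<in> slit" "1 - \<i> \<in> slit" "1 + \<i> \<in> Dm 1" "1 - \<i> \<in> Dm 1" by (auto simp: slit_def Dm_def)
  have "x0 = c0" "y0 = c0"
    using X(2)[of "[0]", OF _ q(1)] Y(2)[of "[0]", OF _ q(2)] c0 x0 y0 qs by (auto simp del: Lr.simps)
  then have k0: "k [0] = 0" using ks[OF _ p, of 0] x0 y0 p by auto
  have Lni: "Ln (-\<i>) = Ln \<i> - \<i> * pi" using Ln_minus_upper[of \<i>] by simp
  have "x1 = c1 - \<i> * pi"
    using X(2)[of "[1]", OF _ q(1)] c1 x1 qs Lni by (auto simp del: Lr.simps Ln_ii simp: algebra_simps)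
  moreover have "y1 = c1 + \<i> * pi"
    using Y(2)[of "[1]", OF _ q(2)] c1 y1 qs Lni by (auto simp del: Lr.simps Ln_ii simp: algebra_simps)
  moreover have "k [1] = x1 - y1" using ks[OF _ p, of 1] x1 y1 p by simp
  ultimately have "k [1] = - 2 * \<i> * pi" by simp
  then have k1: "k [1] \<noteq> 0" by simp
  show ?thesis
    unfolding mono_data_def using X Y XY k_nil k0 k1 by (intro exI[of _ X] exI[of _ Y] exI[of _ k]) auto
qed

definition monoX :: "complex \<Rightarrow> complex list \<Rightarrow> complex \<Rightarrow> complex" where
  "monoX i = (SOME X. \<exists>Y k. mono_data i X Y k)"
definition monoY :: "complex \<Rightarrow> complex list \<Rightarrow> complex \<Rightarrow> complex" where
  "monoY i = (SOME Y. \<exists>k. mono_data i (monoX i) Y k)"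
definition monok :: "complex \<Rightarrow> complex list \<Rightarrow> complex" where
  "monok i = (SOME k. mono_data i (monoX i) (monoY i) k)"

lemma mono_data: "i \<in> {0,1} \<Longrightarrow> mono_data i (monoX i) (monoY i) (monok i)"
  unfolding monok_def monoY_def monoX_def using mono_data_0 mono_data_1
  by (metis (mono_tags, lifting) insertE singletonD someI_ex)

lemma mono:
  assumes "i \<in> {0,1}"
  shows "polysys (Dm i) (monoX i)" "polysys (Dm i) (monoY i)"
    "w \<in> words \<Longrightarrow> z \<in> Hup \<Longrightarrow> monoX i w z = Lr w z"
    "w \<in> words \<Longrightarrow> z \<in> Hlo \<Longrightarrow> monoY i w z = Lr w z"
    "w \<in> words \<Longrightarrow> z \<in> Dm i \<Longrightarrow> monoX i w z = conv (monok i) (monoY i) w z"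
    "monok i [] = 1" "monok i [i] \<noteq> 0" "monok i [1 - i] = 0"
  using mono_data[OF assms] unfolding mono_data_def by blast+

lemma monok_0: "x \<in> words \<Longrightarrow> 1 \<in> set x \<Longrightarrow> monok 0 x = 0"
  using mono_data[of 0] unfolding mono_data_def by blast

section \<open>Words of bounded length and the monodromy operator on coefficients\<close>

definition W :: "nat \<Rightarrow> complex list set" where "W N = {w \<in> words. length w \<le> N}"

lemma finite_W [simp]: "finite (W N)"
proof -
  have "W N = {w. set w \<subseteq> {0,1} \<and> length w \<le> N}" by (auto simp: W_def words_def)
  then show ?thesis using finite_lists_length_le[of "{0,1::complex}" N] by simp
qed

lemma W_words: "w \<in> W N \<Longrightarrow> w \<in> words" and Nil_W [simp]: "[] \<in> W N" and W_mono: "N \<le> M \<Longrightarrow> W N \<subseteq> W M"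
  by (auto simp: W_def)

lemma W_0: "W 0 = {[]}" by (auto simp: W_def)

lemma W_support:
  fixes h :: "complex list \<Rightarrow> 'b::zero"
  assumes "\<And>y. h y \<noteq> 0 \<Longrightarrow> y \<in> W n" "length w > n"
  shows "h w = 0"
  using assms(1)[of w] assms(2) by (auto simp: W_def)

lemma W_Suc_sum:
  fixes f :: "complex list \<Rightarrow> 'b::comm_monoid_add"
  shows "(\<Sum>w\<in>W (Suc N). f w) = f [] + (\<Sum>w\<in>W N. f (0 # w)) + (\<Sum>w\<in>W N. f (1 # w))"
proof -
  have s: "W (Suc N) = insert [] ((#) 0 ` W N \<union> (#) 1 ` W N)"
  proof (intro set_eqI iffI)
    fix w assume "w \<in> W (Suc N)"
    then show "w \<in> insert [] ((#) 0 ` W N \<union> (#) 1 ` W N)" by (cases w) (auto simp: W_def)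
  qed (auto simp: W_def)
  have "(\<Sum>w\<in>W (Suc N). f w) = f [] + (\<Sum>w\<in>(#) 0 ` W N \<union> (#) 1 ` W N. f w)"
    unfolding s by (subst sum.insert) auto
  also have "(\<Sum>w\<in>(#) 0 ` W N \<union> (#) 1 ` W N. f w) = (\<Sum>w\<in>(#) 0 ` W N. f w) + (\<Sum>w\<in>(#) 1 ` W N. f w)"
    by (rule sum.union_disjoint) auto
  finally show ?thesis by (simp add: sum.reindex add.assoc)
qed

text \<open>A word with a cut position is the same as a pair of words, by concatenation. The
  hypothesis on \<open>f\<close> accounts for the pairs whose concatenation is longer than
  \<open>N\<close>.\<close>

lemma split_sum:
  fixes f :: "complex list \<Rightarrow> complex list \<Rightarrow> 'b::comm_monoid_add"
  assumes "\<And>y x. length y + length x > N \<Longrightarrow> f y x = 0"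
  shows "(\<Sum>v\<in>W N. \<Sum>j\<le>length v. f (take j v) (drop j v)) = (\<Sum>y\<in>W N. \<Sum>x\<in>W N. f y x)"
proof -
  let ?S = "{p \<in> W N \<times> W N. length (fst p) + length (snd p) \<le> N}"
  have "(\<Sum>v\<in>W N. \<Sum>j\<le>length v. f (take j v) (drop j v)) = (\<Sum>(v,j)\<in>Sigma (W N) (\<lambda>v. {..length v}). f (take j v) (drop j v))"
    by (rule sum.Sigma) auto
  also have "\<dots> = (\<Sum>(y,x)\<in>?S. f y x)"
    by (rule sum.reindex_bij_witness[where j = "\<lambda>(v,j). (take j v, drop j v)" and i = "\<lambda>(y,x). (y @ x, length y)"])
       (auto simp: W_def words_take words_drop)
  also have "\<dots> = (\<Sum>(y,x)\<in>W N \<times> W N. f y x)"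
  proof (rule sum.mono_neutral_left)
    have "length y + length x \<le> N" if "f y x \<noteq> 0" for y x using assms that by (meson not_le)
    then show "\<forall>p\<in>W N \<times> W N - ?S. (case p of (y, x) \<Rightarrow> f y x) = 0" by auto
  qed auto
  also have "\<dots> = (\<Sum>y\<in>W N. \<Sum>x\<in>W N. f y x)" by (rule sum.cartesian_product[symmetric])
  finally show ?thesis .
qed

text \<open>Monodromy minus the identity, read on coefficients: if \<open>h\<close> are the
  coefficients of a combination of polylogarithms, continuing it around the point adds
  \<open>Kop k N h y\<close> to the coefficient of the word \<open>y\<close>.\<close>

definition Kop :: "(complex list \<Rightarrow> complex) \<Rightarrow> nat \<Rightarrow> (complex list \<Rightarrow> complex) \<Rightarrow> complex list \<Rightarrow> complex" where
  "Kop k N h y = (\<Sum>x\<in>W N - {[]}. k x * h (y @ x))"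

lemma Kop_ext:
  assumes "n \<le> M" "\<And>w. w \<in> words \<Longrightarrow> length w > n \<Longrightarrow> h w = 0" "y \<in> words"
  shows "Kop k M h y = Kop k n h y"
  unfolding Kop_def
proof (rule sum.mono_neutral_right)
  show "\<forall>x\<in>W M - {[]} - (W n - {[]}). k x * h (y @ x) = 0"
  proof
    fix x assume "x \<in> W M - {[]} - (W n - {[]})"
    then have "y @ x \<in> words" "length (y @ x) > n" using assms(3) by (auto simp: W_def)
    then show "k x * h (y @ x) = 0" using assms(2) by simp
  qed
qed (use W_mono[OF assms(1)] in auto)

lemma Kop_add: "Kop k N (\<lambda>w. f w + g w) y = Kop k N f y + Kop k N g y"
  by (simp add: Kop_def ring_distribs sum.distrib)

lemma Kop_top:
  assumes h: "\<And>w. w \<in> words \<Longrightarrow> length w > Suc n \<Longrightarrow> h w = 0" and y: "y \<in> words" "length y = n" and N: "N \<ge> 1"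
  shows "Kop k N h y = k [0] * h (y @ [0]) + k [1] * h (y @ [1])"
proof -
  have "Kop k N h y = (\<Sum>x\<in>{[0],[1]}. k x * h (y @ x))"
    unfolding Kop_def
  proof (rule sum.mono_neutral_right)
    show "\<forall>x\<in>W N - {[]} - {[0], [1]}. k x * h (y @ x) = 0"
    proof
      fix x assume x: "x \<in> W N - {[]} - {[0], [1]}"
      obtain a x' where ax: "x = a # x'" "a \<in> {0,1}" using x by (cases x) (auto simp: W_def)
      then have "x' \<noteq> []" using x by auto
      then have "length (y @ x) > Suc n" using y ax by (cases x') auto
      then show "k x * h (y @ x) = 0" using h[of "y @ x"] y x by (auto simp: W_def)
    qed
  qed (simp, use N in \<open>auto simp: W_def\<close>)
  then show ?thesis by simp
qed

text \<open>Just below the top length only one-letter suffixes survive, and of these only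
  \<open>[i]\<close>. As \<open>monok i [i]\<close> is nonzero, the top coefficients ending in
  \<open>i\<close> can be read off from the monodromy around \<open>i\<close>.\<close>

lemma monok_top:
  assumes "i \<in> {0,1}" "\<And>w. w \<in> words \<Longrightarrow> length w > Suc n \<Longrightarrow> h w = 0" "y \<in> words" "length y = n" "N \<ge> 1"
  shows "Kop (monok i) N h y = monok i [i] * h (y @ [i])"
  using Kop_top[of n h y N "monok i"] assms mono(8)[OF assms(1)] by auto

section \<open>Invariant coefficient families\<close>

text \<open>A family \<open>c\<close> stands for the function \<open>\<Sum> c u v * L_u(cnj z) * L_v(z)\<close>. Invariance under
  crossing the cut \<open>i\<close> is written with the holomorphic and the antiholomorphic factor on
  opposite sides, so that the condition is symmetric under complex conjugation.\<close>
definition csup :: "nat \<Rightarrow> (complex list \<Rightarrow> complex list \<Rightarrow> complex) \<Rightarrow> bool" where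
  "csup N c \<longleftrightarrow> (\<forall>u v. c u v \<noteq> 0 \<longrightarrow> u \<in> W N \<and> v \<in> W N)"

text \<open>The empty word is left out because its two contributions cancel.\<close>

definition defect :: "nat \<Rightarrow> complex \<Rightarrow> (complex list \<Rightarrow> complex list \<Rightarrow> complex) \<Rightarrow> complex list \<Rightarrow> complex list \<Rightarrow> complex" where
  "defect N i c y y' = (\<Sum>x\<in>W N - {[]}. monok i x * (c y (y' @ x) - c (y @ x) y'))"

definition cinv :: "nat \<Rightarrow> (complex list \<Rightarrow> complex list \<Rightarrow> complex) \<Rightarrow> bool" where
  "cinv N c \<longleftrightarrow> csup N c \<and> (\<forall>i\<in>{0,1}. \<forall>y\<in>words. \<forall>y'\<in>words. defect N i c y y' = 0)"

definition Inv :: "(complex list \<Rightarrow> complex list \<Rightarrow> complex) \<Rightarrow> bool" where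
  "Inv c \<longleftrightarrow> (\<exists>N. cinv N c)"

lemma csupD: "csup N c \<Longrightarrow> u \<notin> W N \<Longrightarrow> c u v = 0" "csup N c \<Longrightarrow> v \<notin> W N \<Longrightarrow> c u v = 0"
  unfolding csup_def by blast+

lemma csup_mono: "csup N c \<Longrightarrow> N \<le> M \<Longrightarrow> csup M c"
  unfolding csup_def using W_mono by blast

lemma defect_ext:
  assumes "csup N c" "N \<le> M" "y \<in> words" "y' \<in> words"
  shows "defect M i c y y' = defect N i c y y'"
  unfolding defect_def
proof (rule sum.mono_neutral_right)
  show "\<forall>x\<in>W M - {[]} - (W N - {[]}). monok i x * (c y (y' @ x) - c (y @ x) y') = 0"
  proof
    fix x assume "x \<in> W M - {[]} - (W N - {[]})"
    then have "y' @ x \<notin> W N" "y @ x \<notin> W N" by (auto simp: W_def)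
    then show "monok i x * (c y (y' @ x) - c (y @ x) y') = 0" using csupD[OF assms(1)] by simp
  qed
qed (use W_mono[OF assms(2)] in auto)

lemma cinv_mono: "cinv N c \<Longrightarrow> N \<le> M \<Longrightarrow> cinv M c"
  unfolding cinv_def using csup_mono defect_ext by metis

lemma Inv_obtain2:
  assumes "Inv c" "Inv d" obtains N where "cinv N c" "cinv N d"
  using assms unfolding Inv_def by (metis cinv_mono max.cobounded1 max.cobounded2)

lemma Inv_lincomb: 
  assumes "Inv c" "Inv d"
  shows "Inv (\<lambda>u v. s * c u v + t * d u v)"
proof -
  obtain N where N: "cinv N c" "cinv N d" using Inv_obtain2[OF assms] .
  have "defect N i (\<lambda>u v. s * c u v + t * d u v) y y' = s * defect N i c y y' + t * defect N i d y y'" for i y y'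
    unfolding defect_def sum_distrib_left sum.distrib[symmetric] by (rule sum.cong) (auto simp: algebra_simps)
  moreover have "csup N (\<lambda>u v. s * c u v + t * d u v)"
    unfolding csup_def
  proof (intro allI impI)
    fix u v assume nz: "s * c u v + t * d u v \<noteq> 0"
    have "csup N c" "csup N d" using N by (simp_all add: cinv_def)
    from csupD[OF this(1)] csupD[OF this(2)] nz show "u \<in> W N \<and> v \<in> W N"
      by (metis add_0 mult_zero_right)
  qed
  ultimately have "cinv N (\<lambda>u v. s * c u v + t * d u v)"
    using N unfolding cinv_def by simp
  then show ?thesis unfolding Inv_def by blast
qed

lemma Inv_zero: "Inv (\<lambda>u v. 0)"
  unfolding Inv_def cinv_def csup_def defect_def by simp

lemma Inv_add: "Inv c \<Longrightarrow> Inv d \<Longrightarrow> Inv (\<lambda>u v. c u v + d u v)"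
  and Inv_diff: "Inv c \<Longrightarrow> Inv d \<Longrightarrow> Inv (\<lambda>u v. c u v - d u v)"
  and Inv_scale: "Inv c \<Longrightarrow> Inv (\<lambda>u v. s * c u v)"
  using Inv_lincomb[of c d 1 1] Inv_lincomb[of c d 1 "-1"] Inv_lincomb[of c "\<lambda>u v. 0" s 0] Inv_zero by auto

lemma Inv_sum: "finite S \<Longrightarrow> (\<And>s. s \<in> S \<Longrightarrow> Inv (c s)) \<Longrightarrow> Inv (\<lambda>u v. \<Sum>s\<in>S. c s u v)"
  by (induction S rule: finite_induct) (auto intro: Inv_zero Inv_add)

definition swap :: "(complex list \<Rightarrow> complex list \<Rightarrow> complex) \<Rightarrow> complex list \<Rightarrow> complex list \<Rightarrow> complex" where
  "swap c = (\<lambda>u v. c v u)"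

lemma swap_swap [simp]: "swap (swap c) = c" by (simp add: swap_def)

lemma Inv_swap: assumes "Inv c" shows "Inv (swap c)"
proof -
  obtain N where N: "cinv N c" using assms unfolding Inv_def by blast
  have "defect N i (swap c) y y' = - defect N i c y' y" for i y y'
    unfolding defect_def swap_def sum_negf[symmetric] by (rule sum.cong) (auto simp: algebra_simps)
  then have "cinv N (swap c)" using N unfolding cinv_def csup_def by (auto simp: swap_def)
  then show ?thesis unfolding Inv_def by blast
qed

definition delta :: "complex list \<Rightarrow> complex list \<Rightarrow> complex" where
  "delta u v = (if u = [] \<and> v = [] then 1 else 0)"

lemma Inv_delta: "Inv delta"
proof -
  have "cinv 0 delta" by (auto simp: cinv_def csup_def defect_def delta_def W_0)
  then show ?thesis unfolding Inv_def by blast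
qed

section \<open>Formal derivatives and primitives of coefficient families\<close>

definition dz :: "complex \<Rightarrow> (complex list \<Rightarrow> complex list \<Rightarrow> complex) \<Rightarrow> complex list \<Rightarrow> complex list \<Rightarrow> complex" where
  "dz a c = (\<lambda>u v. c u (a # v))"
definition dzb :: "complex \<Rightarrow> (complex list \<Rightarrow> complex list \<Rightarrow> complex) \<Rightarrow> complex list \<Rightarrow> complex list \<Rightarrow> complex" where
  "dzb a c = (\<lambda>u v. c (a # u) v)"

lemma swap_dz: "swap (dz a c) = dzb a (swap c)" and swap_dzb: "swap (dzb a c) = dz a (swap c)"
  by (simp_all add: swap_def dz_def dzb_def)

lemma Inv_dz: assumes "Inv c" "a \<in> {0,1}" shows "Inv (dz a c)"
proof -
  obtain N where N: "cinv N c" using assms unfolding Inv_def by blast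
  have "csup N (dz a c)" using N unfolding cinv_def csup_def dz_def by (fastforce simp: W_def)
  moreover have "defect N i (dz a c) y y' = defect N i c y (a # y')" for i y y'
    unfolding defect_def dz_def by simp
  ultimately have "cinv N (dz a c)" using N assms(2) unfolding cinv_def by auto
  then show ?thesis unfolding Inv_def by blast
qed

lemma Inv_dzb: assumes "Inv c" "a \<in> {0,1}" shows "Inv (dzb a c)"
  using Inv_swap[OF Inv_dz[OF Inv_swap[OF assms(1)] assms(2)]] by (simp add: swap_dz)

text \<open>The jumps around 0 and around 1 can be prescribed independently, as for a free
  fundamental group: the coefficients of top length are forced by the top part of \<open>j\<close>,
  their contribution is subtracted, and the remainder has shorter support. The operator never sees
  \<open>h []\<close>, which is normalised to 0.\<close>

lemma solve_monodromy:
  assumes "\<And>i y. i \<in> {0,1} \<Longrightarrow> j i y \<noteq> 0 \<Longrightarrow> y \<in> words \<and> length y < n"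
  shows "\<exists>h. (\<forall>y. h y \<noteq> 0 \<longrightarrow> y \<in> W n) \<and> h [] = 0 \<and> (\<forall>i\<in>{0,1}. \<forall>y\<in>words. Kop (monok i) n h y = j i y)"
  using assms
proof (induction n arbitrary: j)
  case 0
  then have "j i y = 0" if "i \<in> {0,1}" for i y using that by (metis not_less_zero)
  then show ?case by (intro exI[of _ "\<lambda>y. 0"]) (auto simp: Kop_def)
next
  case (Suc n)
  \<comment> \<open>The last letter of a word of length \<open>Suc n\<close> decides which of the
    two equations fixes its coefficient; the division is possible because \<open>monok i [i]\<close>
    is nonzero.\<close>
  define ht where "ht w = (if w \<in> words \<and> length w = Suc n then j (last w) (butlast w) / monok (last w) [last w] else 0)" for w
  have ht_long: "ht w = 0" if "length w > Suc n" for w using that by (auto simp: ht_def)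
  define j' where "j' i y = j i y - Kop (monok i) (Suc n) ht y" for i y
  have "y \<in> words \<and> length y < n" if i: "i \<in> {0,1}" and nz: "j' i y \<noteq> 0" for i y
  proof (rule ccontr)
    assume H: "\<not> (y \<in> words \<and> length y < n)"
    show False
    proof (cases "y \<in> words \<and> length y = n")
      case True
      have "Kop (monok i) (Suc n) ht y = monok i [i] * ht (y @ [i])"
        by (rule monok_top[OF i, of n]) (use True ht_long in auto)
      also have "\<dots> = j i y" using True i mono(7)[OF i] by (auto simp: ht_def)
      finally show False using nz by (simp add: j'_def)
    next
      case False
      then have "j i y = 0" using Suc.prems[OF i, of y] H by (metis less_Suc_eq)
      moreover have "Kop (monok i) (Suc n) ht y = 0"
        unfolding Kop_def
      proof (rule sum.neutral, intro ballI)
        fix x assume x: "x \<in> W (Suc n) - {[]}"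
        then have "ht (y @ x) = 0" using H False by (cases x) (auto simp: ht_def)
        then show "monok i x * ht (y @ x) = 0" by simp
      qed
      ultimately show False using nz by (simp add: j'_def)
    qed
  qed
  from Suc.IH[OF this] obtain h where H: "(\<forall>y. h y \<noteq> 0 \<longrightarrow> y \<in> W n) \<and> h [] = 0
     \<and> (\<forall>i\<in>{0,1}. \<forall>y\<in>words. Kop (monok i) n h y = j' i y)" ..
  have h: "\<And>y. h y \<noteq> 0 \<Longrightarrow> y \<in> W n" "h [] = 0"
     "\<And>i y. i \<in> {0,1} \<Longrightarrow> y \<in> words \<Longrightarrow> Kop (monok i) n h y = j' i y"
    using H by (blast, blast, blast)
  show ?case
  proof (intro exI[of _ "\<lambda>w. ht w + h w"] conjI allI ballI impI)
    fix y assume "ht y + h y \<noteq> 0"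
    then consider "ht y \<noteq> 0" | "h y \<noteq> 0" by (metis add_0)
    then show "y \<in> W (Suc n)"
    proof cases
      case 1 then show ?thesis by (simp add: W_def ht_def split: if_splits)
    next
      case 2 then show ?thesis using h(1)[of y] W_mono[of n "Suc n"] by auto
    qed
  next
    show "ht [] + h [] = 0" using h(2) by (simp add: ht_def)
  next
    fix i y assume iy: "i \<in> {0,1::complex}" "y \<in> words"
    have "Kop (monok i) (Suc n) h y = Kop (monok i) n h y"
      by (rule Kop_ext) (use W_support[of h, OF h(1)] iy in auto)
    then show "Kop (monok i) (Suc n) (\<lambda>w. ht w + h w) y = j i y"
      using h(3)[OF iy] by (simp add: Kop_add j'_def)
  qed
qed

text \<open>A combination of polylogarithms without monodromy around 0 and 1 has no terms beyond the
  empty word: by \<open>monok_top\<close> its longest words carry zero coefficients, and one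
  descends.\<close>

lemma monodromy_kernel:
  assumes "\<And>y. h y \<noteq> 0 \<Longrightarrow> y \<in> W n" "\<And>i y. i \<in> {0,1} \<Longrightarrow> y \<in> words \<Longrightarrow> Kop (monok i) n h y = 0" "w \<noteq> []"
  shows "h w = 0"
  using assms
proof (induction n)
  case 0
  then show ?case using W_0 by blast
next
  case (Suc n)
  have top: "h y = 0" if ly: "length y = Suc n" for y
  proof (rule ccontr)
    assume nz: "h y \<noteq> 0"
    then have y: "y \<in> words" using Suc.prems(1) W_words by blast
    obtain y' i where yi: "y = y' @ [i]" using ly by (cases y rule: rev_cases) auto
    have i: "i \<in> {0,1}" and y': "y' \<in> words" "length y' = n" using y yi ly by auto
    have "Kop (monok i) (Suc n) h y' = monok i [i] * h (y' @ [i])"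
      by (rule monok_top[OF i _ y']) (use W_support[of h, OF Suc.prems(1)] in auto)
    then show False using Suc.prems(2)[OF i y'(1)] mono(7)[OF i] nz yi by simp
  qed
  have s: "y \<in> W n" if "h y \<noteq> 0" for y using Suc.prems(1)[OF that] top[of y] that by (fastforce simp: W_def le_Suc_eq)
  have "Kop (monok i) n h y = 0" if "i \<in> {0,1}" "y \<in> words" for i y
    using Kop_ext[of n "Suc n" h y "monok i"] W_support[of h, OF s] Suc.prems(2)[OF that] that by auto
  then show ?case using Suc.IH s Suc.prems(3) by blast
qed

text \<open>The formal version of the fact that a single-valued antiholomorphic combination is
  constant. The difference lives on \<open>v = []\<close>, where invariance with
  \<open>y' = []\<close> says that its entries lie in the kernel of both monodromy
  operators.\<close>

lemma Inv_unique:
  assumes "Inv c" "Inv d" "\<And>a u v. a \<in> {0,1} \<Longrightarrow> c u (a # v) = d u (a # v)" "c [] [] = d [] []"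
  shows "c = d"
proof -
  define e where "e u v = c u v - d u v" for u v
  have "Inv e" unfolding e_def by (rule Inv_diff[OF assms(1,2)])
  then obtain N where N: "cinv N e" unfolding Inv_def by blast
  have e1: "e u v = 0" if "v \<noteq> []" for u v
  proof (cases v)
    case (Cons a v')
    show ?thesis
    proof (cases "a \<in> {0,1}")
      case True then show ?thesis using assms(3) Cons by (simp add: e_def)
    next
      case False
      then have "v \<notin> W N" using Cons by (auto simp: W_def)
      then show ?thesis using N csupD(2) unfolding cinv_def by blast
    qed
  qed (use that in simp)
  have "e u [] = 0" if "u \<noteq> []" for u
  proof (rule monodromy_kernel[where n = N and h = "\<lambda>u. e u []"])
    show "y \<in> W N" if "e y [] \<noteq> 0" for y using N that unfolding cinv_def csup_def by blast
    fix i y assume iy: "i \<in> {0,1::complex}" "y \<in> words"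
    have "defect N i e y [] = - Kop (monok i) N (\<lambda>u. e u []) y"
      unfolding defect_def Kop_def sum_negf[symmetric] by (rule sum.cong) (auto simp: e1)
    then show "Kop (monok i) N (\<lambda>u. e u []) y = 0" using N iy unfolding cinv_def by auto
  qed (rule that)
  then have "e u v = 0" for u v using e1 assms(4) by (metis e_def eq_iff_diff_eq_0)
  then show ?thesis by (intro ext) (simp add: e_def)
qed

text \<open>Prepending \<open>a\<close> to \<open>v\<close> gives a primitive that fails to be
  invariant only in the equations with \<open>y' = []\<close>. The failure \<open>j\<close> is
  compensated by purely antiholomorphic terms \<open>h\<close>, which do not affect the derivative
  with respect to z.\<close>

lemma ex_lift:
  assumes "Inv c" "a \<in> {0,1}"
  shows "\<exists>C. Inv C \<and> (\<forall>u b v. C u (b # v) = (if b = a then c u v else 0)) \<and> C [] [] = 0"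
proof -
  obtain N where N: "cinv N c" using assms unfolding Inv_def by blast
  define C0 where "C0 u v = (case v of [] \<Rightarrow> 0 | b # v' \<Rightarrow> if b = a then c u v' else 0)" for u v
  define j where "j i y = (\<Sum>x\<in>W (Suc N) - {[]}. monok i x * C0 y x)" for i y
  \<comment> \<open>The words \<open>y\<close> that occur come from \<open>c\<close>, so they have
    length at most \<open>N\<close>; this is the strict bound that \<open>solve_monodromy\<close>
    asks for at \<open>Suc N\<close>, the length reached after prepending a letter.\<close>
  have "y \<in> words \<and> length y < Suc N" if nz: "j i y \<noteq> 0" for i y
  proof -
    obtain x where "C0 y x \<noteq> 0"
    proof (rule ccontr)
      assume "\<not> thesis"
      then have "C0 y x = 0" for x using that by blast
      then show False using nz by (simp add: j_def)
    qed
    then obtain v where "c y v \<noteq> 0" by (auto simp: C0_def split: list.splits if_splits)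
    then show ?thesis using N unfolding cinv_def csup_def by (auto simp: W_def less_Suc_eq_le)
  qed
  then obtain h where h: "\<And>y. h y \<noteq> 0 \<Longrightarrow> y \<in> W (Suc N)" "h [] = 0"
     "\<And>i y. i \<in> {0,1} \<Longrightarrow> y \<in> words \<Longrightarrow> Kop (monok i) (Suc N) h y = j i y"
    using solve_monodromy[of j "Suc N"] by blast
  define C where "C u v = (case v of [] \<Rightarrow> h u | b # v' \<Rightarrow> if b = a then c u v' else 0)" for u v
  have "csup (Suc N) C"
    unfolding csup_def
  proof (intro allI impI)
    fix u v assume nz: "C u v \<noteq> 0"
    show "u \<in> W (Suc N) \<and> v \<in> W (Suc N)"
    proof (cases v)
      case Nil then show ?thesis using nz h(1) by (auto simp: C_def)
    next
      case (Cons b v')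
      then have "b = a" "c u v' \<noteq> 0" using nz by (auto simp: C_def split: if_splits)
      then have "u \<in> W N" "v' \<in> W N" using N unfolding cinv_def csup_def by blast+
      then show ?thesis using assms(2) Cons \<open>b = a\<close> by (auto simp: W_def)
    qed
  qed
  moreover have "defect (Suc N) i C y y' = 0" if i: "i \<in> {0,1}" and y: "y \<in> words" "y' \<in> words" for i y y'
  proof (cases y')
    case Nil
    have "defect (Suc N) i C y y' = j i y - Kop (monok i) (Suc N) h y"
      unfolding defect_def j_def Kop_def sum_subtractf[symmetric] Nil
      by (rule sum.cong) (auto simp: C_def C0_def algebra_simps split: list.splits)
    then show ?thesis using h(3)[OF i y(1)] by simp
  next
    case (Cons b y'')
    show ?thesis
    proof (cases "b = a")
      case True
      have "defect (Suc N) i C y y' = defect (Suc N) i c y y''"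
        unfolding defect_def Cons True by (simp add: C_def)
      also have "\<dots> = 0" using cinv_mono[OF N, of "Suc N"] i y Cons unfolding cinv_def by auto
      finally show ?thesis .
    next
      case False then show ?thesis unfolding defect_def Cons by (simp add: C_def)
    qed
  qed
  ultimately have "Inv C" unfolding Inv_def cinv_def by blast
  then show ?thesis using h(2) by (intro exI[of _ C]) (auto simp: C_def)
qed

text \<open>By \<open>Inv_unique\<close> the three conditions determine the family, so this is the
  formal integral from 0 with respect to z; \<open>c [] []\<close> plays the role of the regularised
  value at 0.\<close>

definition lift :: "complex \<Rightarrow> (complex list \<Rightarrow> complex list \<Rightarrow> complex) \<Rightarrow> complex list \<Rightarrow> complex list \<Rightarrow> complex" where
  "lift a c = (SOME C. Inv C \<and> (\<forall>u b v. C u (b # v) = (if b = a then c u v else 0)) \<and> C [] [] = 0)"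

definition liftb :: "complex \<Rightarrow> (complex list \<Rightarrow> complex list \<Rightarrow> complex) \<Rightarrow> complex list \<Rightarrow> complex list \<Rightarrow> complex" where
  "liftb a c = swap (lift a (swap c))"

lemma lift:
  assumes "Inv c" "a \<in> {0,1}"
  shows "Inv (lift a c)" "lift a c u (b # v) = (if b = a then c u v else 0)" "lift a c [] [] = 0"
  using someI_ex[OF ex_lift[OF assms]] unfolding lift_def[symmetric] by blast+

lemma dz_lift: "Inv c \<Longrightarrow> a \<in> {0,1} \<Longrightarrow> dz b (lift a c) = (if b = a then c else (\<lambda>u v. 0))"
  by (auto simp: dz_def lift)

lemma Inv_liftb: "Inv c \<Longrightarrow> a \<in> {0,1} \<Longrightarrow> Inv (liftb a c)"
  unfolding liftb_def by (intro Inv_swap lift)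

lemma liftb_Nil: "Inv c \<Longrightarrow> a \<in> {0,1} \<Longrightarrow> liftb a c [] [] = 0"
  unfolding liftb_def swap_def using lift(3)[OF Inv_swap] by (simp add: swap_def)

lemma dzb_liftb: "Inv c \<Longrightarrow> a \<in> {0,1} \<Longrightarrow> dzb b (liftb a c) = (if b = a then c else (\<lambda>u v. 0))"
  using dz_lift[OF Inv_swap, of c a b] unfolding liftb_def
  by (auto simp: swap_def dz_def dzb_def fun_eq_iff split: if_splits)

lemma lift_uminus:
  assumes "Inv c" "a \<in> {0,1}"
  shows "lift a (\<lambda>u v. - c u v) = (\<lambda>u v. - lift a c u v)"
proof (rule Inv_unique)
  have m: "Inv (\<lambda>u v. - c u v)" using Inv_scale[OF assms(1), of "-1"] by simp
  show "Inv (lift a (\<lambda>u v. - c u v))" by (rule lift(1)[OF m assms(2)])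
  show "Inv (\<lambda>u v. - lift a c u v)" using Inv_scale[OF lift(1)[OF assms], of "-1"] by simp
  show "lift a (\<lambda>u v. - c u v) u (b # v) = - lift a c u (b # v)" for b u v
    using lift(2)[OF m assms(2)] lift(2)[OF assms] by simp
  show "lift a (\<lambda>u v. - c u v) [] [] = - lift a c [] []"
    using lift(3)[OF m assms(2)] lift(3)[OF assms] by simp
qed

text \<open>The coefficients of Brown's single-valued polylogarithm, for a word read in reverse like
  the words of \<open>Lr\<close>.\<close>

fun cw :: "complex list \<Rightarrow> complex list \<Rightarrow> complex list \<Rightarrow> complex" where
  "cw [] = delta"
| "cw (a # w) = lift a (cw w)"

lemma Inv_cw: "w \<in> words \<Longrightarrow> Inv (cw w)"
  by (induction w) (auto intro: Inv_delta lift)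

lemma cw_Cons: "a \<in> {0,1} \<Longrightarrow> w \<in> words \<Longrightarrow> cw (a # w) u (b # v) = (if b = a then cw w u v else 0)"
  and cw_Nil_Nil: "w \<in> words \<Longrightarrow> w \<noteq> [] \<Longrightarrow> cw w [] [] = 0"
proof -
  show "a \<in> {0,1} \<Longrightarrow> w \<in> words \<Longrightarrow> cw (a # w) u (b # v) = (if b = a then cw w u v else 0)"
    using lift(2)[OF Inv_cw] by simp
  show "w \<in> words \<Longrightarrow> w \<noteq> [] \<Longrightarrow> cw w [] [] = 0"
    using lift(3)[OF Inv_cw] by (cases w) auto
qed

text \<open>A family is recovered from its constant entry and its two formal derivatives, by
  \<open>Inv_unique\<close>; induction on the length of \<open>v\<close> expands the derivatives.
  Validity for every large \<open>M\<close> lets the two expansions be summed over a common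
  range.\<close>

lemma Inv_span:
  assumes "Inv c"
  shows "\<exists>N g. (\<forall>w. g w \<noteq> 0 \<longrightarrow> w \<in> W N) \<and> g [] = c [] [] \<and> (\<forall>M\<ge>N. \<forall>u v. c u v = (\<Sum>w\<in>W M. g w * cw w u v))"
proof -
  obtain N where "cinv N c" using assms unfolding Inv_def by blast
  then have "length v \<le> N" if "c u v \<noteq> 0" for u v using that unfolding cinv_def csup_def W_def by blast
  then show ?thesis using assms
  proof (induction N arbitrary: c)
    case 0
    have "c = (\<lambda>u v. c [] [] * delta u v)"
    proof (rule Inv_unique[OF 0(2) Inv_scale[OF Inv_delta]])
      show "c u (a # v) = c [] [] * delta u (a # v)" for a u v using 0(1)[of u "a # v"] by (auto simp: delta_def)
    qed (simp add: delta_def)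
    then have c: "c u v = c [] [] * delta u v" for u v by metis
    show ?case
    proof (intro exI[of _ 0] exI[of _ "\<lambda>w. if w = [] then c [] [] else 0"] conjI allI impI)
      fix M :: nat and u v
      have "(\<Sum>w\<in>W M. (if w = [] then c [] [] else 0) * cw w u v) = (\<Sum>w\<in>W M. if w = [] then c [] [] * delta u v else 0)"
        by (rule sum.cong) auto
      also have "\<dots> = c [] [] * delta u v" by simp
      finally show "c u v = (\<Sum>w\<in>W M. (if w = [] then c [] [] else 0) * cw w u v)" unfolding c[of u v] by (rule sym)
    qed (auto simp: W_0 split: if_splits)
  next
    case (Suc N)
    have ex: "\<exists>N' g. (\<forall>w. g w \<noteq> 0 \<longrightarrow> w \<in> W N') \<and> g [] = dz a c [] [] \<and> (\<forall>M\<ge>N'. \<forall>u v. dz a c u v = (\<Sum>w\<in>W M. g w * cw w u v))"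
      if "a \<in> {0,1}" for a
      using Suc.IH[OF _ Inv_dz[OF Suc(3) that]] Suc(2) by (fastforce simp: dz_def)
    obtain N0 g0 where
      g0: "\<And>w. g0 w \<noteq> 0 \<Longrightarrow> w \<in> W N0" "\<And>M u v. M \<ge> N0 \<Longrightarrow> dz 0 c u v = (\<Sum>w\<in>W M. g0 w * cw w u v)"
      using ex[of 0] by blast
    obtain N1 g1 where
      g1: "\<And>w. g1 w \<noteq> 0 \<Longrightarrow> w \<in> W N1" "\<And>M u v. M \<ge> N1 \<Longrightarrow> dz 1 c u v = (\<Sum>w\<in>W M. g1 w * cw w u v)"
      using ex[of 1] by blast
    define g where "g w = (case w of [] \<Rightarrow> c [] [] | a # w' \<Rightarrow> if a = 0 then g0 w' else if a = 1 then g1 w' else 0)" for w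
    define K where "K = max N0 N1"
    show ?case
    proof (intro exI[of _ "Suc K"] exI[of _ g] conjI allI impI)
      fix w assume "g w \<noteq> 0"
      then show "w \<in> W (Suc K)"
        using g0(1) g1(1) by (auto simp: g_def K_def W_def split: list.splits if_splits) fastforce+
    next
      show "g [] = c [] []" by (simp add: g_def)
    next
      fix M u v assume "Suc K \<le> M"
      then obtain M' where M: "M = Suc M'" "M' \<ge> K" by (cases M) auto
      define R where "R u v = (\<Sum>w\<in>W M. g w * cw w u v)" for u v
      have R: "R u v = c [] [] * delta u v + (\<Sum>w\<in>W M'. g0 w * cw (0 # w) u v) + (\<Sum>w\<in>W M'. g1 w * cw (1 # w) u v)" for u v
        unfolding R_def M(1) W_Suc_sum by (simp add: g_def)
      have "c = R"
      proof (rule Inv_unique[OF Suc(3)])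
        show "Inv R" unfolding R_def by (intro Inv_sum Inv_scale Inv_cw W_words) auto
        show "c [] [] = R [] []" unfolding R
          using cw_Nil_Nil[of "0 # _"] cw_Nil_Nil[of "1 # _"] W_words by (simp add: delta_def del: cw.simps)
        fix a u v assume a: "a \<in> {0,1::complex}"
        have "c u (a # v) = dz a c u v" by (simp add: dz_def)
        also have "\<dots> = R u (a # v)"
        proof (cases "a = 0")
          case True
          have "R u (a # v) = (\<Sum>w\<in>W M'. g0 w * cw w u v)"
            unfolding R True using cw_Cons W_words by (simp add: delta_def del: cw.simps)
          then show ?thesis using g0(2)[of M' u v] M True by (simp add: K_def)
        next
          case False
          then have a1: "a = 1" using a by simp
          have "R u (a # v) = (\<Sum>w\<in>W M'. g1 w * cw w u v)"
            unfolding R a1 using cw_Cons W_words by (simp add: delta_def del: cw.simps)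
          then show ?thesis using g1(2)[of M' u v] M a1 by (simp add: K_def)
        qed
        finally show "c u (a # v) = R u (a # v)" .
      qed
      then show "c u v = (\<Sum>w\<in>W M. g w * cw w u v)" by (simp add: R_def)
    qed
  qed
qed

section \<open>Pure logarithms and the behaviour at 0\<close>

definition zeros :: "complex list \<Rightarrow> bool" where "zeros w \<longleftrightarrow> set w \<subseteq> {0}"

lemma zeros_simps [simp]: "zeros []" "zeros (a # w) \<longleftrightarrow> a = 0 \<and> zeros w" "zeros (u @ v) \<longleftrightarrow> zeros u \<and> zeros v"
  by (auto simp: zeros_def)

lemma zeros_words: "zeros w \<Longrightarrow> w \<in> words" by (auto simp: zeros_def words_def)

lemma zeros_replicate: "zeros w \<longleftrightarrow> w = replicate (length w) 0"
  by (induction w) auto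

lemma not_zeros_iff: "w \<in> words \<Longrightarrow> \<not> zeros w \<longleftrightarrow> 1 \<in> set w"
  by (auto simp: zeros_def words_def)

text \<open>The binomial expansion of (log z + log (cnj z))^n / n!: as the word of j zeros stands
  for log^j / j!, every coefficient is 1.\<close>

definition cpow :: "nat \<Rightarrow> complex list \<Rightarrow> complex list \<Rightarrow> complex" where
  "cpow n u v = (if zeros u \<and> zeros v \<and> length u + length v = n then 1 else 0)"

text \<open>\<open>cpow n\<close> depends only on whether both words consist of zeros and on their
  total length, so moving a suffix from one word to the other changes nothing and the defects
  vanish.\<close>

lemma cw_replicate: "cw (replicate n 0) = cpow n"
proof (induction n)
  case 0
  show ?case by (auto simp: cpow_def delta_def fun_eq_iff)
next
  case (Suc n)
  have "cinv n (cpow n)" for n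
    unfolding cinv_def
  proof (intro conjI ballI)
    show "csup n (cpow n)" by (auto simp: csup_def cpow_def W_def zeros_words split: if_splits)
    show "defect n i (cpow n) y y' = 0" for i y y'
      unfolding defect_def by (rule sum.neutral) (auto simp: cpow_def)
  qed
  then have E: "Inv (cpow n)" for n unfolding Inv_def by blast
  have r: "replicate n 0 \<in> words" by (auto simp: words_def)
  show ?case
  proof (rule Inv_unique[OF _ E])
    show "Inv (cw (replicate (Suc n) 0))" by (rule Inv_cw) (auto simp: words_def)
    show "cw (replicate (Suc n) 0) u (a # v) = cpow (Suc n) u (a # v)" for a u v
      using cw_Cons[OF _ r, of 0 u a v] Suc by (auto simp: cpow_def simp del: cw.simps)
    show "cw (replicate (Suc n) 0) [] [] = cpow (Suc n) [] []"
      using cw_Nil_Nil[of "replicate (Suc n) 0"] r by (simp add: cpow_def del: cw.simps)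
  qed
qed

text \<open>Serves the limit 0 at 0: a polylogarithm whose word contains a letter 1 has no pure
  products of logarithms. The constants \<open>monok 0\<close> vanish on words with a letter 1, so
  the entries at words of zeros satisfy the monodromy equation around 0 among themselves, with no
  source term, and the descent of \<open>monodromy_kernel\<close> works on them alone.\<close>

lemma cw_zeros:
  assumes "w \<in> words" "1 \<in> set w" "zeros u" "zeros v"
  shows "cw w u v = 0"
  using assms
proof (induction w arbitrary: u v)
  case (Cons a w)
  have aw: "a \<in> {0,1}" "w \<in> words" using Cons by auto
  define c where "c = cw (a # w)"
  have I: "Inv c" unfolding c_def by (rule Inv_cw[OF Cons(2)])
  have nonempty: "c u v = 0" if "v \<noteq> []" "zeros u" "zeros v" for u v
  proof (cases v)
    case (Cons b v')
    show ?thesis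
    proof (cases "b = a")
      case True
      then have "1 \<in> set w" using that Cons \<open>1 \<in> set (a # w)\<close> by auto
      then show ?thesis using Cons.IH[OF aw(2), of u v'] cw_Cons[OF aw, of u b v'] that Cons
        by (simp add: c_def del: cw.simps)
    next
      case False then show ?thesis using cw_Cons[OF aw, of u b v'] Cons by (simp add: c_def del: cw.simps)
    qed
  qed (use that in simp)
  obtain N where N: "cinv N c" using I unfolding Inv_def by blast
  \<comment> \<open>Cutting \<open>h\<close> down to words of zeros is compatible with
    \<open>Kop (monok 0)\<close> exactly because \<open>monok 0\<close> ignores all other
    suffixes.\<close>
  define h where "h u = (if zeros u then c u [] else 0)" for u
  have hN: "y \<in> W N" if "h y \<noteq> 0" for y using that N unfolding cinv_def csup_def h_def by (auto split: if_splits)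
  have K0: "Kop (monok 0) N h y = 0" if "y \<in> words" "zeros y" for y
  proof -
    have "defect N 0 c y [] = - Kop (monok 0) N h y"
      unfolding defect_def Kop_def sum_negf[symmetric]
    proof (rule sum.cong)
      fix x assume x: "x \<in> W N - {[]}"
      show "monok 0 x * (c y ([] @ x) - c (y @ x) []) = - (monok 0 x * h (y @ x))"
      proof (cases "zeros x")
        case True then show ?thesis using nonempty[of x y] x that by (simp add: h_def)
      next
        case False
        then have "monok 0 x = 0" using monok_0[of x] x not_zeros_iff W_words by blast
        then show ?thesis by simp
      qed
    qed simp
    then show ?thesis using N that unfolding cinv_def by auto
  qed
  have hz: "h y = 0" if "y \<noteq> []" for y
  proof -
    have "\<forall>y. h y \<noteq> 0 \<longrightarrow> length y \<le> n \<Longrightarrow> n \<le> N \<Longrightarrow> y \<noteq> [] \<Longrightarrow> h y = 0" for n y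
    proof (induction n)
      case (Suc n)
      have "length y \<le> n" if "h y \<noteq> 0" for y
      proof (rule ccontr)
        assume "\<not> length y \<le> n"
        then have ly: "length y = Suc n" using Suc.prems(1) that by (metis le_antisym not_less_eq_eq)
        have zy: "zeros y" using that by (auto simp: h_def split: if_splits)
        obtain y' i where yi: "y = y' @ [i]" using ly by (cases y rule: rev_cases) auto
        have y': "y' \<in> words" "length y' = n" "i = 0" "zeros y'" using zy yi ly zeros_words by auto
        have "Kop (monok 0) N h y' = monok 0 [0] * h (y' @ [0])"
          by (rule monok_top[where n = n]) (use Suc.prems y' in auto)
        then show False using K0[OF y'(1,4)] mono(7)[of 0] that yi y' by simp
      qed
      then show ?case using Suc by auto
    qed auto
    then show ?thesis using hN that by (auto simp: W_def)
  qed
  have c0: "c [] [] = 0" using cw_Nil_Nil[OF Cons(2)] by (simp add: c_def del: cw.simps)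
  have "c u [] = 0" if "zeros u" for u
    using hz[of u] c0 that by (cases "u = []") (auto simp only: h_def if_True)
  then show ?case using nonempty[of v u] Cons(4,5) by (cases "v = []") (auto simp: c_def simp del: cw.simps)
qed simp

section \<open>Linear independence\<close>

lemma Hlo_nonempty: "Hlo \<noteq> {}" and Hup_nonempty: "Hup \<noteq> {}"
proof -
  have "-\<i> \<in> Hlo" "\<i> \<in> Hup" by (simp_all add: Hlo_def Hup_def)
  then show "Hlo \<noteq> {}" "Hup \<noteq> {}" by blast+
qed

lemma hol_zero_off_01:
  assumes "f holomorphic_on - {0,1}" "\<And>z. z \<in> Hlo \<Longrightarrow> f z = 0" "z \<notin> {0,1}"
  shows "f z = 0"
proof -
  have *: "f z = 0" if "open S" "connected S" "Hlo \<subseteq> S" "S \<subseteq> - {0,1}" "z \<in> S" for S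
    using analytic_continuation_open[of Hlo S f "\<lambda>_. 0" z] that assms open_Hlo Hlo_nonempty
      holomorphic_on_subset[OF assms(1)] by auto
  show ?thesis
    using cover[OF assms(3)] *[OF open_slit connected_slit Hlo_subset(1)] *[OF open_Dm connected_Dm Hlo_subset(2)] notin_01
    by blast
qed

text \<open>Continuing a relation around \<open>0\<close> or \<open>1\<close> and subtracting lowers the length of the words.\<close>
lemma Lr_independent:
  assumes "\<And>v. v \<in> W N \<Longrightarrow> r v holomorphic_on - {0,1}"
    and "\<And>z. z \<in> Hlo \<Longrightarrow> (\<Sum>v\<in>W N. r v z * Lr v z) = 0"
    and "v \<in> W N" "z \<notin> {0,1}"
  shows "r v z = 0"
  using assms
proof (induction N arbitrary: r v z)
  case 0
  then have "v = []" by (simp add: W_0)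
  moreover have "r [] z = 0" by (rule hol_zero_off_01) (use 0 in \<open>auto simp: W_0\<close>)
  ultimately show ?case by simp
next
  case (Suc N)
  define r0 where "r0 v = (if v \<in> W (Suc N) then r v else (\<lambda>z. 0))" for v
  have r0h: "r0 v holomorphic_on - {0,1}" for v using Suc.prems(1) by (simp add: r0_def)
  have top: "r v z = 0" if lv: "length v = Suc N" "v \<in> W (Suc N)" and z: "z \<notin> {0,1}" for v z
  proof -
    obtain y i where yi: "v = y @ [i]" using lv by (cases v rule: rev_cases) auto
    have i: "i \<in> {0,1}" and y: "y \<in> words" "length y = N" using yi lv by (auto simp: W_def)
    have s0: "(\<Sum>v\<in>W (Suc N). r v z * Lr v z) = 0" if "z \<in> slit" for z
    proof (rule analytic_continuation_open[where s = Hlo and s' = slit and f = "\<lambda>z. \<Sum>v\<in>W (Suc N). r v z * Lr v z" and g = "\<lambda>_. 0"])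
      show "(\<lambda>z. \<Sum>v\<in>W (Suc N). r v z * Lr v z) holomorphic_on slit"
        by (intro holomorphic_intros holomorphic_on_subset[OF Suc.prems(1)] polysys_holomorphic[OF open_slit polysys_Lr] W_words)
           (auto dest: notin_01)
    qed (use that Suc.prems(2) open_Hlo open_slit connected_slit Hlo_nonempty Hlo_subset in auto)
    \<comment> \<open>The coefficients \<open>r v\<close> are single valued, so continuing the
      relation from the upper half plane across the cut \<open>i\<close> affects the polylogarithms
      alone: \<open>Lr\<close> becomes \<open>monoX i\<close>.\<close>
    have s1: "(\<Sum>v\<in>W (Suc N). r v z * monoX i v z) = 0" if "z \<in> Dm i" for z
    proof (rule analytic_continuation_open[where s = Hup and s' = "Dm i" and f = "\<lambda>z. \<Sum>v\<in>W (Suc N). r v z * monoX i v z" and g = "\<lambda>_. 0"])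
      show "(\<lambda>z. \<Sum>v\<in>W (Suc N). r v z * monoX i v z) holomorphic_on Dm i"
        by (intro holomorphic_intros holomorphic_on_subset[OF Suc.prems(1)] polysys_holomorphic[OF open_Dm mono(1)[OF i]] W_words)
           (auto dest: notin_01)
      fix z assume z: "z \<in> Hup"
      have "(\<Sum>v\<in>W (Suc N). r v z * monoX i v z) = (\<Sum>v\<in>W (Suc N). r v z * Lr v z)"
        by (rule sum.cong) (use mono(3)[OF i _ z] W_words in auto)
      then show "(\<Sum>v\<in>W (Suc N). r v z * monoX i v z) = 0" using s0 Hup_subset z by auto
    qed (use that open_Hup open_Dm connected_Dm Hup_nonempty Hup_subset in auto)
    \<comment> \<open>Expanding \<open>monoX i\<close> on the lower half plane gives the original
      relation (suffix empty) plus a relation with coefficients \<open>K\<close>. The latter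
      involves words of length at most \<open>N\<close>, so the induction hypothesis applies to
      it.\<close>
    define K where "K y z = Kop (monok i) (Suc N) (\<lambda>v. r0 v z) y" for y z
    have K: "(\<Sum>y\<in>W N. K y z * Lr y z) = 0" if z: "z \<in> Hlo" for z
    proof -
      define f where "f y x = monok i x * r0 (y @ x) z * Lr y z" for y x
      have "0 = (\<Sum>v\<in>W (Suc N). r v z * monoX i v z)" using s1 z Hlo_subset by auto
      also have "\<dots> = (\<Sum>v\<in>W (Suc N). \<Sum>j\<le>length v. f (take j v) (drop j v))"
      proof (rule sum.cong)
        fix v assume v: "v \<in> W (Suc N)"
        have "monoX i v z = conv (monok i) (monoY i) v z"
          using mono(5)[OF i] v z Hlo_subset W_words by blast
        also have "\<dots> = (\<Sum>j\<le>length v. monok i (drop j v) * Lr (take j v) z)"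
          unfolding conv_def using mono(4)[OF i _ z] words_take W_words[OF v] by simp
        finally show "r v z * monoX i v z = (\<Sum>j\<le>length v. f (take j v) (drop j v))"
          using v by (simp add: f_def sum_distrib_left r0_def mult_ac)
      qed simp
      also have "\<dots> = (\<Sum>y\<in>W (Suc N). \<Sum>x\<in>W (Suc N). f y x)"
        by (rule split_sum) (auto simp: f_def r0_def W_def)
      also have "\<dots> = (\<Sum>y\<in>W (Suc N). f y [] + K y z * Lr y z)"
      proof (rule sum.cong)
        fix y
        have "(\<Sum>x\<in>W (Suc N). f y x) = f y [] + (\<Sum>x\<in>W (Suc N) - {[]}. f y x)"
          by (rule sum.remove) auto
        then show "(\<Sum>x\<in>W (Suc N). f y x) = f y [] + K y z * Lr y z"
          by (simp add: K_def Kop_def f_def sum_distrib_right)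
      qed simp
      also have "\<dots> = (\<Sum>y\<in>W (Suc N). f y []) + (\<Sum>y\<in>W (Suc N). K y z * Lr y z)" by (rule sum.distrib)
      also have "(\<Sum>y\<in>W (Suc N). f y []) = 0"
        using Suc.prems(2)[OF z] mono(6)[OF i] by (simp add: f_def r0_def)
      also have "(\<Sum>y\<in>W (Suc N). K y z * Lr y z) = (\<Sum>y\<in>W N. K y z * Lr y z)"
      proof (rule sum.mono_neutral_right)
        show "\<forall>y\<in>W (Suc N) - W N. K y z * Lr y z = 0"
        proof
          fix y assume y: "y \<in> W (Suc N) - W N"
          have "r0 (y @ x) z = 0" if "x \<noteq> []" for x
            using that y by (cases x) (auto simp: r0_def W_def)
          then have "K y z = 0" unfolding K_def Kop_def by (intro sum.neutral ballI) simp
          then show "K y z * Lr y z = 0" by simp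
        qed
      qed (auto simp: W_mono)
      finally show ?thesis by simp
    qed
    have "K y z = 0"
    proof (rule Suc.IH[of K])
      show "K v holomorphic_on - {0, 1}" for v
        unfolding K_def[abs_def] Kop_def by (intro holomorphic_intros r0h)
    qed (use K y z in \<open>auto simp: W_def\<close>)
    \<comment> \<open>At a word of length \<open>N\<close> the vanishing \<open>K\<close> reduces to
      one top coefficient times a nonzero constant.\<close>
    moreover have "K y z = monok i [i] * r0 (y @ [i]) z"
      unfolding K_def by (rule monok_top[OF i, of N]) (use y in \<open>auto simp: r0_def W_def\<close>)
    ultimately show ?thesis using mono(7)[OF i] lv yi by (simp add: r0_def)
  qed
  show ?case
  proof (cases "length v = Suc N")
    case True then show ?thesis using top Suc.prems by blast
  next
    case False
    then have v: "v \<in> W N" using Suc.prems by (auto simp: W_def)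
    show ?thesis
    proof (rule Suc.IH[OF _ _ v Suc.prems(4)])
      show "r v holomorphic_on - {0,1}" if "v \<in> W N" for v using that Suc.prems(1) by (auto simp: W_def)
      fix z assume z: "z \<in> Hlo"
      have z01: "z \<notin> {0,1}" using z Hlo_subset notin_01 by blast
      have "(\<Sum>v\<in>W (Suc N). r v z * Lr v z) = (\<Sum>v\<in>W N. r v z * Lr v z)"
      proof (rule sum.mono_neutral_right)
        show "\<forall>v\<in>W (Suc N) - W N. r v z * Lr v z = 0"
          using top[OF _ _ z01] by (auto simp: W_def le_Suc_eq)
      qed (auto simp: W_mono)
      then show "(\<Sum>v\<in>W N. r v z * Lr v z) = 0" using Suc.prems(2)[OF z] by simp
    qed
  qed
qed

section \<open>Wirtinger derivatives\<close>

text \<open>The operators \<open>wirt_dz\<close> and \<open>wirt_dzb\<close> see only two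
  directional derivatives. This predicate ties them to the full real derivative, which the product
  and chain rules require.\<close>

definition has_wirt :: "(complex \<Rightarrow> complex) \<Rightarrow> complex \<Rightarrow> complex \<Rightarrow> complex \<Rightarrow> bool" where
  "has_wirt f p q z \<longleftrightarrow> (f has_derivative (\<lambda>h. p * h + q * cnj h)) (at z)"

lemma has_wirt_directional:
  assumes "has_wirt f p q z"
  shows "vector_derivative (\<lambda>t::real. f (z + d * of_real t)) (at 0) = p * d + q * cnj d"
proof (rule vector_derivative_at)
  have "((\<lambda>t::real. z + d * of_real t) has_derivative (\<lambda>t. d * of_real t)) (at 0)"
    by (auto intro!: derivative_eq_intros)
  moreover have "(f has_derivative (\<lambda>h. p * h + q * cnj h)) (at (z + d * of_real 0))"
    using assms by (simp add: has_wirt_def)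
  ultimately have "((\<lambda>t::real. f (z + d * of_real t)) has_derivative (\<lambda>t. p * (d * of_real t) + q * cnj (d * of_real t))) (at 0)"
    by (rule has_derivative_compose)
  then show "((\<lambda>t::real. f (z + d * of_real t)) has_vector_derivative p * d + q * cnj d) (at 0)"
    unfolding has_vector_derivative_def by (simp add: scaleR_conv_of_real algebra_simps)
qed

lemma has_wirt_imp:
  assumes "has_wirt f p q z"
  shows "wirt_dz f z = p" "wirt_dzb f z = q"
proof -
  have "vector_derivative (\<lambda>t::real. f (z + \<i> * of_real t)) (at 0) = \<i> * (p - q)"
    using has_wirt_directional[OF assms, of \<i>] by (simp add: algebra_simps)
  then have i: "\<i> * vector_derivative (\<lambda>t::real. f (z + \<i> * of_real t)) (at 0) = q - p"
    by (simp flip: mult.assoc)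
  have "vector_derivative (\<lambda>t::real. f (z + of_real t)) (at 0) = p + q"
    using has_wirt_directional[OF assms, of 1] by simp
  then show "wirt_dz f z = p" "wirt_dzb f z = q"
    unfolding wirt_dz_def wirt_dzb_def i by simp_all
qed

lemma differentiable_imp_has_wirt:
  assumes "f differentiable (at z)"
  shows "has_wirt f (wirt_dz f z) (wirt_dzb f z) z"
proof -
  obtain D where D: "(f has_derivative D) (at z)" using assms unfolding differentiable_def by blast
  then interpret bounded_linear D by (rule has_derivative_bounded_linear)
  define p q where "p = (D 1 - \<i> * D \<i>) / 2" and "q = (D 1 + \<i> * D \<i>) / 2"
  have "D h = p * h + q * cnj h" for h
  proof -
    have "h = Re h *\<^sub>R 1 + Im h *\<^sub>R \<i>" by (simp add: complex_eq_iff)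
    then have "D h = D (Re h *\<^sub>R 1 + Im h *\<^sub>R \<i>)" by (rule arg_cong)
    also have "\<dots> = of_real (Re h) * D 1 + of_real (Im h) * D \<i>"
      unfolding add scaleR by (simp add: scaleR_conv_of_real)
    also have "\<dots> = p * (of_real (Re h) + \<i> * of_real (Im h)) + q * (of_real (Re h) - \<i> * of_real (Im h))"
      by (simp add: p_def q_def field_simps)
    also have "of_real (Re h) - \<i> * of_real (Im h) = cnj h" by (simp add: complex_eq_iff)
    also have "of_real (Re h) + \<i> * of_real (Im h) = h" by (simp add: complex_eq_iff)
    finally show ?thesis .
  qed
  then have "D = (\<lambda>h. p * h + q * cnj h)" by blast
  then have "has_wirt f p q z" using D by (simp add: has_wirt_def)
  then show ?thesis using has_wirt_imp by metis
qed

lemma has_wirt_differentiable: "has_wirt f p q z \<Longrightarrow> f differentiable (at z)"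
  and has_wirt_isCont: "has_wirt f p q z \<Longrightarrow> isCont f z"
  unfolding has_wirt_def differentiable_def using has_derivative_continuous by blast+

lemma has_wirt_const: "has_wirt (\<lambda>z. c) 0 0 z"
  unfolding has_wirt_def by simp

lemma has_wirt_add: "has_wirt f p q z \<Longrightarrow> has_wirt g p' q' z \<Longrightarrow> has_wirt (\<lambda>z. f z + g z) (p + p') (q + q') z"
  unfolding has_wirt_def by (drule (1) has_derivative_add) (simp add: algebra_simps)

lemma has_wirt_mult: 
  assumes "has_wirt f p q z" "has_wirt g p' q' z"
  shows "has_wirt (\<lambda>z. f z * g z) (p * g z + f z * p') (q * g z + f z * q') z"
  using has_derivative_mult[OF assms[unfolded has_wirt_def]] unfolding has_wirt_def by (simp add: algebra_simps)

lemma has_wirt_cmult: "has_wirt f p q z \<Longrightarrow> has_wirt (\<lambda>z. c * f z) (c * p) (c * q) z"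
  using has_wirt_mult[OF has_wirt_const[of c z]] by simp

lemma has_wirt_diff: "has_wirt f p q z \<Longrightarrow> has_wirt g p' q' z \<Longrightarrow> has_wirt (\<lambda>z. f z - g z) (p - p') (q - q') z"
  using has_wirt_add[OF _ has_wirt_cmult[of g p' q' z "-1"], of f p q] by simp

lemma has_wirt_sum:
  assumes "finite S" "\<And>s. s \<in> S \<Longrightarrow> has_wirt (f s) (p s) (q s) z"
  shows "has_wirt (\<lambda>z. \<Sum>s\<in>S. f s z) (\<Sum>s\<in>S. p s) (\<Sum>s\<in>S. q s) z"
  using assms by (induction S rule: finite_induct) (auto intro: has_wirt_const has_wirt_add)

lemma has_wirt_holomorphic: "(f has_field_derivative p) (at z) \<longleftrightarrow> has_wirt f p 0 z"
  unfolding has_wirt_def has_field_derivative_def by simp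

lemma has_wirt_cnj: "has_wirt f p q (cnj z) \<Longrightarrow> has_wirt (\<lambda>z. f (cnj z)) q p z"
  unfolding has_wirt_def
proof -
  assume "(f has_derivative (\<lambda>h. p * h + q * cnj h)) (at (cnj z))"
  moreover have "(cnj has_derivative cnj) (at z)"
    by (rule bounded_linear_imp_has_derivative) (rule bounded_linear_cnj)
  ultimately have "((\<lambda>z. f (cnj z)) has_derivative (\<lambda>h. p * cnj h + q * cnj (cnj h))) (at z)"
    by (rule has_derivative_compose[rotated])
  then show "((\<lambda>z. f (cnj z)) has_derivative (\<lambda>h. q * h + p * cnj h)) (at z)" by (simp add: add.commute)
qed

lemma has_wirt_transform:
  "has_wirt f p q z \<Longrightarrow> open S \<Longrightarrow> z \<in> S \<Longrightarrow> (\<And>w. w \<in> S \<Longrightarrow> f w = g w) \<Longrightarrow> has_wirt g p q z"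
  unfolding has_wirt_def by (rule has_derivative_transform_within_open)

text \<open>Nonreal points approach every point vertically and all lie in \<open>slit\<close>, so
  identities between continuous functions need to be checked only where \<open>Lr\<close> is given
  by the principal branch.\<close>

lemma eq_off_real:
  fixes f g :: "complex \<Rightarrow> 'b::t2_space"
  assumes "isCont f z" "isCont g z" "open S" "z \<in> S" "\<And>w. w \<in> S \<Longrightarrow> Im w \<noteq> 0 \<Longrightarrow> f w = g w"
  shows "f z = g z"
proof -
  define \<gamma> where "\<gamma> t = z + \<i> * of_real t" for t :: real
  have "\<gamma> \<midarrow>0\<rightarrow> z" unfolding \<gamma>_def by (auto intro!: tendsto_eq_intros)
  then have g: "(\<gamma> \<longlongrightarrow> z) (at_right 0)" by (rule filterlim_mono) (simp_all add: at_le)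
  have Lf: "((\<lambda>t. f (\<gamma> t)) \<longlongrightarrow> f z) (at_right 0)" and Lg: "((\<lambda>t. g (\<gamma> t)) \<longlongrightarrow> g z) (at_right 0)"
    using assms(1,2) g isCont_tendsto_compose by blast+
  have ev: "\<forall>\<^sub>F t in at_right 0. f (\<gamma> t) = g (\<gamma> t)"
  proof -
    have "\<forall>\<^sub>F t in at_right 0. \<gamma> t \<in> S" using g assms(3,4) topological_tendstoD by blast
    moreover have "\<forall>\<^sub>F t in at_right 0. Im (\<gamma> t) \<noteq> 0"
      unfolding eventually_at_right_field
      \<comment> \<open>From a point below the real axis the vertical path first meets the axis at
        parameter \<open>- Im z\<close>; otherwise it never returns to it.\<close>
      by (intro exI[of _ "if Im z < 0 then - Im z else 1"]) (auto simp: \<gamma>_def)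
    ultimately show ?thesis by eventually_elim (rule assms(5))
  qed
  have "((\<lambda>t. g (\<gamma> t)) \<longlongrightarrow> f z) (at_right 0)" by (rule Lim_transform_eventually[OF Lf ev])
  then show ?thesis using tendsto_unique[OF trivial_limit_at_right_real _ Lg] by blast
qed

section \<open>Single-valued functions from invariant coefficients\<close>

definition rep :: "nat \<Rightarrow> (complex list \<Rightarrow> complex list \<Rightarrow> complex) \<Rightarrow> (complex list \<Rightarrow> complex \<Rightarrow> complex)
    \<Rightarrow> (complex list \<Rightarrow> complex \<Rightarrow> complex) \<Rightarrow> complex \<Rightarrow> complex" where
  "rep N c A B z = (\<Sum>u\<in>W N. \<Sum>v\<in>W N. c u v * A u (cnj z) * B v z)"

lemma rep_ext:
  assumes "csup N c" "N \<le> M" shows "rep M c A B z = rep N c A B z"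
proof -
  have "rep M c A B z = (\<Sum>u\<in>W N. \<Sum>v\<in>W M. c u v * A u (cnj z) * B v z)"
    unfolding rep_def
    by (rule sum.mono_neutral_right) (use W_mono[OF assms(2)] csupD(1)[OF assms(1)] in auto)
  also have "\<dots> = rep N c A B z"
    unfolding rep_def
    by (intro sum.cong sum.mono_neutral_right) (use W_mono[OF assms(2)] csupD(2)[OF assms(1)] in auto)
  finally show ?thesis .
qed

lemma rep_eq: "csup N c \<Longrightarrow> csup M c \<Longrightarrow> rep N c A B z = rep M c A B z"
  using rep_ext[of N c "max N M"] rep_ext[of M c "max N M"] by simp

text \<open>Three local expressions glued together; \<open>rep_eq\<close> makes the choice of
  \<open>N\<close> immaterial and \<open>Phi_Dm\<close> shows that they agree on overlaps. Beyond a
  cut the factor in \<open>cnj z\<close> uses \<open>monoY\<close>, since \<open>cnj z\<close>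
  reaches the cut from the opposite side. The value 0 at 0 and 1 is the one prescribed in
  \<open>svmpl_family\<close>.\<close>

definition Phi :: "(complex list \<Rightarrow> complex list \<Rightarrow> complex) \<Rightarrow> complex \<Rightarrow> complex" where
  "Phi c z = (let N = SOME N. csup N c in
     if z \<in> {0,1} then 0 else if z \<in> slit then rep N c Lr Lr z
     else if z \<in> Dm 0 then rep N c (monoY 0) (monoX 0) z else rep N c (monoY 1) (monoX 1) z)"

lemma Phi_01 [simp]: "z \<in> {0,1} \<Longrightarrow> Phi c z = 0"
  by (auto simp: Phi_def Let_def)

lemma Phi_slit: assumes "csup N c" "z \<in> slit" shows "Phi c z = rep N c Lr Lr z"
proof -
  have "csup (SOME N. csup N c) c" using assms(1) by (rule someI)
  then have "rep (SOME N. csup N c) c Lr Lr z = rep N c Lr Lr z" using assms(1) by (rule rep_eq)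
  then show ?thesis using assms(2) notin_01(1)[OF assms(2)] by (simp add: Phi_def Let_def)
qed

text \<open>On the lower half plane the holomorphic factors pick up the monodromy constants; invariance
  moves them to the antiholomorphic factors, where they turn the \<^const>\<open>monoY\<close> into \<^const>\<open>monoX\<close>.\<close>
lemma rep_mono_lower:
  assumes c: "cinv N c" and i: "i \<in> {0,1}" and z: "z \<in> Hlo"
  shows "rep N c (monoY i) (monoX i) z = rep N c Lr Lr z"
proof -
  let ?k = "monok i" and ?Y = "monoY i" and ?X = "monoX i"
  have zD: "z \<in> Dm i" "cnj z \<in> Dm i" "cnj z \<in> Hup" using z Hlo_subset by auto
  have cz: "c u v = 0" if "length u > N \<or> length v > N" for u v
  proof -
    have "u \<notin> W N \<or> v \<notin> W N" using that by (auto simp: W_def)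
    then show ?thesis using csupD[of N c] c unfolding cinv_def by blast
  qed
  have inv: "(\<Sum>x\<in>W N. ?k x * c y (y' @ x)) = (\<Sum>x\<in>W N. ?k x * c (y @ x) y')" if "y \<in> words" "y' \<in> words" for y y'
  proof -
    have "defect N i c y y' = 0" using c i that unfolding cinv_def by auto
    then have "(\<Sum>x\<in>W N - {[]}. ?k x * c y (y' @ x)) = (\<Sum>x\<in>W N - {[]}. ?k x * c (y @ x) y')"
      by (simp add: defect_def right_diff_distrib sum_subtractf)
    then show ?thesis using sum.remove[OF finite_W Nil_W[of N], of "\<lambda>x. ?k x * c y (y' @ x)"]
       sum.remove[OF finite_W Nil_W[of N], of "\<lambda>x. ?k x * c (y @ x) y'"] by simp
  qed
  have "rep N c ?Y ?X z = (\<Sum>u\<in>W N. \<Sum>v\<in>W N. \<Sum>j\<le>length v. (?k (drop j v) * c u (take j v @ drop j v) * ?Y u (cnj z) * Lr (take j v) z))"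
    unfolding rep_def
  proof (intro sum.cong refl)
    fix u v assume v: "v \<in> W N"
    have "?X v z = conv ?k ?Y v z" using mono(5)[OF i] v W_words zD by blast
    also have "\<dots> = (\<Sum>j\<le>length v. ?k (drop j v) * Lr (take j v) z)"
      unfolding conv_def using mono(4)[OF i _ z] words_take W_words[OF v] by simp
    finally show "c u v * ?Y u (cnj z) * ?X v z = (\<Sum>j\<le>length v. (?k (drop j v) * c u (take j v @ drop j v) * ?Y u (cnj z) * Lr (take j v) z))"
      by (simp add: sum_distrib_left mult_ac)
  qed
  also have "\<dots> = (\<Sum>u\<in>W N. \<Sum>y'\<in>W N. \<Sum>x\<in>W N. ?k x * c u (y' @ x) * ?Y u (cnj z) * Lr y' z)"
    by (intro sum.cong refl split_sum) (simp add: cz)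
  also have "\<dots> = (\<Sum>u\<in>W N. \<Sum>y'\<in>W N. \<Sum>x\<in>W N. ?k x * c (u @ x) y' * ?Y u (cnj z) * Lr y' z)"
  proof (rule sum.cong[OF refl], rule sum.cong[OF refl])
    fix u y' assume "u \<in> W N" "y' \<in> W N"
    then show "(\<Sum>x\<in>W N. ?k x * c u (y' @ x) * ?Y u (cnj z) * Lr y' z) = (\<Sum>x\<in>W N. ?k x * c (u @ x) y' * ?Y u (cnj z) * Lr y' z)"
      using inv W_words by (simp add: sum_distrib_right[symmetric])
  qed
  also have "\<dots> = (\<Sum>y'\<in>W N. \<Sum>u\<in>W N. \<Sum>x\<in>W N. ?k x * c (u @ x) y' * ?Y u (cnj z) * Lr y' z)"
    by (rule sum.swap)
  also have "\<dots> = (\<Sum>y'\<in>W N. \<Sum>v\<in>W N. \<Sum>j\<le>length v. ?k (drop j v) * c (take j v @ drop j v) y' * ?Y (take j v) (cnj z) * Lr y' z)"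
    by (intro sum.cong refl split_sum[symmetric]) (simp add: cz)
  also have "\<dots> = (\<Sum>y'\<in>W N. \<Sum>v\<in>W N. c v y' * Lr v (cnj z) * Lr y' z)"
  proof (intro sum.cong refl)
    fix y' v assume v: "v \<in> W N"
    have "Lr v (cnj z) = conv ?k ?Y v (cnj z)" using mono(5)[OF i _ zD(2)] mono(3)[OF i _ zD(3)] v W_words by metis
    then show "(\<Sum>j\<le>length v. ?k (drop j v) * c (take j v @ drop j v) y' * ?Y (take j v) (cnj z) * Lr y' z) = c v y' * Lr v (cnj z) * Lr y' z"
      by (simp add: conv_def sum_distrib_left sum_distrib_right mult_ac)
  qed
  also have "\<dots> = rep N c Lr Lr z" unfolding rep_def by (rule sum.swap)
  finally show ?thesis .
qed

lemma Phi_Dm: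
  assumes c: "cinv N c" and i: "i \<in> {0,1}" and z: "z \<in> Dm i"
  shows "Phi c z = rep N c (monoY i) (monoX i) z"
proof -
  have cs: "csup N c" using c by (simp add: cinv_def)
  have N: "csup (SOME N. csup N c) c" using cs by (rule someI)
  consider "z \<in> Hup" | "z \<in> Hlo" | "Im z = 0" unfolding Hup_def Hlo_def by fastforce
  then show ?thesis
  proof cases
    case 1
    then have "rep N c (monoY i) (monoX i) z = rep N c Lr Lr z"
      unfolding rep_def using mono(3,4)[OF i] W_words by (intro sum.cong refl) simp
    then show ?thesis using Phi_slit[OF cs] 1 Hup_subset by auto
  next
    case 2
    then show ?thesis using Phi_slit[OF cs] Hlo_subset rep_mono_lower[OF c i 2] by auto
  next
    case 3
    have "z \<notin> {0,1}" "z \<notin> slit" using z 3 by (auto simp: Dm_def slit_def split: if_splits)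
    moreover have "i = 1 \<Longrightarrow> z \<notin> Dm 0" using z 3 by (auto simp: Dm_def)
    moreover have "rep (SOME N. csup N c) c (monoY i) (monoX i) z = rep N c (monoY i) (monoX i) z" using N cs by (rule rep_eq)
    ultimately show ?thesis using i z unfolding Phi_def Let_def by (elim insertE emptyE) simp_all
  qed
qed

text \<open>Differentiation strips the first letter. Passing to \<open>W (Suc N)\<close> makes each
  word of \<open>W N\<close> occur as a tail, and the added words have coefficient 0.\<close>

lemma letter_sum:
  fixes c :: "complex list \<Rightarrow> complex"
  assumes "\<And>v. v \<notin> W N \<Longrightarrow> c v = 0"
  shows "(\<Sum>v\<in>W N. c v * (case v of [] \<Rightarrow> 0 | a # v' \<Rightarrow> f v' / (x - a)))
       = (\<Sum>v\<in>W N. c (0 # v) * f v) / x + (\<Sum>v\<in>W N. c (1 # v) * f v) / (x - 1)"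
proof -
  let ?g = "\<lambda>v. c v * (case v of [] \<Rightarrow> 0 | a # v' \<Rightarrow> f v' / (x - a))"
  have "(\<Sum>v\<in>W N. ?g v) = (\<Sum>v\<in>W (Suc N). ?g v)"
    by (rule sum.mono_neutral_left) (use assms W_mono[of N "Suc N"] in auto)
  also have "\<dots> = (\<Sum>v\<in>W N. c (0 # v) * f v) / x + (\<Sum>v\<in>W N. c (1 # v) * f v) / (x - 1)"
    unfolding W_Suc_sum by (simp add: sum_divide_distrib)
  finally show ?thesis .
qed

lemma polysys_has_wirt:
  assumes "polysys U C" "open U" "w \<in> U" "v \<in> words"
  shows "has_wirt (C v) (case v of [] \<Rightarrow> 0 | a # v' \<Rightarrow> C v' w / (w - a)) 0 w"
proof (cases v)
  case Nil
  have "has_wirt (C v) 0 0 w"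
    by (rule has_wirt_transform[OF has_wirt_const[of 1] assms(2,3)]) (use polysysD(1)[OF assms(1)] Nil in auto)
  then show ?thesis using Nil by simp
next
  case (Cons a v')
  then show ?thesis using polysysD(2)[OF assms(1) _ _ assms(3), of v' a] assms(4) by (auto simp: has_wirt_holomorphic)
qed

lemma rep_has_wirt:
  assumes A: "polysys U A" and B: "polysys U B" and U: "open U" "z \<in> U" "cnj z \<in> U" and c: "csup N c"
  shows "has_wirt (rep N c A B) (rep N (dz 0 c) A B z / z + rep N (dz 1 c) A B z / (z - 1))
      (rep N (dzb 0 c) A B z / cnj z + rep N (dzb 1 c) A B z / (cnj z - 1)) z"
proof -
  define A' B' where "A' u = (case u of [] \<Rightarrow> 0 | a # u' \<Rightarrow> A u' (cnj z) / (cnj z - a))"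
    and "B' v = (case v of [] \<Rightarrow> 0 | a # v' \<Rightarrow> B v' z / (z - a))" for u v
  have "has_wirt (\<lambda>z. c u v * A u (cnj z) * B v z) (c u v * A u (cnj z) * B' v) (c u v * A' u * B v z) z"
    if "u \<in> words" "v \<in> words" for u v
  proof -
    have "has_wirt (\<lambda>z. A u (cnj z)) 0 (A' u) z"
      unfolding A'_def by (rule has_wirt_cnj[OF polysys_has_wirt[OF A U(1,3) that(1)]])
    moreover have "has_wirt (B v) (B' v) 0 z" unfolding B'_def by (rule polysys_has_wirt[OF B U(1,2) that(2)])
    ultimately show ?thesis using has_wirt_mult[OF has_wirt_cmult] by force
  qed
  then have "has_wirt (rep N c A B) (\<Sum>u\<in>W N. \<Sum>v\<in>W N. c u v * A u (cnj z) * B' v) (\<Sum>u\<in>W N. \<Sum>v\<in>W N. c u v * A' u * B v z) z"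
    unfolding rep_def[abs_def] by (intro has_wirt_sum) (auto simp: W_words)
  moreover have "(\<Sum>u\<in>W N. \<Sum>v\<in>W N. c u v * A u (cnj z) * B' v) = rep N (dz 0 c) A B z / z + rep N (dz 1 c) A B z / (z - 1)"
  proof -
    have "(\<Sum>v\<in>W N. c u v * A u (cnj z) * B' v) = (\<Sum>v\<in>W N. dz 0 c u v * A u (cnj z) * B v z) / z + (\<Sum>v\<in>W N. dz 1 c u v * A u (cnj z) * B v z) / (z - 1)" for u
      unfolding B'_def dz_def by (rule letter_sum) (use csupD(2)[OF c] in simp)
    then show ?thesis by (simp add: rep_def sum.distrib sum_divide_distrib)
  qed
  moreover have "(\<Sum>u\<in>W N. \<Sum>v\<in>W N. c u v * A' u * B v z) = rep N (dzb 0 c) A B z / cnj z + rep N (dzb 1 c) A B z / (cnj z - 1)"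
  proof -
    have "(\<Sum>u\<in>W N. (c u v * B v z) * A' u) = (\<Sum>u\<in>W N. (c (0 # u) v * B v z) * A u (cnj z)) / cnj z + (\<Sum>u\<in>W N. (c (1 # u) v * B v z) * A u (cnj z)) / (cnj z - 1)" for v
      unfolding A'_def by (rule letter_sum) (use csupD(1)[OF c] in simp)
    then have "(\<Sum>v\<in>W N. \<Sum>u\<in>W N. c u v * A' u * B v z) = (\<Sum>v\<in>W N. (\<Sum>u\<in>W N. dzb 0 c u v * A u (cnj z) * B v z) / cnj z + (\<Sum>u\<in>W N. dzb 1 c u v * A u (cnj z) * B v z) / (cnj z - 1))"
      by (simp add: dzb_def mult_ac)
    also have "\<dots> = (\<Sum>v\<in>W N. \<Sum>u\<in>W N. dzb 0 c u v * A u (cnj z) * B v z) / cnj z + (\<Sum>v\<in>W N. \<Sum>u\<in>W N. dzb 1 c u v * A u (cnj z) * B v z) / (cnj z - 1)"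
      by (simp add: sum.distrib sum_divide_distrib)
    finally show ?thesis unfolding rep_def by (subst (1 2 3) sum.swap)
  qed
  ultimately show ?thesis by simp
qed

lemma csup_dz: "csup N c \<Longrightarrow> csup N (dz a c)" and csup_dzb: "csup N c \<Longrightarrow> csup N (dzb a c)"
  unfolding csup_def dz_def dzb_def by (fastforce simp: W_def)+

lemma cinv_dz: "cinv N c \<Longrightarrow> a \<in> {0,1} \<Longrightarrow> cinv N (dz a c)" 
proof -
  assume c: "cinv N c" and a: "a \<in> {0,1}"
  have "defect N i (dz a c) y y' = defect N i c y (a # y')" for i y y' unfolding defect_def dz_def by simp
  then show "cinv N (dz a c)" using c a csup_dz unfolding cinv_def by auto
qed

lemma cinv_dzb: "cinv N c \<Longrightarrow> a \<in> {0,1} \<Longrightarrow> cinv N (dzb a c)" 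
proof -
  assume c: "cinv N c" and a: "a \<in> {0,1}"
  have "defect N i (dzb a c) y y' = defect N i c (a # y) y'" for i y y' unfolding defect_def dzb_def by simp
  then show "cinv N (dzb a c)" using c a csup_dzb unfolding cinv_def by auto
qed

lemma Phi_has_wirt:
  assumes "Inv c" and z: "z \<notin> {0,1}"
  shows "has_wirt (Phi c) (Phi (dz 0 c) z / z + Phi (dz 1 c) z / (z - 1))
      (Phi (dzb 0 c) z / cnj z + Phi (dzb 1 c) z / (cnj z - 1)) z"
proof -
  obtain N where N: "cinv N c" using assms(1) unfolding Inv_def by blast
  have cs: "csup N c" using N by (simp add: cinv_def)
  have Nd: "cinv N (dz a c)" "cinv N (dzb a c)" "csup N (dz a c)" "csup N (dzb a c)" if "a \<in> {0,1}" for a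
    using cinv_dz[OF N that] cinv_dzb[OF N that] csup_dz[OF cs] csup_dzb[OF cs] by auto
  have *: ?thesis if "polysys U A" "polysys U B" "open U" "z \<in> U" "cnj z \<in> U"
      "\<And>w. w \<in> U \<Longrightarrow> rep N c A B w = Phi c w"
      "\<And>a. a \<in> {0,1} \<Longrightarrow> Phi (dz a c) z = rep N (dz a c) A B z"
      "\<And>a. a \<in> {0,1} \<Longrightarrow> Phi (dzb a c) z = rep N (dzb a c) A B z" for U A B
    using has_wirt_transform[OF rep_has_wirt[OF that(1-5) cs] that(3,4,6)] that(7,8) by simp
  from cover[OF z] consider "z \<in> slit" | i where "i \<in> {0,1}" "z \<in> Dm i" by blast
  then show ?thesis
  proof cases
    case 1
    show ?thesis
      by (rule *[OF polysys_Lr polysys_Lr open_slit]) (use 1 Phi_slit[OF cs] Phi_slit[OF Nd(3)] Phi_slit[OF Nd(4)] in auto)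
  next
    case (2 i)
    show ?thesis
      by (rule *[OF mono(2)[OF 2(1)] mono(1)[OF 2(1)] open_Dm])
         (use 2(2) Phi_Dm[OF N 2(1)] Phi_Dm[OF Nd(1) 2(1)] Phi_Dm[OF Nd(2) 2(1)] in auto)
  qed
qed

lemma Phi_isCont: "Inv c \<Longrightarrow> z \<notin> {0,1} \<Longrightarrow> isCont (Phi c) z"
  using Phi_has_wirt has_wirt_isCont by blast

lemma Phi_lincomb:
  assumes "Inv c" "Inv d"
  shows "Phi (\<lambda>u v. s * c u v + t * d u v) z = s * Phi c z + t * Phi d z"
proof (cases "z \<in> {0,1}")
  case False
  obtain N where N: "cinv N c" "cinv N d" using Inv_obtain2[OF assms] .
  then have cs: "csup N c" "csup N d" by (simp_all add: cinv_def)
  have cs3: "csup N (\<lambda>u v. s * c u v + t * d u v)"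
    unfolding csup_def using csupD[OF cs(1)] csupD[OF cs(2)] by (metis add_0 mult_zero_right)
  show ?thesis
  proof (rule eq_off_real[where f = "Phi (\<lambda>u v. s * c u v + t * d u v)" and z = z and g = "\<lambda>z. s * Phi c z + t * Phi d z" and S = "- {0,1}"])
    fix w assume "Im w \<noteq> 0"
    then have "w \<in> slit" by (auto simp: slit_def)
    then show "Phi (\<lambda>u v. s * c u v + t * d u v) w = s * Phi c w + t * Phi d w"
      using Phi_slit cs cs3 by (simp add: rep_def sum.distrib sum_distrib_left algebra_simps)
  qed (use False assms Phi_isCont Inv_lincomb in \<open>auto intro!: continuous_intros open_Compl\<close>)
qed simp

lemma Phi_zero: "Phi (\<lambda>u v. 0) z = 0"
  using Phi_lincomb[OF Inv_zero Inv_zero, of 0 0] by simp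

lemma Phi_add: "Inv c \<Longrightarrow> Inv d \<Longrightarrow> Phi (\<lambda>u v. c u v + d u v) z = Phi c z + Phi d z"
  and Phi_diff: "Inv c \<Longrightarrow> Inv d \<Longrightarrow> Phi (\<lambda>u v. c u v - d u v) z = Phi c z - Phi d z"
  and Phi_scale: "Inv c \<Longrightarrow> Phi (\<lambda>u v. s * c u v) z = s * Phi c z"
  using Phi_lincomb[of c d 1 1] Phi_lincomb[of c d 1 "-1"] Phi_lincomb[of c "\<lambda>u v. 0" s 0] Inv_zero by auto

lemma Phi_sum: "finite S \<Longrightarrow> (\<And>s. s \<in> S \<Longrightarrow> Inv (c s)) \<Longrightarrow> Phi (\<lambda>u v. \<Sum>s\<in>S. c s u v) z = (\<Sum>s\<in>S. Phi (c s) z)"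
  by (induction S rule: finite_induct) (auto simp: Phi_zero Phi_add Inv_sum)

lemma Phi_delta: assumes "z \<notin> {0,1}" shows "Phi delta z = 1"
proof (rule eq_off_real[where f = "Phi delta" and z = z and g = "\<lambda>z. 1" and S = "- {0,1}"])
  fix w assume "Im w \<noteq> 0"
  then have "w \<in> slit" by (auto simp: slit_def)
  moreover have "csup 0 delta" by (auto simp: csup_def delta_def)
  ultimately show "Phi delta w = 1" by (simp add: Phi_slit rep_def W_0 delta_def)
qed (use assms Phi_isCont Inv_delta in \<open>auto intro!: open_Compl\<close>)

lemma Phi_swap: assumes "Inv c" shows "Phi (swap c) z = Phi c (cnj z)"
proof (cases "z \<in> {0,1}")
  case False
  then have z: "z \<in> - {0,1}" "cnj z \<notin> {0,1}" by (auto simp: complex_eq_iff)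
  obtain N where N: "cinv N c" using assms unfolding Inv_def by blast
  then have cs: "csup N c" "csup N (swap c)" unfolding cinv_def csup_def swap_def by auto
  have "isCont (\<lambda>z. Phi c (cnj z)) z"
    by (rule isCont_o2[where f = cnj and g = "Phi c"]) (use Phi_isCont[OF assms z(2)] in \<open>auto intro: continuous_intros\<close>)
  then show ?thesis
  proof (rule eq_off_real[where f = "Phi (swap c)" and z = z and g = "\<lambda>z. Phi c (cnj z)" and S = "- {0,1}", rotated])
    fix w assume "Im w \<noteq> 0"
    then have w: "w \<in> slit" "cnj w \<in> slit" by (auto simp: slit_def)
    have "rep N (swap c) Lr Lr w = rep N c Lr Lr (cnj w)"
      unfolding rep_def swap_def by (subst sum.swap) (simp add: mult_ac)
    then show "Phi (swap c) w = Phi c (cnj w)" using Phi_slit cs w by metis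
  qed (use z assms Phi_isCont Inv_swap in \<open>auto intro!: open_Compl\<close>)
qed auto

section \<open>Polarisation and injectivity of the coefficient map\<close>

text \<open>Repeated differentiation with respect to z leaves the antiholomorphic factors alone. At
  the point \<open>cnj y\<close> it therefore yields all derivatives of the holomorphic function
  obtained by freezing the first variable at \<open>y\<close>, and the identity theorem makes that
  function zero.\<close>

lemma polarise:
  assumes U: "open U" "connected U" "\<And>z. z \<in> U \<Longrightarrow> cnj z \<in> U" and J: "finite J"
    and al: "\<And>j. j \<in> J \<Longrightarrow> \<alpha> j holomorphic_on U" and be: "\<And>j. j \<in> J \<Longrightarrow> \<beta> j holomorphic_on U"
    and eq: "\<And>z. z \<in> U \<Longrightarrow> (\<Sum>j\<in>J. \<alpha> j (cnj z) * \<beta> j z) = 0"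
    and yz: "y \<in> U" "z \<in> U"
  shows "(\<Sum>j\<in>J. \<alpha> j y * \<beta> j z) = 0"
proof -
  have D: "(\<Sum>j\<in>J. \<alpha> j (cnj w) * (deriv ^^ n) (\<beta> j) w) = 0" if "w \<in> U" for n w
    using that
  proof (induction n arbitrary: w)
    case (Suc n)
    have h: "(deriv ^^ n) (\<beta> j) holomorphic_on U" if "j \<in> J" for j
      using be[OF that] U(1) by (rule holomorphic_higher_deriv)
    have "has_wirt (\<lambda>z. \<alpha> j (cnj z) * (deriv ^^ n) (\<beta> j) z) (\<alpha> j (cnj w) * (deriv ^^ Suc n) (\<beta> j) w)
       (deriv (\<alpha> j) (cnj w) * (deriv ^^ n) (\<beta> j) w) w" if j: "j \<in> J" for j
    proof -
      have "has_wirt (\<alpha> j) (deriv (\<alpha> j) (cnj w)) 0 (cnj w)"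
        using holomorphic_derivI[OF al[OF j] U(1) U(3)[OF Suc(2)], of UNIV] by (simp add: has_wirt_holomorphic)
      from has_wirt_cnj[OF this] have 1: "has_wirt (\<lambda>z. \<alpha> j (cnj z)) 0 (deriv (\<alpha> j) (cnj w)) w" .
      have "has_wirt ((deriv ^^ n) (\<beta> j)) ((deriv ^^ Suc n) (\<beta> j) w) 0 w"
        using holomorphic_derivI[OF h[OF j] U(1) Suc(2), of UNIV] by (simp add: has_wirt_holomorphic)
      from has_wirt_mult[OF 1 this] show ?thesis by simp
    qed
    then have 1: "has_wirt (\<lambda>z. \<Sum>j\<in>J. \<alpha> j (cnj z) * (deriv ^^ n) (\<beta> j) z) (\<Sum>j\<in>J. \<alpha> j (cnj w) * (deriv ^^ Suc n) (\<beta> j) w)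
       (\<Sum>j\<in>J. deriv (\<alpha> j) (cnj w) * (deriv ^^ n) (\<beta> j) w) w" by (rule has_wirt_sum[OF J])
    have 0: "has_wirt (\<lambda>z. \<Sum>j\<in>J. \<alpha> j (cnj z) * (deriv ^^ n) (\<beta> j) z) 0 0 w"
      by (rule has_wirt_transform[OF has_wirt_const[of 0] U(1) Suc(2)]) (simp add: Suc.IH)
    then show ?case using has_wirt_imp(1)[OF 1] has_wirt_imp(1)[OF 0] by simp
  qed (use eq in simp)
  show ?thesis
  proof (rule holomorphic_fun_eq_0_on_connected[where f = "\<lambda>z. \<Sum>j\<in>J. \<alpha> j y * \<beta> j z" and S = U and z = "cnj y"])
    show "(\<lambda>z. \<Sum>j\<in>J. \<alpha> j y * \<beta> j z) holomorphic_on U" by (intro holomorphic_intros be)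
    fix n
    have "(deriv ^^ n) (\<lambda>z. \<Sum>j\<in>J. \<alpha> j y * \<beta> j z) w = (\<Sum>j\<in>J. \<alpha> j y * (deriv ^^ n) (\<beta> j) w)" if "w \<in> U" for w
      using that
    proof (induction n arbitrary: w)
      case (Suc n)
      have "((\<lambda>z. \<Sum>j\<in>J. \<alpha> j y * (deriv ^^ n) (\<beta> j) z) has_field_derivative (\<Sum>j\<in>J. \<alpha> j y * deriv ((deriv ^^ n) (\<beta> j)) w)) (at w)"
        by (intro DERIV_sum DERIV_cmult holomorphic_derivI[OF _ U(1) Suc(2)] holomorphic_higher_deriv be U(1))
      then have "((deriv ^^ n) (\<lambda>z. \<Sum>j\<in>J. \<alpha> j y * \<beta> j z) has_field_derivative (\<Sum>j\<in>J. \<alpha> j y * deriv ((deriv ^^ n) (\<beta> j)) w)) (at w)"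
        by (rule has_field_derivative_transform_within_open[OF _ U(1) Suc(2)]) (simp add: Suc.IH)
      then show ?case by (simp add: DERIV_imp_deriv)
    qed simp
    from this[OF U(3)[OF yz(1)]] D[OF U(3)[OF yz(1)], of n]
    show "(deriv ^^ n) (\<lambda>z. \<Sum>j\<in>J. \<alpha> j y * \<beta> j z) (cnj y) = 0" by simp
  qed (use U yz in auto)
qed

lemma two_pole_zero:
  assumes "\<And>z. z \<notin> {0,1} \<Longrightarrow> s / z + t / (z - 1) = (0::complex)"
  shows "s = 0" "t = 0"
  using assms[of 2] assms[of "-1"] by (auto simp: field_simps add_eq_0_iff)

lemma Lr_independent_poles:
  assumes "\<And>z. z \<in> slit \<Longrightarrow> (\<Sum>v\<in>W N. (s v / z + t v / (z - 1)) * Lr v z) = 0" "v \<in> W N"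
  shows "s v = 0" "t v = 0"
proof -
  have "s v / z + t v / (z - 1) = 0" if "z \<notin> {0,1}" for z
    by (rule Lr_independent[where r = "\<lambda>v z. s v / z + t v / (z - 1)" and N = N])
       (use assms Hlo_subset that in \<open>auto intro!: holomorphic_intros\<close>)
  then show "s v = 0" "t v = 0" using two_pole_zero by blast+
qed

text \<open>Shows that coefficient families are determined by the function, even with the four pole
  factors present. After polarisation the two variables are independent, and
  \<open>Lr_independent_poles\<close> applies twice: in \<open>z\<close> with \<open>y\<close>
  fixed, then in \<open>y\<close>.\<close>

lemma Phi_poles_independent:
  assumes I: "\<And>a b. a \<in> {0,1} \<Longrightarrow> b \<in> {0,1} \<Longrightarrow> Inv (k a b)"
    and eq: "\<And>z. Im z \<noteq> 0 \<Longrightarrow> (\<Sum>a\<in>{0,1}. \<Sum>b\<in>{0,1}. Phi (k a b) z / ((z - a) * (cnj z - b))) = 0"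
    and ab: "a \<in> {0,1}" "b \<in> {0,1}"
  shows "k a b = (\<lambda>u v. 0)"
proof -
  have i01: "0 \<in> {0,1::complex}" "1 \<in> {0,1::complex}" by auto
  obtain N0 where "cinv N0 (k 0 0)" "cinv N0 (k 0 1)" using Inv_obtain2[OF I[OF i01(1,1)] I[OF i01]] .
  moreover obtain N1 where "cinv N1 (k 1 0)" "cinv N1 (k 1 1)" using Inv_obtain2[OF I[OF i01(2,1)] I[OF i01(2,2)]] .
  ultimately
  have "cinv (max N0 N1) (k a b)" if "a \<in> {0,1}" "b \<in> {0,1}" for a b
    using that cinv_mono[of _ _ "max N0 N1"] by auto
  then obtain N where N: "\<And>a b. a \<in> {0,1} \<Longrightarrow> b \<in> {0,1} \<Longrightarrow> csup N (k a b)" unfolding cinv_def by blast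
  define J where "J = ({0,1::complex} \<times> {0,1::complex}) \<times> (W N \<times> W N)"
  define \<alpha> where "\<alpha> j y = (case j of ((a,b),(u,v)) \<Rightarrow> k a b u v * Lr u y / (y - b))" for j and y :: complex
  define \<beta> where "\<beta> j z = (case j of ((a,b),(u,v)) \<Rightarrow> Lr v z / (z - a))" for j :: "(complex \<times> complex) \<times> (complex list \<times> complex list)" and z :: complex
  have sumJ: "(\<Sum>j\<in>J. \<alpha> j y * \<beta> j z) = (\<Sum>v\<in>W N. ((\<Sum>u\<in>W N. (k 0 0 u v / y + k 0 1 u v / (y - 1)) * Lr u y) / z
      + (\<Sum>u\<in>W N. (k 1 0 u v / y + k 1 1 u v / (y - 1)) * Lr u y) / (z - 1)) * Lr v z)" for y z
  proof -
    have "(\<Sum>j\<in>J. \<alpha> j y * \<beta> j z) = (\<Sum>u\<in>W N. \<Sum>v\<in>W N. (k 0 0 u v * Lr u y / y * (Lr v z / z) + k 0 1 u v * Lr u y / (y - 1) * (Lr v z / z))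
        + (k 1 0 u v * Lr u y / y * (Lr v z / (z - 1)) + k 1 1 u v * Lr u y / (y - 1) * (Lr v z / (z - 1))))"
      unfolding J_def \<alpha>_def \<beta>_def sum.cartesian_product' prod.case by (simp add: sum.distrib)
    also have "\<dots> = (\<Sum>v\<in>W N. \<Sum>u\<in>W N. (((k 0 0 u v / y + k 0 1 u v / (y - 1)) * Lr u y) / z
      + ((k 1 0 u v / y + k 1 1 u v / (y - 1)) * Lr u y) / (z - 1)) * Lr v z)"
      by (subst sum.swap, intro sum.cong refl) (simp add: add_divide_distrib ring_distribs)
    also have "\<dots> = (\<Sum>v\<in>W N. ((\<Sum>u\<in>W N. (k 0 0 u v / y + k 0 1 u v / (y - 1)) * Lr u y) / z
      + (\<Sum>u\<in>W N. (k 1 0 u v / y + k 1 1 u v / (y - 1)) * Lr u y) / (z - 1)) * Lr v z)"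
      by (intro sum.cong refl) (simp add: sum_divide_distrib sum.distrib flip: sum_distrib_right)
    finally show ?thesis .
  qed
  have ph: "(\<Sum>j\<in>J. \<alpha> j (cnj z) * \<beta> j z) = (\<Sum>a\<in>{0,1}. \<Sum>b\<in>{0,1}. Phi (k a b) z / ((z - a) * (cnj z - b)))" if "z \<in> slit" for z
  proof -
    have "(\<Sum>j\<in>J. \<alpha> j (cnj z) * \<beta> j z) = (\<Sum>a\<in>{0,1}. \<Sum>b\<in>{0,1}. \<Sum>u\<in>W N. \<Sum>v\<in>W N. k a b u v * Lr u (cnj z) / (cnj z - b) * (Lr v z / (z - a)))"
      unfolding J_def \<alpha>_def \<beta>_def sum.cartesian_product' prod.case by simp
    also have "\<dots> = (\<Sum>a\<in>{0,1}. \<Sum>b\<in>{0,1}. Phi (k a b) z / ((z - a) * (cnj z - b)))"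
    proof (intro sum.cong refl)
      fix a b assume "a \<in> {0,1::complex}" "b \<in> {0,1::complex}"
      then have "Phi (k a b) z = rep N (k a b) Lr Lr z" using Phi_slit N that by blast
      then show "(\<Sum>u\<in>W N. \<Sum>v\<in>W N. k a b u v * Lr u (cnj z) / (cnj z - b) * (Lr v z / (z - a))) = Phi (k a b) z / ((z - a) * (cnj z - b))"
        by (simp add: rep_def sum_divide_distrib mult_ac)
    qed
    finally show ?thesis .
  qed
  have z0: "(\<Sum>j\<in>J. \<alpha> j (cnj z) * \<beta> j z) = 0" if "z \<in> Hlo" for z
    using ph[of z] eq[of z] that Hlo_subset by (auto simp: Hlo_def)
  have hol: "\<alpha> j holomorphic_on slit" "\<beta> j holomorphic_on slit" if "j \<in> J" for j
  proof -
    obtain a b u v where j0: "j = ((a,b),(u,v))" by (metis prod.exhaust)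
    then have j: "j = ((a,b),(u,v))" "a \<in> {0,1}" "b \<in> {0,1}" "u \<in> words" "v \<in> words"
      using that W_words unfolding J_def by blast+
    have ne: "y \<noteq> a" "y \<noteq> b" if "y \<in> slit" for y using notin_01(1)[OF that] j by auto
    have L: "Lr u holomorphic_on slit" "Lr v holomorphic_on slit" using polysys_holomorphic[OF open_slit polysys_Lr] j by auto
    show "\<alpha> j holomorphic_on slit" "\<beta> j holomorphic_on slit"
      unfolding \<alpha>_def[abs_def] \<beta>_def[abs_def] j(1) prod.case using ne by (auto intro!: holomorphic_intros L)
  qed
  have cont: "isCont (\<lambda>z. \<Sum>j\<in>J. \<alpha> j (cnj z) * \<beta> j z) z" if "z \<in> slit" for z
  proof (intro continuous_intros)
    fix j assume j: "j \<in> J"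
    have "isCont (\<alpha> j) (cnj z)" "isCont (\<beta> j) z"
      using hol[OF j] that open_slit cnj_slit by (meson holomorphic_on_imp_continuous_on continuous_on_eq_continuous_at)+
    then show "isCont (\<lambda>z. \<alpha> j (cnj z)) z" "isCont (\<beta> j) z" by (auto intro!: isCont_o2[where f = cnj and g = "\<alpha> j"] continuous_intros)
  qed
  have z1: "(\<Sum>j\<in>J. \<alpha> j (cnj z) * \<beta> j z) = 0" if "z \<in> slit" for z
  proof (rule eq_off_real[where f = "\<lambda>z. \<Sum>j\<in>J. \<alpha> j (cnj z) * \<beta> j z" and z = z and g = "\<lambda>z. 0" and S = slit])
    fix w assume "w \<in> slit" "Im w \<noteq> 0"
    then show "(\<Sum>j\<in>J. \<alpha> j (cnj w) * \<beta> j w) = 0" using ph eq by simp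
  qed (use that cont open_slit in auto)
  have fin: "finite J" by (simp add: J_def)
  have yz: "(\<Sum>j\<in>J. \<alpha> j y * \<beta> j z) = 0" if "y \<in> slit" "z \<in> slit" for y z
    by (rule polarise[OF open_slit connected_slit _ fin hol z1 that]) auto
  have 1: "(\<Sum>u\<in>W N. (k 0 0 u v / y + k 0 1 u v / (y - 1)) * Lr u y) = 0"
          "(\<Sum>u\<in>W N. (k 1 0 u v / y + k 1 1 u v / (y - 1)) * Lr u y) = 0" if "y \<in> slit" "v \<in> W N" for y v
    using Lr_independent_poles[OF _ that(2), of "\<lambda>v. \<Sum>u\<in>W N. (k 0 0 u v / y + k 0 1 u v / (y - 1)) * Lr u y" "\<lambda>v. \<Sum>u\<in>W N. (k 1 0 u v / y + k 1 1 u v / (y - 1)) * Lr u y"]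
      yz[OF that(1), unfolded sumJ] by blast+
  have "k a b u v = 0" if "u \<in> W N" "v \<in> W N" for u v
    using ab Lr_independent_poles[OF 1(1)[OF _ that(2)] that(1)] Lr_independent_poles[OF 1(2)[OF _ that(2)] that(1)] by auto
  then have "k a b u v = 0" for u v using csupD[OF N[OF ab]] by blast
  then show ?thesis by blast
qed

section \<open>Growth at \<open>0\<close>, \<open>1\<close> and infinity\<close>

definition bdd_by :: "complex set \<Rightarrow> (complex \<Rightarrow> real) \<Rightarrow> (complex \<Rightarrow> complex) \<Rightarrow> bool" where
  "bdd_by A h f \<longleftrightarrow> (\<exists>C\<ge>0. \<forall>z\<in>A. cmod (f z) \<le> C * h z)"

lemma bdd_byI: "(\<And>z. z \<in> A \<Longrightarrow> cmod (f z) \<le> C * h z) \<Longrightarrow> (\<And>z. z \<in> A \<Longrightarrow> 0 \<le> h z) \<Longrightarrow> bdd_by A h f"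
proof -
  assume f: "\<And>z. z \<in> A \<Longrightarrow> cmod (f z) \<le> C * h z" and h: "\<And>z. z \<in> A \<Longrightarrow> 0 \<le> h z"
  have "cmod (f z) \<le> \<bar>C\<bar> * h z" if "z \<in> A" for z
    using f[OF that] mult_right_mono[OF abs_ge_self[of C] h[OF that]] by linarith
  then show "bdd_by A h f" unfolding bdd_by_def by (intro exI[of _ "\<bar>C\<bar>"]) auto
qed

lemma bdd_by_add:
  assumes "bdd_by A h f" "bdd_by A h g" shows "bdd_by A h (\<lambda>z. f z + g z)"
proof -
  obtain C D where C: "C \<ge> 0" "\<forall>z\<in>A. cmod (f z) \<le> C * h z" and D: "D \<ge> 0" "\<forall>z\<in>A. cmod (g z) \<le> D * h z"
    using assms unfolding bdd_by_def by blast
  have "cmod (f z + g z) \<le> (C + D) * h z" if "z \<in> A" for z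
    using norm_triangle_ineq[of "f z" "g z"] C(2) D(2) that by (fastforce simp: distrib_right)
  then show ?thesis using C D unfolding bdd_by_def by (intro exI[of _ "C + D"]) auto
qed

lemma bdd_by_mult:
  assumes "bdd_by A h f" "bdd_by A k g" shows "bdd_by A (\<lambda>z. h z * k z) (\<lambda>z. f z * g z)"
proof -
  obtain C D where C: "C \<ge> 0" "\<forall>z\<in>A. cmod (f z) \<le> C * h z" and D: "D \<ge> 0" "\<forall>z\<in>A. cmod (g z) \<le> D * k z"
    using assms unfolding bdd_by_def by blast
  have "cmod (f z * g z) \<le> (C * D) * (h z * k z)" if "z \<in> A" for z
  proof -
    have "cmod (f z * g z) \<le> (C * h z) * (D * k z)"
      unfolding norm_mult using C(2) D(2) that by (intro mult_mono) (auto intro: order_trans[OF norm_ge_zero])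
    then show ?thesis by (simp add: mult_ac)
  qed
  then show ?thesis using C D unfolding bdd_by_def by (intro exI[of _ "C * D"]) auto
qed

lemma bdd_by_cmult:
  assumes "bdd_by A h f" shows "bdd_by A h (\<lambda>z. c * f z)"
proof -
  obtain C where C: "C \<ge> 0" "\<forall>z\<in>A. cmod (f z) \<le> C * h z" using assms unfolding bdd_by_def by blast
  have "cmod (c * f z) \<le> (cmod c * C) * h z" if "z \<in> A" for z
    using mult_left_mono[of "cmod (f z)" "C * h z" "cmod c"] C that by (simp add: norm_mult mult.assoc)
  then show ?thesis using C unfolding bdd_by_def by (intro exI[of _ "cmod c * C"]) auto
qed

lemma bdd_by_sum: "finite S \<Longrightarrow> (\<And>s. s \<in> S \<Longrightarrow> bdd_by A h (f s)) \<Longrightarrow> bdd_by A h (\<lambda>z. \<Sum>s\<in>S. f s z)"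
proof (induction S rule: finite_induct)
  case empty then show ?case by (auto simp: bdd_by_def intro: exI[of _ 0])
next
  case (insert x F) then show ?case by (simp add: bdd_by_add)
qed

lemma bdd_by_cong: "bdd_by A h f \<Longrightarrow> (\<And>z. z \<in> A \<Longrightarrow> f z = g z) \<Longrightarrow> bdd_by A h g"
  unfolding bdd_by_def by simp

lemma le_off_real:
  fixes f g :: "complex \<Rightarrow> real"
  assumes "isCont f z" "isCont g z" "open S" "z \<in> S" "\<And>w. w \<in> S \<Longrightarrow> Im w \<noteq> 0 \<Longrightarrow> f w \<le> g w"
  shows "f z \<le> g z"
proof -
  have "max (f z) (g z) = g z"
    by (rule eq_off_real[where f = "\<lambda>z. max (f z) (g z)" and g = g and S = S])
       (use assms in \<open>auto intro: continuous_max simp: max_absorb2\<close>)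
  then show ?thesis by simp
qed

lemma bdd_by_off_real:
  assumes "open A" "bdd_by (A \<inter> {z. Im z \<noteq> 0}) h f" "\<And>z. z \<in> A \<Longrightarrow> isCont f z" "\<And>z. z \<in> A \<Longrightarrow> isCont h z"
  shows "bdd_by A h f"
proof -
  obtain C where C: "C \<ge> 0" "\<forall>z\<in>A \<inter> {z. Im z \<noteq> 0}. cmod (f z) \<le> C * h z" using assms(2) unfolding bdd_by_def by blast
  have "cmod (f z) \<le> C * h z" if "z \<in> A" for z
    by (rule le_off_real[where S = A]) (use assms that C in \<open>auto intro!: continuous_intros\<close>)
  then show ?thesis using C(1) unfolding bdd_by_def by blast
qed

definition Reg :: "complex set" where
  "Reg = {z. z \<notin> {0,1} \<and> (cmod z < 1/8 \<or> cmod (z - 1) < 1/8 \<or> cmod z > 8)}"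

text \<open>A common scale that tends to infinity at the three singular points.\<close>
definition nz :: "complex \<Rightarrow> real" where
  "nz z = (if cmod z < 1/8 then 1 / cmod z else if cmod (z - 1) < 1/8 then 1 / cmod (z - 1) else cmod z)"

lemma not_both_near: "cmod z < 1/8 \<Longrightarrow> \<not> cmod (z - 1) < 1/8" "cmod z > 8 \<Longrightarrow> \<not> cmod (z - 1) < 1/8"
  using norm_triangle_ineq4[of z "z - 1"] norm_triangle_ineq2[of z 1] by auto

lemma nz_ge_1: "z \<in> Reg \<Longrightarrow> nz z \<ge> 1"
  by (auto simp: Reg_def nz_def field_simps)

lemma Reg_cases:
  assumes "z \<in> Reg"
  obtains "z \<noteq> 0" "cmod z < 1/8" "nz z = 1 / cmod z"
    | "z \<noteq> 1" "cmod (z - 1) < 1/8" "nz z = 1 / cmod (z - 1)"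
    | "cmod z > 8" "nz z = cmod z"
proof -
  have "z \<notin> {0,1}" and "cmod z < 1/8 \<or> cmod (z - 1) < 1/8 \<or> cmod z > 8" using assms by (auto simp: Reg_def)
  then consider "cmod z < 1/8" | "cmod (z - 1) < 1/8" "\<not> cmod z < 1/8"
    | "cmod z > 8" "\<not> cmod z < 1/8" "\<not> cmod (z - 1) < 1/8"
    using not_both_near[of z] by linarith
  then show thesis
    by cases (use \<open>z \<notin> {0,1}\<close> that in \<open>simp_all add: nz_def\<close>)
qed

lemma inv_powr: "(0::real) < x \<Longrightarrow> (1 / x) powr e = x powr (-e)"
  by (simp add: powr_minus_divide powr_divide)

lemma open_Reg: "open Reg"
proof -
  have eq: "Reg = (- {0,1}) \<inter> ({z. cmod z < 1/8} \<union> {z. cmod (z - 1) < 1/8} \<union> {z. 8 < cmod z})"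
    by (auto simp: Reg_def)
  have "open {z::complex. cmod z < 1/8}" "open {z::complex. cmod (z - 1) < 1/8}" "open {z::complex. 8 < cmod z}"
    by (auto intro!: open_Collect_less continuous_intros)
  then show ?thesis unfolding eq by (intro open_Int open_Un open_Compl finite_imp_closed; simp)
qed

lemma isCont_nz: assumes "z \<in> Reg" shows "isCont nz z"
proof -
  have *: "isCont nz z" if "open S" "z \<in> S" "\<And>w. w \<in> S \<Longrightarrow> f w = nz w" "isCont f z" for f S
    using that isCont_cong[of f nz z] eventually_nhds_in_open[OF that(1,2)] by (meson eventually_mono)
  show ?thesis using assms
  proof (cases rule: Reg_cases)
    case 1
    show ?thesis by (rule *[of "{z. cmod z < 1/8}" "\<lambda>w. 1 / cmod w"])
      (use 1 in \<open>auto simp: nz_def intro!: open_Collect_less continuous_intros\<close>)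
  next
    case 2
    show ?thesis by (rule *[of "{z. cmod (z - 1) < 1/8}" "\<lambda>w. 1 / cmod (w - 1)"])
      (use 2 not_both_near in \<open>auto simp: nz_def intro!: open_Collect_less continuous_intros\<close>)
  next
    case 3
    show ?thesis by (rule *[of "{z. 8 < cmod z}" cmod])
      (use 3 not_both_near in \<open>auto simp: nz_def intro!: open_Collect_less continuous_intros\<close>)
  qed
qed

lemma cmod_cnj_minus_1 [simp]: "cmod (cnj z - 1) = cmod (z - 1)"
  by (metis complex_cnj_diff complex_cnj_one complex_mod_cnj)

lemma nz_cnj [simp]: "nz (cnj z) = nz z" and Reg_cnj [simp]: "cnj z \<in> Reg \<longleftrightarrow> z \<in> Reg"
  by (simp_all add: nz_def Reg_def)

text \<open>One exponent controls all three singular points: \<open>nz z powr e\<close> is |z|^(-e)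
  near 0, |z - 1|^(-e) near 1 and |z|^e near infinity. The set \<open>S\<close> allows for functions
  that are controlled only off the real axis, such as \<open>Lr\<close>.\<close>

definition mild :: "complex set \<Rightarrow> real \<Rightarrow> (complex \<Rightarrow> complex) \<Rightarrow> bool" where
  "mild S e f \<longleftrightarrow> bdd_by (Reg \<inter> S) (\<lambda>z. nz z powr e) f"

lemma mild_add: "mild S e f \<Longrightarrow> mild S e g \<Longrightarrow> mild S e (\<lambda>z. f z + g z)"
  and mild_cmult: "mild S e f \<Longrightarrow> mild S e (\<lambda>z. c * f z)"
  and mild_sum: "finite J \<Longrightarrow> (\<And>j. j \<in> J \<Longrightarrow> mild S e (h j)) \<Longrightarrow> mild S e (\<lambda>z. \<Sum>j\<in>J. h j z)"
  and mild_cong: "mild S e f \<Longrightarrow> (\<And>z. z \<in> S \<Longrightarrow> f z = k z) \<Longrightarrow> mild S e k"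
  unfolding mild_def by (auto intro: bdd_by_add bdd_by_cmult bdd_by_sum elim: bdd_by_cong)

lemma mild_mult: assumes "mild S e f" "mild S e' g" shows "mild S (e + e') (\<lambda>z. f z * g z)"
  using bdd_by_mult[OF assms[unfolded mild_def]] unfolding mild_def by (simp add: powr_add)

lemma mild_cnj: assumes "mild S e f" "\<And>z. z \<in> S \<Longrightarrow> cnj z \<in> S" shows "mild S e (\<lambda>z. f (cnj z))"
  using assms unfolding mild_def bdd_by_def by (metis IntE IntI Reg_cnj nz_cnj)

lemma mild_off_real:
  assumes "mild {z. Im z \<noteq> 0} e f" "\<And>z. z \<notin> {0,1} \<Longrightarrow> isCont f z"
  shows "mild (- {0,1}) e f"
proof -
  have "Reg \<inter> - {0,1} = Reg" by (auto simp: Reg_def)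
  moreover have "bdd_by Reg (\<lambda>z. nz z powr e) f"
  proof (rule bdd_by_off_real[OF open_Reg])
    show "bdd_by (Reg \<inter> {z. Im z \<noteq> 0}) (\<lambda>z. nz z powr e) f" using assms(1) by (simp add: mild_def)
    fix z assume z: "z \<in> Reg"
    show "isCont f z" using z assms(2) by (auto simp: Reg_def)
    show "isCont (\<lambda>z. nz z powr e) z" using isCont_nz[OF z] nz_ge_1[OF z] by (intro continuous_intros) auto
  qed
  ultimately show ?thesis by (simp add: mild_def)
qed

text \<open>Integrate along the ray through \<open>c\<close> orthogonal to the real axis, then along a circular arc.\<close>
lemma half_plane_growth:
  fixes s k :: real and c :: complex
  assumes s: "s = 1 \<or> s = -1" and c: "Im c = 0" and R: "is_interval R" "R \<subseteq> {0<..}" and tb: "tb \<in> R" and k: "k \<noteq> 0"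
    and k1: "\<And>r. r \<in> R \<Longrightarrow> 1 \<le> r powr k" and C: "C \<ge> 0"
    and g: "\<And>w. s * Im w > 0 \<Longrightarrow> cmod (w - c) \<in> R \<Longrightarrow> (g has_field_derivative G w) (at w)"
    and G: "\<And>w. s * Im w > 0 \<Longrightarrow> cmod (w - c) \<in> R \<Longrightarrow> cmod (G w) \<le> C * cmod (w - c) powr (k - 1)"
  shows "\<exists>C'\<ge>0. \<forall>z. s * Im z > 0 \<longrightarrow> cmod (z - c) \<in> R \<longrightarrow> cmod (g z) \<le> C' * cmod (z - c) powr k"
proof -
  have ss: "s * s = 1" "\<bar>s\<bar> = 1" using s by auto
  define \<gamma> where "\<gamma> t = c + \<i> * of_real (s * t)" for t :: real
  have gam: "s * Im (\<gamma> t) > 0" "cmod (\<gamma> t - c) = t" if "t > 0" for t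
    using that c ss by (auto simp: \<gamma>_def norm_mult mult.assoc[symmetric])
  have rad: "cmod (g (\<gamma> b) - g (\<gamma> a)) \<le> C / \<bar>k\<bar> * (b powr k + a powr k)" if ab: "a < b" "a \<in> R" "b \<in> R" for a b
  proof -
    have inR: "t \<in> R" "t > 0" if "a \<le> t" "t \<le> b" for t
      using that ab R unfolding is_interval_1 by (meson, meson greaterThan_iff subsetD)
    have gd: "((\<lambda>t. g (\<gamma> t)) has_vector_derivative (\<i> * of_real s * G (\<gamma> t))) (at t within S)" if "a \<le> t" "t \<le> b" for t S
    proof -
      have "(\<gamma> has_vector_derivative (\<i> * of_real s)) (at t within S)"
        unfolding \<gamma>_def by (auto intro!: derivative_eq_intros has_vector_derivative_real_field simp: has_vector_derivative_def scaleR_conv_of_real)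
      from field_vector_diff_chain_within[OF this, of g "G (\<gamma> t)"] g[OF gam(1), of t] inR[OF that] gam(2)[of t]
      show ?thesis by (auto simp: o_def intro: has_field_derivative_at_within)
    qed
    \<comment> \<open>The comparison function \<open>C / k * t powr k\<close> has derivative
      \<open>C * t powr (k - 1)\<close>; \<open>k \<noteq> 0\<close> keeps it a power instead of a
      logarithm.\<close>
    have "norm (g (\<gamma> b) - g (\<gamma> a)) \<le> C / k * b powr k - C / k * a powr k"
    proof (rule differentiable_bound_general[OF ab(1)])
      show "continuous_on {a..b} (\<lambda>t. g (\<gamma> t))"
        using gd by (auto intro!: continuous_on_vector_derivative)
      show "continuous_on {a..b} (\<lambda>t. C / k * t powr k)"
        by (intro continuous_intros) (use inR in force)
      fix x assume x: "a < x" "x < b"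
      then have x': "x \<in> R" "x > 0" using inR by auto
      show "((\<lambda>t. g (\<gamma> t)) has_vector_derivative (\<i> * of_real s * G (\<gamma> x))) (at x)" using gd x by auto
      have "((\<lambda>t. C / k * t powr k) has_real_derivative (C / k * (k * x powr (k - 1)))) (at x)"
        by (intro DERIV_cmult has_real_derivative_powr x')
      then show "((\<lambda>t. C / k * t powr k) has_vector_derivative (C * x powr (k - 1))) (at x)"
        using k by (simp add: has_real_derivative_iff_has_vector_derivative)
      show "norm (\<i> * of_real s * G (\<gamma> x)) \<le> C * x powr (k - 1)"
        using G[OF gam(1)[OF x'(2)]] gam(2)[OF x'(2)] x' ss by (simp add: norm_mult)
    qed
    also have "\<dots> = C / k * (b powr k - a powr k)" by (simp add: right_diff_distrib)
    also have "\<dots> \<le> \<bar>C / k * (b powr k - a powr k)\<bar>" by (rule abs_ge_self)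
    also have "\<dots> = C / \<bar>k\<bar> * \<bar>b powr k - a powr k\<bar>" using C by (simp add: abs_mult)
    also have "\<dots> \<le> C / \<bar>k\<bar> * (b powr k + a powr k)" using C by (intro mult_left_mono) (auto simp: abs_le_iff)
    finally show ?thesis .
  qed
  have rad': "cmod (g (\<gamma> r)) \<le> cmod (g (\<gamma> tb)) + C / \<bar>k\<bar> * (r powr k + tb powr k)" if "r \<in> R" for r
  proof -
    have "cmod (g (\<gamma> r) - g (\<gamma> tb)) \<le> C / \<bar>k\<bar> * (r powr k + tb powr k)"
      using rad[of r tb] rad[of tb r] that tb C by (cases r tb rule: linorder_cases) (auto simp: norm_minus_commute add.commute)
    then show ?thesis using norm_triangle_ineq2[of "g (\<gamma> r)" "g (\<gamma> tb)"] by simp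
  qed
  have arc: "cmod (g z - g (\<gamma> r)) \<le> C * pi * r powr k" if z: "s * Im z > 0" "cmod (z - c) = r" and r: "r \<in> R" for z r
  proof -
    have r0: "r > 0" using r R by auto
    define J where "J = {\<theta>. 0 < s * \<theta> \<and> s * \<theta> < pi}"
    define h where "h \<theta> = c + of_real r * cis \<theta>" for \<theta>
    have J: "J = (if s = 1 then {0<..<pi} else {-pi<..<0})" using s by (auto simp: J_def)
    have cJ: "convex J" unfolding J by simp
    have hJ: "s * Im (h \<theta>) > 0" "cmod (h \<theta> - c) = r" if "\<theta> \<in> J" for \<theta>
    proof -
      have "s * sin \<theta> = sin (s * \<theta>)" using s by auto
      moreover have "sin (s * \<theta>) > 0" using that by (auto simp: J_def intro: sin_gt_zero)
      ultimately show "s * Im (h \<theta>) > 0" using r0 c by (simp add: h_def mult.left_commute)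
      show "cmod (h \<theta> - c) = r" using r0 by (simp add: h_def norm_mult)
    qed
    have hd: "((\<lambda>\<theta>. g (h \<theta>)) has_vector_derivative (of_real r * (\<i> * cis \<theta>) * G (h \<theta>))) (at \<theta> within J)" if "\<theta> \<in> J" for \<theta>
    proof -
      have "(cis has_vector_derivative (\<i> * cis \<theta>)) (at \<theta> within J)"
        by (rule has_vector_derivative_at_within) (auto simp: has_vector_derivative_def scaleR_conv_of_real mult_ac intro!: derivative_eq_intros has_derivative_cis)
      then have "(h has_vector_derivative (of_real r * (\<i> * cis \<theta>))) (at \<theta> within J)"
        unfolding h_def by (auto intro!: derivative_eq_intros)
      from field_vector_diff_chain_within[OF this, of g "G (h \<theta>)"] g[OF hJ(1)[OF that]] hJ(2)[OF that] r
      show ?thesis by (auto simp: o_def intro: has_field_derivative_at_within)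
    qed
    define \<theta> where "\<theta> = Arg (z - c)"
    have zc: "z - c \<noteq> 0" using z r0 by auto
    have hz: "h \<theta> = z" unfolding h_def \<theta>_def using zc z(2) cis_Arg[OF zc] r0
      by (simp add: sgn_eq)
    have "Im (z - c) = r * sin \<theta>" using hz c by (auto simp: h_def)
    then have ssin: "s * sin \<theta> > 0" using z(1) c r0 by (simp add: zero_less_mult_iff mult.left_commute)
    have range: "-pi < \<theta>" "\<theta> \<le> pi" unfolding \<theta>_def using Arg_bounded by blast+
    have thJ: "\<theta> \<in> J"
    proof (cases "s = 1")
      case True
      then have "sin \<theta> > 0" using ssin by simp
      then have "0 < \<theta>" "\<theta> \<noteq> pi" using range sin_ge_zero[of "-\<theta>"] by (force simp: not_le[symmetric])+
      then show ?thesis using True range by (simp add: J)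
    next
      case False
      then have "sin \<theta> < 0" using ssin s by simp
      then have "\<theta> < 0" using range sin_ge_zero[of \<theta>] by force
      then show ?thesis using False range by (simp add: J)
    qed
    have pJ: "s * pi / 2 \<in> J" using s by (auto simp: J)
    have hp: "h (s * pi / 2) = \<gamma> r" using s by (auto simp: h_def \<gamma>_def complex_eq_iff)
    have "norm (g (h \<theta>) - g (h (s * pi / 2))) \<le> (C * r powr k) * norm (\<theta> - s * pi / 2)"
    proof (rule differentiable_bound[OF cJ _ _ thJ pJ])
      fix x assume x: "x \<in> J"
      show "((\<lambda>\<theta>. g (h \<theta>)) has_derivative (\<lambda>t. t *\<^sub>R (of_real r * (\<i> * cis x) * G (h x)))) (at x within J)"
        using hd[OF x] by (simp add: has_vector_derivative_def)
      have "cmod (of_real r * (\<i> * cis x) * G (h x)) \<le> r * (C * r powr (k - 1))"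
        using G[OF hJ(1)[OF x]] hJ(2)[OF x] r r0 by (simp add: norm_mult)
      also have "\<dots> = C * (r powr 1 * r powr (k - 1))" using r0 by simp
      also have "\<dots> = C * r powr k" unfolding powr_add[symmetric] by simp
      finally show "onorm (\<lambda>t. t *\<^sub>R (of_real r * (\<i> * cis x) * G (h x))) \<le> C * r powr k"
        by (intro onorm_le, unfold norm_scaleR real_norm_def, subst mult.commute, intro mult_right_mono) auto
    qed
    also have "\<dots> \<le> (C * r powr k) * pi"
      using thJ pJ s C by (intro mult_left_mono) (auto simp: J abs_le_iff)
    finally show ?thesis unfolding hz hp by (simp add: mult_ac)
  qed
  show ?thesis
  proof (intro exI conjI allI impI)
    let ?C' = "cmod (g (\<gamma> tb)) + C / \<bar>k\<bar> * (1 + tb powr k) + C * pi"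
    show "0 \<le> ?C'" using C by simp
    fix z assume z: "s * Im z > 0" "cmod (z - c) \<in> R"
    let ?r = "cmod (z - c)"
    have 1: "1 \<le> ?r powr k" by (rule k1[OF z(2)])
    have "cmod (g z) \<le> cmod (g (\<gamma> ?r)) + C * pi * ?r powr k"
      using arc[OF z(1) refl z(2)] norm_triangle_ineq2[of "g z" "g (\<gamma> ?r)"] by simp
    also have "\<dots> \<le> cmod (g (\<gamma> tb)) * 1 + C / \<bar>k\<bar> * (?r powr k + tb powr k * 1) + C * pi * ?r powr k"
      using rad'[OF z(2)] by simp
    also have "\<dots> \<le> cmod (g (\<gamma> tb)) * ?r powr k + C / \<bar>k\<bar> * (?r powr k + tb powr k * ?r powr k) + C * pi * ?r powr k"
      using 1 C by (intro add_mono mult_left_mono order_refl) auto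
    also have "\<dots> = ?C' * ?r powr k" by (simp add: algebra_simps)
    finally show "cmod (g z) \<le> ?C' * ?r powr k" .
  qed
qed

lemma Lr_near_0:
  assumes "w \<in> words" "e > 0"
  shows "\<exists>C\<ge>0. \<forall>z\<in>slit. cmod z \<le> 1/2 \<longrightarrow> cmod (Lr w z) \<le> C * cmod z powr (-e)"
    and "\<not> zeros w \<Longrightarrow> \<exists>C. \<forall>z\<in>slit. cmod z \<le> 1/2 \<longrightarrow> cmod (Lr w z) \<le> C * cmod z powr (1/2)"
proof -
  have nz: "slit_log.nonzero_word w \<longleftrightarrow> \<not> zeros w" by (auto simp: slit_log.nonzero_word_def zeros_def)
  show 1: "\<not> zeros w \<Longrightarrow> \<exists>C. \<forall>z\<in>slit. cmod z \<le> 1/2 \<longrightarrow> cmod (Lr w z) \<le> C * cmod z powr (1/2)"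
    using slit_log.Lg_props[OF assms(1)] nz by (simp add: Lr_eq_Lg)
  show "\<exists>C\<ge>0. \<forall>z\<in>slit. cmod z \<le> 1/2 \<longrightarrow> cmod (Lr w z) \<le> C * cmod z powr (-e)"
  proof (cases "zeros w")
    case True
    define n where "n = length w"
    have w: "w = replicate n 0" using True zeros_replicate n_def by blast
    obtain C where C: "C \<ge> 0" "\<forall>z\<in>slit. cmod z \<le> 1/2 \<longrightarrow> cmod (Ln z ^ n) \<le> C * cmod z powr (-e)"
      using slit_log.l_powr_bound[OF assms(2), of n] by blast
    have "cmod (Lr w z) \<le> cmod (Ln z ^ n)" for z
      unfolding Lr_eq_Lg w slit_log.Lg_zero norm_divide by (simp add: divide_le_eq mult_le_cancel_left1)
    then show ?thesis using C by (meson order_trans)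
  next
    case False
    then obtain C where C: "\<forall>z\<in>slit. cmod z \<le> 1/2 \<longrightarrow> cmod (Lr w z) \<le> C * cmod z powr (1/2)" using 1 by blast
    have "cmod (Lr w z) \<le> \<bar>C\<bar> * cmod z powr (-e)" if z: "z \<in> slit" "cmod z \<le> 1/2" for z
    proof -
      have "cmod (Lr w z) \<le> C * cmod z powr (1/2)" using C z by blast
      also have "\<dots> \<le> \<bar>C\<bar> * cmod z powr (-e)"
        using z notin_01(1)[OF z(1)] assms(2) by (intro mult_mono powr_mono') auto
      finally show ?thesis .
    qed
    then show ?thesis by (intro exI[of _ "\<bar>C\<bar>"]) auto
  qed
qed

text \<open>The bound at 0 is \<open>Lr_near_0\<close>. At 1 and at infinity the derivative is
  bounded by r^(-e - 1) and r^(e - 1), and integrating such powers reproduces the exponent, so an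
  arbitrarily small \<open>e\<close> survives every step of the induction. The half planes are
  treated separately because the cuts end at these points.\<close>

lemma Lr_mild:
  assumes "w \<in> words" "e > 0"
  shows "mild {z. Im z \<noteq> 0} e (Lr w)"
  using assms(1)
proof (induction w)
  case Nil
  have "1 \<le> nz z powr e" if "z \<in> Reg" for z using nz_ge_1[OF that] assms(2) by (simp add: ge_one_powr_ge_zero)
  then show ?case unfolding mild_def by (intro bdd_byI[where C = 1]) auto
next
  case (Cons a v)
  have av: "a \<in> {0,1}" "v \<in> words" using Cons by auto
  obtain C where C: "C \<ge> 0" "\<And>z. z \<in> Reg \<Longrightarrow> Im z \<noteq> 0 \<Longrightarrow> cmod (Lr v z) \<le> C * nz z powr e"
    using Cons.IH[OF av(2)] unfolding mild_def bdd_by_def by auto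
  have sl: "z \<in> slit" if "Im z \<noteq> 0" for z using that by (auto simp: slit_def)
  have D: "(Lr (a # v) has_field_derivative Lr v z / (z - a)) (at z)" if "Im z \<noteq> 0" for z
    by (rule polysysD(2)[OF polysys_Lr av(2,1) sl[OF that]])
  obtain C0 where C0: "C0 \<ge> 0" "\<And>z. Im z \<noteq> 0 \<Longrightarrow> cmod z \<le> 1/2 \<Longrightarrow> cmod (Lr (a # v) z) \<le> C0 * cmod z powr (-e)"
    using Lr_near_0(1)[OF Cons.prems assms(2)] sl by blast
  have near1: "\<exists>C'\<ge>0. \<forall>z. s * Im z > 0 \<longrightarrow> cmod (z - 1) \<in> {0<..<1/8} \<longrightarrow> cmod (Lr (a # v) z) \<le> C' * cmod (z - 1) powr (-e)"
    if s: "s = 1 \<or> s = -1" for s :: real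
  proof (rule half_plane_growth[where tb = "1/16" and C = C and G = "\<lambda>z. Lr v z / (z - a)"])
    show "1 \<le> r powr (-e)" if "r \<in> {0<..<1/8}" for r
      using that assms(2) by (simp add: powr_minus one_le_inverse powr_le1)
    fix w assume w: "s * Im w > 0" "cmod (w - 1) \<in> {0<..<1/8}"
    then have I: "Im w \<noteq> 0" by auto
    show "(Lr (a # v) has_field_derivative Lr v w / (w - a)) (at w)" by (rule D[OF I])
    have wa: "cmod (w - a) \<ge> cmod (w - 1)" using av(1) w norm_triangle_ineq2[of 1 "1 - w"] by (auto simp: norm_minus_commute)
    have "w \<in> Reg" using w I by (auto simp: Reg_def)
    moreover have "nz w = 1 / cmod (w - 1)" using w not_both_near[of w] by (auto simp: nz_def)
    ultimately have "cmod (Lr v w) \<le> C * cmod (w - 1) powr (-e)" using C(2)[of w] I inv_powr[of "cmod (w - 1)" e] w by auto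
    then have "cmod (Lr v w / (w - a)) \<le> C * cmod (w - 1) powr (-e) / cmod (w - 1)"
      unfolding norm_divide using w wa C(1) by (intro frac_le) auto
    also have "\<dots> = C * cmod (w - 1) powr (-e - 1)" using w by (simp add: powr_diff)
    finally show "cmod (Lr v w / (w - a)) \<le> C * cmod (w - 1) powr (-e - 1)" .
  qed (use s C assms(2) in auto)
  have inf: "\<exists>C'\<ge>0. \<forall>z. s * Im z > 0 \<longrightarrow> cmod (z - 0) \<in> {8<..} \<longrightarrow> cmod (Lr (a # v) z) \<le> C' * cmod (z - 0) powr e"
    if s: "s = 1 \<or> s = -1" for s :: real
  proof (rule half_plane_growth[where tb = "16" and C = "2 * C" and G = "\<lambda>z. Lr v z / (z - a)"])
    show "1 \<le> r powr e" if "r \<in> {8<..}" for r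
      using that assms(2) by (simp add: ge_one_powr_ge_zero)
    fix w assume w: "s * Im w > 0" "cmod (w - 0) \<in> {8<..}"
    then have I: "Im w \<noteq> 0" by auto
    show "(Lr (a # v) has_field_derivative Lr v w / (w - a)) (at w)" by (rule D[OF I])
    have wa: "cmod (w - a) \<ge> cmod w / 2" using av(1) w norm_triangle_ineq2[of w 1] by auto
    have "w \<in> Reg" using w I by (auto simp: Reg_def)
    moreover have "nz w = cmod w" using w not_both_near(2)[of w] by (auto simp: nz_def)
    ultimately have "cmod (Lr v w) \<le> C * cmod w powr e" using C(2)[of w] I by auto
    then have "cmod (Lr v w / (w - a)) \<le> C * cmod w powr e / (cmod w / 2)"
      unfolding norm_divide using w wa C(1) by (intro frac_le) auto
    also have "\<dots> = 2 * C * cmod (w - 0) powr (e - 1)" using w by (simp add: powr_diff)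
    finally show "cmod (Lr v w / (w - a)) \<le> 2 * C * cmod (w - 0) powr (e - 1)" .
  qed (use s C assms(2) in auto)
  obtain C1 C2 where C12: "C1 \<ge> 0" "C2 \<ge> 0"
    "\<And>z. Im z > 0 \<Longrightarrow> cmod (z - 1) \<in> {0<..<1/8} \<Longrightarrow> cmod (Lr (a # v) z) \<le> C1 * cmod (z - 1) powr (-e)"
    "\<And>z. Im z < 0 \<Longrightarrow> cmod (z - 1) \<in> {0<..<1/8} \<Longrightarrow> cmod (Lr (a # v) z) \<le> C2 * cmod (z - 1) powr (-e)"
    using near1[of 1] near1[of "-1"] by auto
  obtain C3 C4 where C34: "C3 \<ge> 0" "C4 \<ge> 0"
    "\<And>z. Im z > 0 \<Longrightarrow> cmod z > 8 \<Longrightarrow> cmod (Lr (a # v) z) \<le> C3 * cmod z powr e"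
    "\<And>z. Im z < 0 \<Longrightarrow> cmod z > 8 \<Longrightarrow> cmod (Lr (a # v) z) \<le> C4 * cmod z powr e"
    using inf[of 1] inf[of "-1"] by auto
  define K where "K = C0 + C1 + C2 + C3 + C4"
  have K: "C0 \<le> K" "C1 \<le> K" "C2 \<le> K" "C3 \<le> K" "C4 \<le> K" using C0 C12 C34 by (auto simp: K_def)
  have "cmod (Lr (a # v) z) \<le> K * nz z powr e" if z: "z \<in> Reg" "Im z \<noteq> 0" for z
  proof -
    have *: "cmod (Lr (a # v) z) \<le> K * x" if "cmod (Lr (a # v) z) \<le> B * x" "B \<le> K" "x \<ge> 0" for B x
      using that mult_right_mono[of B K x] by linarith
    have I: "Im z > 0 \<or> Im z < 0" using z by auto
    show ?thesis using z(1)
    proof (cases rule: Reg_cases)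
      case 1
      then show ?thesis using *[OF C0(2)[of z] K(1)] z inv_powr[of "cmod z" e] by (simp del: Lr.simps)
    next
      case 2
      then have "cmod (z - 1) \<in> {0<..<1/8}" by auto
      then show ?thesis using I *[OF C12(3)[of z] K(2)] *[OF C12(4)[of z] K(3)] 2 inv_powr[of "cmod (z - 1)" e] by (auto simp del: Lr.simps)
    next
      case 3
      then show ?thesis using I *[OF C34(3)[of z] K(4)] *[OF C34(4)[of z] K(5)] by (auto simp del: Lr.simps)
    qed
  qed
  then show ?case unfolding mild_def by (intro bdd_byI[where C = K]) (auto simp del: Lr.simps)
qed

lemma Lr_prod_mild:
  assumes "u \<in> words" "v \<in> words" "e > 0"
  shows "mild {z. Im z \<noteq> 0} e (\<lambda>z. Lr u (cnj z) * Lr v z)"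
  using mild_mult[OF mild_cnj[OF Lr_mild[OF assms(1), of "e/2"]] Lr_mild[OF assms(2), of "e/2"]] assms(3) by auto

lemma Phi_mild:
  assumes "Inv c" "e > 0"
  shows "mild (- {0,1}) e (Phi c)"
proof (rule mild_off_real)
  obtain N where N: "csup N c" using assms unfolding Inv_def cinv_def by blast
  have "mild {z. Im z \<noteq> 0} e (\<lambda>z. \<Sum>u\<in>W N. \<Sum>v\<in>W N. c u v * (Lr u (cnj z) * Lr v z))"
    by (intro mild_sum mild_cmult Lr_prod_mild assms(2)) (auto simp: W_words)
  then show "mild {z. Im z \<noteq> 0} e (Phi c)"
  proof (rule mild_cong)
    fix z assume "z \<in> {z. Im z \<noteq> 0}"
    then have "z \<in> slit" by (auto simp: slit_def)
    then show "(\<Sum>u\<in>W N. \<Sum>v\<in>W N. c u v * (Lr u (cnj z) * Lr v z)) = Phi c z"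
      using Phi_slit[OF N] by (simp add: rep_def mult.assoc)
  qed
qed (use assms Phi_isCont in blast)

text \<open>In every remaining term one factor belongs to a word with a letter 1 and is
  O(|z|^(1/2)), while the other is at worst O(|z|^(-1/4)); the product is O(|z|^(1/4)).\<close>

lemma Phi_tendsto_0:
  assumes I: "Inv c" and z: "\<And>u v. zeros u \<Longrightarrow> zeros v \<Longrightarrow> c u v = 0"
  shows "(Phi c \<longlongrightarrow> 0) (at 0)"
proof -
  obtain N where N: "csup N c" using I unfolding Inv_def cinv_def by blast
  define A where "A = {z::complex. z \<noteq> 0 \<and> cmod z < 1/8}"
  have oA: "open A"
  proof -
    have "A = - {0} \<inter> {z. cmod z < 1/8}" by (auto simp: A_def)
    then show ?thesis by (auto intro!: open_Int open_Collect_less continuous_intros)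
  qed
  have sl: "z \<in> slit \<and> cnj z \<in> slit" if "Im z \<noteq> 0" for z using that by (auto simp: slit_def)
  have near: "bdd_by (A \<inter> {z. Im z \<noteq> 0}) (\<lambda>z. cmod z powr (-1/4)) (Lr w)"
     "bdd_by (A \<inter> {z. Im z \<noteq> 0}) (\<lambda>z. cmod z powr (-1/4)) (\<lambda>z. Lr w (cnj z))" if w: "w \<in> words" for w
  proof -
    obtain C where C: "C \<ge> 0" "\<forall>z\<in>slit. cmod z \<le> 1/2 \<longrightarrow> cmod (Lr w z) \<le> C * cmod z powr (-(1/4))"
      using Lr_near_0(1)[OF w, of "1/4"] by auto
    show "bdd_by (A \<inter> {z. Im z \<noteq> 0}) (\<lambda>z. cmod z powr (-1/4)) (Lr w)"
      by (rule bdd_byI[where C = C]) (use C(2) sl in \<open>fastforce simp: A_def\<close>)+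
    show "bdd_by (A \<inter> {z. Im z \<noteq> 0}) (\<lambda>z. cmod z powr (-1/4)) (\<lambda>z. Lr w (cnj z))"
    proof (rule bdd_byI[where C = C])
      fix z assume "z \<in> A \<inter> {z. Im z \<noteq> 0}"
      then show "cmod (Lr w (cnj z)) \<le> C * cmod z powr (-1/4)" using C(2)[rule_format, of "cnj z"] sl[of z] by (auto simp: A_def)
    qed auto
  qed
  have near': "bdd_by (A \<inter> {z. Im z \<noteq> 0}) (\<lambda>z. cmod z powr (1/2)) (Lr w)"
     "bdd_by (A \<inter> {z. Im z \<noteq> 0}) (\<lambda>z. cmod z powr (1/2)) (\<lambda>z. Lr w (cnj z))" if w: "w \<in> words" "\<not> zeros w" for w
  proof -
    obtain C where C: "\<forall>z\<in>slit. cmod z \<le> 1/2 \<longrightarrow> cmod (Lr w z) \<le> C * cmod z powr (1/2)"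
      using Lr_near_0(2)[OF w(1) _ w(2), of 1] by auto
    show "bdd_by (A \<inter> {z. Im z \<noteq> 0}) (\<lambda>z. cmod z powr (1/2)) (Lr w)"
      by (rule bdd_byI[where C = C]) (use C sl in \<open>fastforce simp: A_def\<close>)+
    show "bdd_by (A \<inter> {z. Im z \<noteq> 0}) (\<lambda>z. cmod z powr (1/2)) (\<lambda>z. Lr w (cnj z))"
    proof (rule bdd_byI[where C = C])
      fix z assume "z \<in> A \<inter> {z. Im z \<noteq> 0}"
      then show "cmod (Lr w (cnj z)) \<le> C * cmod z powr (1/2)" using C[rule_format, of "cnj z"] sl[of z] by (auto simp: A_def)
    qed auto
  qed
  have e: "cmod z powr (1/2) * cmod z powr (-1/4) = cmod z powr (1/4)"
          "cmod z powr (-1/4) * cmod z powr (1/2) = cmod z powr (1/4)" for z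
    unfolding powr_add[symmetric] by simp_all
  have t: "bdd_by (A \<inter> {z. Im z \<noteq> 0}) (\<lambda>z. cmod z powr (1/4)) (\<lambda>z. c u v * (Lr u (cnj z) * Lr v z))"
    if "u \<in> words" "v \<in> words" for u v
  proof (cases "zeros u")
    case False
    show ?thesis using bdd_by_cmult[OF bdd_by_mult[OF near'(2)[OF that(1) False] near(1)[OF that(2)]]] by (simp only: e)
  next
    case True
    show ?thesis
    proof (cases "zeros v")
      case False
      show ?thesis using bdd_by_cmult[OF bdd_by_mult[OF near(2)[OF that(1)] near'(1)[OF that(2) False]]] by (simp only: e)
    next
      case zv: True
      show ?thesis using z[OF True zv] by (auto simp: bdd_by_def intro!: exI[of _ 0])
    qed
  qed
  have "bdd_by (A \<inter> {z. Im z \<noteq> 0}) (\<lambda>z. cmod z powr (1/4)) (\<lambda>z. \<Sum>u\<in>W N. \<Sum>v\<in>W N. c u v * (Lr u (cnj z) * Lr v z))"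
    by (intro bdd_by_sum t) (auto simp: W_words)
  then have "bdd_by (A \<inter> {z. Im z \<noteq> 0}) (\<lambda>z. cmod z powr (1/4)) (Phi c)"
    by (rule bdd_by_cong) (use sl in \<open>simp add: Phi_slit[OF N] rep_def mult.assoc\<close>)
  then have "bdd_by A (\<lambda>z. cmod z powr (1/4)) (Phi c)"
    by (rule bdd_by_off_real[OF oA]) (auto simp: A_def intro!: Phi_isCont[OF I] continuous_intros)
  then obtain C where C: "\<forall>z\<in>A. cmod (Phi c z) \<le> C * cmod z powr (1/4)" unfolding bdd_by_def by blast
  have "\<forall>\<^sub>F z in at 0. norm (Phi c z) \<le> C * cmod z powr (1/4)"
    unfolding eventually_at by (rule exI[of _ "1/8"]) (use C in \<open>auto simp: A_def dist_norm\<close>)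
  moreover have "((\<lambda>z. C * cmod z powr (1/4)) \<longlongrightarrow> 0) (at (0::complex))"
  proof -
    have "((\<lambda>z. cmod z powr (1/4)) \<longlongrightarrow> 0) (at (0::complex))"
      by (rule tendsto_zero_powrI[of _ _ _ "1/4"]) (auto intro!: tendsto_eq_intros)
    then show ?thesis by (rule tendsto_mult_right_zero)
  qed
  ultimately show ?thesis by (rule Lim_null_comparison)
qed

section \<open>Liouville's theorem for functions of moderate growth\<close>

lemma removable_point:
  assumes f: "f holomorphic_on S - {p}" and S: "open S" "p \<in> S" and d: "d > 0" and e: "e < 1"
    and b: "\<And>z. z \<in> S - {p} \<Longrightarrow> cmod (z - p) < d \<Longrightarrow> cmod (f z) \<le> C * cmod (z - p) powr (-e)"
  shows "\<exists>g. g holomorphic_on S \<and> (\<forall>z\<in>S - {p}. g z = f z)"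
proof -
  have "((\<lambda>z. (z - p) * f z) \<longlongrightarrow> 0) (at p)"
  proof (rule Lim_null_comparison)
    obtain r where r: "r > 0" "ball p r \<subseteq> S" using S open_contains_ball by blast
    show "\<forall>\<^sub>F z in at p. norm ((z - p) * f z) \<le> C * cmod (z - p) powr (1 - e)"
      unfolding eventually_at
    proof (intro exI[of _ "min r d"] conjI ballI impI)
      fix z assume z: "z \<noteq> p \<and> dist z p < min r d"
      then have "z \<in> S - {p}" using r by (auto simp: dist_commute subset_iff)
      then have "norm ((z - p) * f z) \<le> cmod (z - p) * (C * cmod (z - p) powr (-e))"
        unfolding norm_mult using b[of z] z by (intro mult_left_mono) (auto simp: dist_norm)
      also have "\<dots> = C * (cmod (z - p) powr 1 * cmod (z - p) powr (-e))" using z by simp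
      also have "\<dots> = C * cmod (z - p) powr (1 - e)" unfolding powr_add[symmetric] by simp
      finally show "norm ((z - p) * f z) \<le> C * cmod (z - p) powr (1 - e)" .
    qed (use r d in auto)
    have "((\<lambda>z. cmod (z - p)) \<longlongrightarrow> 0) (at p)" by (auto intro!: tendsto_eq_intros)
    then have "((\<lambda>z. cmod (z - p) powr (1 - e)) \<longlongrightarrow> 0) (at p)"
      using e by (intro tendsto_zero_powrI[of _ _ _ "1 - e"]) auto
    then show "((\<lambda>z. C * cmod (z - p) powr (1 - e)) \<longlongrightarrow> 0) (at p)" by (rule tendsto_mult_right_zero)
  qed
  then show ?thesis using holomorphic_on_extend_lim[OF f] S interior_open by blast
qed

text \<open>Growth below a simple pole makes 0 and 1 removable. The entire extension is bounded by
  |z|^(n + 1), hence a polynomial of degree at most n + 1, and the bound with n + e, e < 1, removes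
  the leading coefficient.\<close>

lemma polynomial_growth:
  assumes g: "g holomorphic_on - {0,1}" and e: "0 < e" "e < 1" and d: "0 < d" "d \<le> 1" and R: "8 \<le> R"
    and 0: "\<And>z. z \<notin> {0,1} \<Longrightarrow> cmod z < d \<Longrightarrow> cmod (g z) \<le> C * cmod z powr (-e)"
    and 1: "\<And>z. z \<notin> {0,1} \<Longrightarrow> cmod (z - 1) < d \<Longrightarrow> cmod (g z) \<le> C * cmod (z - 1) powr (-e)"
    and inf: "\<And>z. cmod z > R \<Longrightarrow> cmod (g z) \<le> C * cmod z powr (real n + e)"
  shows "\<exists>a. \<forall>z. z \<notin> {0,1} \<longrightarrow> g z = (\<Sum>k\<le>n. a k * z ^ k)"
proof -
  have s: "- {0,1} = (- {1}) - {0::complex}" "- {1} = UNIV - {1::complex}" by auto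
  obtain g1 where g1: "g1 holomorphic_on - {1}" "\<forall>z\<in>- {1} - {0}. g1 z = g z"
    using removable_point[of g "- {1}" 0 d e C] g 0 e d unfolding s by (auto intro: open_Compl)
  have "cmod (g1 z) \<le> C * cmod (z - 1) powr (-e)" if "z \<in> UNIV - {1}" "cmod (z - 1) < d" for z
    using that g1(2) 1[of z] d by (cases "z = 0") auto
  then obtain g2 where g2: "g2 holomorphic_on UNIV" "\<forall>z\<in>UNIV - {1}. g2 z = g1 z"
    using removable_point[of g1 UNIV 1 d e C] g1 e d unfolding s by auto
  have gg: "g2 z = g z" if "z \<notin> {0,1}" for z using that g1 g2 by auto
  have "0 \<le> C * (R + 1) powr (real n + e)" using order_trans[OF norm_ge_zero inf[of "of_real (R + 1)"]] R by simp
  then have C: "C \<ge> 0" using R by (simp add: zero_le_mult_iff)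
  have "cmod (g2 z) \<le> C * cmod z ^ Suc n" if z: "R + 1 \<le> cmod z" for z
  proof -
    have "z \<notin> {0,1}" using z R by auto
    then have "cmod (g2 z) \<le> C * cmod z powr (real n + e)" using gg inf[of z] z by auto
    also have "\<dots> \<le> C * cmod z powr (real (Suc n))" using z e C R by (intro mult_left_mono powr_mono) auto
    also have "cmod z powr (real (Suc n)) = cmod z ^ Suc n" using z R by (subst powr_realpow) auto
    finally show ?thesis .
  qed
  from Liouville_polynomial[OF g2(1) this] obtain a where a: "\<And>z. g2 z = (\<Sum>k\<le>Suc n. a k * z ^ k)" by metis
  have "a (Suc n) = 0"
  proof -
    have "((\<lambda>t::real. g2 (of_real t) / of_real t ^ Suc n) \<longlongrightarrow> a (Suc n)) at_top"
    proof -
      have "((\<lambda>t::real. (\<Sum>k\<le>n. a k * (of_real t ^ k / of_real t ^ Suc n)) + a (Suc n)) \<longlongrightarrow> (\<Sum>k\<le>n. a k * 0) + a (Suc n)) at_top"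
      proof (intro tendsto_intros)
        fix k assume k: "k \<in> {..n}"
        have "((\<lambda>t::real. of_real (inverse t ^ (Suc n - k))) \<longlongrightarrow> (of_real 0 :: complex)) at_top"
          by (rule tendsto_of_real) (use k in \<open>auto intro!: tendsto_null_power tendsto_inverse_0_at_top filterlim_ident\<close>)
        moreover have "\<forall>\<^sub>F t::real in at_top. of_real (inverse t ^ (Suc n - k)) = (of_real t ^ k / of_real t ^ Suc n :: complex)"
          using eventually_gt_at_top[of 0]
        proof eventually_elim
          case (elim t)
          have "(of_real t :: complex) ^ Suc n = of_real t ^ k * of_real t ^ (Suc n - k)"
            using k by (simp flip: power_add)
          then show ?case using elim by (simp add: field_simps del: power_Suc)
        qed
        ultimately show "((\<lambda>t::real. of_real t ^ k / of_real t ^ Suc n) \<longlongrightarrow> (0::complex)) at_top"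
          by (simp add: Lim_transform_eventually)
      qed
      moreover have "\<forall>\<^sub>F t::real in at_top. (\<Sum>k\<le>n. a k * (of_real t ^ k / of_real t ^ Suc n)) + a (Suc n) = g2 (of_real t) / of_real t ^ Suc n"
        using eventually_gt_at_top[of 0]
        by eventually_elim (simp add: a add_divide_distrib sum_divide_distrib del: power_Suc)
      ultimately show ?thesis by (simp add: Lim_transform_eventually del: power_Suc)
    qed
    moreover have "((\<lambda>t::real. g2 (of_real t) / of_real t ^ Suc n) \<longlongrightarrow> 0) at_top"
    proof (rule Lim_null_comparison)
      show "\<forall>\<^sub>F t::real in at_top. norm (g2 (of_real t) / of_real t ^ Suc n) \<le> C * t powr (e - 1)"
        using eventually_gt_at_top[of R]
      proof eventually_elim
        case (elim t)
        have "cmod (g2 (of_real t)) \<le> C * t powr (real n + e)" using gg[of "of_real t"] inf[of "of_real t"] elim R by auto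
        then have "norm (g2 (of_real t) / of_real t ^ Suc n) \<le> C * t powr (real n + e) / t powr (real (Suc n))"
          using elim R by (simp add: norm_divide norm_power powr_realpow divide_right_mono del: power_Suc of_nat_Suc)
        also have "\<dots> = C * t powr (e - 1)" by (simp add: powr_diff[symmetric] flip: times_divide_eq_right)
        finally show ?case .
      qed
      show "((\<lambda>t. C * t powr (e - 1)) \<longlongrightarrow> 0) at_top"
        using e by (intro tendsto_mult_right_zero tendsto_neg_powr filterlim_ident) auto
    qed
    ultimately show ?thesis using tendsto_unique[OF trivial_limit_at_top_linorder] by blast
  qed
  then show ?thesis using gg a by (intro exI[of _ a]) auto
qed

lemma mild_bounds:
  assumes "mild (- {0,1}) e f"
  obtains C where "C \<ge> 0" "\<And>z. z \<notin> {0,1} \<Longrightarrow> cmod z < 1/8 \<Longrightarrow> cmod (f z) \<le> C * cmod z powr (-e)"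
    "\<And>z. z \<notin> {0,1} \<Longrightarrow> cmod (z - 1) < 1/8 \<Longrightarrow> cmod (f z) \<le> C * cmod (z - 1) powr (-e)"
    "\<And>z. cmod z > 8 \<Longrightarrow> cmod (f z) \<le> C * cmod z powr e"
proof -
  obtain C where C: "C \<ge> 0" "\<And>z. z \<in> Reg \<Longrightarrow> z \<notin> {0,1} \<Longrightarrow> cmod (f z) \<le> C * nz z powr e"
    using assms unfolding mild_def bdd_by_def by blast
  show thesis
  proof (rule that[OF C(1)])
    fix z :: complex
    show "cmod (f z) \<le> C * cmod z powr (-e)" if z: "z \<notin> {0,1}" "cmod z < 1/8"
    proof -
      have "z \<in> Reg" "nz z = 1 / cmod z" using z by (auto simp: Reg_def nz_def)
      then show ?thesis using C(2)[of z] inv_powr[of "cmod z" e] z by simp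
    qed
    show "cmod (f z) \<le> C * cmod (z - 1) powr (-e)" if z: "z \<notin> {0,1}" "cmod (z - 1) < 1/8"
    proof -
      have "z \<in> Reg" "nz z = 1 / cmod (z - 1)" using z not_both_near(1)[of z] by (auto simp: Reg_def nz_def)
      then show ?thesis using C(2)[of z] inv_powr[of "cmod (z - 1)" e] z by simp
    qed
    show "cmod (f z) \<le> C * cmod z powr e" if z: "cmod z > 8"
    proof -
      have "z \<in> Reg" "nz z = cmod z" using z not_both_near(2)[of z] by (auto simp: Reg_def nz_def)
      then show ?thesis using C(2)[of z] z by (auto simp: Reg_def)
    qed
  qed
qed

lemma mild_const:
  assumes "g holomorphic_on - {0,1}" "mild (- {0,1}) e g" "0 < e" "e < 1"
  obtains c where "\<And>z. z \<notin> {0,1} \<Longrightarrow> g z = c"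
proof -
  obtain C where C: "\<And>z. z \<notin> {0,1} \<Longrightarrow> cmod z < 1/8 \<Longrightarrow> cmod (g z) \<le> C * cmod z powr (-e)"
    "\<And>z. z \<notin> {0,1} \<Longrightarrow> cmod (z - 1) < 1/8 \<Longrightarrow> cmod (g z) \<le> C * cmod (z - 1) powr (-e)"
    "\<And>z. cmod z > 8 \<Longrightarrow> cmod (g z) \<le> C * cmod z powr e" using mild_bounds[OF assms(2)] by metis
  obtain a where "\<forall>z. z \<notin> {0,1} \<longrightarrow> g z = (\<Sum>k\<le>0. a k * z ^ k)"
    using polynomial_growth[where g = g and e = e and d = "1/8" and R = 8 and C = C and n = 0] assms C by auto
  then show thesis using that[of "a 0"] by simp
qed

section \<open>The single-valued polylogarithms\<close>

lemma svmpl_familyD: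
  assumes "svmpl_family P"
  shows "\<not> set w \<subseteq> {0,1} \<Longrightarrow> P w z = 0" "z \<in> {0,1} \<Longrightarrow> P w z = 0"
    "set w \<subseteq> {0,1} \<Longrightarrow> z \<notin> {0,1} \<Longrightarrow> P w differentiable (at z)"
    "set w \<subseteq> {0,1} \<Longrightarrow> \<exists>S c. finite S \<and> (\<forall>(u,v)\<in>S. set u \<subseteq> {0,1} \<and> set v \<subseteq> {0,1}) \<and>
            (\<forall>z\<in>slit. P w z = (\<Sum>(u,v)\<in>S. c (u,v) * mpl u (cnj z) * mpl v z))"
    "z \<notin> {0,1} \<Longrightarrow> P (replicate n 0) z = complex_of_real ((ln ((cmod z)\<^sup>2)) ^ n / fact n)"
    "set w \<subseteq> {0,1} \<Longrightarrow> a \<in> {0,1} \<Longrightarrow> z \<notin> {0,1} \<Longrightarrow> wirt_dz (P (w @ [a])) z = P w z / (z - a)"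
    "set w \<subseteq> {0,1} \<Longrightarrow> \<not> (\<forall>b\<in>set w. b = 0) \<Longrightarrow> (P w \<longlongrightarrow> 0) (at 0)"
proof -
  note A = assms[unfolded svmpl_family_def]
  note A1 = A[THEN conjunct1] and R1 = A[THEN conjunct2]
  note A2 = R1[THEN conjunct1] and R2 = R1[THEN conjunct2]
  note A3 = R2[THEN conjunct1] and R3 = R2[THEN conjunct2]
  note A4 = R3[THEN conjunct1] and R4 = R3[THEN conjunct2, THEN conjunct2]
  note A6 = R4[THEN conjunct1] and R6 = R4[THEN conjunct2]
  note A7 = R6[THEN conjunct1] and A8 = R6[THEN conjunct2]
  show "\<not> set w \<subseteq> {0,1} \<Longrightarrow> P w z = 0" using A1 by simp
  show "z \<in> {0,1} \<Longrightarrow> P w z = 0" using A2 by blast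
  show "set w \<subseteq> {0,1} \<Longrightarrow> z \<notin> {0,1} \<Longrightarrow> P w differentiable (at z)" using A3 by blast
  show "set w \<subseteq> {0,1} \<Longrightarrow> \<exists>S c. finite S \<and> (\<forall>(u,v)\<in>S. set u \<subseteq> {0,1} \<and> set v \<subseteq> {0,1}) \<and>
            (\<forall>z\<in>slit. P w z = (\<Sum>(u,v)\<in>S. c (u,v) * mpl u (cnj z) * mpl v z))" using A4 by simp
  show "z \<notin> {0,1} \<Longrightarrow> P (replicate n 0) z = complex_of_real ((ln ((cmod z)\<^sup>2)) ^ n / fact n)" using A6 by blast
  show "set w \<subseteq> {0,1} \<Longrightarrow> a \<in> {0,1} \<Longrightarrow> z \<notin> {0,1} \<Longrightarrow> wirt_dz (P (w @ [a])) z = P w z / (z - a)" using A7 by blast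
  show "set w \<subseteq> {0,1} \<Longrightarrow> \<not> (\<forall>b\<in>set w. b = 0) \<Longrightarrow> (P w \<longlongrightarrow> 0) (at 0)" using A8 by blast
qed

text \<open>By induction on the word, two families have the same derivative with respect to z, so
  their difference is antiholomorphic. Its local expression in products of \<open>Lr\<close> makes
  it mild, hence constant, and the limit at 0 makes the constant 0. Words of zeros are prescribed
  explicitly and need no limit.\<close>

lemma svmpl_family_unique:
  assumes P: "svmpl_family P" and Q: "svmpl_family Q"
  shows "P w z = Q w z"
proof (cases "set w \<subseteq> {0,1}")
  case False then show ?thesis using svmpl_familyD(1)[OF P] svmpl_familyD(1)[OF Q] by simp
next
  case True
  have M: "mild {z. Im z \<noteq> 0} (1/2) (R w)" if R: "svmpl_family R" and w: "set w \<subseteq> {0,1}" for R w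
  proof -
    obtain S c where S: "finite S" "\<forall>(u,v)\<in>S. set u \<subseteq> {0,1} \<and> set v \<subseteq> {0,1}"
      "\<forall>z\<in>slit. R w z = (\<Sum>(u,v)\<in>S. c (u,v) * mpl u (cnj z) * mpl v z)" using svmpl_familyD(4)[OF R w] by blast
    have "mild {z. Im z \<noteq> 0} (1/2) (\<lambda>z. \<Sum>p\<in>S. c p * (Lr (rev (fst p)) (cnj z) * Lr (rev (snd p)) z))"
      using S(2) by (intro mild_sum S(1) mild_cmult Lr_prod_mild) (fastforce simp: words_def)+
    then show ?thesis
    proof (rule mild_cong)
      fix z assume "z \<in> {z. Im z \<noteq> 0}"
      then have "z \<in> slit" by (auto simp: slit_def)
      then show "(\<Sum>p\<in>S. c p * (Lr (rev (fst p)) (cnj z) * Lr (rev (snd p)) z)) = R w z"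
        using S(3) by (simp add: mpl_def case_prod_beta mult.assoc)
    qed
  qed
  show ?thesis using True
  proof (induction w arbitrary: z rule: rev_induct)
    case Nil
    then show ?case using svmpl_familyD(2)[OF P, of z] svmpl_familyD(2)[OF Q, of z]
        svmpl_familyD(5)[OF P, of z 0] svmpl_familyD(5)[OF Q, of z 0] by (cases "z \<in> {0,1}") auto
  next
    case (snoc a w)
    then have aw: "a \<in> {0,1}" "set w \<subseteq> {0,1}" and waw: "set (w @ [a]) \<subseteq> {0,1}" by auto
    let ?v = "w @ [a]"
    show ?case
    proof (cases "z \<in> {0,1} \<or> (\<forall>b\<in>set ?v. b = 0)")
      case True
      then consider "z \<in> {0,1}" | "z \<notin> {0,1}" "?v = replicate (length ?v) 0"
        by (metis replicate_length_same)
      then show ?thesis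
        by cases (use svmpl_familyD(2)[OF P, of z] svmpl_familyD(2)[OF Q, of z] svmpl_familyD(5)[OF P, of z "length ?v"] svmpl_familyD(5)[OF Q, of z "length ?v"] in \<open>metis\<close>)+
    next
      case False
      define D where "D z = P ?v z - Q ?v z" for z
      have Dw: "has_wirt D 0 (wirt_dzb (P ?v) z - wirt_dzb (Q ?v) z) z" if z: "z \<notin> {0,1}" for z
      proof -
        have "has_wirt D (wirt_dz (P ?v) z - wirt_dz (Q ?v) z) (wirt_dzb (P ?v) z - wirt_dzb (Q ?v) z) z"
          unfolding D_def using svmpl_familyD(3)[OF P waw z] svmpl_familyD(3)[OF Q waw z]
          by (intro has_wirt_diff differentiable_imp_has_wirt)
        moreover have "wirt_dz (P ?v) z = wirt_dz (Q ?v) z"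
          using svmpl_familyD(6)[OF P aw(2,1) z] svmpl_familyD(6)[OF Q aw(2,1) z] snoc.IH[OF aw(2)] by simp
        ultimately show ?thesis by simp
      qed
      have c01: "cnj z \<notin> {0,1}" if "z \<notin> {0,1}" for z using that by (auto simp: complex_eq_iff)
      define g where "g z = D (cnj z)" for z
      have "\<exists>f'. (g has_field_derivative f') (at z)" if "z \<notin> {0,1}" for z
        using has_wirt_cnj[OF Dw[OF c01[OF that]]] unfolding g_def has_wirt_holomorphic by blast
      then have hol: "g holomorphic_on - {0,1}"
        by (subst holomorphic_on_open) (auto intro!: open_Compl)
      have "mild {z. Im z \<noteq> 0} (1/2) (\<lambda>z. P ?v z + (-1) * Q ?v z)"
        by (intro mild_add mild_cmult M[OF P waw] M[OF Q waw])
      then have "mild {z. Im z \<noteq> 0} (1/2) D" by (rule mild_cong) (simp add: D_def)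
      then have "mild (- {0,1}) (1/2) D" by (rule mild_off_real) (use Dw has_wirt_isCont in blast)
      then have "mild (- {0,1}) (1/2) g" unfolding g_def by (rule mild_cnj) (use c01 in auto)
      then have "\<exists>c. \<forall>z. z \<notin> {0,1} \<longrightarrow> g z = c" by (rule mild_const[OF hol]) auto
      then obtain c where c: "\<And>z. z \<notin> {0,1} \<Longrightarrow> g z = c" by blast
      have Dc: "D z = c" if "z \<notin> {0,1}" for z using c[OF c01[OF that]] by (simp add: g_def)
      have "(D \<longlongrightarrow> 0 - 0) (at 0)" unfolding D_def
        using svmpl_familyD(7)[OF P waw] svmpl_familyD(7)[OF Q waw] False by (intro tendsto_diff) auto
      moreover have "\<forall>\<^sub>F z in at 0. D z = c"
        unfolding eventually_at by (rule exI[of _ 1]) (auto intro!: Dc simp: dist_norm)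
      ultimately have "((\<lambda>z::complex. c) \<longlongrightarrow> 0) (at 0)" using tendsto_cong by fastforce
      then have "c = 0" by (simp add: tendsto_const_iff)
      then show ?thesis using Dc[of z] False by (simp add: D_def)
    qed
  qed
qed

section \<open>Brown's family, its span and its primitives in terms of coefficient families\<close>

definition svP0 :: "complex list \<Rightarrow> complex \<Rightarrow> complex" where
  "svP0 w = (if set w \<subseteq> {0,1} then Phi (cw (rev w)) else (\<lambda>_. 0))"

lemma Phi_cpow:
  assumes "z \<notin> {0,1}"
  shows "Phi (cpow n) z = complex_of_real ((ln ((cmod z)\<^sup>2)) ^ n / fact n)"
proof (rule eq_off_real[where f = "Phi (cpow n)" and g = "\<lambda>z. complex_of_real ((ln ((cmod z)\<^sup>2)) ^ n / fact n)" and S = "- {0,1}"])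
  have "replicate n 0 \<in> words" by (auto simp: words_def)
  then have I: "Inv (cpow n)" using Inv_cw cw_replicate by metis
  show "isCont (Phi (cpow n)) z" by (rule Phi_isCont[OF I assms])
  show "isCont (\<lambda>z. complex_of_real ((ln ((cmod z)\<^sup>2)) ^ n / fact n)) z"
    using assms by (intro continuous_intros) auto
  fix w assume w: "w \<in> - {0,1}" "Im w \<noteq> 0"
  then have sl: "w \<in> slit" by (auto simp: slit_def)
  have cs: "csup n (cpow n)" by (auto simp: csup_def cpow_def W_def zeros_words split: if_splits)
  have Z: "Lr (replicate k 0) x = Ln x ^ k / fact k" for k x
    unfolding Lr_eq_Lg by (rule slit_log.Lg_zero)
  have inj: "inj_on (\<lambda>k. replicate k (0::complex)) {..n}" by (rule inj_onI) (metis length_replicate)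
  have zW: "{w \<in> W n. zeros w} = (\<lambda>k. replicate k 0) ` {..n}"
    using zeros_replicate by (auto simp: W_def zeros_def words_def image_iff)
  have "Phi (cpow n) w = (\<Sum>u\<in>W n. \<Sum>v\<in>W n. cpow n u v * Lr u (cnj w) * Lr v w)"
    using Phi_slit[OF cs sl] by (simp add: rep_def)
  also have "\<dots> = (\<Sum>u\<in>{w \<in> W n. zeros w}. \<Sum>v\<in>{w \<in> W n. zeros w}. cpow n u v * Lr u (cnj w) * Lr v w)"
  proof -
    have "(\<Sum>v\<in>W n. cpow n u v * Lr u (cnj w) * Lr v w) = (\<Sum>v\<in>{w \<in> W n. zeros w}. cpow n u v * Lr u (cnj w) * Lr v w)" for u
      by (rule sum.mono_neutral_right) (auto simp: cpow_def)
    then show ?thesis by (simp, intro sum.mono_neutral_right) (auto simp: cpow_def)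
  qed
  also have "\<dots> = (\<Sum>i\<le>n. \<Sum>j\<le>n. cpow n (replicate i 0) (replicate j 0) * (Ln (cnj w) ^ i / fact i) * (Ln w ^ j / fact j))"
    unfolding zW sum.reindex[OF inj] by (simp add: Z)
  also have "\<dots> = (\<Sum>i\<le>n. (Ln (cnj w) ^ i / fact i) * (Ln w ^ (n - i) / fact (n - i)))"
  proof (rule sum.cong[OF refl])
    fix i assume i: "i \<in> {..n}"
    have "(\<Sum>j\<le>n. cpow n (replicate i 0) (replicate j 0) * (Ln (cnj w) ^ i / fact i) * (Ln w ^ j / fact j))
       = (\<Sum>j\<le>n. if j = n - i then (Ln (cnj w) ^ i / fact i) * (Ln w ^ j / fact j) else 0)"
      by (rule sum.cong) (use i in \<open>auto simp: cpow_def zeros_def\<close>)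
    then show "(\<Sum>j\<le>n. cpow n (replicate i 0) (replicate j 0) * (Ln (cnj w) ^ i / fact i) * (Ln w ^ j / fact j))
       = (Ln (cnj w) ^ i / fact i) * (Ln w ^ (n - i) / fact (n - i))" by simp
  qed
  also have "\<dots> = (Ln (cnj w) + Ln w) ^ n / fact n"
    unfolding binomial_ring sum_divide_distrib by (intro sum.cong) (auto simp: binomial_fact)
  also have "Ln (cnj w) = cnj (Ln w)" using sl by (intro cnj_Ln[symmetric]) (auto simp: slit_def complex_nonpos_Reals_iff)
  also have "cnj (Ln w) + Ln w = of_real (ln ((cmod w)\<^sup>2))"
    using w by (simp add: complex_eq_iff ln_realpow)
  finally show "Phi (cpow n) w = complex_of_real ((ln ((cmod w)\<^sup>2)) ^ n / fact n)" by simp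
qed (use assms in \<open>auto intro: open_Compl\<close>)

lemma svmpl_family_svP0: "svmpl_family svP0"
proof -
  have w01: "w \<in> words \<longleftrightarrow> set w \<subseteq> {0,1}" for w by (simp add: words_def)
  have I: "Inv (cw (rev w))" if "set w \<subseteq> {0,1}" for w using that by (intro Inv_cw) (simp add: words_def)
  show ?thesis
    unfolding svmpl_family_def
  proof (intro conjI allI impI)
    fix w :: "complex list"
    show "\<not> set w \<subseteq> {0, 1} \<Longrightarrow> svP0 w = (\<lambda>_. 0)" by (simp add: svP0_def)
    show "svP0 w z = 0" if "z \<in> {0,1}" for z using that by (simp add: svP0_def)
    assume w: "set w \<subseteq> {0,1}"
    have P: "svP0 w = Phi (cw (rev w))" using w by (simp add: svP0_def)
    show "continuous_on (- {0, 1}) (svP0 w)"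
      unfolding P using Phi_isCont[OF I[OF w]] by (auto intro: continuous_at_imp_continuous_on)
    show "svP0 w differentiable at z" if "z \<notin> {0,1}" for z
      unfolding P using Phi_has_wirt[OF I[OF w] that] has_wirt_differentiable by blast
    show "\<exists>S c. finite S \<and> (\<forall>(u, v)\<in>S. set u \<subseteq> {0, 1} \<and> set v \<subseteq> {0, 1}) \<and>
                 (\<forall>z\<in>slit. svP0 w z = (\<Sum>(u, v)\<in>S. c (u, v) * mpl u (cnj z) * mpl v z))"
    proof -
      obtain N where N: "csup N (cw (rev w))" using I[OF w] unfolding Inv_def cinv_def by blast
      have rW: "bij_betw rev (W N) (W N)"
        by (rule bij_betwI[where g = rev]) (auto simp: W_def)
      show ?thesis
      proof (intro exI[of _ "W N \<times> W N"] exI[of _ "\<lambda>(u,v). cw (rev w) (rev u) (rev v)"] conjI ballI)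
        show "case p of (u, v) \<Rightarrow> set u \<subseteq> {0, 1} \<and> set v \<subseteq> {0, 1}" if "p \<in> W N \<times> W N" for p
          using that by (auto simp: W_def words_def)
        fix z assume "z \<in> slit"
        then have "svP0 w z = (\<Sum>u\<in>W N. \<Sum>v\<in>W N. cw (rev w) u v * Lr u (cnj z) * Lr v z)"
          unfolding P using Phi_slit[OF N] by (simp add: rep_def)
        also have "\<dots> = (\<Sum>u\<in>W N. \<Sum>v\<in>W N. cw (rev w) (rev u) v * Lr (rev u) (cnj z) * Lr v z)"
          by (rule sum.reindex_bij_betw[OF rW, symmetric])
        also have "\<dots> = (\<Sum>u\<in>W N. \<Sum>v\<in>W N. cw (rev w) (rev u) (rev v) * Lr (rev u) (cnj z) * Lr (rev v) z)"
          by (intro sum.cong refl sum.reindex_bij_betw[OF rW, symmetric])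
        finally show "svP0 w z = (\<Sum>(u,v)\<in>W N \<times> W N. (case (u,v) of (u,v) \<Rightarrow> cw (rev w) (rev u) (rev v)) * mpl u (cnj z) * mpl v z)"
          by (simp add: mpl_def sum.cartesian_product)
      qed auto
    qed
    show "wirt_dz (svP0 (w @ [a])) z = svP0 w z / (z - a)" if a: "a \<in> {0,1}" and z: "z \<notin> {0,1}" for a z
    proof -
      have "svP0 (w @ [a]) = Phi (lift a (cw (rev w)))" using w a by (simp add: svP0_def)
      then have "wirt_dz (svP0 (w @ [a])) z = Phi (dz 0 (lift a (cw (rev w)))) z / z + Phi (dz 1 (lift a (cw (rev w)))) z / (z - 1)"
        using has_wirt_imp(1)[OF Phi_has_wirt[OF lift(1)[OF I[OF w] a] z]] by simp
      then show ?thesis using a unfolding P dz_lift[OF I[OF w] a] by (auto simp: Phi_zero)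
    qed
    show "(svP0 w \<longlongrightarrow> 0) (at 0)" if "\<not> (\<forall>b\<in>set w. b = 0)"
      unfolding P using w that by (intro Phi_tendsto_0[OF I[OF w]] cw_zeros) (auto simp: words_def)
  next
    fix z :: complex assume z: "z \<notin> {0,1}"
    show "svP0 [] z = 1" using Phi_delta[OF z] by (simp add: svP0_def)
    show "svP0 (replicate n 0) z = complex_of_real ((ln ((cmod z)\<^sup>2)) ^ n / fact n)" for n
    proof -
      have "set (replicate n (0::complex)) \<subseteq> {0,1}" by auto
      then have "svP0 (replicate n 0) = Phi (cpow n)" unfolding svP0_def rev_replicate cw_replicate by simp
      then show ?thesis using Phi_cpow[OF z] by simp
    qed
  qed
qed

lemma svmpl_eq: "svmpl = svP0"
  unfolding svmpl_def using svmpl_family_svP0 svmpl_family_unique by (intro the_equality) (auto intro!: ext)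

lemma svmpl_Phi: "set w \<subseteq> {0,1} \<Longrightarrow> svmpl w = Phi (cw (rev w))"
  by (simp add: svmpl_eq svP0_def)

text \<open>Removes words and spans from the rest of the argument: \<open>Inv_span\<close> provides
  the expansion in \<open>cw\<close>, and reversal translates between the two reading
  directions.\<close>

lemma svP_iff: "p \<in> svP \<longleftrightarrow> (\<exists>c. Inv c \<and> (\<forall>z. z \<notin> {0,1} \<longrightarrow> p z = Phi c z))"
proof
  assume "p \<in> svP"
  then obtain S c where S: "finite S" "\<forall>w\<in>S. set w \<subseteq> {0,1}" "\<forall>z. z \<notin> {0,1} \<longrightarrow> p z = (\<Sum>w\<in>S. c w * svmpl w z)"
    unfolding svP_def by blast
  have I: "Inv (cw (rev w))" if "w \<in> S" for w using S(2) that by (intro Inv_cw) (simp add: words_def)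
  show "\<exists>c. Inv c \<and> (\<forall>z. z \<notin> {0,1} \<longrightarrow> p z = Phi c z)"
  proof (intro exI[of _ "\<lambda>u v. \<Sum>w\<in>S. c w * cw (rev w) u v"] conjI allI impI)
    show "Inv (\<lambda>u v. \<Sum>w\<in>S. c w * cw (rev w) u v)" by (intro Inv_sum S(1) Inv_scale I)
    show "p z = Phi (\<lambda>u v. \<Sum>w\<in>S. c w * cw (rev w) u v) z" if "z \<notin> {0,1}" for z
      using S that by (subst Phi_sum) (auto intro!: Inv_scale I simp: Phi_scale[OF I] svmpl_Phi)
  qed
next
  assume "\<exists>c. Inv c \<and> (\<forall>z. z \<notin> {0,1} \<longrightarrow> p z = Phi c z)"
  then obtain c where c: "Inv c" "\<And>z. z \<notin> {0,1} \<Longrightarrow> p z = Phi c z" by blast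
  obtain N g where g: "\<forall>u v. c u v = (\<Sum>w\<in>W N. g w * cw w u v)" using Inv_span[OF c(1)] by blast
  have rW: "bij_betw rev (W N) (W N)" by (rule bij_betwI[where g = rev]) (auto simp: W_def)
  have "Phi c z = (\<Sum>w\<in>W N. g (rev w) * svmpl w z)" for z
  proof -
    have "c = (\<lambda>u v. \<Sum>w\<in>W N. g w * cw w u v)" using g by blast
    then have "Phi c z = Phi (\<lambda>u v. \<Sum>w\<in>W N. g w * cw w u v) z" by metis
    also have "\<dots> = (\<Sum>w\<in>W N. g w * Phi (cw w) z)"
      by (subst Phi_sum) (auto intro!: Inv_scale Inv_cw simp: Phi_scale Inv_cw W_words)
    also have "\<dots> = (\<Sum>w\<in>W N. g (rev w) * Phi (cw (rev w)) z)"
      by (rule sum.reindex_bij_betw[OF rW, symmetric])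
    also have "\<dots> = (\<Sum>w\<in>W N. g (rev w) * svmpl w z)"
      by (intro sum.cong refl) (subst svmpl_Phi, auto simp: W_def words_def)
    finally show ?thesis .
  qed
  moreover have "\<forall>w\<in>W N. set w \<subseteq> {0,1}" by (auto simp: W_def words_def)
  ultimately show "p \<in> svP" unfolding svP_def
    using c(2) by (intro CollectI exI[of _ "W N"] exI[of _ "\<lambda>w. g (rev w)"]) simp
qed

text \<open>Every nonempty word has \<open>cw w [] [] = 0\<close>, so \<open>c [] []\<close> is the
  coefficient of the empty word. Both sides vanish at 0 and 1, so here the functions agree
  everywhere, as the description of the primitives in \<open>prim_z\<close> requires.\<close>

lemma svP_pos_iff: "F \<in> svP_pos \<longleftrightarrow> (\<exists>c. Inv c \<and> c [] [] = 0 \<and> F = Phi c)"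
proof
  assume "F \<in> svP_pos"
  then obtain S c where S: "finite S" "\<forall>w\<in>S. w \<noteq> [] \<and> set w \<subseteq> {0,1}" "F = (\<lambda>z. \<Sum>w\<in>S. c w * svmpl w z)"
    unfolding svP_pos_def by blast
  have I: "Inv (cw (rev w))" if "w \<in> S" for w using S(2) that by (intro Inv_cw) (simp add: words_def)
  show "\<exists>c. Inv c \<and> c [] [] = 0 \<and> F = Phi c"
  proof (intro exI[of _ "\<lambda>u v. \<Sum>w\<in>S. c w * cw (rev w) u v"] conjI)
    show "Inv (\<lambda>u v. \<Sum>w\<in>S. c w * cw (rev w) u v)" by (intro Inv_sum S(1) Inv_scale I)
    show "(\<Sum>w\<in>S. c w * cw (rev w) [] []) = 0"
      by (rule sum.neutral) (use S(2) cw_Nil_Nil[of "rev _"] in \<open>auto simp: words_def\<close>)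
    show "F = Phi (\<lambda>u v. \<Sum>w\<in>S. c w * cw (rev w) u v)"
      unfolding S(3) by (rule ext, subst Phi_sum) (use S in \<open>auto intro!: Inv_scale I sum.cong simp: Phi_scale[OF I] svmpl_Phi\<close>)
  qed
next
  assume "\<exists>c. Inv c \<and> c [] [] = 0 \<and> F = Phi c"
  then obtain c where c: "Inv c" "c [] [] = 0" "F = Phi c" by blast
  obtain N g where "g [] = c [] []" "\<forall>M\<ge>N. \<forall>u v. c u v = (\<Sum>w\<in>W M. g w * cw w u v)" using Inv_span[OF c(1)] by blast
  then have g: "g [] = 0" "\<forall>u v. c u v = (\<Sum>w\<in>W N. g w * cw w u v)" using c(2) by auto
  have rW: "bij_betw rev (W N - {[]}) (W N - {[]})" by (rule bij_betwI[where g = rev]) (auto simp: W_def)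
  have "F = (\<lambda>z. \<Sum>w\<in>W N - {[]}. g (rev w) * svmpl w z)"
  proof
    fix z
    have "c = (\<lambda>u v. \<Sum>w\<in>W N. g w * cw w u v)" using g by blast
    then have "F z = Phi (\<lambda>u v. \<Sum>w\<in>W N. g w * cw w u v) z" using c(3) by metis
    also have "\<dots> = (\<Sum>w\<in>W N. g w * Phi (cw w) z)"
      by (subst Phi_sum) (auto intro!: Inv_scale Inv_cw simp: Phi_scale Inv_cw W_words)
    also have "\<dots> = (\<Sum>w\<in>W N - {[]}. g w * Phi (cw w) z)"
      by (rule sum.mono_neutral_right) (use g(1) in auto)
    also have "\<dots> = (\<Sum>w\<in>W N - {[]}. g (rev w) * Phi (cw (rev w)) z)"
      by (rule sum.reindex_bij_betw[OF rW, symmetric])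
    also have "\<dots> = (\<Sum>w\<in>W N - {[]}. g (rev w) * svmpl w z)"
      by (intro sum.cong refl) (subst svmpl_Phi, auto simp: W_def words_def)
    finally show "F z = (\<Sum>w\<in>W N - {[]}. g (rev w) * svmpl w z)" .
  qed
  moreover have "\<forall>w\<in>W N - {[]}. w \<noteq> [] \<and> set w \<subseteq> {0,1}" by (auto simp: W_def words_def)
  ultimately show "F \<in> svP_pos" unfolding svP_pos_def
    by (intro CollectI exI[of _ "W N - {[]}"] exI[of _ "\<lambda>w. g (rev w)"]) simp
qed

lemma Phi_wirt_dz: "Inv c \<Longrightarrow> z \<notin> {0,1} \<Longrightarrow> wirt_dz (Phi c) z = Phi (dz 0 c) z / z + Phi (dz 1 c) z / (z - 1)"
  and Phi_wirt_dzb: "Inv c \<Longrightarrow> z \<notin> {0,1} \<Longrightarrow> wirt_dzb (Phi c) z = Phi (dzb 0 c) z / cnj z + Phi (dzb 1 c) z / (cnj z - 1)"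
  using has_wirt_imp[OF Phi_has_wirt] by blast+

lemma Phi_dz_zero:
  assumes I: "Inv d" and z: "\<And>z. Im z \<noteq> 0 \<Longrightarrow> Phi (dz 0 d) z / z + Phi (dz 1 d) z / (z - 1) = 0" and d0: "d [] [] = 0"
  shows "d = (\<lambda>u v. 0)"
proof -
  have a: "dz a d = (\<lambda>u v. 0)" if "a \<in> {0,1}" for a
  proof -
    \<comment> \<open>Dividing the relation by \<open>cnj z\<close> brings it into the shape of
      \<open>Phi_poles_independent\<close>, with nothing at the antiholomorphic pole 1.\<close>
    define k where "k a b = (if b = 0 then dz a d else (\<lambda>u v. 0))" for a b :: complex
    have "k a 0 = (\<lambda>u v. 0)"
    proof (rule Phi_poles_independent[of k])
      show "Inv (k a b)" if "a \<in> {0,1}" "b \<in> {0,1}" for a b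
        using Inv_dz[OF I that(1)] Inv_zero by (simp add: k_def)
      fix z :: complex assume "Im z \<noteq> 0"
      then have z01: "z \<noteq> 0" "cnj z \<noteq> 0" "Phi (dz 0 d) z / z + Phi (dz 1 d) z / (z - 1) = 0" using z by auto
      have "(\<Sum>a\<in>{0,1}. \<Sum>b\<in>{0,1}. Phi (k a b) z / ((z - a) * (cnj z - b))) = (Phi (dz 0 d) z / z + Phi (dz 1 d) z / (z - 1)) / cnj z"
        by (simp add: k_def Phi_zero add_divide_distrib)
      then show "(\<Sum>a\<in>{0,1}. \<Sum>b\<in>{0,1}. Phi (k a b) z / ((z - a) * (cnj z - b))) = 0" using z01 by simp
    qed (use that in auto)
    then show ?thesis by (simp add: k_def)
  qed
  show ?thesis
  proof (rule Inv_unique[OF I Inv_zero])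
    show "d u (b # v) = 0" if "b \<in> {0,1}" for b u v using a[OF that] unfolding dz_def by metis
  qed (rule d0)
qed

lemma lift_unique:
  assumes a: "a \<in> {0,1}" and c: "Inv c" and c': "Inv c'" "c' [] [] = 0"
    and D': "\<And>z. z \<notin> {0,1} \<Longrightarrow> wirt_dz (Phi c') z = Phi c z / (z - a)"
  shows "c' = lift a c"
proof -
  note L = lift[OF c a]
  have "(\<lambda>u v. c' u v - lift a c u v) = (\<lambda>u v. 0)"
  proof (rule Phi_dz_zero)
    show I: "Inv (\<lambda>u v. c' u v - lift a c u v)" by (rule Inv_diff[OF c'(1) L(1)])
    show "c' [] [] - lift a c [] [] = 0" using c' L by simp
    fix z :: complex assume "Im z \<noteq> 0"
    then have z: "z \<notin> {0,1}" by auto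
    have d: "dz b (\<lambda>u v. c' u v - lift a c u v) = (\<lambda>u v. dz b c' u v - dz b (lift a c) u v)" for b
      by (simp add: dz_def)
    have P: "Phi (dz b (\<lambda>u v. c' u v - lift a c u v)) z = Phi (dz b c') z - (if b = a then Phi c z else 0)"
      if "b \<in> {0,1}" for b
      unfolding d by (subst Phi_diff) (use that c' L(1) c Inv_zero Inv_dz in \<open>auto simp: dz_lift[OF c a] Phi_zero\<close>)
    have "Phi (dz 0 c') z / z + Phi (dz 1 c') z / (z - 1) = Phi c z / (z - a)"
      using Phi_wirt_dz[OF c'(1) z] D'[OF z] by simp
    show "Phi (dz 0 (\<lambda>u v. c' u v - lift a c u v)) z / z + Phi (dz 1 (\<lambda>u v. c' u v - lift a c u v)) z / (z - 1) = 0"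
    proof -
      have "Phi (dz 0 (\<lambda>u v. c' u v - lift a c u v)) z / z + Phi (dz 1 (\<lambda>u v. c' u v - lift a c u v)) z / (z - 1)
        = (Phi (dz 0 c') z / z + Phi (dz 1 c') z / (z - 1)) - Phi c z / (z - a)"
        using P[of 0] P[of 1] a by (auto simp: diff_divide_distrib)
      then show ?thesis using \<open>Phi (dz 0 c') z / z + Phi (dz 1 c') z / (z - 1) = Phi c z / (z - a)\<close> by simp
    qed
  qed
  then show ?thesis by (metis eq_iff_diff_eq_0 ext)
qed

lemma lift_wirt_dz:
  assumes a: "a \<in> {0,1}" and c: "Inv c" and z: "z \<notin> {0,1}"
  shows "wirt_dz (Phi (lift a c)) z = Phi c z / (z - a)"
  using Phi_wirt_dz[OF lift(1)[OF c a] z] a unfolding dz_lift[OF c a] by (auto simp: Phi_zero)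

text \<open>Shows that the definite description in \<open>prim_z\<close> has exactly one solution:
  \<open>lift\<close> provides it, and \<open>lift_unique\<close> excludes any other.\<close>

lemma prim_z_Phi:
  assumes a: "a \<in> {0,1}" and c: "Inv c" and p: "\<And>z. z \<notin> {0,1} \<Longrightarrow> p z = Phi c z"
  shows "prim_z a p = Phi (lift a c)"
  unfolding prim_z_def
proof (rule the_equality)
  show "Phi (lift a c) \<in> svP_pos \<and> (\<forall>z. z \<notin> {0,1} \<longrightarrow> wirt_dz (Phi (lift a c)) z = p z / (z - a))"
    using lift[OF c a] lift_wirt_dz[OF a c] p by (auto simp: svP_pos_iff)
  fix F assume "F \<in> svP_pos \<and> (\<forall>z. z \<notin> {0,1} \<longrightarrow> wirt_dz F z = p z / (z - a))"
  then show "F = Phi (lift a c)" using lift_unique[OF a c] p unfolding svP_pos_iff by metis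
qed

lemma wirt_cnj:
  assumes "f differentiable (at (cnj z))"
  shows "wirt_dz (\<lambda>z. f (cnj z)) z = wirt_dzb f (cnj z)" "wirt_dzb (\<lambda>z. f (cnj z)) z = wirt_dz f (cnj z)"
  using has_wirt_imp[OF has_wirt_cnj[OF differentiable_imp_has_wirt[OF assms]]] by simp_all

lemma cnj_notin_01: "z \<notin> {0,1} \<Longrightarrow> cnj z \<notin> {0,1}"
  by (auto simp: complex_eq_iff)

lemma wirt_dz_swap:
  assumes "Inv c" "z \<notin> {0,1}"
  shows "wirt_dz (Phi (swap c)) z = wirt_dzb (Phi c) (cnj z)"
proof -
  have "Phi c differentiable (at (cnj z))"
    using Phi_has_wirt[OF assms(1) cnj_notin_01[OF assms(2)]] has_wirt_differentiable by blast
  from wirt_cnj(1)[OF this] show ?thesis by (simp add: Phi_swap[OF assms(1), abs_def])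
qed

lemma prim_zb_Phi:
  assumes b: "b \<in> {0,1}" and c: "Inv c" and p: "\<And>z. z \<notin> {0,1} \<Longrightarrow> p z = Phi c z"
  shows "prim_zb b p = Phi (liftb b c)"
  unfolding prim_zb_def
proof (rule the_equality)
  have "wirt_dzb (Phi (liftb b c)) z = Phi c z / (cnj z - b)" if z: "z \<notin> {0,1}" for z
    using Phi_wirt_dzb[OF Inv_liftb[OF c b] z] b unfolding dzb_liftb[OF c b] by (auto simp: Phi_zero)
  then show "Phi (liftb b c) \<in> svP_pos \<and> (\<forall>z. z \<notin> {0,1} \<longrightarrow> wirt_dzb (Phi (liftb b c)) z = p z / (cnj z - b))"
    using Inv_liftb[OF c b] liftb_Nil[OF c b] p by (auto simp: svP_pos_iff)
  fix F assume "F \<in> svP_pos \<and> (\<forall>z. z \<notin> {0,1} \<longrightarrow> wirt_dzb F z = p z / (cnj z - b))"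
  then obtain c' where c': "Inv c'" "c' [] [] = 0" "F = Phi c'"
    and F: "\<And>z. z \<notin> {0,1} \<Longrightarrow> wirt_dzb F z = p z / (cnj z - b)"
    unfolding svP_pos_iff by blast
  have "swap c' = lift b (swap c)"
  proof (rule lift_unique[OF b Inv_swap[OF c] Inv_swap[OF c'(1)]])
    show "swap c' [] [] = 0" using c' by (simp add: swap_def)
    fix z :: complex assume z: "z \<notin> {0,1}"
    have "wirt_dz (Phi (swap c')) z = p (cnj z) / (z - b)"
      using wirt_dz_swap[OF c'(1) z] F[OF cnj_notin_01[OF z]] c'(3) by simp
    then show "wirt_dz (Phi (swap c')) z = Phi (swap c) z / (z - b)"
      using p[OF cnj_notin_01[OF z]] Phi_swap[OF c] by simp
  qed
  then have "c' = liftb b c" unfolding liftb_def by (metis swap_swap)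
  then show "F = Phi (liftb b c)" using c'(3) by simp
qed

section \<open>Antisymmetric harmonic functions of moderate growth\<close>

lemma eq_from_above:
  fixes f g :: "complex \<Rightarrow> 'b::t2_space"
  assumes "isCont f z" "isCont g z" "open S" "z \<in> S" "\<And>w. w \<in> S \<Longrightarrow> Im w > Im z \<Longrightarrow> f w = g w"
  shows "f z = g z"
proof -
  define \<gamma> where "\<gamma> t = z + \<i> * of_real t" for t :: real
  have "\<gamma> \<midarrow>0\<rightarrow> z" unfolding \<gamma>_def by (auto intro!: tendsto_eq_intros)
  then have g: "(\<gamma> \<longlongrightarrow> z) (at_right 0)" by (rule filterlim_mono) (simp_all add: at_le)
  have Lf: "((\<lambda>t. f (\<gamma> t)) \<longlongrightarrow> f z) (at_right 0)" and Lg: "((\<lambda>t. g (\<gamma> t)) \<longlongrightarrow> g z) (at_right 0)"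
    using assms(1,2) g isCont_tendsto_compose by blast+
  have "\<forall>\<^sub>F t in at_right 0. \<gamma> t \<in> S" using g assms(3,4) topological_tendstoD by blast
  then have ev: "\<forall>\<^sub>F t in at_right 0. f (\<gamma> t) = g (\<gamma> t)"
    using eventually_at_right_less[of "0::real"] by eventually_elim (simp add: \<gamma>_def assms(5))
  have "((\<lambda>t. g (\<gamma> t)) \<longlongrightarrow> f z) (at_right 0)" by (rule Lim_transform_eventually[OF Lf ev])
  then show ?thesis using tendsto_unique[OF trivial_limit_at_right_real _ Lg] by blast
qed

text \<open>The function exp (f / M) has modulus between exp (-1) and exp 1, so Cauchy's inequality
  bounds its derivative at the centre by exp 1 / r. Dividing by its modulus there costs a second
  factor exp 1.\<close>

lemma deriv_bound_by_Re:
  assumes f: "f holomorphic_on ball z (2 * r)" and r: "r > 0" and M: "M > 0"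
    and b: "\<And>w. w \<in> ball z (2 * r) \<Longrightarrow> \<bar>Re (f w)\<bar> \<le> M"
  shows "cmod (deriv f z) \<le> exp 2 * M / r"
proof -
  define F where "F w = exp (of_real (1 / M) * f w)" for w
  have sub: "cball z r \<subseteq> ball z (2 * r)" "ball z r \<subseteq> ball z (2 * r)" using r by auto
  have F: "F holomorphic_on ball z (2 * r)" unfolding F_def by (intro holomorphic_intros f)
  have cF: "cmod (F w) = exp (Re (f w) / M)" for w unfolding F_def norm_exp_eq_Re by simp
  have "cmod ((deriv ^^ 1) F z) \<le> fact 1 * exp 1 / r ^ 1"
  proof (rule Cauchy_inequality)
    show "F holomorphic_on ball z r" using F sub holomorphic_on_subset by blast
    show "continuous_on (cball z r) F" using F sub holomorphic_on_imp_continuous_on continuous_on_subset by blast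
    fix x assume "cmod (z - x) = r"
    then have "x \<in> ball z (2 * r)" using r by (simp add: dist_norm)
    then have "Re (f x) \<le> M" using b by fastforce
    then show "cmod (F x) \<le> exp 1" unfolding cF using M by simp
  qed (use r in auto)
  then have 1: "cmod (deriv F z) \<le> exp 1 / r" by simp
  have zb: "z \<in> ball z (2 * r)" using r by simp
  have "(F has_field_derivative (F z * (of_real (1 / M) * deriv f z))) (at z)"
    unfolding F_def using holomorphic_derivI[OF f open_ball zb, of UNIV] M by (auto intro!: derivative_eq_intros)
  then have dF: "deriv F z = F z * (of_real (1 / M) * deriv f z)" by (rule DERIV_imp_deriv)
  have "exp (-1) \<le> cmod (F z)"
  proof -
    have "- M \<le> Re (f z)" using b[OF zb] by linarith
    then show ?thesis unfolding cF using M by (simp add: field_simps)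
  qed
  then have "exp (-1) * (cmod (deriv f z) / M) \<le> cmod (F z) * (cmod (deriv f z) / M)"
    using M by (intro mult_right_mono) auto
  also have "\<dots> = cmod (deriv F z)" unfolding dF using M by (simp add: norm_mult norm_divide)
  also have "\<dots> \<le> exp 1 / r" by (rule 1)
  finally have "exp 1 * (exp (-1) * (cmod (deriv f z) / M)) \<le> exp 1 * (exp 1 / r)" by (intro mult_left_mono) auto
  moreover have "exp 1 * (exp (-1) * x) = x" for x :: real by (simp add: exp_minus)
  moreover have "exp 1 * (exp 1 / r) = exp 2 / r"
  proof -
    have "exp 1 * exp 1 = exp (2::real)" by (simp flip: exp_add)
    then show ?thesis by (simp only: times_divide_eq_right)
  qed
  ultimately have "cmod (deriv f z) / M \<le> exp 2 / r" by (simp only:)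
  then show ?thesis using M by (simp add: field_simps)
qed

text \<open>A harmonic function is locally \<open>\<phi> + cnj \<xi>\<close>, so that its real and imaginary parts are
  the real part of \<open>\<phi> + \<xi>\<close> and the imaginary part of \<open>\<phi> - \<xi>\<close>.\<close>
lemma harmonic_gradient_bound:
  assumes D: "\<And>w. w \<in> ball z (2 * r) \<Longrightarrow> has_wirt D (E w) (q w) w" and E: "E holomorphic_on ball z (2 * r)"
    and r: "r > 0" and M: "M > 0" and b: "\<And>w. w \<in> ball z (2 * r) \<Longrightarrow> cmod (D w) \<le> M"
  shows "cmod (E z) \<le> exp 2 * M / r"
proof -
  let ?B = "ball z (2 * r)"
  have zb: "z \<in> ?B" using r by simp
  have "starlike ?B" using r by (intro convex_imp_starlike) auto
  then obtain \<phi> where phi: "\<And>w. w \<in> ?B \<Longrightarrow> (\<phi> has_field_derivative E w) (at w)"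
    using holomorphic_starlike_primitive[OF holomorphic_on_imp_continuous_on[OF E] _ open_ball, of "{}"]
      E open_ball holomorphic_on_imp_differentiable_at finite.emptyI by (metis Diff_empty)
  define \<xi> where "\<xi> w = cnj (D w - \<phi> w)" for w
  have chi: "(\<xi> has_field_derivative cnj (q w)) (at w)" if "w \<in> ?B" for w
  proof -
    have "has_wirt (\<lambda>w. D w - \<phi> w) 0 (q w) w"
      using has_wirt_diff[OF D[OF that] phi[OF that, unfolded has_wirt_holomorphic]] by simp
    then have "((\<lambda>w. D w - \<phi> w) has_derivative (\<lambda>h. q w * cnj h)) (at w)" by (simp add: has_wirt_def)
    from bounded_linear.has_derivative[OF bounded_linear_cnj this]
    show ?thesis unfolding \<xi>_def has_field_derivative_def by simp
  qed
  have hp: "\<phi> holomorphic_on ?B" and hc: "\<xi> holomorphic_on ?B"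
    unfolding holomorphic_on_open[OF open_ball] using phi chi by blast+
  have DD: "D w = \<phi> w + cnj (\<xi> w)" for w by (simp add: \<xi>_def)
  have "cmod (deriv (\<lambda>w. \<phi> w + \<xi> w) z) \<le> exp 2 * M / r"
  proof (rule deriv_bound_by_Re[OF _ r M])
    show "(\<lambda>w. \<phi> w + \<xi> w) holomorphic_on ?B" by (intro holomorphic_intros hp hc)
    fix w assume "w \<in> ?B"
    have "Re (\<phi> w + \<xi> w) = Re (D w)" by (simp add: DD)
    then show "\<bar>Re (\<phi> w + \<xi> w)\<bar> \<le> M" using abs_Re_le_cmod[of "D w"] b[OF \<open>w \<in> ?B\<close>] by simp
  qed
  moreover have "deriv (\<lambda>w. \<phi> w + \<xi> w) z = E z + cnj (q z)"
    by (intro DERIV_imp_deriv derivative_intros phi chi zb)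
  ultimately have 1: "cmod (E z + cnj (q z)) \<le> exp 2 * M / r" by simp
  have "cmod (deriv (\<lambda>w. - \<i> * (\<phi> w - \<xi> w)) z) \<le> exp 2 * M / r"
  proof (rule deriv_bound_by_Re[OF _ r M])
    show "(\<lambda>w. - \<i> * (\<phi> w - \<xi> w)) holomorphic_on ?B" by (intro holomorphic_intros hp hc)
    fix w assume "w \<in> ?B"
    have "Re (- \<i> * (\<phi> w - \<xi> w)) = Im (D w)" by (simp add: DD)
    then show "\<bar>Re (- \<i> * (\<phi> w - \<xi> w))\<bar> \<le> M" using abs_Im_le_cmod[of "D w"] b[OF \<open>w \<in> ?B\<close>] by simp
  qed
  moreover have "deriv (\<lambda>w. - \<i> * (\<phi> w - \<xi> w)) z = - \<i> * (E z - cnj (q z))"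
    by (intro DERIV_imp_deriv DERIV_cmult derivative_intros phi chi zb)
  ultimately have 2: "cmod (E z - cnj (q z)) \<le> exp 2 * M / r" by (simp add: norm_mult)
  have "2 * cmod (E z) = cmod ((E z + cnj (q z)) + (E z - cnj (q z)))" by (simp add: norm_mult)
  also have "\<dots> \<le> exp 2 * M / r + exp 2 * M / r" by (rule order_trans[OF norm_triangle_ineq add_mono[OF 1 2]])
  finally have "2 * cmod (E z) \<le> exp 2 * M / r + exp 2 * M / r" .
  moreover have "x \<le> a" if "2 * x \<le> a + a" for x a :: real using that by simp
  ultimately show ?thesis by blast
qed

text \<open>The z-derivative of \<open>D\<close> is holomorphic off the real axis and continuous
  across it away from 0 and 1, hence holomorphic there too. The gradient estimate and
  \<open>polynomial_growth\<close> reduce it to A / z + B / (z - 1). On \<open>slit\<close>,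
  \<open>D\<close> is then a combination of the arguments of z and 1 - z, and its vanishing at -1
  and at 2 kills both residues.\<close>

lemma antisymmetric_harmonic_zero:
  assumes D: "\<And>z. z \<notin> {0,1} \<Longrightarrow> has_wirt D (p z) (q z) z"
    and qc: "\<And>z. z \<notin> {0,1} \<Longrightarrow> isCont q z"
    and qd: "\<And>z. Im z \<noteq> 0 \<Longrightarrow> \<exists>s. has_wirt q 0 s z"
    and mild: "mild (- {0,1}) (1/4) D"
    and anti: "\<And>z. z \<notin> {0,1} \<Longrightarrow> D (cnj z) = - D z"
    and z: "z \<notin> {0,1}"
  shows "D z = 0"
proof -
  have pq: "p z = - q (cnj z)" if "z \<notin> {0,1}" for z
  proof -
    have 1: "has_wirt (\<lambda>z. D (cnj z)) (q (cnj z)) (p (cnj z)) z" by (rule has_wirt_cnj[OF D[OF cnj_notin_01[OF that]]])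
    have "has_wirt (\<lambda>z. (-1) * D z) ((-1) * p z) ((-1) * q z) z" by (rule has_wirt_cmult[OF D[OF that]])
    then have "has_wirt (\<lambda>z. D (cnj z)) ((-1) * p z) ((-1) * q z) z"
      by (rule has_wirt_transform[where S = "- {0,1}"]) (use that anti in \<open>auto intro: open_Compl\<close>)
    from has_wirt_imp(1)[OF this] show ?thesis using has_wirt_imp(1)[OF 1] by simp
  qed
  \<comment> \<open>By antisymmetry this is \<open>p\<close>. Writing it through \<open>q\<close>
    transfers the continuity assumed for \<open>q\<close> to the z-derivative of
    \<open>D\<close>.\<close>
  define E where "E z = - q (cnj z)" for z
  have Ec: "isCont E z" if "z \<notin> {0,1}" for z
  proof -
    have "isCont (\<lambda>z. q (cnj z)) z"
      by (rule isCont_o2[where f = cnj and g = q]) (use qc cnj_notin_01[OF that] in \<open>auto intro: continuous_intros\<close>)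
    then show ?thesis unfolding E_def by (rule continuous_minus)
  qed
  have Ed: "\<exists>f'. (E has_field_derivative f') (at z)" if I: "Im z \<noteq> 0" for z
  proof -
    obtain s where "has_wirt q 0 s (cnj z)" using qd[of "cnj z"] I by auto
    from has_wirt_cmult[OF has_wirt_cnj[OF this], of "-1"] have "has_wirt E (- s) 0 z" by (simp add: E_def[abs_def])
    then show ?thesis unfolding has_wirt_holomorphic by blast
  qed
  have E: "E holomorphic_on - {0,1}"
  proof (rule holomorphic_on_paste_across_line[where d = \<i> and k = 0])
    show "open (- {0,1::complex})" by (auto intro: open_Compl)
    then have o: "open (- {0,1} \<inter> {z. \<i> \<bullet> z < 0})" "open (- {0,1} \<inter> {z. 0 < \<i> \<bullet> z})"
      by (auto intro!: open_Int open_halfspace_Im_lt open_halfspace_Im_gt simp: inner_complex_def)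
    show "E holomorphic_on - {0, 1} \<inter> {z. \<i> \<bullet> z < 0}" "E holomorphic_on - {0, 1} \<inter> {z. 0 < \<i> \<bullet> z}"
      unfolding holomorphic_on_open[OF o(1)] holomorphic_on_open[OF o(2)]
      by (intro ballI Ed; simp add: inner_complex_def)+
    show "continuous_on (- {0, 1}) E" using Ec by (auto intro: continuous_at_imp_continuous_on)
  qed simp
  have DE: "has_wirt D (E z) (q z) z" if "z \<notin> {0,1}" for z using D[OF that] pq[OF that] by (simp add: E_def)
  obtain C where C: "C \<ge> 0" "\<And>z. z \<notin> {0,1} \<Longrightarrow> cmod z < 1/8 \<Longrightarrow> cmod (D z) \<le> C * cmod z powr (-(1/4))"
    "\<And>z. z \<notin> {0,1} \<Longrightarrow> cmod (z - 1) < 1/8 \<Longrightarrow> cmod (D z) \<le> C * cmod (z - 1) powr (-(1/4))"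
    "\<And>z. cmod z > 8 \<Longrightarrow> cmod (D z) \<le> C * cmod z powr (1/4)" using mild_bounds[OF mild] by metis
  have grad: "cmod (E w) \<le> exp 2 * ((C + 1) * x) / r"
    if "r > 0" "ball w (2 * r) \<subseteq> - {0,1}" "\<And>v. v \<in> ball w (2 * r) \<Longrightarrow> cmod (D v) \<le> C * x" "x > 0" for w r x
  proof (rule harmonic_gradient_bound[where D = D and q = q and E = E and z = w])
    show "has_wirt D (E v) (q v) v" if "v \<in> ball w (2 * r)" for v using DE that \<open>ball w (2 * r) \<subseteq> _\<close> by blast
    show "E holomorphic_on ball w (2 * r)" using E that(2) holomorphic_on_subset by blast
    show "(C + 1) * x > 0" using C that by (intro mult_pos_pos) auto
    show "cmod (D v) \<le> (C + 1) * x" if "v \<in> ball w (2 * r)" for v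
      using \<open>\<And>v. v \<in> ball w (2 * r) \<Longrightarrow> cmod (D v) \<le> C * x\<close>[OF that] \<open>x > 0\<close> by (simp add: distrib_right)
  qed (rule that)
  \<comment> \<open>The gradient estimate on a disc of radius x / 4, with 2^(1/4) rounded up to 2,
    gives 8 exp 2 (C + 1) = K / 16. The remaining factor 16 leaves room for the factor z (z -
    1).\<close>
  define K where "K = 128 * exp 2 * (C + 1)"
  have K0: "K > 0" using C by (simp add: K_def)
  have p2: "(2::real) powr (1/4) \<le> 2" using powr_mono[of "1/4" 1 "2::real"] by simp
  \<comment> \<open>Points of the disc of radius x / 2 about \<open>z\<close> lie within 3 x / 2 of
    \<open>c\<close>; with x < 1/20 this is less than 1/8, where the bound on \<open>D\<close>
    holds.\<close>
  have nearp: "cmod (E z) \<le> (K / 16) * cmod (z - c) powr (-(1/4)) / cmod (z - c)"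
    if c: "c \<in> {0,1}" and z: "z \<notin> {0,1}" "cmod (z - c) < 1/20"
     and Dc: "\<And>z. z \<notin> {0,1} \<Longrightarrow> cmod (z - c) < 1/8 \<Longrightarrow> cmod (D z) \<le> C * cmod (z - c) powr (-(1/4))" for z c
  proof -
    let ?x = "cmod (z - c)"
    have x: "?x > 0" using c z by auto
    have v: "?x / 2 < cmod (v - c)" "cmod (v - c) < 3/2 * ?x" if "v \<in> ball z (2 * (?x / 4))" for v
    proof -
      have "dist z v < ?x / 2" using that by simp
      then show "?x / 2 < cmod (v - c)" "cmod (v - c) < 3/2 * ?x"
        using norm_triangle_ineq2[of "z - c" "z - v"] norm_triangle_ineq2[of "v - c" "z - c"]
        by (auto simp: dist_norm norm_minus_commute)
    qed
    have v01: "v \<notin> {0,1}" if "v \<in> ball z (2 * (?x / 4))" for v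
      using v[OF that] c z x by auto
    have "cmod (E z) \<le> exp 2 * ((C + 1) * (?x / 2) powr (-(1/4))) / (?x / 4)"
    proof (rule grad)
      show "ball z (2 * (?x / 4)) \<subseteq> - {0,1}" using v01 by blast
      fix u assume u: "u \<in> ball z (2 * (?x / 4))"
      have "cmod (D u) \<le> C * cmod (u - c) powr (-(1/4))" using Dc[OF v01[OF u]] v[OF u] z by simp
      also have "\<dots> \<le> C * (?x / 2) powr (-(1/4))" using v[OF u] x C by (intro mult_left_mono powr_mono2') auto
      finally show "cmod (D u) \<le> C * (?x / 2) powr (-(1/4))" .
    qed (use x in auto)
    also have "(?x / 2) powr (-(1/4)) = ?x powr (-(1/4)) * 2 powr (1/4)" using x by (simp add: powr_divide powr_minus divide_simps)
    also have "exp 2 * ((C + 1) * (?x powr (-(1/4)) * 2 powr (1/4))) / (?x / 4) \<le> exp 2 * ((C + 1) * (?x powr (-(1/4)) * 2)) / (?x / 4)"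
      using p2 C x by (intro divide_right_mono mult_left_mono) auto
    also have "\<dots> = (K / 16) * ?x powr (-(1/4)) / ?x" by (simp add: K_def)
    finally show ?thesis .
  qed
  define G where "G z = E z * (z * (z - 1))" for z
  have "\<exists>a. \<forall>z. z \<notin> {0,1} \<longrightarrow> G z = (\<Sum>k\<le>1. a k * z ^ k)"
  proof (rule polynomial_growth[where e = "1/4" and C = K and d = "1/20" and R = 16])
    show "G holomorphic_on - {0,1}" unfolding G_def by (intro holomorphic_intros E)
    fix z :: complex
    { assume z: "z \<notin> {0,1}" "cmod z < 1/20"
      have "cmod (G z) \<le> ((K / 16) * cmod z powr (-(1/4)) / cmod z) * (cmod z * 2)"
        unfolding G_def norm_mult using nearp[of 0 z] C(2) z K0 norm_triangle_ineq4[of z 1] by (intro mult_mono) auto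
      also have "\<dots> = (K / 8) * cmod z powr (-(1/4))" using z by simp
      also have "\<dots> \<le> K * cmod z powr (-(1/4))" using K0 by (intro mult_right_mono) auto
      finally show "cmod (G z) \<le> K * cmod z powr (-(1/4))" . }
    { assume z: "z \<notin> {0,1}" "cmod (z - 1) < 1/20"
      have "cmod (G z) \<le> ((K / 16) * cmod (z - 1) powr (-(1/4)) / cmod (z - 1)) * (2 * cmod (z - 1))"
        unfolding G_def norm_mult using nearp[of 1 z] C(3) z K0 norm_triangle_ineq2[of z 1] by (intro mult_mono) auto
      also have "\<dots> = (K / 8) * cmod (z - 1) powr (-(1/4))" using z by simp
      also have "\<dots> \<le> K * cmod (z - 1) powr (-(1/4))" using K0 by (intro mult_right_mono) auto
      finally show "cmod (G z) \<le> K * cmod (z - 1) powr (-(1/4))" . }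
    { assume z: "cmod z > 16"
      let ?x = "cmod z"
      have v: "?x / 2 < cmod v" "cmod v < 3/2 * ?x" if "v \<in> ball z (2 * (?x / 4))" for v
      proof -
        have "dist z v < ?x / 2" using that by simp
        then show "?x / 2 < cmod v" "cmod v < 3/2 * ?x"
          using norm_triangle_ineq2[of z "z - v"] norm_triangle_ineq2[of v z]
          by (auto simp: dist_norm norm_minus_commute)
      qed
      have v01: "v \<notin> {0,1}" if "v \<in> ball z (2 * (?x / 4))" for v
        using v[OF that] z by auto
      have "cmod (E z) \<le> exp 2 * ((C + 1) * (2 * ?x) powr (1/4)) / (?x / 4)"
      proof (rule grad)
        show "ball z (2 * (?x / 4)) \<subseteq> - {0,1}" using v01 by blast
        fix u assume u: "u \<in> ball z (2 * (?x / 4))"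
        have "cmod (D u) \<le> C * cmod u powr (1/4)" using C(4) v[OF u] z by simp
        also have "\<dots> \<le> C * (2 * ?x) powr (1/4)" using v[OF u] z C by (intro mult_left_mono powr_mono2) auto
        finally show "cmod (D u) \<le> C * (2 * ?x) powr (1/4)" .
      qed (use z in auto)
      also have "(2 * ?x) powr (1/4) = 2 powr (1/4) * ?x powr (1/4)" using z by (simp add: powr_mult)
      also have "exp 2 * ((C + 1) * (2 powr (1/4) * ?x powr (1/4))) / (?x / 4) \<le> exp 2 * ((C + 1) * (2 * ?x powr (1/4))) / (?x / 4)"
        using p2 C z by (intro divide_right_mono mult_left_mono mult_right_mono) auto
      also have "\<dots> = (K / 16) * ?x powr (1/4) / ?x" by (simp add: K_def)
      finally have "cmod (G z) \<le> ((K / 16) * ?x powr (1/4) / ?x) * (?x * (2 * ?x))"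
        unfolding G_def norm_mult using z norm_triangle_ineq4[of z 1] K0 by (intro mult_mono) auto
      also have "\<dots> = (K / 8) * (?x powr 1 * ?x powr (1/4))" using z by (simp add: field_simps)
      also have "\<dots> = (K / 8) * ?x powr (1 + 1/4)" unfolding powr_add ..
      also have "\<dots> \<le> K * ?x powr (real 1 + 1/4)" using K0 by (intro mult_mono) auto
      finally show "cmod (G z) \<le> K * ?x powr (real 1 + 1/4)" . }
  qed auto
  then obtain a where "\<forall>z. z \<notin> {0,1} \<longrightarrow> G z = (\<Sum>k\<le>1. a k * z ^ k)" by blast
  then have a: "G z = a 0 + a 1 * z" if "z \<notin> {0,1}" for z using that by simp
  \<comment> \<open>The residues of (a 0 + a 1 z) / (z (z - 1)) at 0 and at 1.\<close>
  define A B where "A = - a (0::nat)" and "B = a 0 + a (1::nat)"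
  have EAB: "E z = A / z + B / (z - 1)" if "z \<notin> {0,1}" for z
  proof -
    have "E z = (a 0 + a 1 * z) / (z * (z - 1))" using a[OF that] that by (simp add: G_def field_simps)
    also have "\<dots> = A / z + B / (z - 1)" using that by (simp add: A_def B_def field_simps)
    finally show ?thesis .
  qed
  have qAB: "q z = - A / cnj z - B / (cnj z - 1)" if "z \<notin> {0,1}" for z
    using EAB[OF cnj_notin_01[OF that]] by (simp add: E_def minus_equation_iff[of "q z"])
  define U where "U z = A * (Ln z - Ln (cnj z)) + B * (Ln (1 - z) - Ln (1 - cnj z))" for z
  have UW: "has_wirt U (E z) (q z) z" if "z \<in> slit" for z
  proof -
    have z01: "z \<notin> {0,1}" using that notin_01 by blast
    have L0: "has_wirt Ln (1 / z) 0 z" if "z \<in> slit" for z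
      using slit_log.l_deriv[OF that] by (simp add: has_wirt_holomorphic)
    have L1: "has_wirt (\<lambda>z. Ln (1 - z)) (1 / (z - 1)) 0 z" if "z \<in> slit" for z
    proof -
      have z: "1 - z \<notin> \<real>\<^sub>\<le>\<^sub>0" using that by (auto simp: slit_def complex_nonpos_Reals_iff)
      have "((\<lambda>z. Ln (1 - z)) has_field_derivative 1 / (1 - z) * (-1)) (at z)"
        using z by (auto intro!: derivative_eq_intros simp: inverse_eq_divide)
      also have "1 / (1 - z) * (-1) = 1 / (z - 1)" using minus_divide_right[of 1 "1 - z"] by simp
      finally show ?thesis by (simp add: has_wirt_holomorphic)
    qed
    have cs: "cnj z \<in> slit" using that by simp
    have "has_wirt U (A * (1 / z - 0) + B * (1 / (z - 1) - 0)) (A * (0 - 1 / cnj z) + B * (0 - 1 / (cnj z - 1))) z"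
      unfolding U_def[abs_def]
      by (intro has_wirt_add has_wirt_cmult has_wirt_diff L0 L1 that has_wirt_cnj[of Ln, OF L0[OF cs]]
           has_wirt_cnj[of "\<lambda>z. Ln (1 - z)", OF L1[OF cs]])
    then show ?thesis using EAB[OF z01] qAB[OF z01] by simp
  qed
  \<comment> \<open>Equal derivatives give equality up to a constant, and both functions vanish at
    the real point 1/2: \<open>D\<close> by antisymmetry, \<open>U\<close> by inspection.\<close>
  have DU: "D z = U z" if "z \<in> slit" for z
  proof -
    have half: "1/2 \<in> slit" by (simp add: slit_def)
    have "((\<lambda>z. D z - U z) has_field_derivative 0) (at w)" if "w \<in> slit" for w
      using has_wirt_diff[OF DE[of w] UW[OF that]] notin_01(1)[OF that] by (simp add: has_wirt_holomorphic)
    from deriv_zero_imp_eq[OF open_slit connected_slit this that half]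
    have "D z - U z = D (1/2) - U (1/2)" .
    moreover have "D (1/2) = 0" using anti[of "1/2"] by simp
    moreover have "U (1/2) = 0" by (simp add: U_def)
    ultimately show ?thesis by simp
  qed
  \<comment> \<open>\<open>V\<close> is the form \<open>U\<close> takes when continued from the
    upper half plane to the negative axis. At -1 the term with \<open>B\<close> cancels and that
    with \<open>A\<close> leaves the jump \<open>2 * \<i> * pi\<close>, whereas \<open>D\<close>
    vanishes there.\<close>
  have A0: "A = 0"
  proof -
    define V where "V z = A * (Ln (-z) - Ln (- cnj z) + 2 * \<i> * pi) + B * (Ln (1 - z) - Ln (1 - cnj z))" for z
    have "D (-1) = V (-1)"
    proof (rule eq_from_above[where S = UNIV and f = D and g = V and z = "-1"])
      show "isCont D (-1)" using has_wirt_isCont[OF D[of "-1"]] by simp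
      have c1: "isCont (\<lambda>z. Ln (- z)) (-1)" "isCont (\<lambda>z. Ln (- cnj z)) (-1)" "isCont (\<lambda>z. Ln (1 - z)) (-1)" "isCont (\<lambda>z. Ln (1 - cnj z)) (-1)"
        by (auto intro!: continuous_intros simp: complex_nonpos_Reals_iff)
      show "isCont V (-1)" unfolding V_def by (intro continuous_intros c1)
      fix w :: complex assume "Im (-1) < Im w"
      then have w: "Im w > 0" by simp
      then have "w \<in> slit" by (auto simp: slit_def)
      moreover have "Ln (-w) = Ln w - \<i> * pi" "Ln (- cnj w) = Ln (cnj w) + \<i> * pi"
        using Ln_minus_upper[OF w] Ln_minus_lower[of "cnj w"] w by auto
      ultimately show "D w = V w" using DU[of w] by (simp add: U_def V_def algebra_simps)
    qed auto
    moreover have "D (-1) = 0" using anti[of "-1"] by simp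
    moreover have "V (-1) = A * (2 * \<i> * pi)" by (simp add: V_def)
    ultimately show ?thesis by simp
  qed
  have B0: "B = 0"
  proof -
    define V where "V z = B * (Ln (z - 1) - Ln (cnj z - 1) - 2 * \<i> * pi)" for z
    have "D 2 = V 2"
    proof (rule eq_from_above[where S = UNIV and f = D and g = V and z = 2])
      show "isCont D 2" using has_wirt_isCont[OF D[of 2]] by simp
      have c1: "isCont (\<lambda>z. Ln (z - 1)) 2" "isCont (\<lambda>z. Ln (cnj z - 1)) 2"
        by (auto intro!: continuous_intros simp: complex_nonpos_Reals_iff)
      show "isCont V 2" unfolding V_def by (intro continuous_intros c1)
      fix w :: complex assume "Im 2 < Im w"
      then have w: "Im w > 0" by simp
      then have "w \<in> slit" by (auto simp: slit_def)
      then have "D w = B * (Ln (1 - w) - Ln (1 - cnj w))" using DU[of w] A0 by (simp add: U_def)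
      moreover have "Ln (1 - w) = Ln (w - 1) - \<i> * pi" "Ln (1 - cnj w) = Ln (cnj w - 1) + \<i> * pi"
        using Ln_minus_upper[of "w - 1"] Ln_minus_lower[of "cnj w - 1"] w by auto
      ultimately show "D w = V w" by (simp add: V_def)
    qed auto
    moreover have "D 2 = 0" using anti[of 2] by simp
    moreover have "V 2 = B * (- 2 * \<i> * pi)" by (simp add: V_def)
    ultimately show ?thesis by simp
  qed
  show ?thesis
  proof (rule eq_off_real[where f = D and g = "\<lambda>z. 0" and S = "- {0,1}"])
    show "isCont D z" using D[OF z] has_wirt_isCont by blast
    show "D w = 0" if "Im w \<noteq> 0" for w
      using DU[of w] that by (auto simp: slit_def U_def A0 B0)
  qed (use z in \<open>auto intro: open_Compl\<close>)
qed

section \<open>Gaussian smoothing of the Newtonian potential in dimension four\<close>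

definition gs :: "real \<Rightarrow> real^4 \<Rightarrow> real" where
  "gs s x = (s / pi)\<^sup>2 * exp (- s * (norm x)\<^sup>2)"

text \<open>What the kernel 1 / |x|^2 loses when it is averaged against the Gaussian
  \<open>gs s\<close>, see \<open>gs_conv_newton\<close>: a concentrated positive kernel of total
  mass pi^2 / s.\<close>

definition ws :: "real \<Rightarrow> real^4 \<Rightarrow> real" where
  "ws s x = exp (- s * (norm x)\<^sup>2) / (norm x)\<^sup>2"

lemma gs_measurable [measurable]: "gs s \<in> borel_measurable borel"
  unfolding gs_def by measurable

lemma ws_measurable [measurable]: "ws s \<in> borel_measurable borel"
  unfolding ws_def by measurable

lemma gs_nonneg [simp]: "gs s x \<ge> 0" and ws_nonneg [simp]: "ws s x \<ge> 0"
  by (simp_all add: gs_def ws_def)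

definition g1 :: "real \<Rightarrow> real \<Rightarrow> real" where
  "g1 s t = sqrt (s / pi) * exp (- s * t\<^sup>2)"

lemma g1_normal: "s > 0 \<Longrightarrow> g1 s t = normal_density 0 (sqrt (1 / (2 * s))) t"
  by (simp add: g1_def normal_density_def real_sqrt_divide field_simps)

lemma gs_prod: assumes "s > 0" shows "gs s x = (\<Prod>b\<in>Basis. g1 s (x \<bullet> b))"
proof -
  have n: "(norm x)\<^sup>2 = (\<Sum>b\<in>Basis. (x \<bullet> b)\<^sup>2)"
    unfolding power2_norm_eq_inner by (subst euclidean_inner) (simp add: power2_eq_square)
  have "(\<Prod>b\<in>Basis. g1 s (x \<bullet> b)) = sqrt (s / pi) ^ 4 * exp (\<Sum>b\<in>Basis. - s * (x \<bullet> b)\<^sup>2)"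
    by (simp add: g1_def prod.distrib exp_sum)
  also have "sqrt (s / pi) ^ 4 = ((sqrt (s / pi))\<^sup>2)\<^sup>2" by (simp flip: power_mult)
  also have "\<dots> = (s / pi)\<^sup>2" using assms by simp
  also have "(\<Sum>b\<in>Basis. - s * (x \<bullet> b)\<^sup>2) = - s * (norm x)\<^sup>2" unfolding n sum_distrib_left ..
  finally show ?thesis by (simp add: gs_def)
qed

lemma nn_integral_g1: assumes "s > 0" shows "(\<integral>\<^sup>+t. ennreal (g1 s t) \<partial>lborel) = 1"
proof -
  let ?\<sigma> = "sqrt (1 / (2 * s))"
  have sg: "?\<sigma> > 0" using assms by simp
  have "(\<integral>\<^sup>+t. ennreal (normal_density 0 ?\<sigma> t) \<partial>lborel) = ennreal (\<integral>t. normal_density 0 ?\<sigma> t \<partial>lborel)"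
    by (rule nn_integral_eq_integral) (use sg in auto)
  then show ?thesis using sg assms by (simp add: g1_normal)
qed

lemma nn_integral_g1_sq: assumes "s > 0" shows "(\<integral>\<^sup>+t. ennreal (g1 s t * t\<^sup>2) \<partial>lborel) = ennreal (1 / (2 * s))"
proof -
  let ?\<sigma> = "sqrt (1 / (2 * s))"
  have sg: "?\<sigma> > 0" using assms by simp
  have h: "has_bochner_integral lborel (\<lambda>t. g1 s t * t\<^sup>2) (1 / (2 * s))"
    using normal_moment_even[OF sg, of 0 1] assms by (simp add: g1_normal fact_numeral)
  show ?thesis
    using nn_integral_eq_integral[of lborel "\<lambda>t. g1 s t * t\<^sup>2"] h assms
    by (auto simp: has_bochner_integral_iff g1_def)
qed

lemma nn_integral_gs: assumes "s > 0" shows "(\<integral>\<^sup>+x. ennreal (gs s x) \<partial>lborel) = 1"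
proof -
  have "(\<integral>\<^sup>+x. ennreal (gs s x) \<partial>lborel) = (\<integral>\<^sup>+x. (\<Prod>b\<in>Basis. ennreal (g1 s (x \<bullet> b))) \<partial>(lborel :: (real^4) measure))"
    using assms by (intro nn_integral_cong) (subst prod_ennreal, auto simp: gs_prod g1_def)
  also have "\<dots> = (\<Prod>b\<in>(Basis :: (real^4) set). (\<integral>\<^sup>+t. ennreal (g1 s t) \<partial>lborel))"
    by (rule nn_integral_lborel_prod) (auto simp: g1_def)
  finally show ?thesis by (simp add: nn_integral_g1[OF assms])
qed

lemma nn_integral_gs_sq:
  assumes "s > 0" "b \<in> Basis"
  shows "(\<integral>\<^sup>+x. ennreal (gs s x * (x \<bullet> b)\<^sup>2) \<partial>lborel) = ennreal (1 / (2 * s))"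
proof -
  define F where "F c t = g1 s t * (if c = b then t\<^sup>2 else 1)" for c :: "real^4" and t
  have F0: "F c t \<ge> 0" for c t using assms by (simp add: F_def g1_def)
  have "gs s x * (x \<bullet> b)\<^sup>2 = (\<Prod>c\<in>Basis. F c (x \<bullet> c))" for x
  proof -
    have "(\<Prod>c\<in>Basis. F c (x \<bullet> c)) = gs s x * (\<Prod>c\<in>Basis. if c = b then (x \<bullet> c)\<^sup>2 else 1)"
      unfolding F_def prod.distrib gs_prod[OF assms(1)] ..
    then show ?thesis using assms(2) by simp
  qed
  then have "(\<integral>\<^sup>+x. ennreal (gs s x * (x \<bullet> b)\<^sup>2) \<partial>lborel) = (\<integral>\<^sup>+x. (\<Prod>c\<in>Basis. ennreal (F c (x \<bullet> c))) \<partial>(lborel :: (real^4) measure))"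
    using F0 by (intro nn_integral_cong) (simp add: prod_ennreal)
  also have "\<dots> = (\<Prod>c\<in>(Basis :: (real^4) set). (\<integral>\<^sup>+t. ennreal (F c t) \<partial>lborel))"
    by (rule nn_integral_lborel_prod) (auto simp: F_def g1_def)
  also have "\<dots> = (\<Prod>c\<in>(Basis :: (real^4) set). if c = b then ennreal (1 / (2 * s)) else 1)"
    by (intro prod.cong refl) (simp add: F_def nn_integral_g1[OF assms(1)] nn_integral_g1_sq[OF assms(1)])
  finally show ?thesis using assms(2) by simp
qed

lemma nn_integral_translate:
  fixes f :: "real^4 \<Rightarrow> ennreal"
  assumes [measurable]: "f \<in> borel_measurable borel"
  shows "(\<integral>\<^sup>+x. f (a + x) \<partial>lborel) = (\<integral>\<^sup>+x. f x \<partial>lborel)"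
proof -
  have "(\<integral>\<^sup>+x. f x \<partial>lborel) = (\<integral>\<^sup>+x. f x \<partial>(distr lborel borel ((+) a)))"
    by (simp add: lborel_distr_plus)
  also have "\<dots> = (\<integral>\<^sup>+x. f (a + x) \<partial>lborel)" by (subst nn_integral_distr) auto
  finally show ?thesis ..
qed

text \<open>Completing the square in \<open>h\<close> about the centre \<open>c\<close> leaves a
  Gaussian of parameter s + t, whose mass is 1. The exponent 2 of s / (s + t) is half the
  dimension.\<close>

lemma gs_conv_exp:
  assumes s: "s > 0" and t: "t \<ge> 0"
  shows "(\<integral>\<^sup>+h. ennreal (gs s h * exp (- t * (norm (x - h))\<^sup>2)) \<partial>lborel)
     = ennreal ((s / (s + t))\<^sup>2 * exp (- (s * t / (s + t)) * (norm x)\<^sup>2))"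
proof -
  define c where "c = (t / (s + t)) *\<^sub>R x"
  have st: "s + t > 0" using s t by simp
  have sq: "s * (norm h)\<^sup>2 + t * (norm (x - h))\<^sup>2 = (s + t) * (norm (h - c))\<^sup>2 + (s * t / (s + t)) * (norm x)\<^sup>2" for h
  proof -
    have 1: "(norm (x - h))\<^sup>2 = (norm x)\<^sup>2 - 2 * (x \<bullet> h) + (norm h)\<^sup>2"
      unfolding power2_norm_eq_inner by (simp add: inner_diff inner_commute)
    have 2: "(norm (h - c))\<^sup>2 = (norm h)\<^sup>2 - 2 * (t / (s + t)) * (x \<bullet> h) + (t / (s + t))\<^sup>2 * (norm x)\<^sup>2"
      unfolding power2_norm_eq_inner c_def by (simp add: inner_diff inner_commute power2_eq_square)
    have 3: "(s + t) * (t / (s + t))\<^sup>2 + s * t / (s + t) = t"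
    proof -
      have "(s + t) * (t / (s + t))\<^sup>2 = t * t / (s + t)" using st by (simp add: power2_eq_square)
      then have "(s + t) * (t / (s + t))\<^sup>2 + s * t / (s + t) = t * (s + t) / (s + t)"
        by (simp add: add_divide_distrib[symmetric] algebra_simps)
      then show ?thesis using st by simp
    qed
    have "(s + t) * (norm (h - c))\<^sup>2 + (s * t / (s + t)) * (norm x)\<^sup>2
       = (s + t) * (norm h)\<^sup>2 - 2 * ((s + t) * (t / (s + t))) * (x \<bullet> h) + ((s + t) * (t / (s + t))\<^sup>2 + s * t / (s + t)) * (norm x)\<^sup>2"
      unfolding 2 by (simp add: algebra_simps)
    also have "\<dots> = (s + t) * (norm h)\<^sup>2 - 2 * t * (x \<bullet> h) + t * (norm x)\<^sup>2" unfolding 3 using st by simp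
    also have "\<dots> = s * (norm h)\<^sup>2 + t * (norm (x - h))\<^sup>2" unfolding 1 by (simp add: algebra_simps)
    finally show ?thesis ..
  qed
  define K where "K = (s / (s + t))\<^sup>2 * exp (- (s * t / (s + t)) * (norm x)\<^sup>2)"
  have "gs s h * exp (- t * (norm (x - h))\<^sup>2) = K * gs (s + t) (- c + h)" for h
  proof -
    have "exp (- s * (norm h)\<^sup>2) * exp (- t * (norm (x - h))\<^sup>2) = exp (- (s + t) * (norm (h - c))\<^sup>2) * exp (- (s * t / (s + t)) * (norm x)\<^sup>2)"
      unfolding exp_add[symmetric] by (simp only: mult_minus_left minus_add_distrib[symmetric] sq)
    then have "gs s h * exp (- t * (norm (x - h))\<^sup>2)
      = (s / pi)\<^sup>2 * (exp (- (s + t) * (norm (h - c))\<^sup>2) * exp (- (s * t / (s + t)) * (norm x)\<^sup>2))"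
      unfolding gs_def by (simp only: mult.assoc)
    also have "(s / pi)\<^sup>2 = (s / (s + t))\<^sup>2 * ((s + t) / pi)\<^sup>2"
      using st by (simp flip: power_mult_distrib)
    also have "h - c = - c + h" by simp
    finally show ?thesis unfolding K_def gs_def by (simp only: mult_ac)
  qed
  then have "(\<integral>\<^sup>+h. ennreal (gs s h * exp (- t * (norm (x - h))\<^sup>2)) \<partial>lborel) = (\<integral>\<^sup>+h. ennreal K * ennreal (gs (s + t) (- c + h)) \<partial>lborel)"
    by (simp add: ennreal_mult' K_def)
  also have "\<dots> = ennreal K * (\<integral>\<^sup>+h. ennreal (gs (s + t) (- c + h)) \<partial>lborel)"
    by (rule nn_integral_cmult) measurable
  also have "(\<integral>\<^sup>+h. ennreal (gs (s + t) (- c + h)) \<partial>lborel) = 1"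
    using nn_integral_translate[of "\<lambda>h. ennreal (gs (s + t) h)" "- c"] nn_integral_gs[OF st] by simp
  finally show ?thesis by (simp add: K_def)
qed

lemma nn_integral_exp_tail:
  assumes "A > 0" 
  shows "(\<integral>\<^sup>+t. ennreal (exp (- t * A)) * indicator {a..} t \<partial>lborel) = ennreal (exp (- a * A) / A)"
proof -
  have "(\<integral>\<^sup>+t. ennreal (exp (- t * A)) * indicator {a..} t \<partial>lborel) = 0 - (- (exp (- a * A) / A))"
  proof (rule nn_integral_FTC_atLeast)
    show "((\<lambda>t. - (exp (- t * A) / A)) has_real_derivative exp (- t * A)) (at t)" for t
      using assms by (auto intro!: derivative_eq_intros)
    have "((\<lambda>t. exp (- t * A)) \<longlongrightarrow> 0) at_top"
      using assms by real_asymp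
    from tendsto_minus[OF tendsto_divide[OF this tendsto_const, of A]]
    show "((\<lambda>t. - (exp (- t * A) / A)) \<longlongrightarrow> 0) at_top" using assms by simp
  qed auto
  then show ?thesis by simp
qed

text \<open>Write the Newtonian kernel \<open>1 / |x|^2\<close> as the integral of \<open>exp (- t |x|^2)\<close> over \<open>t\<close>.\<close>
lemma gs_conv_newton:
  assumes s: "s > 0" and x: "x \<noteq> 0"
  shows "(\<integral>\<^sup>+h. ennreal (gs s h) * ennreal (1 / (norm (x - h))\<^sup>2) \<partial>lborel) + ennreal (ws s x) = ennreal (1 / (norm x)\<^sup>2)"
proof -
  define A where "A = (norm x)\<^sup>2"
  have A: "A > 0" using x by (simp add: A_def)
  have "(\<integral>\<^sup>+h. ennreal (gs s h) * ennreal (1 / (norm (x - h))\<^sup>2) \<partial>lborel)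
    = (\<integral>\<^sup>+h. (\<integral>\<^sup>+t. ennreal (gs s h * exp (- t * (norm (x - h))\<^sup>2)) * indicator {0..} t \<partial>lborel) \<partial>lborel)"
  proof (rule nn_integral_cong_AE)
    show "AE h in lborel. ennreal (gs s h) * ennreal (1 / (norm (x - h))\<^sup>2) = (\<integral>\<^sup>+t. ennreal (gs s h * exp (- t * (norm (x - h))\<^sup>2)) * indicator {0..} t \<partial>lborel)"
      using AE_lborel_singleton[of x]
    proof eventually_elim
      case (elim h)
      then have "(norm (x - h))\<^sup>2 > 0" by simp
      from nn_integral_exp_tail[OF this, of 0]
      have "ennreal (1 / (norm (x - h))\<^sup>2) = (\<integral>\<^sup>+t. ennreal (exp (- t * (norm (x - h))\<^sup>2)) * indicator {0..} t \<partial>lborel)" by simp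
      then have "ennreal (gs s h) * ennreal (1 / (norm (x - h))\<^sup>2) = (\<integral>\<^sup>+t. ennreal (gs s h) * (ennreal (exp (- t * (norm (x - h))\<^sup>2)) * indicator {0..} t) \<partial>lborel)"
        by (simp add: nn_integral_cmult)
      then show ?case by (simp add: ennreal_mult' mult.assoc)
    qed
  qed
  also have "\<dots> = (\<integral>\<^sup>+t. (\<integral>\<^sup>+h. ennreal (gs s h * exp (- t * (norm (x - h))\<^sup>2)) * indicator {0..} t \<partial>lborel) \<partial>lborel)"
    by (rule lborel_pair.Fubini') measurable
  also have "\<dots> = (\<integral>\<^sup>+t. ennreal ((s / (s + t))\<^sup>2 * exp (- (s * t / (s + t)) * A)) * indicator {0..} t \<partial>lborel)"
  proof (rule nn_integral_cong)
    fix t :: real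
    show "(\<integral>\<^sup>+h. ennreal (gs s h * exp (- t * (norm (x - h))\<^sup>2)) * indicator {0..} t \<partial>lborel) = ennreal ((s / (s + t))\<^sup>2 * exp (- (s * t / (s + t)) * A)) * indicator {0..} t"
      using gs_conv_exp[OF s, of t x] by (auto simp: A_def split: split_indicator)
  qed
  also have "\<dots> = ennreal (- (exp (- s * A) / A) - (- (exp (- (s * 0 / (s + 0)) * A) / A)))"
  proof (rule nn_integral_FTC_atLeast)
    show "((\<lambda>t. - (exp (- (s * t / (s + t)) * A) / A)) has_real_derivative (s / (s + t))\<^sup>2 * exp (- (s * t / (s + t)) * A)) (at t)" if "0 \<le> t" for t
    proof -
      \<comment> \<open>In dimension four the prefactor (s / (s + t))^2 is exactly the derivative of
        \<open>u\<close>, so the integrand is that of exp (- A u) and has an elementary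
        primitive.\<close>
      define u where "u t = s * t / (s + t)" for t
      have "(u has_real_derivative (s / (s + t))\<^sup>2) (at t)"
        unfolding u_def using s that by (auto intro!: derivative_eq_intros simp: power2_eq_square field_simps)
      then show ?thesis using A unfolding u_def[symmetric] by (auto intro!: derivative_eq_intros)
    qed
    have "((\<lambda>t. s - s\<^sup>2 / (s + t)) \<longlongrightarrow> s - 0) at_top"
      by (intro tendsto_intros tendsto_divide_0[OF tendsto_const] filterlim_at_top_imp_at_infinity filterlim_tendsto_add_at_top[OF tendsto_const] filterlim_ident)
    moreover have "\<forall>\<^sub>F t in at_top. s - s\<^sup>2 / (s + t) = s * t / (s + t)"
      using eventually_gt_at_top[of 0] by eventually_elim (use s in \<open>simp add: field_simps power2_eq_square\<close>)
    ultimately have "((\<lambda>t. s * t / (s + t)) \<longlongrightarrow> s) at_top" by (simp add: Lim_transform_eventually)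
    then show "((\<lambda>t. - (exp (- (s * t / (s + t)) * A) / A)) \<longlongrightarrow> - (exp (- s * A) / A)) at_top"
      using A by (intro tendsto_intros) auto
  qed auto
  also have "\<dots> + ennreal (ws s x) = ennreal (1 / A)"
    using A s by (subst ennreal_plus[symmetric]) (auto simp: ws_def A_def field_simps)
  finally show ?thesis by (simp add: A_def)
qed

text \<open>Here \<open>ws s\<close> is the integral of exp (- t |h|^2) over t from \<open>s\<close>
  on. Integrating over h first leaves pi^2 / t^2.\<close>

lemma nn_integral_ws:
  assumes s: "s > 0" shows "(\<integral>\<^sup>+h. ennreal (ws s h) \<partial>lborel) = ennreal (pi\<^sup>2 / s)"
proof -
  have "(\<integral>\<^sup>+h. ennreal (ws s h) \<partial>lborel) = (\<integral>\<^sup>+h. (\<integral>\<^sup>+t. ennreal (exp (- t * (norm h)\<^sup>2)) * indicator {s..} t \<partial>lborel) \<partial>(lborel :: (real^4) measure))"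
  proof (rule nn_integral_cong_AE)
    show "AE h in lborel. ennreal (ws s h) = (\<integral>\<^sup>+t. ennreal (exp (- t * (norm h)\<^sup>2)) * indicator {s..} t \<partial>lborel)"
      using AE_lborel_singleton[of 0]
      by eventually_elim (subst nn_integral_exp_tail, auto simp: ws_def)
  qed
  also have "\<dots> = (\<integral>\<^sup>+t. (\<integral>\<^sup>+h. ennreal (exp (- t * (norm h)\<^sup>2)) * indicator {s..} t \<partial>(lborel :: (real^4) measure)) \<partial>lborel)"
    by (rule lborel_pair.Fubini') measurable
  also have "\<dots> = (\<integral>\<^sup>+t. ennreal (pi\<^sup>2 / t\<^sup>2) * indicator {s..} t \<partial>lborel)"
  proof (rule nn_integral_cong)
    fix t :: real
    have "(\<integral>\<^sup>+h. ennreal (exp (- t * (norm h)\<^sup>2)) \<partial>(lborel :: (real^4) measure)) = ennreal (pi\<^sup>2 / t\<^sup>2)" if "t \<ge> s"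
    proof -
      have t: "t > 0" using that s by simp
      have "(\<integral>\<^sup>+h. ennreal (exp (- t * (norm h)\<^sup>2)) \<partial>(lborel :: (real^4) measure)) = (\<integral>\<^sup>+h. ennreal (pi\<^sup>2 / t\<^sup>2) * ennreal (gs t h) \<partial>lborel)"
        using t by (intro nn_integral_cong) (simp add: gs_def ennreal_mult'[symmetric] power_divide)
      also have "\<dots> = ennreal (pi\<^sup>2 / t\<^sup>2)" by (subst nn_integral_cmult) (auto simp: nn_integral_gs[OF t])
      finally show ?thesis .
    qed
    then show "(\<integral>\<^sup>+h. ennreal (exp (- t * (norm h)\<^sup>2)) * indicator {s..} t \<partial>(lborel :: (real^4) measure)) = ennreal (pi\<^sup>2 / t\<^sup>2) * indicator {s..} t"
      by (auto split: split_indicator)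
  qed
  also have "\<dots> = ennreal (0 - (- (pi\<^sup>2 / s)))"
  proof (rule nn_integral_FTC_atLeast)
    show "((\<lambda>t. - (pi\<^sup>2 / t)) has_real_derivative pi\<^sup>2 / t\<^sup>2) (at t)" if "s \<le> t" for t
      using that s by (auto intro!: derivative_eq_intros simp: power2_eq_square)
    show "((\<lambda>t. - (pi\<^sup>2 / t)) \<longlongrightarrow> 0) at_top"
      by real_asymp
  qed auto
  finally show ?thesis by simp
qed

text \<open>Tonelli's theorem and \<open>gs_conv_newton\<close>. Working in \<open>ennreal\<close>
  permits the exchange of integrals before any finiteness is known, and a sum replaces the
  difference that Poisson's equation would suggest.\<close>

lemma potential_smoothing:
  fixes f :: "real^4 \<Rightarrow> ennreal"
  assumes [measurable]: "f \<in> borel_measurable borel" and s: "s > 0"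
  defines "U \<equiv> \<lambda>x. \<integral>\<^sup>+y. ennreal (1 / (norm (y - x))\<^sup>2) * f y \<partial>lborel"
  shows "U x = (\<integral>\<^sup>+h. ennreal (gs s h) * U (x + h) \<partial>lborel) + (\<integral>\<^sup>+h. ennreal (ws s h) * f (x + h) \<partial>lborel)"
proof -
  have "(\<integral>\<^sup>+h. ennreal (gs s h) * U (x + h) \<partial>lborel)
     = (\<integral>\<^sup>+h. (\<integral>\<^sup>+y. ennreal (gs s h) * (ennreal (1 / (norm (y - (x + h)))\<^sup>2) * f y) \<partial>lborel) \<partial>lborel)"
    unfolding U_def by (intro nn_integral_cong nn_integral_cmult[symmetric]) measurable
  also have "\<dots> = (\<integral>\<^sup>+y. (\<integral>\<^sup>+h. ennreal (gs s h) * (ennreal (1 / (norm (y - (x + h)))\<^sup>2) * f y) \<partial>lborel) \<partial>lborel)"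
    by (rule lborel_pair.Fubini') measurable
  also have "\<dots> = (\<integral>\<^sup>+y. (\<integral>\<^sup>+h. ennreal (gs s h) * ennreal (1 / (norm ((y - x) - h))\<^sup>2) \<partial>lborel) * f y \<partial>lborel)"
    by (intro nn_integral_cong) (simp add: nn_integral_multc[symmetric] mult.assoc diff_diff_add)
  finally have 1: "(\<integral>\<^sup>+h. ennreal (gs s h) * U (x + h) \<partial>lborel) = \<dots>" .
  have "(\<integral>\<^sup>+h. ennreal (ws s h) * f (x + h) \<partial>lborel) = (\<integral>\<^sup>+h. ennreal (ws s ((x + h) - x)) * f (x + h) \<partial>lborel)" by simp
  also have "\<dots> = (\<integral>\<^sup>+y. ennreal (ws s (y - x)) * f y \<partial>lborel)"
    by (rule nn_integral_translate[of "\<lambda>y. ennreal (ws s (y - x)) * f y"]) measurable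
  finally have 2: "(\<integral>\<^sup>+h. ennreal (ws s h) * f (x + h) \<partial>lborel) = \<dots>" .
  have "U x = (\<integral>\<^sup>+y. ((\<integral>\<^sup>+h. ennreal (gs s h) * ennreal (1 / (norm ((y - x) - h))\<^sup>2) \<partial>lborel) * f y + ennreal (ws s (y - x)) * f y) \<partial>lborel)"
    unfolding U_def
  proof (rule nn_integral_cong_AE)
    show "AE y in lborel. ennreal (1 / (norm (y - x))\<^sup>2) * f y = (\<integral>\<^sup>+h. ennreal (gs s h) * ennreal (1 / (norm ((y - x) - h))\<^sup>2) \<partial>lborel) * f y + ennreal (ws s (y - x)) * f y"
      using AE_lborel_singleton[of x]
    proof eventually_elim
      case (elim y)
      then have "y - x \<noteq> 0" by simp
      from gs_conv_newton[OF s this] show ?case by (simp only: distrib_right[symmetric])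
    qed
  qed
  also have "\<dots> = (\<integral>\<^sup>+y. (\<integral>\<^sup>+h. ennreal (gs s h) * ennreal (1 / (norm ((y - x) - h))\<^sup>2) \<partial>lborel) * f y \<partial>lborel) + (\<integral>\<^sup>+y. ennreal (ws s (y - x)) * f y \<partial>lborel)"
    by (rule nn_integral_add) measurable
  finally show ?thesis unfolding 1 2 .
qed

section \<open>Reflections\<close>

text \<open>Reflection in the hyperplane orthogonal to \<open>n\<close>; for \<open>n = 0\<close>
  the quotient is 0 and the map is the identity.\<close>

definition reflect :: "real^4 \<Rightarrow> real^4 \<Rightarrow> real^4" where
  "reflect n x = x - (2 * (x \<bullet> n) / (n \<bullet> n)) *\<^sub>R n"

lemma reflect_linear: "linear (reflect n)"
  by (rule linearI) (auto simp: reflect_def inner_add_left algebra_simps add_divide_distrib)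

lemma reflect_reflect: "reflect n (reflect n x) = x"
proof (cases "n = 0")
  case False
  then have "n \<bullet> n \<noteq> 0" by simp
  then show ?thesis by (simp add: reflect_def inner_diff_left algebra_simps diff_divide_distrib)
qed (simp add: reflect_def)

lemma reflect_orthogonal: "orthogonal_transformation (reflect n)"
proof (cases "n = 0")
  case False
  then have "n \<bullet> n \<noteq> 0" by simp
  then have "reflect n x \<bullet> reflect n y = x \<bullet> y" for x y
    by (simp add: reflect_def inner_diff_left inner_diff_right inner_commute field_simps)
  then show ?thesis using reflect_linear unfolding orthogonal_transformation_def by blast
next
  case True
  then have "reflect n = (\<lambda>x. x)" by (simp add: reflect_def fun_eq_iff)
  then show ?thesis by (simp add: orthogonal_transformation_id)
qed

lemma norm_reflect [simp]: "norm (reflect n x) = norm x"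
  using reflect_orthogonal orthogonal_transformation_norm by blast

lemma reflect_diff: "reflect n x - reflect n y = reflect n (x - y)"
  using linear_diff[OF reflect_linear] by metis

lemma reflect_measurable [measurable]: "reflect n \<in> borel_measurable borel"
  using linear_continuous_on[OF linear_conv_bounded_linear[THEN iffD1, OF reflect_linear]] borel_measurable_continuous_onI by blast

lemma distr_reflect: "distr lborel borel (reflect n) = lborel"
proof (rule lborel_eqI[symmetric])
  fix l u :: "real^4" assume "\<And>b. b \<in> Basis \<Longrightarrow> l \<bullet> b \<le> u \<bullet> b"
  then have e: "emeasure lborel (box l u) = ennreal (\<Prod>b\<in>Basis. (u - l) \<bullet> b)" by (simp add: emeasure_lborel_box)
  have v: "reflect n -` box l u = reflect n ` box l u"
    using reflect_reflect[of n] by (auto simp: image_iff) metis+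
  have lm: "box l u \<in> lmeasurable" by simp
  have "emeasure lborel (reflect n -` box l u) = emeasure lebesgue (reflect n ` box l u)"
  proof -
    have "reflect n -` box l u \<in> sets borel" using measurable_sets[OF reflect_measurable, of "box l u" n] by simp
    then show ?thesis unfolding v by simp
  qed
  also have "\<dots> = emeasure lebesgue (box l u)"
    unfolding emeasure_eq_measure2[OF lm] emeasure_eq_measure2[OF measurable_orthogonal_image[OF reflect_orthogonal lm]]
      measure_orthogonal_image[OF reflect_orthogonal lm] ..
  also have "\<dots> = emeasure lborel (box l u)" by simp
  finally show "emeasure (distr lborel borel (reflect n)) (box l u) = ennreal (\<Prod>b\<in>Basis. (u - l) \<bullet> b)"
    using e by (subst emeasure_distr) auto
qed simp

lemma integral_reflect:
  fixes f :: "real^4 \<Rightarrow> real"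
  assumes [measurable]: "f \<in> borel_measurable borel"
  shows "(\<integral>x. f (reflect n x) \<partial>lborel) = (\<integral>x. f x \<partial>lborel)"
  using integral_distr[of "reflect n" lborel borel f] by (simp add: distr_reflect)

text \<open>Shared by the two limits below, with \<open>gs\<close> and r = |h|^2 for the mean value,
  and with \<open>ws\<close> and r = 1 for the source. Near 0 the function \<open>w\<close> is at
  most epsilon times \<open>r\<close>, whose scaled integral stays below \<open>C\<close>. Far out,
  \<open>K s\<close> is dominated by a multiple of \<open>K 1\<close> that tends to 0 even after
  multiplication by s, so integrability against \<open>K 1\<close> controls the tail.\<close>

lemma concentrated_limit:
  fixes K :: "real \<Rightarrow> real^4 \<Rightarrow> real"
  assumes K [measurable]: "\<And>s. K s \<in> borel_measurable borel" and K0: "\<And>s h. K s h \<ge> 0"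
    and tail: "\<And>\<delta> s h. 0 < \<delta> \<Longrightarrow> 1 \<le> s \<Longrightarrow> \<delta> \<le> norm h \<Longrightarrow> K s h \<le> T \<delta> s * K 1 h"
    and T: "\<And>\<delta>. 0 < \<delta> \<Longrightarrow> ((\<lambda>s. s * T \<delta> s) \<longlongrightarrow> 0) at_top" "\<And>\<delta> s. T \<delta> s \<ge> 0"
    and r0: "\<And>h. r h \<ge> 0" and ir: "\<And>s. 1 \<le> s \<Longrightarrow> integrable lborel (\<lambda>h. K s h * r h)"
    and C: "\<And>s. 1 \<le> s \<Longrightarrow> s * (\<integral>h. K s h * r h \<partial>lborel) \<le> C"
    and w [measurable]: "w \<in> borel_measurable borel" and iw: "integrable lborel (\<lambda>h. K 1 h * w h)"
    and small: "\<And>\<epsilon>. 0 < \<epsilon> \<Longrightarrow> \<exists>\<delta>>0. \<forall>h. norm h < \<delta> \<longrightarrow> \<bar>w h\<bar> \<le> \<epsilon> * r h"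
  shows "1 \<le> s \<Longrightarrow> integrable lborel (\<lambda>h. K s h * w h)"
    and "((\<lambda>s. s * (\<integral>h. K s h * w h \<partial>lborel)) \<longlongrightarrow> 0) at_top"
proof -
  have bound: "\<bar>K s h * w h\<bar> \<le> \<epsilon> * (K s h * r h) + T \<delta> s * \<bar>K 1 h * w h\<bar>"
    if \<epsilon>: "\<epsilon> > 0" and \<delta>: "\<delta> > 0" and d: "\<forall>h. norm h < \<delta> \<longrightarrow> \<bar>w h\<bar> \<le> \<epsilon> * r h" and s: "1 \<le> s" for \<epsilon> \<delta> s h
  proof (cases "norm h < \<delta>")
    case True
    then have "K s h * \<bar>w h\<bar> \<le> K s h * (\<epsilon> * r h)" using d K0 by (intro mult_left_mono) auto
    moreover have "T \<delta> s * \<bar>K 1 h * w h\<bar> \<ge> 0" using T by simp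
    ultimately show ?thesis by (simp add: abs_mult K0 mult_ac)
  next
    case False
    then have "K s h * \<bar>w h\<bar> \<le> (T \<delta> s * K 1 h) * \<bar>w h\<bar>" using tail[OF \<delta> s] by (intro mult_right_mono) auto
    moreover have "\<epsilon> * (K s h * r h) \<ge> 0" using \<epsilon> K0 r0 by simp
    ultimately show ?thesis by (simp add: abs_mult K0 mult_ac)
  qed
  have iR: "integrable lborel (\<lambda>h. \<epsilon> * (K s h * r h) + T \<delta> s * \<bar>K 1 h * w h\<bar>)" if "1 \<le> s" for \<epsilon> \<delta> s
    using ir[OF that] iw by (intro Bochner_Integration.integrable_add integrable_mult_right integrable_abs)
  have int: "integrable lborel (\<lambda>h. K s h * w h)" if s: "1 \<le> s" for s
  proof -
    obtain \<delta> where \<delta>: "\<delta> > 0" "\<forall>h. norm h < \<delta> \<longrightarrow> \<bar>w h\<bar> \<le> 1 * r h" using small[of 1] by auto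
    show ?thesis
      by (rule Bochner_Integration.integrable_bound[OF iR[OF s, of 1 \<delta>]])
        (use bound[OF _ \<delta> s] in \<open>auto intro!: AE_I2 intro: order_trans[OF _ abs_ge_self]\<close>)
  qed
  then show "1 \<le> s \<Longrightarrow> integrable lborel (\<lambda>h. K s h * w h)" .
  define M where "M = (\<integral>h. \<bar>K 1 h * w h\<bar> \<partial>lborel)"
  have C0: "C \<ge> 0"
  proof -
    have "0 \<le> 1 * (\<integral>h. K 1 h * r h \<partial>lborel)" using K0 r0 by (simp add: integral_nonneg_AE)
    then show ?thesis using C[of 1] by simp
  qed
  show "((\<lambda>s. s * (\<integral>h. K s h * w h \<partial>lborel)) \<longlongrightarrow> 0) at_top"
  proof (rule tendstoI)
    fix e :: real assume e: "e > 0"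
    define \<epsilon> where "\<epsilon> = e / (2 * (C + 1))"
    have \<epsilon>: "\<epsilon> > 0" and \<epsilon>C: "\<epsilon> * C \<le> e / 2" using e C0 by (auto simp: \<epsilon>_def field_simps)
    obtain \<delta> where \<delta>: "\<delta> > 0" "\<forall>h. norm h < \<delta> \<longrightarrow> \<bar>w h\<bar> \<le> \<epsilon> * r h" using small[OF \<epsilon>] by auto
    have "((\<lambda>s. (s * T \<delta> s) * M) \<longlongrightarrow> 0 * M) at_top" by (intro tendsto_mult T(1) \<delta> tendsto_const)
    then have "\<forall>\<^sub>F s in at_top. (s * T \<delta> s) * M < e / 2" using e by (intro order_tendstoD) auto
    then show "\<forall>\<^sub>F s in at_top. dist (s * (\<integral>h. K s h * w h \<partial>lborel)) 0 < e"
      using eventually_ge_at_top[of 1]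
    proof eventually_elim
      case (elim s)
      have "\<bar>\<integral>h. K s h * w h \<partial>lborel\<bar> \<le> (\<integral>h. \<bar>K s h * w h\<bar> \<partial>lborel)" by (rule integral_abs_bound)
      also have "\<dots> \<le> (\<integral>h. \<epsilon> * (K s h * r h) + T \<delta> s * \<bar>K 1 h * w h\<bar> \<partial>lborel)"
        using int iR bound[OF \<epsilon> \<delta>] elim(2) by (intro integral_mono integrable_abs) auto
      also have "\<dots> = \<epsilon> * (\<integral>h. K s h * r h \<partial>lborel) + T \<delta> s * M"
        unfolding M_def using ir[OF elim(2)] iw by (subst Bochner_Integration.integral_add) auto
      finally have "s * \<bar>\<integral>h. K s h * w h \<partial>lborel\<bar> \<le> s * (\<epsilon> * (\<integral>h. K s h * r h \<partial>lborel) + T \<delta> s * M)"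
        using elim(2) by (intro mult_left_mono) auto
      also have "\<dots> = \<epsilon> * (s * (\<integral>h. K s h * r h \<partial>lborel)) + (s * T \<delta> s) * M" by (simp add: algebra_simps)
      also have "\<dots> < e / 2 + e / 2"
        using mult_left_mono[OF C[OF elim(2)], of \<epsilon>] \<epsilon> \<epsilon>C elim(1) by linarith
      finally show ?case using elim(2) by (simp add: abs_mult)
    qed
  qed
qed

section \<open>Moments and limits of the two kernels\<close>

lemma integral_odd_0:
  fixes f :: "real^4 \<Rightarrow> real"
  assumes "f \<in> borel_measurable borel" "\<And>x. f (reflect n x) = - f x"
  shows "(\<integral>x. f x \<partial>lborel) = 0"
  using integral_reflect[OF assms(1), of n] assms(2) by simp

lemma gs_reflect [simp]: "gs s (reflect n x) = gs s x"
  by (simp add: gs_def)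

lemma reflect_axis: "reflect (axis i 1) x $ j = (if j = i then - (x $ j) else x $ j)"
  by (auto simp: reflect_def inner_axis) (auto simp: axis_def)

lemma gs_integrable: assumes "s > 0"
  shows "integrable lborel (gs s)" "(\<integral>h. gs s h \<partial>lborel) = 1"
proof -
  have "has_bochner_integral lborel (gs s) 1"
    by (rule has_bochner_integral_nn_integral) (use nn_integral_gs[OF assms] in auto)
  then show "integrable lborel (gs s)" "(\<integral>h. gs s h \<partial>lborel) = 1"
    by (auto simp: has_bochner_integral_iff)
qed

lemma gs_second_moment: assumes "s > 0"
  shows "integrable lborel (\<lambda>h. gs s h * (h $ i)\<^sup>2)" "(\<integral>h. gs s h * (h $ i)\<^sup>2 \<partial>lborel) = 1 / (2 * s)"
proof -
  have "has_bochner_integral lborel (\<lambda>h. gs s h * (h $ i)\<^sup>2) (1 / (2 * s))"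
    by (rule has_bochner_integral_nn_integral)
      (use nn_integral_gs_sq[OF assms, of "axis i 1"] assms in \<open>auto simp: inner_axis axis_in_Basis_iff\<close>)
  then show "integrable lborel (\<lambda>h. gs s h * (h $ i)\<^sup>2)" "(\<integral>h. gs s h * (h $ i)\<^sup>2 \<partial>lborel) = 1 / (2 * s)"
    by (auto simp: has_bochner_integral_iff)
qed

lemma norm_sq_4: "(norm (h :: real^4))\<^sup>2 = (h $ 1)\<^sup>2 + (h $ 2)\<^sup>2 + (h $ 3)\<^sup>2 + (h $ 4)\<^sup>2"
  unfolding power2_norm_eq_inner by (simp add: inner_vec_def sum_4 power2_eq_square)

lemma gs_norm_sq: assumes "s > 0"
  shows "integrable lborel (\<lambda>h. gs s h * (norm h)\<^sup>2)" "(\<integral>h. gs s h * (norm h)\<^sup>2 \<partial>lborel) = 2 / s"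
proof -
  have e: "gs s h * (norm h)\<^sup>2 = (\<Sum>i\<in>UNIV. gs s h * (h $ i)\<^sup>2)" for h
    by (simp add: norm_sq_4 sum_4 algebra_simps)
  show "integrable lborel (\<lambda>h. gs s h * (norm h)\<^sup>2)"
    unfolding e by (intro Bochner_Integration.integrable_sum gs_second_moment assms)
  have "(\<integral>h. (\<Sum>i\<in>UNIV. gs s h * (h $ i)\<^sup>2) \<partial>lborel) = (\<Sum>i\<in>(UNIV :: 4 set). 1 / (2 * s))"
    by (subst Bochner_Integration.integral_sum) (auto simp: gs_second_moment[OF assms])
  then show "(\<integral>h. gs s h * (norm h)\<^sup>2 \<partial>lborel) = 2 / s" unfolding e by simp
qed

text \<open>A second-order Taylor polynomial as it occurs for axially symmetric functions at a point
  of the plane: the last two coordinates enter only through their sum of squares.\<close>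

definition quadr :: "real \<Rightarrow> real \<Rightarrow> real \<Rightarrow> real \<Rightarrow> real \<Rightarrow> real \<Rightarrow> real \<Rightarrow> real^4 \<Rightarrow> real" where
  "quadr c0 a b q11 q12 q22 q33 h =
     c0 + a * h $ 1 + b * h $ 2 + q11 * (h $ 1)\<^sup>2 + q12 * (h $ 1 * h $ 2) + q22 * (h $ 2)\<^sup>2
       + q33 * ((h $ 3)\<^sup>2 + (h $ 4)\<^sup>2)"

lemma quadr_measurable [measurable]: "quadr c0 a b q11 q12 q22 q33 \<in> borel_measurable borel"
  unfolding quadr_def by measurable

lemma gs_quadr:
  assumes s: "s > 0"
  shows "integrable lborel (\<lambda>h. gs s h * quadr c0 a b q11 q12 q22 q33 h)"
    and "(\<integral>h. gs s h * quadr c0 a b q11 q12 q22 q33 h \<partial>lborel) = c0 + (q11 + q22 + 2 * q33) / (2 * s)"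
proof -
  note sm = gs_second_moment[OF s] and g = gs_integrable[OF s]
  have lin: "integrable lborel (\<lambda>h. gs s h * h $ i)" for i
  proof (rule Bochner_Integration.integrable_bound)
    show "integrable lborel (\<lambda>h. gs s h + gs s h * (h $ i)\<^sup>2)" using g sm by auto
    have "\<bar>t\<bar> \<le> 1 + t\<^sup>2" for t :: real
    proof -
      have "0 \<le> (\<bar>t\<bar> - 1)\<^sup>2" by simp
      then show ?thesis by (simp add: power2_diff)
    qed
    then have "gs s h * \<bar>h $ i\<bar> \<le> gs s h * (1 + (h $ i)\<^sup>2)" for h by (intro mult_left_mono) auto
    then show "AE h in lborel. norm (gs s h * h $ i) \<le> norm (gs s h + gs s h * (h $ i)\<^sup>2)"
      by (auto simp: abs_mult algebra_simps)
  qed measurable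
  have mix: "integrable lborel (\<lambda>h. gs s h * (h $ 1 * h $ 2))"
  proof (rule Bochner_Integration.integrable_bound)
    show "integrable lborel (\<lambda>h. gs s h * (h $ 1)\<^sup>2 + gs s h * (h $ 2)\<^sup>2)" using sm by auto
    have "\<bar>t * u\<bar> \<le> t\<^sup>2 + u\<^sup>2" for t u :: real
    proof -
      have "0 \<le> (\<bar>t\<bar> - \<bar>u\<bar>)\<^sup>2" "0 \<le> \<bar>t\<bar> * \<bar>u\<bar>" by auto
      then show ?thesis unfolding power2_diff abs_mult power2_abs by linarith
    qed
    then have "gs s h * \<bar>h $ 1 * h $ 2\<bar> \<le> gs s h * ((h $ 1)\<^sup>2 + (h $ 2)\<^sup>2)" for h by (intro mult_left_mono) auto
    then show "AE h in lborel. norm (gs s h * (h $ 1 * h $ 2)) \<le> norm (gs s h * (h $ 1)\<^sup>2 + gs s h * (h $ 2)\<^sup>2)"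
      by (auto simp: abs_mult algebra_simps)
  qed measurable
  have odd: "(\<integral>h. gs s h * h $ i \<partial>lborel) = 0" for i
    by (rule integral_odd_0[where n = "axis i 1"]) (auto simp: reflect_axis)
  have odd2: "(\<integral>h. gs s h * (h $ 1 * h $ 2) \<partial>lborel) = 0"
    by (rule integral_odd_0[where n = "axis 1 1"]) (auto simp: reflect_axis)
  have e: "gs s h * quadr c0 a b q11 q12 q22 q33 h =
     c0 * gs s h + a * (gs s h * h $ 1) + b * (gs s h * h $ 2) + q11 * (gs s h * (h $ 1)\<^sup>2)
     + q12 * (gs s h * (h $ 1 * h $ 2)) + q22 * (gs s h * (h $ 2)\<^sup>2)
     + q33 * (gs s h * (h $ 3)\<^sup>2) + q33 * (gs s h * (h $ 4)\<^sup>2)" for h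
    by (simp add: quadr_def algebra_simps)
  have "has_bochner_integral lborel (\<lambda>h. gs s h * quadr c0 a b q11 q12 q22 q33 h)
     (c0 * 1 + a * 0 + b * 0 + q11 * (1 / (2 * s)) + q12 * 0 + q22 * (1 / (2 * s)) + q33 * (1 / (2 * s)) + q33 * (1 / (2 * s)))"
    unfolding e using g sm lin mix odd odd2
    by (intro has_bochner_integral_add has_bochner_integral_mult_right) (auto simp: has_bochner_integral_iff)
  then show "integrable lborel (\<lambda>h. gs s h * quadr c0 a b q11 q12 q22 q33 h)"
    and "(\<integral>h. gs s h * quadr c0 a b q11 q12 q22 q33 h \<partial>lborel) = c0 + (q11 + q22 + 2 * q33) / (2 * s)"
    using s by (auto simp: has_bochner_integral_iff field_simps)
qed

lemma gaussian_tail: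
  fixes h :: "real^4"
  assumes "0 < \<delta>" "1 \<le> s" "\<delta> \<le> norm h"
  shows "exp (- s * (norm h)\<^sup>2) \<le> exp (- (s - 1) * \<delta>\<^sup>2) * exp (- 1 * (norm h)\<^sup>2)"
proof -
  have "(s - 1) * \<delta>\<^sup>2 \<le> (s - 1) * (norm h)\<^sup>2" using assms by (intro mult_left_mono power_mono) auto
  then show ?thesis unfolding exp_add[symmetric] exp_le_cancel_iff by (simp add: algebra_simps)
qed

lemma gaussian_tail_limit: "0 < (\<delta>::real) \<Longrightarrow> ((\<lambda>s. s * (s\<^sup>2 * exp (- (s - 1) * \<delta>\<^sup>2))) \<longlongrightarrow> 0) at_top"
  "0 < (\<delta>::real) \<Longrightarrow> ((\<lambda>s. s * exp (- (s - 1) * \<delta>\<^sup>2)) \<longlongrightarrow> 0) at_top"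
  by real_asymp+

text \<open>The coordinates have variance 1 / (2 s), so the mean exceeds the central value by the
  Laplacian over 4 s to leading order. The limit is a quarter of the Laplacian of
  \<open>quadr\<close>.\<close>

lemma gaussian_mean_expansion:
  fixes u :: "real^4 \<Rightarrow> real"
  assumes u [measurable]: "u \<in> borel_measurable borel" and iu: "integrable lborel (\<lambda>h. gs 1 h * u h)"
    and small: "\<And>\<epsilon>. 0 < \<epsilon> \<Longrightarrow> \<exists>\<delta>>0. \<forall>h. norm h < \<delta> \<longrightarrow> \<bar>u h - quadr c0 a b q11 q12 q22 q33 h\<bar> \<le> \<epsilon> * (norm h)\<^sup>2"
  shows "((\<lambda>s. s * ((\<integral>h. gs s h * u h \<partial>lborel) - c0)) \<longlongrightarrow> (q11 + q22 + 2 * q33) / 2) at_top"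
proof -
  define w where "w h = u h - quadr c0 a b q11 q12 q22 q33 h" for h
  note q = gs_quadr[of _ c0 a b q11 q12 q22 q33]
  have tail: "gs s h \<le> (s\<^sup>2 * exp (- (s - 1) * \<delta>\<^sup>2)) * gs 1 h" if "0 < \<delta>" "1 \<le> s" "\<delta> \<le> norm h" for \<delta> s h
  proof -
    have "s\<^sup>2 / pi\<^sup>2 * exp (- s * (norm h)\<^sup>2) \<le> s\<^sup>2 / pi\<^sup>2 * (exp (- (s - 1) * \<delta>\<^sup>2) * exp (- 1 * (norm h)\<^sup>2))"
      using gaussian_tail[OF that] by (intro mult_left_mono) auto
    then show ?thesis by (simp add: gs_def power_divide)
  qed
  have w [measurable]: "w \<in> borel_measurable borel" unfolding w_def by measurable
  have iw: "integrable lborel (\<lambda>h. gs 1 h * w h)"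
    unfolding w_def right_diff_distrib using iu q(1)[of 1] by auto
  have C: "s * (\<integral>h. gs s h * (norm h)\<^sup>2 \<partial>lborel) \<le> 2" if "1 \<le> s" for s
    using gs_norm_sq(2)[of s] that by simp
  note L = concentrated_limit[where K = gs and T = "\<lambda>\<delta> s. s\<^sup>2 * exp (- (s - 1) * \<delta>\<^sup>2)" and r = "\<lambda>h. (norm h)\<^sup>2" and w = w and C = 2]
  have int: "integrable lborel (\<lambda>h. gs s h * w h)" if "1 \<le> s" for s
    by (rule L(1)) (use that tail gaussian_tail_limit C gs_norm_sq(1) w iw small in \<open>auto simp flip: w_def\<close>)
  have lim: "((\<lambda>s. s * (\<integral>h. gs s h * w h \<partial>lborel)) \<longlongrightarrow> 0) at_top"
    by (rule L(2)) (use tail gaussian_tail_limit C gs_norm_sq(1) w iw small in \<open>auto simp flip: w_def\<close>)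
  have "((\<lambda>s. s * (\<integral>h. gs s h * w h \<partial>lborel) + (q11 + q22 + 2 * q33) / 2) \<longlongrightarrow> 0 + (q11 + q22 + 2 * q33) / 2) at_top"
    by (intro tendsto_add lim tendsto_const)
  moreover have "\<forall>\<^sub>F s in at_top. s * (\<integral>h. gs s h * w h \<partial>lborel) + (q11 + q22 + 2 * q33) / 2 = s * ((\<integral>h. gs s h * u h \<partial>lborel) - c0)"
    using eventually_ge_at_top[of 1]
  proof eventually_elim
    case (elim s)
    then have s: "s > 0" by simp
    have "(\<integral>h. gs s h * u h \<partial>lborel) = (\<integral>h. gs s h * w h + gs s h * quadr c0 a b q11 q12 q22 q33 h \<partial>lborel)"
      by (simp add: w_def algebra_simps)
    also have "\<dots> = (\<integral>h. gs s h * w h \<partial>lborel) + (c0 + (q11 + q22 + 2 * q33) / (2 * s))"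
      using int[OF elim] q(1)[OF s] by (subst Bochner_Integration.integral_add) (auto simp: q(2)[OF s])
    finally show ?case using s by (simp add: field_simps)
  qed
  ultimately show ?thesis by (simp add: Lim_transform_eventually)
qed

lemma ws_integrable: assumes "s > 0"
  shows "integrable lborel (ws s)" "(\<integral>h. ws s h \<partial>lborel) = pi\<^sup>2 / s"
proof -
  have "has_bochner_integral lborel (ws s) (pi\<^sup>2 / s)"
    by (rule has_bochner_integral_nn_integral) (use nn_integral_ws[OF assms] assms in auto)
  then show "integrable lborel (ws s)" "(\<integral>h. ws s h \<partial>lborel) = pi\<^sup>2 / s"
    by (auto simp: has_bochner_integral_iff)
qed

lemma ws_limit:
  fixes u :: "real^4 \<Rightarrow> real"
  assumes u [measurable]: "u \<in> borel_measurable borel" and iu: "integrable lborel (\<lambda>h. ws 1 h * u h)"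
    and small: "\<And>\<epsilon>. 0 < \<epsilon> \<Longrightarrow> \<exists>\<delta>>0. \<forall>h. norm h < \<delta> \<longrightarrow> \<bar>u h - c\<bar> \<le> \<epsilon>"
  shows "((\<lambda>s. s * (\<integral>h. ws s h * u h \<partial>lborel)) \<longlongrightarrow> pi\<^sup>2 * c) at_top"
proof -
  define w where "w h = u h - c" for h
  have tail: "ws s h \<le> exp (- (s - 1) * \<delta>\<^sup>2) * ws 1 h" if "0 < \<delta>" "1 \<le> s" "\<delta> \<le> norm h" for \<delta> s h
  proof -
    have "exp (- s * (norm h)\<^sup>2) / (norm h)\<^sup>2 \<le> (exp (- (s - 1) * \<delta>\<^sup>2) * exp (- 1 * (norm h)\<^sup>2)) / (norm h)\<^sup>2"
      using gaussian_tail[OF that] by (intro divide_right_mono) auto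
    then show ?thesis by (simp add: ws_def)
  qed
  have w [measurable]: "w \<in> borel_measurable borel" unfolding w_def by measurable
  have iw: "integrable lborel (\<lambda>h. ws 1 h * w h)"
    unfolding w_def right_diff_distrib using iu ws_integrable(1)[of 1] by auto
  have C: "s * (\<integral>h. ws s h \<partial>lborel) \<le> pi\<^sup>2" if "1 \<le> s" for s
    using ws_integrable(2)[of s] that by simp
  note L = concentrated_limit[where K = ws and T = "\<lambda>\<delta> s. exp (- (s - 1) * \<delta>\<^sup>2)" and r = "\<lambda>h. 1" and w = w and C = "pi\<^sup>2"]
  have int: "integrable lborel (\<lambda>h. ws s h * w h)" if "1 \<le> s" for s
    by (rule L(1)) (use that tail gaussian_tail_limit C ws_integrable(1) w iw small in \<open>auto simp flip: w_def\<close>)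
  have lim: "((\<lambda>s. s * (\<integral>h. ws s h * w h \<partial>lborel)) \<longlongrightarrow> 0) at_top"
    by (rule L(2)) (use tail gaussian_tail_limit C ws_integrable(1) w iw small in \<open>auto simp flip: w_def\<close>)
  have "((\<lambda>s. s * (\<integral>h. ws s h * w h \<partial>lborel) + pi\<^sup>2 * c) \<longlongrightarrow> 0 + pi\<^sup>2 * c) at_top"
    by (intro tendsto_add lim tendsto_const)
  moreover have "\<forall>\<^sub>F s in at_top. s * (\<integral>h. ws s h * w h \<partial>lborel) + pi\<^sup>2 * c = s * (\<integral>h. ws s h * u h \<partial>lborel)"
    using eventually_ge_at_top[of 1]
  proof eventually_elim
    case (elim s)
    then have s: "s > 0" by simp
    have "(\<integral>h. ws s h * u h \<partial>lborel) = (\<integral>h. ws s h * w h + ws s h * c \<partial>lborel)"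
      by (simp add: w_def algebra_simps)
    also have "\<dots> = (\<integral>h. ws s h * w h \<partial>lborel) + pi\<^sup>2 / s * c"
      using int[OF elim] ws_integrable[OF s] by (subst Bochner_Integration.integral_add) auto
    finally show ?case using s by (simp add: field_simps)
  qed
  ultimately show ?thesis by (simp add: Lim_transform_eventually)
qed

text \<open>A finite weighted integral with an almost everywhere positive weight forces
  \<open>f\<close> to be finite almost everywhere, so nothing is lost when \<open>enn2real\<close>
  maps infinity to 0.\<close>

lemma integrable_enn2real:
  assumes k [measurable]: "k \<in> borel_measurable borel" and k0: "\<And>h. k h \<ge> 0" and pos: "AE h in lborel. k h > 0"
    and f [measurable]: "(f :: real^4 \<Rightarrow> ennreal) \<in> borel_measurable borel"
    and fin: "(\<integral>\<^sup>+h. ennreal (k h) * f h \<partial>lborel) < \<infinity>"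
  shows "integrable lborel (\<lambda>h. k h * enn2real (f h))"
    and "(\<integral>\<^sup>+h. ennreal (k h) * f h \<partial>lborel) = ennreal (\<integral>h. k h * enn2real (f h) \<partial>lborel)"
proof -
  have "AE h in lborel. ennreal (k h) * f h \<noteq> \<infinity>"
    by (rule nn_integral_noteq_infinite) (use fin in auto)
  with pos have "AE h in lborel. ennreal (k h) * f h = ennreal (k h * enn2real (f h))"
    by eventually_elim (auto simp: ennreal_mult_eq_top_iff ennreal_mult'' less_top)
  then have e: "(\<integral>\<^sup>+h. ennreal (k h) * f h \<partial>lborel) = (\<integral>\<^sup>+h. ennreal (k h * enn2real (f h)) \<partial>lborel)"
    by (rule nn_integral_cong_AE)
  have "(\<lambda>h. k h * enn2real (f h)) \<in> borel_measurable lborel" by measurable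
  then show i: "integrable lborel (\<lambda>h. k h * enn2real (f h))"
    by (rule integrableI_nonneg) (use e fin k0 in auto)
  show "(\<integral>\<^sup>+h. ennreal (k h) * f h \<partial>lborel) = ennreal (\<integral>h. k h * enn2real (f h) \<partial>lborel)"
    unfolding e by (rule nn_integral_eq_integral[OF i]) (use k0 in auto)
qed

text \<open>Let \<open>s\<close> tend to infinity in \<open>potential_smoothing\<close>.\<close>
lemma poisson_equation:
  fixes f :: "real^4 \<Rightarrow> ennreal"
  assumes f [measurable]: "f \<in> borel_measurable borel"
  defines "U \<equiv> \<lambda>x. \<integral>\<^sup>+y. ennreal (1 / (norm (y - x))\<^sup>2) * f y \<partial>lborel"
  assumes fin: "U x < \<infinity>"
    and U2: "\<And>\<epsilon>. 0 < \<epsilon> \<Longrightarrow> \<exists>\<delta>>0. \<forall>h. norm h < \<delta> \<longrightarrow> \<bar>enn2real (U (x + h)) - quadr c0 a b q11 q12 q22 q33 h\<bar> \<le> \<epsilon> * (norm h)\<^sup>2"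
    and f0: "\<And>\<epsilon>. 0 < \<epsilon> \<Longrightarrow> \<exists>\<delta>>0. \<forall>h. norm h < \<delta> \<longrightarrow> \<bar>enn2real (f (x + h)) - c\<bar> \<le> \<epsilon>"
  shows "pi\<^sup>2 * c = - (q11 + q22 + 2 * q33) / 2"
proof -
  have U [measurable]: "U \<in> borel_measurable borel" unfolding U_def by measurable
  have sm: "U x = (\<integral>\<^sup>+h. ennreal (gs s h) * U (x + h) \<partial>lborel) + (\<integral>\<^sup>+h. ennreal (ws s h) * f (x + h) \<partial>lborel)"
    if "s > 0" for s unfolding U_def by (rule potential_smoothing[OF f that])
  have fins: "(\<integral>\<^sup>+h. ennreal (gs s h) * U (x + h) \<partial>lborel) < \<infinity>" "(\<integral>\<^sup>+h. ennreal (ws s h) * f (x + h) \<partial>lborel) < \<infinity>"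
    if "s > 0" for s using fin unfolding sm[OF that] by (simp_all add: less_top)
  have gpos: "AE h in lborel. gs s h > 0" if "s > 0" for s using that by (simp add: gs_def)
  have wpos: "AE h in lborel. ws s h > 0" for s using AE_lborel_singleton[of 0] by eventually_elim (simp add: ws_def)
  have iU: "integrable lborel (\<lambda>h. gs s h * enn2real (U (x + h)))"
    and eU: "(\<integral>\<^sup>+h. ennreal (gs s h) * U (x + h) \<partial>lborel) = ennreal (\<integral>h. gs s h * enn2real (U (x + h)) \<partial>lborel)"
    if "s > 0" for s
    by (rule integrable_enn2real; use fins[OF that] gpos[OF that] in simp)+
  have if': "integrable lborel (\<lambda>h. ws s h * enn2real (f (x + h)))"
    and ef: "(\<integral>\<^sup>+h. ennreal (ws s h) * f (x + h) \<partial>lborel) = ennreal (\<integral>h. ws s h * enn2real (f (x + h)) \<partial>lborel)"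
    if "s > 0" for s
    by (rule integrable_enn2real; use fins[OF that] wpos in simp)+
  have c0: "enn2real (U x) = c0" using U2[of 1] by (auto simp: quadr_def dest!: spec[of _ 0])
  have eq: "enn2real (U x) = (\<integral>h. gs s h * enn2real (U (x + h)) \<partial>lborel) + (\<integral>h. ws s h * enn2real (f (x + h)) \<partial>lborel)"
    if "s > 0" for s
    unfolding sm[OF that] eU[OF that] ef[OF that]
    by (subst ennreal_plus[symmetric]) (auto intro!: enn2real_ennreal add_nonneg_nonneg Bochner_Integration.integral_nonneg simp del: ennreal_plus)
  have 1: "((\<lambda>s. s * ((\<integral>h. gs s h * enn2real (U (x + h)) \<partial>lborel) - c0)) \<longlongrightarrow> (q11 + q22 + 2 * q33) / 2) at_top"
    by (rule gaussian_mean_expansion[OF _ iU U2]) auto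
  have 2: "((\<lambda>s. s * (\<integral>h. ws s h * enn2real (f (x + h)) \<partial>lborel)) \<longlongrightarrow> pi\<^sup>2 * c) at_top"
    by (rule ws_limit[OF _ if' f0]) auto
  have "\<forall>\<^sub>F s in at_top. s * ((\<integral>h. gs s h * enn2real (U (x + h)) \<partial>lborel) - c0) + s * (\<integral>h. ws s h * enn2real (f (x + h)) \<partial>lborel) = 0"
    using eventually_gt_at_top[of 0]
  proof eventually_elim
    case (elim s)
    then show ?case using eq[OF elim] unfolding c0 by (simp add: algebra_simps flip: distrib_left)
  qed
  with tendsto_add[OF 1 2] have "((\<lambda>s. 0) \<longlongrightarrow> (q11 + q22 + 2 * q33) / 2 + pi\<^sup>2 * c) (at_top :: real filter)"
    by (rule Lim_transform_eventually)
  then have "(q11 + q22 + 2 * q33) / 2 + pi\<^sup>2 * c = 0" by (simp only: tendsto_const_iff trivial_limit_at_top_linorder not_False_eq_True)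
  then show ?thesis by argo
qed

section \<open>Real-analytic functions of two variables\<close>

definition psum :: "(nat \<Rightarrow> nat \<Rightarrow> real) \<Rightarrow> real \<Rightarrow> complex \<Rightarrow> (complex \<Rightarrow> real) \<Rightarrow> bool" where
  "psum c r z0 F \<longleftrightarrow> (\<forall>z. cmod (z - z0) < r \<longrightarrow>
     ((\<lambda>(i,j). c i j * (Re z - Re z0) ^ i * (Im z - Im z0) ^ j) has_sum F z) UNIV)"

lemma psum_center: 
  assumes "psum c r z0 F" "r > 0" shows "F z0 = c 0 0"
proof -
  have "((\<lambda>(i,j). c i j * 0 ^ i * 0 ^ j) has_sum F z0) UNIV"
    using assms(1)[unfolded psum_def, rule_format, of z0] assms(2) by simp
  moreover have "((\<lambda>(i,j). c i j * 0 ^ i * 0 ^ j) has_sum c 0 0) UNIV"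
  proof -
    have "((\<lambda>(i,j). c i j * 0 ^ i * 0 ^ j) has_sum (\<Sum>(i,j)\<in>{(0,0)}. c i j * 0 ^ i * 0 ^ j)) {(0::nat,0::nat)}"
      by (rule has_sum_finite) auto
    moreover have "((\<lambda>(i,j). c i j * 0 ^ i * 0 ^ j) has_sum s) {(0::nat,0::nat)} \<longleftrightarrow> ((\<lambda>(i,j). c i j * 0 ^ i * 0 ^ j) has_sum s) UNIV" for s
      by (rule has_sum_cong_neutral) (auto simp: power_0_left split: if_splits)
    ultimately show ?thesis by simp
  qed
  ultimately show ?thesis using has_sum_unique by blast
qed

text \<open>Convergence at the corner z0 + s (1 + i) of a square makes the series absolutely
  convergent there, which provides one summable majorant for both termwise derivatives on a smaller
  disc. The shifted coefficients allow the lemma to be applied again to the derivatives.\<close>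

lemma psum_derivative:
  assumes P: "psum c r z0 F" and r: "r > 0"
  shows "\<exists>\<rho>>0. \<exists>Fx Fy. psum (\<lambda>i j. real (Suc i) * c (Suc i) j) \<rho> z0 Fx \<and> psum (\<lambda>i j. real (Suc j) * c i (Suc j)) \<rho> z0 Fy
     \<and> (\<forall>z. cmod (z - z0) < \<rho> \<longrightarrow> (F has_derivative (\<lambda>h. Re h * Fx z + Im h * Fy z)) (at z))"
proof -
  define s where "s = r / 2"
  have s: "s > 0" using r by (simp add: s_def)
  define X Y where "X z = Re z - Re z0" and "Y z = Im z - Im z0" for z
  \<comment> \<open>The corner has distance sqrt 2 s from \<open>z0\<close>, less than r = 2
    s.\<close>
  define z1 where "z1 = z0 + Complex s s"
  have "cmod (z1 - z0) < r"
  proof -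
    have "cmod (Complex s s) = sqrt 2 * s" using s by (simp add: cmod_def real_sqrt_mult flip: mult_2)
    also have "\<dots> < 2 * s" using s real_sqrt_less_mono[of 2 4] by (simp add: real_sqrt_four)
    finally show ?thesis by (simp add: z1_def s_def)
  qed
  from P[unfolded psum_def, rule_format, OF this]
  have "(\<lambda>(i,j). c i j * s ^ i * s ^ j) summable_on UNIV"
    unfolding summable_on_def by (auto simp: z1_def)
  then have S: "(\<lambda>p. norm ((\<lambda>(i,j). c i j * s ^ i * s ^ j) p)) summable_on UNIV"
    using summable_on_iff_abs_summable_on_real by blast
  define M where "M p = 2 / s * norm ((\<lambda>(i,j). c i j * s ^ i * s ^ j) p)" for p
  have M: "M summable_on UNIV" unfolding M_def by (rule summable_on_cmult_right[OF S])
  \<comment> \<open>Halving the radius pays for the factor i produced by differentiation, since i is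
    at most 2^i.\<close>
  define \<rho> where "\<rho> = s / 2"
  have rho: "\<rho> > 0" "\<rho> < r" using s by (auto simp: \<rho>_def s_def)
  define dx where "dx p z = (case p of (i,j) \<Rightarrow> c i j * (real i * X z ^ (i - 1)) * Y z ^ j)" for p z
  define dy where "dy p z = (case p of (i,j) \<Rightarrow> c i j * X z ^ i * (real j * Y z ^ (j - 1)))" for p z
  define f where "f p z = (case p of (i,j) \<Rightarrow> c i j * X z ^ i * Y z ^ j)" for p z
  have XY: "\<bar>X z\<bar> \<le> \<rho>" "\<bar>Y z\<bar> \<le> \<rho>" if "cmod (z - z0) < \<rho>" for z
    using that abs_Re_le_cmod[of "z - z0"] abs_Im_le_cmod[of "z - z0"] by (auto simp: X_def Y_def)
  have aux: "real i * \<rho> ^ (i - 1) \<le> 2 / s * s ^ i" for i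
  proof (cases i)
    case (Suc k)
    have "real (Suc k) \<le> 2 ^ (Suc k)" using less_exp[of "Suc k"] by (metis less_imp_le of_nat_le_iff of_nat_numeral of_nat_power)
    then have "real (Suc k) * \<rho> ^ k \<le> 2 ^ (Suc k) * \<rho> ^ k" using rho by (intro mult_right_mono) auto
    also have "\<dots> = 2 / s * s ^ Suc k" using s by (simp add: \<rho>_def power_divide)
    finally show ?thesis using Suc by simp
  qed (use s in simp)
  have rs: "\<rho> ^ j \<le> s ^ j" for j using s by (intro power_mono) (auto simp: \<rho>_def)
  have bound: "\<bar>C * (real i * x ^ (i - 1)) * y ^ j\<bar> \<le> 2 / s * \<bar>C * s ^ i * s ^ j\<bar>"
    if "\<bar>x\<bar> \<le> \<rho>" "\<bar>y\<bar> \<le> \<rho>" for C x y :: real and i j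
  proof -
    have "\<bar>C * (real i * x ^ (i - 1)) * y ^ j\<bar> = \<bar>C\<bar> * (real i * \<bar>x\<bar> ^ (i - 1)) * \<bar>y\<bar> ^ j" by (simp add: abs_mult power_abs)
    also have "\<dots> \<le> \<bar>C\<bar> * (real i * \<rho> ^ (i - 1)) * \<rho> ^ j"
      using that rho by (intro mult_mono mult_left_mono power_mono) auto
    also have "\<dots> \<le> \<bar>C\<bar> * (2 / s * s ^ i) * s ^ j"
      by (intro mult_mono[OF mult_left_mono[OF aux] rs]) (use s rho in auto)
    also have "\<dots> = 2 / s * \<bar>C * s ^ i * s ^ j\<bar>" using s by (simp add: abs_mult)
    finally show ?thesis .
  qed
  have dxM: "norm (dx p z) \<le> M p" if "cmod (z - z0) < \<rho>" for p z
    using bound[OF XY[OF that]] by (cases p) (simp add: dx_def M_def)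
  have dyM: "norm (dy p z) \<le> M p" if "cmod (z - z0) < \<rho>" for p z
    using bound[OF XY(2,1)[OF that], of "c (fst p) (snd p)" "snd p" "fst p"] by (cases p) (simp add: dy_def M_def mult_ac)
  define Fx where "Fx z = infsum (\<lambda>p. dx p z) UNIV" for z
  define Fy where "Fy z = infsum (\<lambda>p. dy p z) UNIV" for z
  have hs: "((\<lambda>p. dx p z) has_sum Fx z) UNIV" "((\<lambda>p. dy p z) has_sum Fy z) UNIV" if z: "cmod (z - z0) < \<rho>" for z
  proof -
    have "(\<lambda>p. dx p z) summable_on UNIV" "(\<lambda>p. dy p z) summable_on UNIV"
      using dxM[OF z] dyM[OF z] by (auto intro!: abs_summable_summable Infinite_Sum.abs_summable_on_comparison_test'[OF M])
    then show "((\<lambda>p. dx p z) has_sum Fx z) UNIV" "((\<lambda>p. dy p z) has_sum Fy z) UNIV"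
      unfolding Fx_def Fy_def by (auto intro: has_sum_infsum)
  qed
  \<comment> \<open>Enumerating the index pairs turns the unordered sums into ordinary series, to
    which termwise differentiation applies.\<close>
  have bij: "bij_betw prod_decode UNIV UNIV" by (rule bij_prod_decode)
  have toseq: "(\<lambda>n. g (prod_decode n)) sums S" if "(g has_sum S) UNIV" for g :: "nat \<times> nat \<Rightarrow> real" and S
    using that has_sum_reindex_bij_betw[OF bij, of g S] has_sum_imp_sums by blast
  have SM: "summable (\<lambda>n. M (prod_decode n))"
    using toseq[OF has_sum_infsum[OF M]] sums_summable by blast
  have ux: "uniform_limit (ball z0 \<rho>) (\<lambda>n z. \<Sum>i<n. dx (prod_decode i) z) Fx sequentially"
  proof -
    have "uniform_limit (ball z0 \<rho>) (\<lambda>n z. \<Sum>i<n. dx (prod_decode i) z) (\<lambda>z. \<Sum>i. dx (prod_decode i) z) sequentially"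
      by (rule Weierstrass_m_test[OF _ SM]) (use dxM in \<open>simp add: dist_norm norm_minus_commute\<close>)
    then show ?thesis
      by (rule uniform_limit_cong'[THEN iffD1, rotated 2]) (use toseq[OF hs(1)] in \<open>auto simp: sums_iff dist_norm norm_minus_commute\<close>)
  qed
  have uy: "uniform_limit (ball z0 \<rho>) (\<lambda>n z. \<Sum>i<n. dy (prod_decode i) z) Fy sequentially"
  proof -
    have "uniform_limit (ball z0 \<rho>) (\<lambda>n z. \<Sum>i<n. dy (prod_decode i) z) (\<lambda>z. \<Sum>i. dy (prod_decode i) z) sequentially"
      by (rule Weierstrass_m_test[OF _ SM]) (use dyM in \<open>simp add: dist_norm norm_minus_commute\<close>)
    then show ?thesis
      by (rule uniform_limit_cong'[THEN iffD1, rotated 2]) (use toseq[OF hs(2)] in \<open>auto simp: sums_iff dist_norm norm_minus_commute\<close>)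
  qed
  have Fsum: "(\<lambda>n. f (prod_decode n) z) sums F z" if "cmod (z - z0) < \<rho>" for z
  proof -
    have "((\<lambda>p. f p z) has_sum F z) UNIV" using P that rho unfolding psum_def f_def X_def Y_def by auto
    then show ?thesis by (rule toseq)
  qed
  have "\<exists>g. \<forall>z\<in>ball z0 \<rho>. (\<lambda>n. f (prod_decode n) z) sums g z \<and> (g has_derivative (\<lambda>h. Re h * Fx z + Im h * Fy z)) (at z within ball z0 \<rho>)"
  proof (rule has_derivative_series[where f' = "\<lambda>n z h. Re h * dx (prod_decode n) z + Im h * dy (prod_decode n) z"])
    fix n z assume "z \<in> ball z0 \<rho>"
    obtain i j where ij: "prod_decode n = (i,j)" by (cases "prod_decode n")
    have "((\<lambda>z. X z) has_derivative Re) (at z within ball z0 \<rho>)" "((\<lambda>z. Y z) has_derivative Im) (at z within ball z0 \<rho>)"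
      unfolding X_def Y_def by (auto intro!: derivative_eq_intros)
    then show "(f (prod_decode n) has_derivative (\<lambda>h. Re h * dx (prod_decode n) z + Im h * dy (prod_decode n) z)) (at z within ball z0 \<rho>)"
      unfolding ij f_def[abs_def] dx_def dy_def prod.case by (auto intro!: derivative_eq_intros simp: algebra_simps)
  next
    fix e :: real assume e: "e > 0"
    have "\<forall>\<^sub>F n in sequentially. \<forall>z\<in>ball z0 \<rho>. dist (\<Sum>i<n. dx (prod_decode i) z) (Fx z) < e / 2"
         "\<forall>\<^sub>F n in sequentially. \<forall>z\<in>ball z0 \<rho>. dist (\<Sum>i<n. dy (prod_decode i) z) (Fy z) < e / 2"
      using uniform_limitD[OF ux, of "e / 2"] uniform_limitD[OF uy, of "e / 2"] e by auto
    then show "\<forall>\<^sub>F n in sequentially. \<forall>z\<in>ball z0 \<rho>. \<forall>h. norm ((\<Sum>i<n. Re h * dx (prod_decode i) z + Im h * dy (prod_decode i) z) - (Re h * Fx z + Im h * Fy z)) \<le> e * norm h"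
    proof eventually_elim
      case (elim n)
      show ?case
      proof (intro ballI allI)
        fix z h assume z: "z \<in> ball z0 \<rho>"
        let ?a = "(\<Sum>i<n. dx (prod_decode i) z) - Fx z" and ?b = "(\<Sum>i<n. dy (prod_decode i) z) - Fy z"
        have "(\<Sum>i<n. Re h * dx (prod_decode i) z + Im h * dy (prod_decode i) z) - (Re h * Fx z + Im h * Fy z) = Re h * ?a + Im h * ?b"
          by (simp add: sum.distrib sum_distrib_left right_diff_distrib)
        also have "norm \<dots> \<le> \<bar>Re h\<bar> * \<bar>?a\<bar> + \<bar>Im h\<bar> * \<bar>?b\<bar>" by (simp add: abs_mult[symmetric] abs_triangle_ineq)
        also have "\<dots> \<le> cmod h * (e / 2) + cmod h * (e / 2)"
          using elim z by (intro add_mono mult_mono abs_Re_le_cmod abs_Im_le_cmod) (auto simp: dist_real_def less_imp_le)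
        finally show "norm ((\<Sum>i<n. Re h * dx (prod_decode i) z + Im h * dy (prod_decode i) z) - (Re h * Fx z + Im h * Fy z)) \<le> e * norm h"
          by (simp add: mult.commute)
      qed
    qed
  next
    show "z0 \<in> ball z0 \<rho>" using rho by simp
    show "(\<lambda>n. f (prod_decode n) z0) sums F z0" using Fsum[of z0] rho by simp
  qed (rule convex_ball)
  then obtain g where g: "\<And>z. z \<in> ball z0 \<rho> \<Longrightarrow> (\<lambda>n. f (prod_decode n) z) sums g z"
     "\<And>z. z \<in> ball z0 \<rho> \<Longrightarrow> (g has_derivative (\<lambda>h. Re h * Fx z + Im h * Fy z)) (at z within ball z0 \<rho>)" by blast
  have gF: "g z = F z" if "z \<in> ball z0 \<rho>" for z
    using g(1)[OF that] Fsum[of z] that sums_unique2 by (fastforce simp: dist_norm norm_minus_commute)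
  have "(F has_derivative (\<lambda>h. Re h * Fx z + Im h * Fy z)) (at z)" if "cmod (z - z0) < \<rho>" for z
  proof -
    have z: "z \<in> ball z0 \<rho>" using that by (simp add: dist_norm norm_minus_commute)
    have "(g has_derivative (\<lambda>h. Re h * Fx z + Im h * Fy z)) (at z)"
      using g(2)[OF z] at_within_open[OF z open_ball] by simp
    then show ?thesis by (rule has_derivative_transform_within_open[OF _ open_ball z gF])
  qed
  moreover have "psum (\<lambda>i j. real (Suc i) * c (Suc i) j) \<rho> z0 Fx"
    unfolding psum_def
  proof (intro allI impI)
    fix z assume z: "cmod (z - z0) < \<rho>"
    let ?h = "\<lambda>(i::nat,j::nat). (Suc i, j)"
    have inj: "inj_on ?h UNIV" by (auto simp: inj_on_def)
    have "((\<lambda>p. dx p z) has_sum Fx z) (?h ` UNIV)"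
    proof (subst has_sum_cong_neutral[where T = UNIV and g = "\<lambda>p. dx p z"])
      fix p :: "nat \<times> nat" assume "p \<in> UNIV - ?h ` UNIV"
      then have "fst p = 0" by (cases p; cases "fst p") (auto simp: image_iff)
      then show "dx p z = 0" by (cases p) (simp add: dx_def)
    qed (use hs(1)[OF z] in auto)
    then have "(((\<lambda>p. dx p z) \<circ> ?h) has_sum Fx z) UNIV" by (simp add: has_sum_reindex[OF inj])
    then show "((\<lambda>(i, j). real (Suc i) * c (Suc i) j * (Re z - Re z0) ^ i * (Im z - Im z0) ^ j) has_sum Fx z) UNIV"
      by (rule has_sum_cong[THEN iffD1, rotated]) (auto simp: dx_def X_def Y_def)
  qed
  moreover have "psum (\<lambda>i j. real (Suc j) * c i (Suc j)) \<rho> z0 Fy"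
    unfolding psum_def
  proof (intro allI impI)
    fix z assume z: "cmod (z - z0) < \<rho>"
    let ?h = "\<lambda>(i::nat,j::nat). (i, Suc j)"
    have inj: "inj_on ?h UNIV" by (auto simp: inj_on_def)
    have "((\<lambda>p. dy p z) has_sum Fy z) (?h ` UNIV)"
    proof (subst has_sum_cong_neutral[where T = UNIV and g = "\<lambda>p. dy p z"])
      fix p :: "nat \<times> nat" assume "p \<in> UNIV - ?h ` UNIV"
      then have "snd p = 0" by (cases p; cases "snd p") (auto simp: image_iff)
      then show "dy p z = 0" by (cases p) (simp add: dy_def)
    qed (use hs(2)[OF z] in auto)
    then have "(((\<lambda>p. dy p z) \<circ> ?h) has_sum Fy z) UNIV" by (simp add: has_sum_reindex[OF inj])
    then show "((\<lambda>(i, j). real (Suc j) * c i (Suc j) * (Re z - Re z0) ^ i * (Im z - Im z0) ^ j) has_sum Fy z) UNIV"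
      by (rule has_sum_cong[THEN iffD1, rotated]) (auto simp: dy_def X_def Y_def)
  qed
  ultimately show ?thesis using rho(1) by blast
qed

text \<open>All index pairs outside \<open>A\<close> have total degree at least 3, so each remaining
  term is at most (t / s)^3 times its absolute value at the corner (s, s), with t the larger of |x|
  and |y|.\<close>

lemma psum_Taylor2:
  assumes P: "psum c r z0 F" and r: "r > 0"
  shows "\<exists>C\<ge>0. \<exists>s>0. \<forall>x y. \<bar>x\<bar> \<le> s \<longrightarrow> \<bar>y\<bar> \<le> s \<longrightarrow>
     \<bar>F (z0 + Complex x y) - (c 0 0 + c 1 0 * x + c 0 1 * y + c 2 0 * x\<^sup>2 + c 1 1 * (x * y) + c 0 2 * y\<^sup>2)\<bar>
       \<le> C * (max \<bar>x\<bar> \<bar>y\<bar>) ^ 3"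
proof -
  define s where "s = r / 2"
  have s: "s > 0" using r by (simp add: s_def)
  have near: "cmod (Complex x y) < r" if "\<bar>x\<bar> \<le> s" "\<bar>y\<bar> \<le> s" for x y
  proof -
    have "x\<^sup>2 \<le> s\<^sup>2" "y\<^sup>2 \<le> s\<^sup>2" using that s by (auto simp: abs_le_square_iff[symmetric])
    then have "cmod (Complex x y) \<le> sqrt (2 * s\<^sup>2)" by (simp add: cmod_def)
    also have "\<dots> < sqrt (4 * s\<^sup>2)" using s by (intro real_sqrt_less_mono) simp
    also have "\<dots> = r" using s by (simp add: real_sqrt_mult real_sqrt_four s_def)
    finally show ?thesis .
  qed
  have hs: "((\<lambda>(i,j). c i j * x ^ i * y ^ j) has_sum F (z0 + Complex x y)) UNIV" if "\<bar>x\<bar> \<le> s" "\<bar>y\<bar> \<le> s" for x y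
    using P[unfolded psum_def, rule_format, of "z0 + Complex x y"] near[OF that] by simp
  define N where "N p = norm ((\<lambda>(i,j). c i j * s ^ i * s ^ j) p)" for p
  have "(\<lambda>(i,j). c i j * s ^ i * s ^ j) summable_on UNIV"
    using hs[of s s] s unfolding summable_on_def by auto
  then have N: "N summable_on UNIV"
    unfolding N_def using summable_on_iff_abs_summable_on_real by blast
  define A where "A = {(0::nat,0::nat),(1,0),(0,1),(2,0),(1,1),(0,2)}"
  define M where "M = infsum N (UNIV - A)"
  have NA: "N summable_on (UNIV - A)" by (rule summable_on_subset_banach[OF N]) simp
  have M0: "M \<ge> 0" unfolding M_def by (rule infsum_nonneg) (simp add: N_def)
  have "\<bar>F (z0 + Complex x y) - (c 0 0 + c 1 0 * x + c 0 1 * y + c 2 0 * x\<^sup>2 + c 1 1 * (x * y) + c 0 2 * y\<^sup>2)\<bar>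
      \<le> M / s ^ 3 * (max \<bar>x\<bar> \<bar>y\<bar>) ^ 3" if xy: "\<bar>x\<bar> \<le> s" "\<bar>y\<bar> \<le> s" for x y
  proof -
    define t where "t = max \<bar>x\<bar> \<bar>y\<bar>"
    have t: "0 \<le> t" "t \<le> s" "\<bar>x\<bar> \<le> t" "\<bar>y\<bar> \<le> t" using xy by (auto simp: t_def)
    define f where "f = (\<lambda>(i,j). c i j * x ^ i * y ^ j)"
    have "(f has_sum sum f A) A" by (rule has_sum_finite) (simp add: A_def)
    then have hf: "(f has_sum (F (z0 + Complex x y) - sum f A)) (UNIV - A)"
      by (intro has_sum_Diff) (use hs[OF xy] in \<open>auto simp: f_def\<close>)
    have hN: "((\<lambda>p. (t / s) ^ 3 * N p) has_sum ((t / s) ^ 3 * M)) (UNIV - A)"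
      unfolding M_def by (intro has_sum_cmult_right has_sum_infsum NA)
    have hN': "((\<lambda>p. (- ((t / s) ^ 3)) * N p) has_sum (- ((t / s) ^ 3)) * M) (UNIV - A)"
      unfolding M_def by (intro has_sum_cmult_right has_sum_infsum NA)
    have le: "norm (f p) \<le> (t / s) ^ 3 * N p" if "p \<in> UNIV - A" for p
    proof -
      obtain i j where p: "p = (i,j)" by (cases p)
      have ij: "3 \<le> i + j"
      proof (rule ccontr)
        assume "\<not> 3 \<le> i + j"
        then have "(i = 0 \<or> i = 1 \<or> i = 2) \<and> (j = 0 \<or> j = 1 \<or> j = 2) \<and> i + j < 3" by arith
        with that show False by (auto simp: p A_def)
      qed
      have "norm (f p) = \<bar>c i j\<bar> * (\<bar>x\<bar> ^ i * \<bar>y\<bar> ^ j)" by (simp add: f_def p abs_mult power_abs)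
      also have "\<dots> \<le> \<bar>c i j\<bar> * (t ^ i * t ^ j)" using t by (intro mult_left_mono mult_mono power_mono) auto
      also have "t ^ i * t ^ j = (t / s) ^ (i + j) * (s ^ i * s ^ j)" using s by (simp add: power_divide flip: power_add)
      also have "\<bar>c i j\<bar> * \<dots> \<le> \<bar>c i j\<bar> * ((t / s) ^ 3 * (s ^ i * s ^ j))"
        using t s ij by (intro mult_left_mono mult_right_mono power_decreasing) auto
      also have "\<dots> = (t / s) ^ 3 * N p" using s by (simp add: N_def p abs_mult)
      finally show ?thesis .
    qed
    have "F (z0 + Complex x y) - sum f A \<le> (t / s) ^ 3 * M"
      by (rule has_sum_mono[OF hf hN]) (use le in \<open>simp add: abs_le_iff\<close>)
    moreover have "(- ((t / s) ^ 3)) * M \<le> F (z0 + Complex x y) - sum f A"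
      by (rule has_sum_mono[OF hN' hf]) (use le in \<open>fastforce simp: abs_le_iff\<close>)
    ultimately have "\<bar>F (z0 + Complex x y) - sum f A\<bar> \<le> (t / s) ^ 3 * M" by linarith
    moreover have "sum f A = c 0 0 + c 1 0 * x + c 0 1 * y + c 2 0 * x\<^sup>2 + c 1 1 * (x * y) + c 0 2 * y\<^sup>2"
      by (simp add: A_def f_def)
    ultimately show ?thesis by (simp add: power_divide t_def mult.commute)
  qed
  then show ?thesis using s M0 by (intro exI[of _ "M / s ^ 3"] conjI exI[of _ s]) auto
qed

text \<open>Moving by \<open>h\<close> in the direction of the imaginary part and by squared
  distance \<open>k\<close> in the two orthogonal directions changes the axial coordinate by h + d.
  With a = |y0 + h| and S = sqrt (a^2 + k), rationalising gives S - a = k / (S + a), and both S and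
  a are close to b = |y0|.\<close>

lemma sqrt_expansion:
  fixes y0 b a k S n sg d :: real
  assumes sg: "sg = 1 \<or> sg = - 1" and b: "b = sg * y0" "b > 0" and n: "0 \<le> n" "n \<le> b / 2"
    and h: "\<bar>h\<bar> \<le> n" and k: "0 \<le> k" "k \<le> n\<^sup>2"
    and d: "d = sg * sqrt ((y0 + h)\<^sup>2 + k) - y0 - h"
  shows "\<bar>d\<bar> \<le> n\<^sup>2 / b" "\<bar>d - k / (2 * y0)\<bar> \<le> 3 * n ^ 3 / (2 * b\<^sup>2)"
proof -
  define a where "a = b + sg * h"
  define S where "S = sqrt (a\<^sup>2 + k)"
  have a: "a \<ge> b / 2" "\<bar>b - a\<bar> \<le> n" using sg h n by (auto simp: a_def)
  have a0: "a > 0" using a b by linarith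
  have "sg * sg = 1" using sg by auto
  then have "(y0 + h)\<^sup>2 = a\<^sup>2" and ay: "y0 = sg * b" "h = sg * (a - b)"
    using sg by (auto simp: a_def b power2_eq_square algebra_simps)
  then have dS: "d = sg * (S - a)" by (simp add: d S_def algebra_simps)
  have Sa: "a \<le> S" "S \<le> a + n"
  proof -
    show "a \<le> S" unfolding S_def using k a0 by (intro real_le_rsqrt) auto
    have "0 \<le> a * n" using a0 n by simp
    then have "a\<^sup>2 + k \<le> (a + n)\<^sup>2" using k unfolding power2_sum by linarith
    then show "S \<le> a + n" unfolding S_def using a0 n by (intro real_le_lsqrt) auto
  qed
  have S2: "S * S = a * a + k" unfolding S_def using k by (simp flip: power2_eq_square)
  have pos: "S + a > 0" "S + a \<ge> b" using a a0 Sa by linarith+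
  have e: "S - a = k / (S + a)" using S2 pos by (simp add: field_simps)
  have "\<bar>d\<bar> = k / (S + a)" using sg k pos unfolding dS e by (auto simp: abs_mult)
  also have "\<dots> \<le> n\<^sup>2 / b" using k pos b by (intro frac_le) auto
  finally show "\<bar>d\<bar> \<le> n\<^sup>2 / b" .
  have "k / (2 * y0) = sg * (k / (2 * b))" using sg b ay by (auto simp: field_simps)
  then have "\<bar>d - k / (2 * y0)\<bar> = \<bar>k / (S + a) - k / (2 * b)\<bar>"
    using sg unfolding dS e by (auto simp flip: right_diff_distrib simp: abs_mult)
  also have "k / (S + a) - k / (2 * b) = (k * (2 * b) - k * (S + a)) / ((S + a) * (2 * b))"
    by (rule diff_frac_eq) (use pos b(2) in auto)
  also have "k * (2 * b) - k * (S + a) = k * (2 * b - S - a)" by (simp add: algebra_simps)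
  also have "\<bar>k * (2 * b - S - a) / ((S + a) * (2 * b))\<bar> = k * \<bar>2 * b - S - a\<bar> / ((S + a) * (2 * b))"
  proof -
    have "(S + a) * (2 * b) > 0" using pos(1) b(2) by simp
    then show ?thesis using k by (simp only: abs_divide abs_mult[of k] abs_of_nonneg abs_of_pos)
  qed
  also have "\<dots> \<le> n\<^sup>2 * (3 * n) / (b * (2 * b))"
    using k pos b a Sa by (intro frac_le mult_mono) auto
  also have "\<dots> = 3 * n ^ 3 / (2 * b\<^sup>2)" by (simp add: power2_eq_square power3_eq_cube)
  finally show "\<bar>d - k / (2 * y0)\<bar> \<le> 3 * n ^ 3 / (2 * b\<^sup>2)" .
qed

text \<open>The term \<open>c 0 1 / (2 * Im z0)\<close> comes from the curvature of the orbits of the rotations.\<close>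
lemma axial_expansion:
  fixes u :: "real^4 \<Rightarrow> real"
  assumes P: "psum c r z0 F" and r: "r > 0" and im: "Im z0 \<noteq> 0"
    and ax: "\<And>x. u x = F (Complex (x $ 1) (sgn (Im z0) * sqrt ((x $ 2)\<^sup>2 + ((x $ 3)\<^sup>2 + (x $ 4)\<^sup>2))))"
    and e: "0 < \<epsilon>"
  shows "\<exists>\<delta>>0. \<forall>h. norm h < \<delta> \<longrightarrow>
     \<bar>u (embC z0 + h) - quadr (c 0 0) (c 1 0) (c 0 1) (c 2 0) (c 1 1) (c 0 2) (c 0 1 / (2 * Im z0)) h\<bar> \<le> \<epsilon> * (norm h)\<^sup>2"
proof -
  obtain C s where C: "C \<ge> 0" and s: "s > 0" and T: "\<And>x y. \<bar>x\<bar> \<le> s \<Longrightarrow> \<bar>y\<bar> \<le> s \<Longrightarrow>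
     \<bar>F (z0 + Complex x y) - (c 0 0 + c 1 0 * x + c 0 1 * y + c 2 0 * x\<^sup>2 + c 1 1 * (x * y) + c 0 2 * y\<^sup>2)\<bar>
       \<le> C * (max \<bar>x\<bar> \<bar>y\<bar>) ^ 3" using psum_Taylor2[OF P r] by blast
  define sg where "sg = sgn (Im z0)"
  define y0 where "y0 = Im z0"
  define b where "b = sg * y0"
  have sg: "sg = 1 \<or> sg = - 1" and b: "b > 0" using im by (auto simp: sg_def b_def y0_def sgn_if)
  \<comment> \<open>The constants of the cubic errors: three caused by the curvature shift
    \<open>d\<close> in the terms with \<open>c 0 1\<close>, \<open>c 1 1\<close> and
    \<open>c 0 2\<close>, and the Taylor remainder, where 8 is the cube of the factor 2 in the bound
    on \<open>\<eta>\<close>.\<close>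
  define K where "K = \<bar>c 0 1\<bar> * (3 / (2 * b\<^sup>2)) + \<bar>c 1 1\<bar> * (1 / b) + \<bar>c 0 2\<bar> * (3 / b) + 8 * C"
  have K: "K \<ge> 0" using b C by (simp add: K_def)
  define \<delta> where "\<delta> = min (min (b / 2) (s / 2)) (\<epsilon> / (K + 1))"
  have \<delta>: "\<delta> > 0" using b s e K by (simp add: \<delta>_def)
  have "\<bar>u (embC z0 + h) - quadr (c 0 0) (c 1 0) (c 0 1) (c 2 0) (c 1 1) (c 0 2) (c 0 1 / (2 * Im z0)) h\<bar> \<le> \<epsilon> * (norm h)\<^sup>2"
    if h: "norm h < \<delta>" for h
  proof -
    have combine: "\<bar>v - q\<bar> \<le> s1 + s2 + s3 + R"
      if "\<bar>v - w\<bar> \<le> R" "w - q = t1 + t2 + t3" "\<bar>t1\<bar> \<le> s1" "\<bar>t2\<bar> \<le> s2" "\<bar>t3\<bar> \<le> s3" for v w q R t1 t2 t3 s1 s2 s3 :: real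
      using that by linarith
    define n where "n = norm h"
    have n: "0 \<le> n" "n \<le> b / 2" "2 * n \<le> s" "n \<le> \<epsilon> / (K + 1)" using h by (auto simp: n_def \<delta>_def)
    have comp: "\<bar>h $ i\<bar> \<le> n" for i unfolding n_def by (rule component_le_norm_cart)
    define k where "k = (h $ 3)\<^sup>2 + (h $ 4)\<^sup>2"
    have k: "0 \<le> k" "k \<le> n\<^sup>2" by (auto simp: k_def n_def norm_sq_4)
    define d where "d = sg * sqrt ((y0 + h $ 2)\<^sup>2 + k) - y0 - h $ 2"
    have d1: "\<bar>d\<bar> \<le> n\<^sup>2 / b" and d2: "\<bar>d - k / (2 * y0)\<bar> \<le> 3 * n ^ 3 / (2 * b\<^sup>2)"
      using sqrt_expansion[OF sg b_def b n(1,2) comp[of 2] k d_def] by auto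
    have d3: "\<bar>d\<bar> \<le> n / 2"
    proof -
      have "n\<^sup>2 / b \<le> n * (b / 2) / b" unfolding power2_eq_square
        using n b by (intro divide_right_mono mult_left_mono) auto
      moreover have "n * (b / 2) / b = n / 2" using b by simp
      ultimately show ?thesis using d1 by linarith
    qed
    define \<eta> where "\<eta> = h $ 2 + d"
    have eta: "\<bar>\<eta>\<bar> \<le> 2 * n" using d3 comp[of 2] n unfolding \<eta>_def by linarith
    have comps: "embC z0 $ 1 = Re z0" "embC z0 $ 2 = Im z0" "embC z0 $ 3 = 0" "embC z0 $ 4 = 0"
      by (auto simp: embC_def)
    have u: "u (embC z0 + h) = F (z0 + Complex (h $ 1) \<eta>)"
      unfolding ax by (intro arg_cong[of _ _ F])
        (simp add: complex_eq_iff comps \<eta>_def d_def y0_def sg_def k_def)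
    have p1: "\<bar>F (z0 + Complex (h $ 1) \<eta>) - (c 0 0 + c 1 0 * h $ 1 + c 0 1 * \<eta> + c 2 0 * (h $ 1)\<^sup>2 + c 1 1 * (h $ 1 * \<eta>) + c 0 2 * \<eta>\<^sup>2)\<bar>
        \<le> C * (2 * n) ^ 3"
    proof -
      have "\<bar>h $ 1\<bar> \<le> s" "\<bar>\<eta>\<bar> \<le> s" using comp[of 1] eta n by linarith+
      then have "\<bar>F (z0 + Complex (h $ 1) \<eta>) - (c 0 0 + c 1 0 * h $ 1 + c 0 1 * \<eta> + c 2 0 * (h $ 1)\<^sup>2 + c 1 1 * (h $ 1 * \<eta>) + c 0 2 * \<eta>\<^sup>2)\<bar>
        \<le> C * (max \<bar>h $ 1\<bar> \<bar>\<eta>\<bar>) ^ 3" by (rule T)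
      also have "\<dots> \<le> C * (2 * n) ^ 3"
        using comp[of 1] eta n C by (intro mult_left_mono power_mono) auto
      finally show ?thesis .
    qed
    have p2: "(c 0 0 + c 1 0 * h $ 1 + c 0 1 * \<eta> + c 2 0 * (h $ 1)\<^sup>2 + c 1 1 * (h $ 1 * \<eta>) + c 0 2 * \<eta>\<^sup>2)
       - quadr (c 0 0) (c 1 0) (c 0 1) (c 2 0) (c 1 1) (c 0 2) (c 0 1 / (2 * Im z0)) h
       = c 0 1 * (d - k / (2 * y0)) + c 1 1 * (h $ 1 * d) + c 0 2 * (2 * (h $ 2 * d) + d * d)"
      by (simp add: quadr_def \<eta>_def k_def y0_def power2_eq_square algebra_simps add_divide_distrib)
    have p3: "\<bar>c 0 1 * (d - k / (2 * y0))\<bar> \<le> \<bar>c 0 1\<bar> * (3 / (2 * b\<^sup>2)) * n ^ 3"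
      using mult_left_mono[OF d2, of "\<bar>c 0 1\<bar>"] by (simp add: abs_mult)
    have hd: "\<bar>h $ i * d\<bar> \<le> n ^ 3 / b" for i
      using mult_mono[OF comp[of i] d1] n by (simp add: abs_mult power2_eq_square power3_eq_cube)
    have p4: "\<bar>c 1 1 * (h $ 1 * d)\<bar> \<le> \<bar>c 1 1\<bar> * (1 / b) * n ^ 3"
      using mult_left_mono[OF hd[of 1], of "\<bar>c 1 1\<bar>"] by (simp add: abs_mult)
    have p5: "\<bar>c 0 2 * (2 * (h $ 2 * d) + d * d)\<bar> \<le> \<bar>c 0 2\<bar> * (3 / b) * n ^ 3"
    proof -
      have "\<bar>d * d\<bar> \<le> (n / 2) * (n\<^sup>2 / b)" unfolding abs_mult by (rule mult_mono[OF d3 d1]) (use n in auto)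
      also have "\<dots> \<le> n * (n\<^sup>2 / b)" using n b by (intro mult_right_mono) auto
      also have "\<dots> = n ^ 3 / b" by (simp add: power2_eq_square power3_eq_cube)
      finally have "\<bar>2 * (h $ 2 * d) + d * d\<bar> \<le> 3 * (n ^ 3 / b)" using hd[of 2] by linarith
      from mult_left_mono[OF this, of "\<bar>c 0 2\<bar>"] show ?thesis by (simp add: abs_mult)
    qed
    have K': "K * n ^ 3 = \<bar>c 0 1\<bar> * (3 / (2 * b\<^sup>2)) * n ^ 3 + \<bar>c 1 1\<bar> * (1 / b) * n ^ 3 + \<bar>c 0 2\<bar> * (3 / b) * n ^ 3 + C * (2 * n) ^ 3"
      by (simp add: K_def power_mult_distrib distrib_right)
    have "\<bar>u (embC z0 + h) - quadr (c 0 0) (c 1 0) (c 0 1) (c 2 0) (c 1 1) (c 0 2) (c 0 1 / (2 * Im z0)) h\<bar> \<le> K * n ^ 3"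
      unfolding u K' by (rule combine[OF p1 p2 p3 p4 p5])
    also have "\<dots> = K * n * n\<^sup>2" by (simp add: power2_eq_square power3_eq_cube)
    also have "\<dots> \<le> \<epsilon> * n\<^sup>2"
    proof (rule mult_right_mono)
      have "K * n \<le> (K + 1) * n" using n by (simp add: distrib_right)
      also have "\<dots> \<le> (K + 1) * (\<epsilon> / (K + 1))" using n K by (intro mult_left_mono) auto
      also have "\<dots> = \<epsilon>" using K by simp
      finally show "K * n \<le> \<epsilon>" .
    qed simp
    finally show ?thesis by (simp add: n_def)
  qed
  then show ?thesis using \<delta> by blast
qed

section \<open>Graphical functions\<close>

lemma vpos_measurable [measurable]:
  assumes "v \<in> I \<or> v \<in> {v0, v1, vz}"
  shows "(\<lambda>p. vpos v0 v1 vz (fst p) (snd p) v) \<in> borel_measurable (borel \<Otimes>\<^sub>M PiM I (\<lambda>_. lborel))"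
proof (cases "v \<in> {v0, v1, vz}")
  case False
  then have "v \<in> I" using assms by simp
  then have "(\<lambda>p. snd p v) \<in> borel_measurable (borel \<Otimes>\<^sub>M PiM I (\<lambda>_. lborel :: (real^4) measure))"
    using measurable_compose[OF measurable_snd measurable_component_singleton[OF \<open>v \<in> I\<close>], of borel "\<lambda>_. lborel :: (real^4) measure"] by simp
  then show ?thesis using False by (simp add: vpos_def[abs_def])
next
  case True
  then show ?thesis by (cases "v = v0"; cases "v = v1") (simp_all add: vpos_def[abs_def])
qed

definition edges_nn :: "('v \<times> 'v) list \<Rightarrow> ('v \<Rightarrow> real^4) \<Rightarrow> ennreal" where
  "edges_nn E X = prod_list (map (\<lambda>e. ennreal (1 / (norm (X (fst e) - X (snd e)))\<^sup>2)) E)"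

lemma edges_nn_measurable:
  assumes "\<forall>e\<in>set E. fst e \<in> V \<and> snd e \<in> V" and "\<And>v. v \<in> V \<Longrightarrow> (\<lambda>p. X p v) \<in> borel_measurable M"
  shows "(\<lambda>p. edges_nn E (X p)) \<in> borel_measurable M"
  using assms(1)
proof (induction E)
  case (Cons e E)
  then have [measurable]: "(\<lambda>p. edges_nn E (X p)) \<in> borel_measurable M"
    "(\<lambda>p. X p (fst e)) \<in> borel_measurable M" "(\<lambda>p. X p (snd e)) \<in> borel_measurable M"
    using assms(2) by auto
  have "(\<lambda>p. ennreal (1 / (norm (X p (fst e) - X p (snd e)))\<^sup>2) * edges_nn E (X p)) \<in> borel_measurable M" by measurable
  then show ?case by (simp add: edges_nn_def)
qed (simp add: edges_nn_def)

lemma edges_nn_cong: "(\<And>v. v \<in> V \<Longrightarrow> X v = Y v) \<Longrightarrow> \<forall>e\<in>set E. fst e \<in> V \<and> snd e \<in> V \<Longrightarrow> edges_nn E X = edges_nn E Y"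
  by (auto simp: edges_nn_def intro!: arg_cong[of _ _ prod_list] map_cong)

lemma edges_nn_reflect: "edges_nn E (\<lambda>v. reflect n (X v)) = edges_nn E X"
  by (simp add: edges_nn_def reflect_diff)

lemma gf_nn_alt: "gf_nn V E v0 v1 vz y = ennreal ((1 / pi\<^sup>2) ^ card (V - {v0, v1, vz})) *
     (\<integral>\<^sup>+ x. edges_nn E (vpos v0 v1 vz y x) \<partial>(PiM (V - {v0, v1, vz}) (\<lambda>_. lborel)))"
  by (simp add: gf_nn_def edges_nn_def)

interpretation lborel4: product_sigma_finite "\<lambda>_ :: 'v. lborel :: (real^4) measure"
  by standard

lemma gf_nn_measurable:
  assumes "finite V" "\<forall>e\<in>set E. fst e \<in> V \<and> snd e \<in> V"
  shows "gf_nn V E v0 v1 vz \<in> borel_measurable borel"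
proof -
  let ?I = "V - {v0, v1, vz}"
  interpret sigma_finite_measure "PiM ?I (\<lambda>_. lborel :: (real^4) measure)"
    by (rule lborel4.sigma_finite) (use assms in simp)
  have "(\<lambda>p. edges_nn E (vpos v0 v1 vz (fst p) (snd p))) \<in> borel_measurable (borel \<Otimes>\<^sub>M PiM ?I (\<lambda>_. lborel))"
    by (rule edges_nn_measurable[OF assms(2)]) (auto intro!: vpos_measurable)
  then have [measurable]: "(\<lambda>y. \<integral>\<^sup>+ x. edges_nn E (vpos v0 v1 vz y x) \<partial>(PiM ?I (\<lambda>_. lborel))) \<in> borel_measurable borel"
    by (intro borel_measurable_nn_integral) (simp add: case_prod_beta')
  show ?thesis unfolding gf_nn_alt[abs_def] by measurable
qed

text \<open>The appended edge is the only factor that sees \<open>vn\<close>. Integrating over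
  \<open>vz\<close> last leaves the integral for the original graph with its external vertex at x,
  and the new internal vertex accounts for the factor 1 / pi^2.\<close>

lemma gf_nn_append_edge:
  fixes V :: "'v set"
  assumes V: "finite V" "v0 \<in> V" "v1 \<in> V" "vz \<in> V" "distinct [v0, v1, vz]" "vn \<notin> V"
    and E: "\<forall>e\<in>set E. fst e \<in> V \<and> snd e \<in> V"
  shows "gf_nn (insert vn V) ((vz, vn) # E) v0 v1 vn y
     = ennreal (1 / pi\<^sup>2) * (\<integral>\<^sup>+x. ennreal (1 / (norm (x - y))\<^sup>2) * gf_nn V E v0 v1 vz x \<partial>lborel)"
proof -
  let ?I = "V - {v0, v1, vz}" and ?L = "\<lambda>_ :: 'v. lborel :: (real^4) measure"
  have I: "insert vn V - {v0, v1, vn} = insert vz ?I" "finite ?I" "vz \<notin> ?I" using V by auto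
  interpret sigma_finite_measure "PiM ?I ?L" by (rule lborel4.sigma_finite[OF I(2)])
  let ?X = "vpos v0 v1 vn y"
  have meas: "(\<lambda>X. edges_nn ((vz, vn) # E) (?X X)) \<in> borel_measurable (PiM (insert vz ?I) ?L)"
  proof (rule edges_nn_measurable[where V = "insert vn V"])
    fix v assume v: "v \<in> insert vn V"
    have "(\<lambda>X. (y, X)) \<in> measurable (PiM (insert vz ?I) ?L) (borel \<Otimes>\<^sub>M PiM (insert vz ?I) ?L)" by measurable
    from measurable_compose[OF this vpos_measurable[of v _ v0 v1 vn]]
    show "(\<lambda>X. ?X X v) \<in> borel_measurable (PiM (insert vz ?I) ?L)" using v by auto
  qed (use E V in auto)
  have pos: "?X (w(vz := x)) v = vpos v0 v1 vz x w v" if "v \<in> V" for v w x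
    using that V by (auto simp: vpos_def)
  have split: "edges_nn ((vz, vn) # E) (?X (w(vz := x))) = ennreal (1 / (norm (x - y))\<^sup>2) * edges_nn E (vpos v0 v1 vz x w)" for w x
  proof -
    have "?X (w(vz := x)) vn = y" "?X (w(vz := x)) vz = x" using V by (auto simp: vpos_def)
    moreover have "edges_nn E (?X (w(vz := x))) = edges_nn E (vpos v0 v1 vz x w)"
      by (rule edges_nn_cong[OF pos E])
    ultimately show ?thesis by (simp add: edges_nn_def)
  qed
  have mE: "(\<lambda>w. edges_nn E (vpos v0 v1 vz x w)) \<in> borel_measurable (PiM ?I ?L)" for x
  proof (rule edges_nn_measurable[OF E])
    fix v assume v: "v \<in> V"
    have "(\<lambda>X. (x, X)) \<in> measurable (PiM ?I ?L) (borel \<Otimes>\<^sub>M PiM ?I ?L)" by measurable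
    from measurable_compose[OF this vpos_measurable[of v _ v0 v1 vz]]
    show "(\<lambda>X. vpos v0 v1 vz x X v) \<in> borel_measurable (PiM ?I ?L)" using v by auto
  qed
  have "(\<integral>\<^sup>+ X. edges_nn ((vz, vn) # E) (?X X) \<partial>(PiM (insert vz ?I) ?L))
     = (\<integral>\<^sup>+x. (\<integral>\<^sup>+w. edges_nn ((vz, vn) # E) (?X (w(vz := x))) \<partial>(PiM ?I ?L)) \<partial>lborel)"
    by (rule lborel4.product_nn_integral_insert_rev[OF I(2,3) meas])
  also have "\<dots> = (\<integral>\<^sup>+x. ennreal (1 / (norm (x - y))\<^sup>2) * (\<integral>\<^sup>+w. edges_nn E (vpos v0 v1 vz x w) \<partial>(PiM ?I ?L)) \<partial>lborel)"
    unfolding split by (intro nn_integral_cong nn_integral_cmult mE)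
  finally have main: "(\<integral>\<^sup>+ X. edges_nn ((vz, vn) # E) (?X X) \<partial>(PiM (insert vz ?I) ?L)) = \<dots>" .
  have c: "ennreal ((1 / pi\<^sup>2) ^ Suc (card ?I)) = ennreal (1 / pi\<^sup>2) * ennreal ((1 / pi\<^sup>2) ^ card ?I)"
    by (simp add: ennreal_mult'[symmetric])
  have [measurable]: "(\<lambda>x. (\<integral>\<^sup>+w. edges_nn E (vpos v0 v1 vz x w) \<partial>(PiM ?I ?L))) \<in> borel_measurable borel"
  proof -
    have "(\<lambda>p. edges_nn E (vpos v0 v1 vz (fst p) (snd p))) \<in> borel_measurable (borel \<Otimes>\<^sub>M PiM ?I ?L)"
      by (rule edges_nn_measurable[OF E]) (auto intro!: vpos_measurable)
    then show ?thesis by (intro borel_measurable_nn_integral) (simp add: case_prod_beta')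
  qed
  have "(\<integral>\<^sup>+x. ennreal (1 / (norm (x - y))\<^sup>2) * gf_nn V E v0 v1 vz x \<partial>lborel)
    = (\<integral>\<^sup>+x. ennreal ((1 / pi\<^sup>2) ^ card ?I) * (ennreal (1 / (norm (x - y))\<^sup>2) * (\<integral>\<^sup>+w. edges_nn E (vpos v0 v1 vz x w) \<partial>(PiM ?I ?L))) \<partial>lborel)"
    by (intro nn_integral_cong) (simp only: gf_nn_alt mult_ac)
  also have "\<dots> = ennreal ((1 / pi\<^sup>2) ^ card ?I) * (\<integral>\<^sup>+x. ennreal (1 / (norm (x - y))\<^sup>2) * (\<integral>\<^sup>+w. edges_nn E (vpos v0 v1 vz x w) \<partial>(PiM ?I ?L)) \<partial>lborel)"
    by (rule nn_integral_cmult) measurable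
  finally show ?thesis
    unfolding gf_nn_alt[of "insert vn V"] I(1) main card_insert_disjoint[OF I(2,3)] c by (simp only: mult.assoc)
qed

text \<open>Reflect all internal vertices at once: the product Lebesgue measure and all distances
  are preserved, and the vertices at 0 and \<open>e1\<close> stay fixed because \<open>n\<close> is
  orthogonal to \<open>e1\<close>.\<close>

lemma gf_nn_reflect:
  fixes V :: "'v set"
  assumes V: "finite V" and E: "\<forall>e\<in>set E. fst e \<in> V \<and> snd e \<in> V" and n: "n \<bullet> e1 = 0"
  shows "gf_nn V E v0 v1 vz (reflect n y) = gf_nn V E v0 v1 vz y"
proof -
  let ?I = "V - {v0, v1, vz}" and ?L = "\<lambda>_ :: 'v. lborel :: (real^4) measure"
  let ?R = "\<lambda>x. \<lambda>i\<in>?I. reflect n (x i)"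
  have I: "finite ?I" using V by simp
  have rl: "reflect n \<in> measurable lborel lborel" using reflect_measurable by simp
  have R [measurable]: "?R \<in> measurable (PiM ?I ?L) (PiM ?I ?L)"
    by (rule measurable_restrict, rule measurable_compose[OF _ rl], rule measurable_component_singleton)
  have d: "distr (PiM ?I ?L) (PiM ?I ?L) ?R = PiM ?I ?L"
  proof (rule lborel4.PiM_eqI[OF I])
    fix A assume A: "\<And>i. i \<in> ?I \<Longrightarrow> A i \<in> sets (lborel :: (real^4) measure)"
    have A': "reflect n -` A i \<in> sets (lborel :: (real^4) measure)" if "i \<in> ?I" for i
      using measurable_sets[OF rl A[OF that]] by simp
    have "?R -` (Pi\<^sub>E ?I A) \<inter> space (PiM ?I ?L) = Pi\<^sub>E ?I (\<lambda>i. reflect n -` A i)"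
      by (auto simp: space_PiM PiE_def extensional_def restrict_def Pi_def)
    moreover have "Pi\<^sub>E ?I A \<in> sets (PiM ?I ?L)" using A I by (intro sets_PiM_I_finite) auto
    moreover have "emeasure (PiM ?I ?L) (Pi\<^sub>E ?I (\<lambda>i. reflect n -` A i)) = (\<Prod>i\<in>?I. emeasure lborel (reflect n -` A i))"
      by (rule lborel4.emeasure_PiM[OF I A'])
    ultimately have "emeasure (distr (PiM ?I ?L) (PiM ?I ?L) ?R) (Pi\<^sub>E ?I A) = (\<Prod>i\<in>?I. emeasure lborel (reflect n -` A i))"
      by (simp add: emeasure_distr)
    also have "\<dots> = (\<Prod>i\<in>?I. emeasure lborel (A i))"
    proof (rule prod.cong)
      fix i assume i: "i \<in> ?I"
      have "emeasure lborel (A i) = emeasure (distr lborel borel (reflect n)) (A i)" by (simp add: distr_reflect)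
      also have "\<dots> = emeasure lborel (reflect n -` A i)" using A[OF i] by (subst emeasure_distr) auto
      finally show "emeasure lborel (reflect n -` A i) = emeasure lborel (A i)" ..
    qed simp
    finally show "emeasure (distr (PiM ?I ?L) (PiM ?I ?L) ?R) (Pi\<^sub>E ?I A) = (\<Prod>i\<in>?I. emeasure lborel (A i))" .
  qed simp
  have mE: "(\<lambda>w. edges_nn E (vpos v0 v1 vz x w)) \<in> borel_measurable (PiM ?I ?L)" for x
  proof (rule edges_nn_measurable[OF E])
    fix v assume v: "v \<in> V"
    have "(\<lambda>X. (x, X)) \<in> measurable (PiM ?I ?L) (borel \<Otimes>\<^sub>M PiM ?I ?L)" by measurable
    from measurable_compose[OF this vpos_measurable[of v _ v0 v1 vz]]
    show "(\<lambda>X. vpos v0 v1 vz x X v) \<in> borel_measurable (PiM ?I ?L)" using v by auto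
  qed
  have e: "edges_nn E (vpos v0 v1 vz (reflect n y) (?R x)) = edges_nn E (vpos v0 v1 vz y x)" for x
  proof -
    have "vpos v0 v1 vz (reflect n y) (?R x) v = reflect n (vpos v0 v1 vz y x v)" if "v \<in> V" for v
      using that n by (auto simp: vpos_def reflect_def inner_commute)
    from edges_nn_cong[OF this E] show ?thesis by (simp add: edges_nn_reflect)
  qed
  have "(\<integral>\<^sup>+ x. edges_nn E (vpos v0 v1 vz (reflect n y) x) \<partial>(PiM ?I ?L))
     = (\<integral>\<^sup>+ x. edges_nn E (vpos v0 v1 vz (reflect n y) x) \<partial>(distr (PiM ?I ?L) (PiM ?I ?L) ?R))" by (simp only: d)
  also have "\<dots> = (\<integral>\<^sup>+ x. edges_nn E (vpos v0 v1 vz (reflect n y) (?R x)) \<partial>(PiM ?I ?L))"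
    by (rule nn_integral_distr[OF R]) (simp add: mE)
  also have "\<dots> = (\<integral>\<^sup>+ x. edges_nn E (vpos v0 v1 vz y x) \<partial>(PiM ?I ?L))" unfolding e ..
  finally show ?thesis unfolding gf_nn_alt by simp
qed

lemma embC_nth: "embC z $ 1 = Re z" "embC z $ 2 = Im z" "embC z $ 3 = 0" "embC z $ 4 = 0"
  by (auto simp: embC_def)

lemma norm_embC: "norm (embC z) = cmod z"
proof -
  have "(norm (embC z))\<^sup>2 = (cmod z)\<^sup>2" unfolding norm_sq_4 embC_nth by (simp add: cmod_power2)
  then show ?thesis by simp
qed

text \<open>The points x and \<open>embC z\<close> have equal norm and equal first coordinate, so
  the reflection with normal x - \<open>embC z\<close> exchanges them and fixes \<open>e1\<close>. A
  single reflection thus replaces the rotations about the axis.\<close>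

lemma gf_nn_axial:
  fixes x :: "real^4"
  assumes V: "finite V" and E: "\<forall>e\<in>set E. fst e \<in> V \<and> snd e \<in> V"
    and z: "Re z = x $ 1" "(Im z)\<^sup>2 = (x $ 2)\<^sup>2 + ((x $ 3)\<^sup>2 + (x $ 4)\<^sup>2)"
  shows "gf_nn V E v0 v1 vz x = gf_nn V E v0 v1 vz (embC z)"
proof -
  define n where "n = x - embC z"
  have n1: "n \<bullet> e1 = 0" using z by (simp add: n_def e1_def inner_axis embC_nth inner_diff_left)
  have "(norm x)\<^sup>2 = (norm (embC z))\<^sup>2" unfolding norm_embC cmod_power2 norm_sq_4 z by simp
  then have nn: "n \<bullet> n = 2 * (x \<bullet> n)"
    unfolding power2_norm_eq_inner n_def by (simp add: inner_diff_left inner_diff_right inner_commute)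
  have "reflect n x = embC z"
  proof (cases "n = 0")
    case False
    then have q: "2 * (x \<bullet> n) / (n \<bullet> n) = 1" using nn by (metis divide_self inner_eq_zero_iff)
    show ?thesis unfolding reflect_def q by (simp add: n_def)
  qed (simp add: reflect_def n_def)
  with gf_nn_reflect[OF V E n1, of v0 v1 vz x] show ?thesis by simp
qed

lemma gf_cnj:
  assumes "finite V" "\<forall>e\<in>set E. fst e \<in> V \<and> snd e \<in> V"
  shows "gf V E v0 v1 vz (embC (cnj z)) = gf V E v0 v1 vz (embC z)"
  using gf_nn_axial[OF assms, of z "embC (cnj z)"] by (simp add: gf_def embC_nth)

text \<open>With the normalisation 1 / pi^2 of the vertex integrals, Poisson's equation says that
  the Laplacian of the new function is -4 times the old one. The right-hand side is this Laplacian,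
  F_xx + F_yy + (2/y) F_y, written in Taylor coefficients.\<close>

lemma gf_append_edge_pde:
  fixes V :: "'v set"
  assumes V: "finite V" "v0 \<in> V" "v1 \<in> V" "vz \<in> V" "distinct [v0, v1, vz]" "vn \<notin> V"
    and E: "\<forall>e\<in>set E. fst e \<in> V \<and> snd e \<in> V"
    and im: "Im z0 \<noteq> 0" and fin: "gf_nn (insert vn V) ((vz, vn) # E) v0 v1 vn (embC z0) < \<infinity>"
    and P: "psum c r z0 (\<lambda>z. gf (insert vn V) ((vz, vn) # E) v0 v1 vn (embC z))" and r: "r > 0"
    and cont: "isCont (\<lambda>z. gf V E v0 v1 vz (embC z)) z0"
  shows "gf V E v0 v1 vz (embC z0) = - (c 2 0 + c 0 2 + c 0 1 / Im z0) / 2"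
proof -
  let ?f = "gf_nn V E v0 v1 vz" and ?u = "gf (insert vn V) ((vz, vn) # E) v0 v1 vn"
  define U where "U x = (\<integral>\<^sup>+y. ennreal (1 / (norm (y - x))\<^sup>2) * ?f y \<partial>lborel)" for x
  have E': "\<forall>e\<in>set ((vz, vn) # E). fst e \<in> insert vn V \<and> snd e \<in> insert vn V" using E V by auto
  have rec: "gf_nn (insert vn V) ((vz, vn) # E) v0 v1 vn y = ennreal (1 / pi\<^sup>2) * U y" for y
    unfolding U_def by (rule gf_nn_append_edge[OF V E])
  have uU: "enn2real (U y) = pi\<^sup>2 * ?u y" for y
    by (simp add: gf_def rec enn2real_mult)
  have finU: "U (embC z0) < \<infinity>" using fin unfolding rec by (auto simp: ennreal_mult_less_top)
  \<comment> \<open>The axial coordinate of x, with the sign chosen so that it stays in the half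
    plane of \<open>z0\<close> and sends \<open>embC z0\<close> back to \<open>z0\<close>.\<close>
  define zz where "zz x = Complex (x $ 1) (sgn (Im z0) * sqrt ((x $ 2)\<^sup>2 + ((x $ 3)\<^sup>2 + (x $ 4)\<^sup>2)))" for x :: "real^4"
  have sg: "sgn (Im z0) * sgn (Im z0) = 1" using im by (simp add: sgn_if)
  have zz: "Re (zz x) = x $ 1" "(Im (zz x))\<^sup>2 = (x $ 2)\<^sup>2 + ((x $ 3)\<^sup>2 + (x $ 4)\<^sup>2)" for x
    using sg by (auto simp: zz_def power_mult_distrib power2_eq_square[of "sgn _"])
  have ax: "gf_nn V E v0 v1 vz x = gf_nn V E v0 v1 vz (embC (zz x))"
    "gf_nn (insert vn V) ((vz, vn) # E) v0 v1 vn x = gf_nn (insert vn V) ((vz, vn) # E) v0 v1 vn (embC (zz x))" for x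
    using gf_nn_axial[OF V(1) E zz] gf_nn_axial[OF _ E' zz] V(1) by auto
  have z0: "zz (embC z0) = z0" using im by (simp add: complex_eq_iff zz_def embC_nth sgn_if)
  have "isCont zz (embC z0)"
    unfolding zz_def complex_eq_iff Complex_eq by (intro continuous_intros)
  then have "isCont (\<lambda>x. gf V E v0 v1 vz (embC (zz x))) (embC z0)"
    using isCont_o2[of "embC z0" zz "\<lambda>z. gf V E v0 v1 vz (embC z)"] cont z0 by simp
  then have cf: "isCont (gf V E v0 v1 vz) (embC z0)" using ax(1) by (simp add: gf_def[abs_def])
  have "pi\<^sup>2 * gf V E v0 v1 vz (embC z0) = - (pi\<^sup>2 * c 2 0 + pi\<^sup>2 * c 0 2 + 2 * (pi\<^sup>2 * (c 0 1 / (2 * Im z0)))) / 2"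
  proof (rule poisson_equation[where f = ?f and x = "embC z0" and ?c0.0 = "pi\<^sup>2 * c 0 0" and a = "pi\<^sup>2 * c 1 0" and b = "pi\<^sup>2 * c 0 1" and ?q12.0 = "pi\<^sup>2 * c 1 1"])
    show "?f \<in> borel_measurable borel" by (rule gf_nn_measurable[OF V(1) E])
    show "(\<integral>\<^sup>+ y. ennreal (1 / (norm (y - embC z0))\<^sup>2) * ?f y \<partial>lborel) < \<infinity>" using finU by (simp add: U_def)
    fix \<epsilon> :: real assume e: "\<epsilon> > 0"
    have "\<exists>\<delta>>0. \<forall>h. norm h < \<delta> \<longrightarrow>
      \<bar>?u (embC z0 + h) - quadr (c 0 0) (c 1 0) (c 0 1) (c 2 0) (c 1 1) (c 0 2) (c 0 1 / (2 * Im z0)) h\<bar> \<le> (\<epsilon> / pi\<^sup>2) * (norm h)\<^sup>2"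
      by (rule axial_expansion[OF P r im]) (use ax(2) e in \<open>auto simp: gf_def zz_def\<close>)
    then obtain \<delta> where \<delta>: "\<delta> > 0" "\<And>h. norm h < \<delta> \<Longrightarrow>
      \<bar>?u (embC z0 + h) - quadr (c 0 0) (c 1 0) (c 0 1) (c 2 0) (c 1 1) (c 0 2) (c 0 1 / (2 * Im z0)) h\<bar> \<le> (\<epsilon> / pi\<^sup>2) * (norm h)\<^sup>2" by blast
    have "\<bar>enn2real (U (embC z0 + h)) - quadr (pi\<^sup>2 * c 0 0) (pi\<^sup>2 * c 1 0) (pi\<^sup>2 * c 0 1) (pi\<^sup>2 * c 2 0) (pi\<^sup>2 * c 1 1) (pi\<^sup>2 * c 0 2) (pi\<^sup>2 * (c 0 1 / (2 * Im z0))) h\<bar> \<le> \<epsilon> * (norm h)\<^sup>2"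
      if h: "norm h < \<delta>" for h
    proof -
      have q: "quadr (pi\<^sup>2 * c 0 0) (pi\<^sup>2 * c 1 0) (pi\<^sup>2 * c 0 1) (pi\<^sup>2 * c 2 0) (pi\<^sup>2 * c 1 1) (pi\<^sup>2 * c 0 2) (pi\<^sup>2 * (c 0 1 / (2 * Im z0))) h
        = pi\<^sup>2 * quadr (c 0 0) (c 1 0) (c 0 1) (c 2 0) (c 1 1) (c 0 2) (c 0 1 / (2 * Im z0)) h"
        by (simp add: quadr_def distrib_left mult.assoc)
      show ?thesis using mult_left_mono[OF \<delta>(2)[OF h], of "pi\<^sup>2"]
        unfolding q uU right_diff_distrib[symmetric] abs_mult by simp
    qed
    then show "\<exists>\<delta>>0. \<forall>h. norm h < \<delta> \<longrightarrow>
      \<bar>enn2real (\<integral>\<^sup>+ y. ennreal (1 / (norm (y - (embC z0 + h)))\<^sup>2) * ?f y \<partial>lborel) - quadr (pi\<^sup>2 * c 0 0) (pi\<^sup>2 * c 1 0) (pi\<^sup>2 * c 0 1) (pi\<^sup>2 * c 2 0) (pi\<^sup>2 * c 1 1) (pi\<^sup>2 * c 0 2) (pi\<^sup>2 * (c 0 1 / (2 * Im z0))) h\<bar> \<le> \<epsilon> * (norm h)\<^sup>2"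
      using \<delta>(1) unfolding U_def by blast
    have "(gf V E v0 v1 vz \<longlongrightarrow> gf V E v0 v1 vz (embC z0)) (at (embC z0))" using cf isCont_def by blast
    then obtain d where d: "d > 0" "\<And>x. dist x (embC z0) < d \<Longrightarrow> dist (gf V E v0 v1 vz x) (gf V E v0 v1 vz (embC z0)) < \<epsilon>"
      using cf[unfolded continuous_at_eps_delta, rule_format, OF e] by blast
    show "\<exists>\<delta>>0. \<forall>h. norm h < \<delta> \<longrightarrow> \<bar>enn2real (?f (embC z0 + h)) - gf V E v0 v1 vz (embC z0)\<bar> \<le> \<epsilon>"
      using d(1) d(2)[of "embC z0 + _"] by (intro exI[of _ d]) (auto simp: dist_norm gf_def less_imp_le)
  qed
  also have "\<dots> = pi\<^sup>2 * (- (c 2 0 + c 0 2 + c 0 1 / Im z0) / 2)" by (simp add: field_simps)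
  finally show ?thesis by simp
qed

section \<open>Growth of functions with Gegenbauer expansions\<close>

lemma deriv_has_fps_expansion:
  fixes f :: "real \<Rightarrow> real"
  shows "f has_fps_expansion F \<Longrightarrow> (deriv ^^ n) f has_fps_expansion (fps_deriv ^^ n) F"
  by (induction n) (auto intro: has_fps_expansion_deriv)

text \<open>The generating function times its quadratic denominator is 1, which gives the recursion
  G_n = 2 x G_(n-1) - G_(n-2). The generous rate 4^n is compensated later by restricting to radii at
  most 1/8.\<close>

lemma gegenbauer_1_bound:
  assumes x: "\<bar>x\<bar> \<le> 1"
  shows "\<bar>gegenbauer 1 n x\<bar> \<le> 4 ^ n"
proof -
  define F :: "real fps" where "F = 1 - fps_const (2 * x) * fps_X + fps_X ^ 2"
  define G where "G = inverse F"
  have F0: "fps_nth F 0 \<noteq> 0" by (simp add: F_def)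
  have "(\<lambda>t. inverse (1 - 2 * x * t + t ^ 2)) has_fps_expansion G"
    unfolding G_def F_def by (intro fps_expansion_intros) (simp add: F0[unfolded F_def])
  moreover have "\<forall>\<^sub>F t in nhds 0. inverse (1 - 2 * x * t + t ^ 2) = (1 - 2 * x * t + t\<^sup>2) powr (- 1)"
  proof -
    have "((\<lambda>t. 1 - 2 * x * t + t\<^sup>2) \<longlongrightarrow> 1 - 2 * x * 0 + 0\<^sup>2) (nhds 0)"
      by (intro tendsto_intros filterlim_ident)
    from order_tendstoD(1)[OF this, of 0] have "\<forall>\<^sub>F t in nhds 0. 0 < 1 - 2 * x * t + t\<^sup>2" by simp
    then show ?thesis by eventually_elim (simp add: powr_minus)
  qed
  ultimately have E: "(\<lambda>t. (1 - 2 * x * t + t\<^sup>2) powr (- 1)) has_fps_expansion G"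
    by (rule has_fps_expansion_cong[THEN iffD1, OF _ refl, rotated])
  from has_fps_expansion_imp_0_eq_fps_nth_0[OF deriv_has_fps_expansion[OF E, of n]]
  have gn: "gegenbauer 1 n x = fps_nth G n" by (simp add: gegenbauer_def fps_0th_higher_deriv)
  have GF: "F * G = 1" unfolding G_def using inverse_mult_eq_1'[OF F0] .
  then have GF: "G - fps_const (2 * x) * (fps_X * G) + fps_X ^ 2 * G = 1" by (simp add: F_def algebra_simps)
  have rec: "fps_nth G n - 2 * x * (if n = 0 then 0 else fps_nth G (n - 1)) + (if n < 2 then 0 else fps_nth G (n - 2)) = (if n = 0 then 1 else 0)" for n
    using arg_cong[OF GF, of "\<lambda>H. fps_nth H n"] by (simp add: fps_X_power_mult_nth)
  have "\<bar>fps_nth G n\<bar> \<le> 4 ^ n"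
  proof (induction n rule: less_induct)
    case (less n)
    have m: "\<bar>2 * x * y\<bar> \<le> 2 * \<bar>y\<bar>" for y using mult_right_mono[OF x, of "2 * \<bar>y\<bar>"] by (simp add: abs_mult)
    consider "n = 0" | "n = 1" | k where "n = Suc (Suc k)" by (metis One_nat_def not0_implies_Suc)
    then show ?case
    proof cases
      case 1 then show ?thesis using rec[of 0] by simp
    next
      case 2 then show ?thesis using rec[of 0] rec[of 1] x by simp
    next
      case 3
      have "fps_nth G n = 2 * x * fps_nth G (Suc k) - fps_nth G k" using rec[of n] 3 by simp
      then have "\<bar>fps_nth G n\<bar> \<le> 2 * \<bar>fps_nth G (Suc k)\<bar> + \<bar>fps_nth G k\<bar>" using m[of "fps_nth G (Suc k)"] by linarith
      also have "\<dots> \<le> 2 * 4 ^ Suc k + 4 ^ k" using less[of "Suc k"] less[of k] 3 by (intro add_mono mult_left_mono) auto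
      also have "\<dots> \<le> 4 ^ n" by (simp add: 3)
      finally show ?thesis .
    qed
  qed
  then show ?thesis by (simp add: gn)
qed

text \<open>The ratio 1/2 is the product of the rate 4 of the Gegenbauer bound and the radius 1/8.
  The coefficient bound starts at m = 1, hence a comparison of eventual terms.\<close>

lemma polynomial_coefficients_summable:
  fixes a :: "nat \<Rightarrow> nat \<Rightarrow> nat \<Rightarrow> real"
  assumes "\<forall>l m n. m \<ge> 1 \<longrightarrow> \<bar>a l m n\<bar> \<le> A * real m powr \<alpha>" "A > 0"
  shows "summable (\<lambda>m. (\<Sum>l\<le>L. \<Sum>n\<le>m. \<bar>a l m n\<bar>) * (1 / 2) ^ m)"
proof (rule summable_comparison_test_ev)
  have "(\<lambda>m. real (Suc L) * (real (Suc m) * (A * real m powr \<alpha>)) * (1 / 2) ^ m) \<in> O(\<lambda>m. (3 / 4) ^ m)"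
    by real_asymp
  moreover have "summable (\<lambda>m. norm ((3 / 4) ^ m :: real))" by (simp add: summable_geometric)
  ultimately show "summable (\<lambda>m. real (Suc L) * (real (Suc m) * (A * real m powr \<alpha>)) * (1 / 2) ^ m)"
    by (rule summable_comparison_test_bigo[rotated])
  show "\<forall>\<^sub>F m in sequentially. norm ((\<Sum>l\<le>L. \<Sum>n\<le>m. \<bar>a l m n\<bar>) * (1 / 2) ^ m)
      \<le> real (Suc L) * (real (Suc m) * (A * real m powr \<alpha>)) * (1 / 2) ^ m"
    using eventually_ge_at_top[of 1]
  proof eventually_elim
    case (elim m)
    have "(\<Sum>l\<le>L. \<Sum>n\<le>m. \<bar>a l m n\<bar>) \<le> (\<Sum>l\<le>L. \<Sum>n\<le>m. A * real m powr \<alpha>)"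
      using assms(1) elim by (intro sum_mono) auto
    also have "\<dots> = real (Suc L) * (real (Suc m) * (A * real m powr \<alpha>))" by simp
    finally have "(\<Sum>l\<le>L. \<Sum>n\<le>m. \<bar>a l m n\<bar>) * (1 / 2) ^ m \<le> real (Suc L) * (real (Suc m) * (A * real m powr \<alpha>)) * (1 / 2) ^ m"
      by (intro mult_right_mono) auto
    moreover have "0 \<le> (\<Sum>l\<le>L. \<Sum>n\<le>m. \<bar>a l m n\<bar>)" by (intro sum_nonneg) auto
    ultimately show ?case by simp
  qed
qed

text \<open>Handles both expansions at once: \<open>t\<close> is the radius near 0 or its inverse
  near infinity, and \<open>\<sigma>\<close> is the leading power. The logarithms are bounded by
  their highest power, and the rest sums to a constant.\<close>

lemma gegenbauer_series_bound:
  fixes a :: "nat \<Rightarrow> nat \<Rightarrow> nat \<Rightarrow> real"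
  assumes S: "(\<lambda>m. \<Sum>l\<le>L. \<Sum>n\<le>m. a l m n * lam ^ l * w m * G n) sums y"
    and G: "\<And>n. \<bar>G n\<bar> \<le> 4 ^ n" and w: "\<And>m. \<bar>w m\<bar> \<le> \<sigma> * t ^ m" and t: "0 \<le> t" "t \<le> 1 / 8" and \<sigma>: "\<sigma> \<ge> 0"
    and sm: "summable (\<lambda>m. (\<Sum>l\<le>L. \<Sum>n\<le>m. \<bar>a l m n\<bar>) * (1 / 2) ^ m)"
  shows "\<bar>y\<bar> \<le> \<sigma> * (\<bar>lam\<bar> + 1) ^ L * (\<Sum>m. (\<Sum>l\<le>L. \<Sum>n\<le>m. \<bar>a l m n\<bar>) * (1 / 2) ^ m)"
proof -
  let ?s = "\<lambda>m. (\<Sum>l\<le>L. \<Sum>n\<le>m. a l m n * lam ^ l * w m * G n)"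
  let ?k = "\<lambda>m. (\<Sum>l\<le>L. \<Sum>n\<le>m. \<bar>a l m n\<bar>) * (1 / 2) ^ m"
  have le: "norm (?s m) \<le> \<sigma> * (\<bar>lam\<bar> + 1) ^ L * ?k m" for m
  proof -
    have one: "\<bar>a l m n * lam ^ l * w m * G n\<bar> \<le> \<bar>a l m n\<bar> * (\<sigma> * (\<bar>lam\<bar> + 1) ^ L * (1 / 2) ^ m)" if "l \<le> L" "n \<le> m" for l n
    proof -
      have "\<bar>lam\<bar> ^ l \<le> (\<bar>lam\<bar> + 1) ^ l" by (intro power_mono) auto
      also have "\<dots> \<le> (\<bar>lam\<bar> + 1) ^ L" using that by (intro power_increasing) auto
      finally have 1: "\<bar>lam\<bar> ^ l \<le> (\<bar>lam\<bar> + 1) ^ L" .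
      have "\<bar>G n\<bar> \<le> 4 ^ m" using G[of n] power_increasing[OF that(2), of "4::real"] by linarith
      then have "\<bar>w m\<bar> * \<bar>G n\<bar> \<le> (\<sigma> * t ^ m) * 4 ^ m" using w \<sigma> t by (intro mult_mono) auto
      also have "\<dots> = \<sigma> * (4 * t) ^ m" by (simp add: power_mult_distrib)
      also have "\<dots> \<le> \<sigma> * (1 / 2) ^ m" using \<sigma> t by (intro mult_left_mono power_mono) auto
      finally have "\<bar>lam\<bar> ^ l * (\<bar>w m\<bar> * \<bar>G n\<bar>) \<le> (\<bar>lam\<bar> + 1) ^ L * (\<sigma> * (1 / 2) ^ m)"
        by (rule mult_mono[OF 1]) auto
      from mult_left_mono[OF this, of "\<bar>a l m n\<bar>"] show ?thesis by (simp add: abs_mult power_abs mult_ac)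
    qed
    have "norm (?s m) \<le> (\<Sum>l\<le>L. \<Sum>n\<le>m. \<bar>a l m n * lam ^ l * w m * G n\<bar>)"
      unfolding real_norm_def by (intro order_trans[OF sum_abs] sum_mono order_refl)
    also have "\<dots> \<le> (\<Sum>l\<le>L. \<Sum>n\<le>m. \<bar>a l m n\<bar> * (\<sigma> * (\<bar>lam\<bar> + 1) ^ L * (1 / 2) ^ m))"
      using one by (intro sum_mono) auto
    also have "\<dots> = \<sigma> * (\<bar>lam\<bar> + 1) ^ L * ?k m" by (simp add: sum_distrib_right[symmetric])
    finally show ?thesis .
  qed
  have "norm (suminf ?s) \<le> (\<Sum>m. \<sigma> * (\<bar>lam\<bar> + 1) ^ L * ?k m)"
    by (rule norm_suminf_le[OF le]) (intro summable_mult sm)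
  also have "\<dots> = \<sigma> * (\<bar>lam\<bar> + 1) ^ L * (\<Sum>m. ?k m)" by (rule suminf_mult[OF sm])
  finally show ?thesis using S by (simp add: sums_iff)
qed

lemma log_power_bound: "\<exists>C\<ge>0. \<forall>y\<ge>1. (ln y + 1) ^ L \<le> C * y powr (1 / 4 :: real)"
proof -
  define e where "e = 1 / (4 * real (Suc L))"
  have e: "e > 0" "e * real L \<le> 1 / 4" by (auto simp: e_def field_simps)
  have "(ln y + 1) ^ L \<le> (1 / e + 1) ^ L * y powr (1 / 4)" if y: "y \<ge> 1" for y
  proof -
    have "ln y + 1 \<le> y powr e / e + y powr e" using ln_powr_bound[OF y e(1)] ge_one_powr_ge_zero[OF y, of e] e by simp
    also have "\<dots> = (1 / e + 1) * y powr e" by (simp add: algebra_simps)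
    finally have "(ln y + 1) ^ L \<le> ((1 / e + 1) * y powr e) ^ L" using y by (intro power_mono) auto
    also have "\<dots> = (1 / e + 1) ^ L * y powr (e * real L)" using y by (simp add: power_mult_distrib powr_realpow[symmetric] powr_powr)
    also have "\<dots> \<le> (1 / e + 1) ^ L * y powr (1 / 4)" using e y by (intro mult_left_mono powr_mono) auto
    finally show ?thesis .
  qed
  then show ?thesis using e by (intro exI[of _ "(1 / e + 1) ^ L"]) auto
qed

text \<open>For p = q = 1 both expansions start with 1 / |x| times a power of the logarithm of
  bounded degree, and \<open>log_power_bound\<close> absorbs that power into an exponent
  1/4.\<close>

lemma classC_growth:
  assumes "classC 1 1 1 f"
  obtains C where "C \<ge> 0" "\<And>x. 0 < norm x \<Longrightarrow> norm x < 1/8 \<Longrightarrow> \<bar>f x\<bar> \<le> C * norm x powr (- 1/4) / norm x"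
    "\<And>x. 8 < norm x \<Longrightarrow> \<bar>f x\<bar> \<le> C * norm x powr (1/4) / norm x"
proof -
  obtain L A B \<alpha> \<beta> a b where AB: "A > 0" "B > 0"
    and ca: "\<forall>l m n. m \<ge> 1 \<longrightarrow> \<bar>a l m n\<bar> \<le> A * real m powr \<alpha>" and cb: "\<forall>l m n. m \<ge> 1 \<longrightarrow> \<bar>b l m n\<bar> \<le> B * real m powr \<beta>"
    and sa: "\<And>z. 0 < norm z \<Longrightarrow> norm z < 1 \<Longrightarrow>
        (\<lambda>m. \<Sum>l\<le>L. \<Sum>n\<le>m. a l m n * (ln (norm z)) ^ l * norm z powr (real m - of_int 1) * gegenbauer 1 n (cosang z)) sums f z"
    and sb: "\<And>z. norm z > 1 \<Longrightarrow>
        (\<lambda>m. \<Sum>l\<le>L. \<Sum>n\<le>m. b l m n * (ln (norm z)) ^ l * norm z powr (- real m - of_int 1) * gegenbauer 1 n (cosang z)) sums f z"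
    using assms unfolding classC_def by blast
  note Sa = polynomial_coefficients_summable[OF ca AB(1), of L] and Sb = polynomial_coefficients_summable[OF cb AB(2), of L]
  define Ka where "Ka = (\<Sum>m. (\<Sum>l\<le>L. \<Sum>n\<le>m. \<bar>a l m n\<bar>) * (1 / 2) ^ m)"
  define Kb where "Kb = (\<Sum>m. (\<Sum>l\<le>L. \<Sum>n\<le>m. \<bar>b l m n\<bar>) * (1 / 2) ^ m)"
  have K: "Ka \<ge> 0" "Kb \<ge> 0" unfolding Ka_def Kb_def by (auto intro!: suminf_nonneg Sa Sb mult_nonneg_nonneg sum_nonneg)
  obtain C :: real where C: "C \<ge> 0" "\<And>y. y \<ge> 1 \<Longrightarrow> (ln y + 1) ^ L \<le> C * y powr (1 / 4)" using log_power_bound by blast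
  have "norm e1 = 1" by (simp add: e1_def)
  then have "\<bar>cosang z\<bar> \<le> 1" for z
    using Cauchy_Schwarz_ineq2[of z e1] by (auto simp: cosang_def divide_le_eq)
  then have G: "\<bar>gegenbauer 1 n (cosang z)\<bar> \<le> 4 ^ n" for n z by (rule gegenbauer_1_bound)
  show thesis
  proof
    show "C * (Ka + Kb) \<ge> 0" using C K by simp
    fix x :: "real^4"
    show "\<bar>f x\<bar> \<le> C * (Ka + Kb) * norm x powr (- 1/4) / norm x" if x: "0 < norm x" "norm x < 1/8"
    proof -
      have "\<bar>f x\<bar> \<le> 1 / norm x * (\<bar>ln (norm x)\<bar> + 1) ^ L * Ka"
        unfolding Ka_def
        by (rule gegenbauer_series_bound[where t = "norm x" and G = "\<lambda>n. gegenbauer 1 n (cosang x)", OF sa])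
          (use x G Sa in \<open>auto simp: powr_diff powr_realpow\<close>)
      also have "(\<bar>ln (norm x)\<bar> + 1) ^ L = (ln (1 / norm x) + 1) ^ L" using x by (simp add: ln_div)
      also have "1 / norm x * \<dots> * Ka \<le> 1 / norm x * (C * (1 / norm x) powr (1 / 4)) * (Ka + Kb)"
        using x K C by (intro mult_mono mult_left_mono) (auto intro!: C(2))
      also have "\<dots> = C * (Ka + Kb) * norm x powr (- 1/4) / norm x" using x by (simp add: inv_powr)
      finally show ?thesis .
    qed
    show "\<bar>f x\<bar> \<le> C * (Ka + Kb) * norm x powr (1/4) / norm x" if x: "8 < norm x"
    proof -
      have "\<bar>norm x powr (- real m - of_int 1)\<bar> \<le> 1 / norm x * (1 / norm x) ^ m" for m
      proof -
        have "x \<noteq> 0" using x by auto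
        then show ?thesis by (simp add: powr_diff powr_minus powr_realpow power_divide field_simps)
      qed
      then have "\<bar>f x\<bar> \<le> 1 / norm x * (\<bar>ln (norm x)\<bar> + 1) ^ L * Kb"
        unfolding Kb_def
        by (intro gegenbauer_series_bound[where t = "1 / norm x" and G = "\<lambda>n. gegenbauer 1 n (cosang x)", OF sb])
          (use x G Sb in \<open>auto simp: divide_le_eq\<close>)
      also have "\<dots> \<le> 1 / norm x * (C * norm x powr (1 / 4)) * (Ka + Kb)"
        using x K C(1) C(2)[of "norm x"] by (intro mult_mono mult_left_mono) auto
      finally show ?thesis by (simp add: field_simps)
    qed
  qed
qed

text \<open>The factor \<open>z - cnj z\<close> is at most twice |z| and, being unchanged when z is
  shifted by 1, at most twice |z - 1|. This cancels the denominators 1 / |x| of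
  \<open>classC_growth\<close>; the point 1 is reached through the expansion of f (e1 - x).\<close>

lemma classC_mild:
  assumes f0: "classC 1 1 1 f" and f1: "classC 1 1 1 (\<lambda>x. f (e1 - x))"
  shows "mild (- {0,1}) (1/4) (\<lambda>z. (z - cnj z) * complex_of_real (f (embC z)))"
proof -
  obtain C where C: "C \<ge> 0" "\<And>x. 0 < norm x \<Longrightarrow> norm x < 1/8 \<Longrightarrow> \<bar>f x\<bar> \<le> C * norm x powr (- 1/4) / norm x"
    "\<And>x. 8 < norm x \<Longrightarrow> \<bar>f x\<bar> \<le> C * norm x powr (1/4) / norm x" using classC_growth[OF f0] by metis
  obtain C1 where C1: "C1 \<ge> 0" "\<And>x. 0 < norm x \<Longrightarrow> norm x < 1/8 \<Longrightarrow> \<bar>f (e1 - x)\<bar> \<le> C1 * norm x powr (- 1/4) / norm x"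
    using classC_growth[OF f1] by metis
  have im: "cmod (z - cnj z) \<le> 2 * cmod z" "cmod (z - cnj z) \<le> 2 * cmod (z - 1)" for z
    using norm_triangle_ineq4[of z "cnj z"] norm_triangle_ineq4[of "z - 1" "cnj z - 1"] complex_mod_cnj[of "z - 1"] by auto
  have main: "cmod (d * complex_of_real F) \<le> 2 * K * n" if "cmod d \<le> 2 * r" "\<bar>F\<bar> \<le> K * n / r" "r > 0" for d F K n r
  proof -
    have "cmod d * \<bar>F\<bar> \<le> (2 * r) * (K * n / r)" using that by (intro mult_mono) auto
    then show ?thesis using that(3) by (simp add: norm_mult)
  qed
  have "cmod ((z - cnj z) * complex_of_real (f (embC z))) \<le> 2 * (C + C1) * nz z powr (1/4)" if z: "z \<in> Reg" for z
    using z
  proof (cases rule: Reg_cases)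
    case 1
    have "cmod ((z - cnj z) * complex_of_real (f (embC z))) \<le> 2 * C * cmod z powr (- 1/4)"
      by (rule main[OF im(1)]) (use 1 C(2)[of "embC z"] in \<open>auto simp: norm_embC\<close>)
    also have "\<dots> \<le> 2 * (C + C1) * cmod z powr (- 1/4)" using C1 by (intro mult_right_mono) auto
    finally show ?thesis using 1 by (simp add: inv_powr)
  next
    case 2
    have e: "e1 - embC z = embC (1 - z)" by (auto simp: vec_eq_iff e1_def axis_def embC_def)
    have n: "norm (embC (1 - z)) = cmod (z - 1)" by (simp add: norm_embC norm_minus_commute)
    have "f (embC z) = f (e1 - embC (1 - z))" by (simp flip: e)
    then have "cmod ((z - cnj z) * complex_of_real (f (embC z))) \<le> 2 * C1 * cmod (z - 1) powr (- 1/4)"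
      by (intro main[OF im(2)]) (use 2 C1(2)[of "embC (1 - z)"] in \<open>auto simp: n\<close>)
    also have "\<dots> \<le> 2 * (C + C1) * cmod (z - 1) powr (- 1/4)" using C by (intro mult_right_mono) auto
    finally show ?thesis using 2 by (simp add: inv_powr)
  next
    case 3
    have "cmod ((z - cnj z) * complex_of_real (f (embC z))) \<le> 2 * C * cmod z powr (1/4)"
      by (rule main[OF im(1)]) (use 3 C(3)[of "embC z"] in \<open>auto simp: norm_embC\<close>)
    also have "\<dots> \<le> 2 * (C + C1) * cmod z powr (1/4)" using C1 by (intro mult_right_mono) auto
    finally show ?thesis using 3 by simp
  qed
  then show ?thesis unfolding mild_def by (intro bdd_byI[where C = "2 * (C + C1)"]) auto
qed

section \<open>The differential equation for real-analytic functions\<close>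

lemma has_wirt_real:
  assumes "((F :: complex \<Rightarrow> real) has_derivative (\<lambda>h. Re h * x + Im h * y)) (at z)"
  shows "has_wirt (\<lambda>z. of_real (F z)) ((of_real x - \<i> * of_real y) / 2) ((of_real x + \<i> * of_real y) / 2) z"
proof -
  have "((\<lambda>z. complex_of_real (F z)) has_derivative (\<lambda>h. of_real (Re h * x + Im h * y))) (at z)"
    using assms by (rule has_derivative_of_real)
  moreover have "complex_of_real (Re h * x + Im h * y) = (of_real x - \<i> * of_real y) / 2 * h + (of_real x + \<i> * of_real y) / 2 * cnj h" for h
    by (simp add: complex_eq_iff algebra_simps add_divide_distrib diff_divide_distrib)
  ultimately show ?thesis unfolding has_wirt_def by simp
qed

lemma has_wirt_ident: "has_wirt (\<lambda>z. z) 1 0 z" and has_wirt_ident_cnj: "has_wirt cnj 0 1 z"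
proof -
  show "has_wirt (\<lambda>z. z) 1 0 z" by (simp add: has_wirt_def)
  from has_wirt_cnj[of "\<lambda>z. z" 1 0 z] show "has_wirt cnj 0 1 z" by (simp add: has_wirt_def)
qed

lemma has_wirt_Im: "has_wirt (\<lambda>z. z - cnj z) 1 (- 1) z"
  using has_wirt_diff[OF has_wirt_ident has_wirt_ident_cnj] by simp

text \<open>With z = x + i y, applying a quarter of the Laplacian to 2 i y F gives i (F_y + y (F_xx
  + F_yy) / 2). In Taylor coefficients this is the stated value, and it contains the combination of
  \<open>gf_append_edge_pde\<close> multiplied by y.\<close>

lemma psum_wirt:
  assumes P: "psum c r z0 F" and r: "r > 0"
  defines "H \<equiv> \<lambda>z. (z - cnj z) * complex_of_real (F z)"
  shows "\<exists>p q. has_wirt H p q z0"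
    and "\<exists>s. has_wirt (wirt_dzb H) (\<i> * of_real (c 0 1 + Im z0 * (c 2 0 + c 0 2))) s z0"
proof -
  obtain \<rho> Fx Fy where \<rho>: "\<rho> > 0" and Px: "psum (\<lambda>i j. real (Suc i) * c (Suc i) j) \<rho> z0 Fx"
    and Py: "psum (\<lambda>i j. real (Suc j) * c i (Suc j)) \<rho> z0 Fy"
    and D: "\<And>z. cmod (z - z0) < \<rho> \<Longrightarrow> (F has_derivative (\<lambda>h. Re h * Fx z + Im h * Fy z)) (at z)"
    using psum_derivative[OF P r] by blast
  define q where "q z = (-1) * complex_of_real (F z) + (z - cnj z) * ((of_real (Fx z) + \<i> * of_real (Fy z)) * (1 / 2))" for z
  have DH: "has_wirt H (of_real (F z) + (z - cnj z) * ((of_real (Fx z) - \<i> * of_real (Fy z)) / 2)) (q z) z" if "cmod (z - z0) < \<rho>" for z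
    using has_wirt_mult[OF has_wirt_Im has_wirt_real[OF D[OF that]]] unfolding H_def q_def by simp
  show "\<exists>p q. has_wirt H p q z0" using DH[of z0] \<rho> by auto
  obtain \<rho>x Fxx Fxy where x: "\<rho>x > 0" "psum (\<lambda>i j. real (Suc i) * (real (Suc (Suc i)) * c (Suc (Suc i)) j)) \<rho>x z0 Fxx"
      "psum (\<lambda>i j. real (Suc j) * (real (Suc i) * c (Suc i) (Suc j))) \<rho>x z0 Fxy"
      "\<And>z. cmod (z - z0) < \<rho>x \<Longrightarrow> (Fx has_derivative (\<lambda>h. Re h * Fxx z + Im h * Fxy z)) (at z)"
    using psum_derivative[OF Px \<rho>] by blast
  obtain \<rho>y Fyx Fyy where y: "\<rho>y > 0" "psum (\<lambda>i j. real (Suc i) * (real (Suc j) * c (Suc i) (Suc j))) \<rho>y z0 Fyx"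
      "psum (\<lambda>i j. real (Suc j) * (real (Suc (Suc j)) * c i (Suc (Suc j)))) \<rho>y z0 Fyy"
      "\<And>z. cmod (z - z0) < \<rho>y \<Longrightarrow> (Fy has_derivative (\<lambda>h. Re h * Fyx z + Im h * Fyy z)) (at z)"
    using psum_derivative[OF Py \<rho>] by blast
  have vals: "Fx z0 = c 1 0" "Fy z0 = c 0 1" "Fxx z0 = 2 * c 2 0" "Fxy z0 = c 1 1" "Fyx z0 = c 1 1" "Fyy z0 = 2 * c 0 2"
    using psum_center[OF Px \<rho>] psum_center[OF Py \<rho>] psum_center[OF x(2,1)] psum_center[OF x(3,1)] psum_center[OF y(2,1)] psum_center[OF y(3,1)]
    by (auto simp: numeral_2_eq_2)
  have dx: "(Fx has_derivative (\<lambda>h. Re h * (2 * c 2 0) + Im h * c 1 1)) (at z0)" using x(4)[of z0] x(1) vals by simp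
  have dy: "(Fy has_derivative (\<lambda>h. Re h * c 1 1 + Im h * (2 * c 0 2))) (at z0)" using y(4)[of z0] y(1) vals by simp
  have dF: "(F has_derivative (\<lambda>h. Re h * c 1 0 + Im h * c 0 1)) (at z0)" using D[of z0] \<rho> vals by simp
  note dFxy = has_wirt_mult[OF has_wirt_add[OF has_wirt_real[OF dx] has_wirt_cmult[OF has_wirt_real[OF dy], of \<i>]] has_wirt_const[of "1 / 2"]]
  note dq = has_wirt_add[OF has_wirt_cmult[OF has_wirt_real[OF dF], of "-1"] has_wirt_mult[OF has_wirt_Im dFxy]]
  have "\<exists>p s. has_wirt q p s z0 \<and> p = \<i> * of_real (c 0 1 + Im z0 * (c 2 0 + c 0 2))"
    unfolding q_def[abs_def]
    by (intro exI conjI, rule dq) (simp add: vals complex_eq_iff algebra_simps add_divide_distrib diff_divide_distrib)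
  then obtain s where "has_wirt q (\<i> * of_real (c 0 1 + Im z0 * (c 2 0 + c 0 2))) s z0" by blast
  then have "has_wirt (wirt_dzb H) (\<i> * of_real (c 0 1 + Im z0 * (c 2 0 + c 0 2))) s z0"
    by (rule has_wirt_transform[where S = "ball z0 \<rho>"])
      (use \<rho> has_wirt_imp(2)[OF DH] in \<open>auto simp: dist_norm norm_minus_commute\<close>)
  then show "\<exists>s. has_wirt (wirt_dzb H) (\<i> * of_real (c 0 1 + Im z0 * (c 2 0 + c 0 2))) s z0" ..
qed

lemma has_wirt_Phi_over_cnj:
  assumes "Inv c" "z \<notin> {0,1}" "b \<in> {0,1}"
  shows "\<exists>s. has_wirt (\<lambda>z. Phi c z / (cnj z - b)) (\<Sum>a\<in>{0,1}. Phi (dz a c) z / ((z - a) * (cnj z - b))) s z"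
proof -
  have nb: "cnj z - b \<noteq> 0" "z \<noteq> 0" "z \<noteq> 1" using assms(2,3) cnj_notin_01[OF assms(2)] by auto
  have "((\<lambda>w. 1 / (w - b)) has_field_derivative (- 1 / (cnj z - b)\<^sup>2)) (at (cnj z))"
    using nb by (auto intro!: derivative_eq_intros simp: power2_eq_square)
  then have "has_wirt (\<lambda>z. 1 / (cnj z - b)) 0 (- 1 / (cnj z - b)\<^sup>2) z"
    using has_wirt_cnj[of "\<lambda>w. 1 / (w - b)"] has_wirt_holomorphic by simp
  from has_wirt_mult[OF Phi_has_wirt[OF assms(1,2)] this] show ?thesis
    using nb by (intro exI) (auto simp: add_divide_distrib mult.commute elim!: back_subst[of "\<lambda>p. has_wirt _ p _ z"])
qed

lemma Phi_second_wirt: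
  assumes "Inv c" "z \<notin> {0,1}"
  shows "\<exists>s. has_wirt (wirt_dzb (Phi c)) (\<Sum>a\<in>{0,1}. \<Sum>b\<in>{0,1}. Phi (dz a (dzb b c)) z / ((z - a) * (cnj z - b))) s z"
proof -
  have "\<exists>s. \<forall>b\<in>{0,1}. has_wirt (\<lambda>z. Phi (dzb b c) z / (cnj z - b)) (\<Sum>a\<in>{0,1}. Phi (dz a (dzb b c)) z / ((z - a) * (cnj z - b))) (s b) z"
    using has_wirt_Phi_over_cnj[OF Inv_dzb[OF assms(1)] assms(2)] by (intro bchoice) blast
  then obtain s where s: "\<And>b. b \<in> {0,1} \<Longrightarrow> has_wirt (\<lambda>z. Phi (dzb b c) z / (cnj z - b)) (\<Sum>a\<in>{0,1}. Phi (dz a (dzb b c)) z / ((z - a) * (cnj z - b))) (s b) z"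
    by blast
  have "has_wirt (\<lambda>z. \<Sum>b\<in>{0,1}. Phi (dzb b c) z / (cnj z - b)) (\<Sum>b\<in>{0,1}. \<Sum>a\<in>{0,1}. Phi (dz a (dzb b c)) z / ((z - a) * (cnj z - b))) (\<Sum>b\<in>{0,1}. s b) z"
    by (rule has_wirt_sum) (use s in auto)
  then have "has_wirt (wirt_dzb (Phi c)) (\<Sum>b\<in>{0,1}. \<Sum>a\<in>{0,1}. Phi (dz a (dzb b c)) z / ((z - a) * (cnj z - b))) (\<Sum>b\<in>{0,1}. s b) z"
    by (rule has_wirt_transform[where S = "- {0,1}"]) (use assms Phi_wirt_dzb[OF assms(1)] in \<open>auto intro: open_Compl\<close>)
  then show ?thesis by (subst sum.swap) blast
qed

text \<open>Applied twice: to identify (z - cnj z) f_G1 with the polylogarithmic candidate, and to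
  identify any further solution in \<open>svB0\<close> with the same candidate.\<close>

lemma antisymmetric_Poisson_unique:
  assumes H: "\<And>z. z \<notin> {0,1} \<Longrightarrow> \<exists>p q. has_wirt H p q z" "\<And>z. z \<notin> {0,1} \<Longrightarrow> \<exists>p s. has_wirt (wirt_dzb H) p s z"
    and G: "\<And>z. z \<notin> {0,1} \<Longrightarrow> \<exists>p q. has_wirt G p q z" "\<And>z. z \<notin> {0,1} \<Longrightarrow> \<exists>p s. has_wirt (wirt_dzb G) p s z"
    and mild: "mild (- {0,1}) (1/4) H" "mild (- {0,1}) (1/4) G"
    and anti: "\<And>z. z \<notin> {0,1} \<Longrightarrow> H (cnj z) = - H z" "\<And>z. z \<notin> {0,1} \<Longrightarrow> G (cnj z) = - G z"
    and eq: "\<And>z. Im z \<noteq> 0 \<Longrightarrow> wirt_dz (wirt_dzb H) z = wirt_dz (wirt_dzb G) z"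
    and z: "z \<notin> {0,1}"
  shows "H z = G z"
proof -
  have h: "has_wirt f (wirt_dz f z) (wirt_dzb f z) z" if "\<exists>p q. has_wirt f p q z" for f z
    using that has_wirt_imp by metis
  have "H z - G z = 0"
  proof (rule antisymmetric_harmonic_zero[where D = "\<lambda>z. H z - G z" and z = z and p = "\<lambda>z. wirt_dz H z - wirt_dz G z" and q = "\<lambda>z. wirt_dzb H z - wirt_dzb G z"])
    fix z :: complex assume z: "z \<notin> {0,1}"
    show "has_wirt (\<lambda>z. H z - G z) (wirt_dz H z - wirt_dz G z) (wirt_dzb H z - wirt_dzb G z) z"
      by (intro has_wirt_diff h H G z)
    show "isCont (\<lambda>z. wirt_dzb H z - wirt_dzb G z) z"
      using has_wirt_diff[OF h[OF H(2)[OF z]] h[OF G(2)[OF z]]] by (rule has_wirt_isCont)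
    show "H (cnj z) - G (cnj z) = - (H z - G z)" using anti z by simp
  next
    fix z :: complex assume i: "Im z \<noteq> 0"
    then have z: "z \<notin> {0,1}" by auto
    from has_wirt_diff[OF h[OF H(2)[OF z]] h[OF G(2)[OF z]]]
    show "\<exists>s. has_wirt (\<lambda>z. wirt_dzb H z - wirt_dzb G z) 0 s z" using eq[OF i] by auto
  next
    show "mild (- {0,1}) (1/4) (\<lambda>z. H z - G z)"
      using mild_add[OF mild(1) mild_cmult[OF mild(2), of "-1"]] by simp
  qed (rule z)
  then show ?thesis by simp
qed

section \<open>The antisymmetric candidate built from both orders of integration\<close>

lemma swap_lift: "swap (lift a c) = liftb a (swap c)" and swap_liftb: "swap (liftb a c) = lift a (swap c)"
  by (simp_all add: liftb_def)

lemma liftb_uminus: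
  assumes "Inv c" "a \<in> {0,1}" shows "liftb a (\<lambda>u v. - c u v) = (\<lambda>u v. - liftb a c u v)"
  using lift_uminus[OF Inv_swap[OF assms(1)] assms(2)] unfolding liftb_def by (simp add: swap_def)

text \<open>Half the sum over both orders of integration makes the primitive antisymmetric under complex conjugation.\<close>
definition Qc :: "(complex \<Rightarrow> complex \<Rightarrow> complex list \<Rightarrow> complex list \<Rightarrow> complex) \<Rightarrow> complex list \<Rightarrow> complex list \<Rightarrow> complex" where
  "Qc \<kappa> = (\<lambda>u v. (- 1 / 2) * (\<Sum>a\<in>{0,1}. \<Sum>b\<in>{0,1}. lift a (liftb b (\<kappa> a b)) u v + liftb b (lift a (\<kappa> a b)) u v))"

context
  fixes \<kappa> :: "complex \<Rightarrow> complex \<Rightarrow> complex list \<Rightarrow> complex list \<Rightarrow> complex"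
  assumes I: "\<And>a b. a \<in> {0,1} \<Longrightarrow> b \<in> {0,1} \<Longrightarrow> Inv (\<kappa> a b)"
begin

lemma Inv_Qc_term: "a \<in> {0,1} \<Longrightarrow> b \<in> {0,1} \<Longrightarrow> Inv (\<lambda>u v. lift a (liftb b (\<kappa> a b)) u v + liftb b (lift a (\<kappa> a b)) u v)"
  by (intro Inv_add lift(1) Inv_liftb I)

lemma Inv_Qc: "Inv (Qc \<kappa>)"
  unfolding Qc_def by (intro Inv_scale Inv_sum Inv_Qc_term) auto

lemma Phi_Qc: "Phi (Qc \<kappa>) z = (- 1 / 2) * (\<Sum>a\<in>{0,1}. \<Sum>b\<in>{0,1}. Phi (lift a (liftb b (\<kappa> a b))) z + Phi (liftb b (lift a (\<kappa> a b))) z)"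
proof -
  have "Phi (Qc \<kappa>) z = (- 1 / 2) * Phi (\<lambda>u v. \<Sum>a\<in>{0,1}. \<Sum>b\<in>{0,1}. lift a (liftb b (\<kappa> a b)) u v + liftb b (lift a (\<kappa> a b)) u v) z"
    unfolding Qc_def by (intro Phi_scale Inv_sum Inv_Qc_term) auto
  also have "Phi (\<lambda>u v. \<Sum>a\<in>{0,1}. \<Sum>b\<in>{0,1}. lift a (liftb b (\<kappa> a b)) u v + liftb b (lift a (\<kappa> a b)) u v) z
    = (\<Sum>a\<in>{0,1}. Phi (\<lambda>u v. \<Sum>b\<in>{0,1}. lift a (liftb b (\<kappa> a b)) u v + liftb b (lift a (\<kappa> a b)) u v) z)"
    by (intro Phi_sum Inv_sum Inv_Qc_term) auto
  also have "\<dots> = (\<Sum>a\<in>{0,1}. \<Sum>b\<in>{0,1}. Phi (\<lambda>u v. lift a (liftb b (\<kappa> a b)) u v + liftb b (lift a (\<kappa> a b)) u v) z)"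
    by (intro sum.cong refl Phi_sum Inv_Qc_term) auto
  also have "\<dots> = (\<Sum>a\<in>{0,1}. \<Sum>b\<in>{0,1}. Phi (lift a (liftb b (\<kappa> a b))) z + Phi (liftb b (lift a (\<kappa> a b))) z)"
    by (intro sum.cong refl Phi_add lift(1) Inv_liftb I) auto
  finally show ?thesis .
qed

text \<open>Either order of integration has the mixed formal derivative \<open>\<kappa> a b\<close>;
  the two add up to twice that, which the factor -1/2 turns into the sign required by the
  differential equation.\<close>

lemma dz_dzb_Qc:
  assumes ab: "a \<in> {0,1}" "b \<in> {0,1}"
  shows "dz a (dzb b (Qc \<kappa>)) = (\<lambda>u v. - \<kappa> a b u v)"
proof (intro ext)
  fix u v
  have 1: "lift a' (liftb b' (\<kappa> a' b')) (b # u) (a # v) = (if a = a' \<and> b = b' then \<kappa> a b u v else 0)"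
    and 2: "liftb b' (lift a' (\<kappa> a' b')) (b # u) (a # v) = (if a = a' \<and> b = b' then \<kappa> a b u v else 0)"
    if ab': "a' \<in> {0,1}" "b' \<in> {0,1}" for a' b'
  proof -
    note k = I[OF ab']
    have B: "liftb b' c (b # u) w = (if b = b' then c u w else 0)" if "Inv c" for c w
      using fun_cong[OF fun_cong[OF dzb_liftb[OF that ab'(2), of b]], of u w] by (simp add: dzb_def split: if_splits)
    show "lift a' (liftb b' (\<kappa> a' b')) (b # u) (a # v) = (if a = a' \<and> b = b' then \<kappa> a b u v else 0)"
      using lift(2)[OF Inv_liftb[OF k ab'(2)] ab'(1)] B[OF k] by auto
    show "liftb b' (lift a' (\<kappa> a' b')) (b # u) (a # v) = (if a = a' \<and> b = b' then \<kappa> a b u v else 0)"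
      using B[OF lift(1)[OF k ab'(1)]] lift(2)[OF k ab'(1)] by auto
  qed
  have "dz a (dzb b (Qc \<kappa>)) u v = (- 1 / 2) * (\<Sum>a'\<in>{0,1}. \<Sum>b'\<in>{0,1}. if a = a' \<and> b = b' then 2 * \<kappa> a b u v else 0)"
    unfolding dz_def dzb_def Qc_def by (intro arg_cong2[of _ _ _ _ times] sum.cong refl) (simp add: 1 2)
  also have "\<dots> = - \<kappa> a b u v" using ab by auto
  finally show "dz a (dzb b (Qc \<kappa>)) u v = - \<kappa> a b u v" .
qed

text \<open>Conjugation turns \<open>lift\<close> into \<open>liftb\<close> and thereby exchanges
  the two orders of integration, together with the roles of \<open>a\<close> and \<open>b\<close>.
  Summation over both orders and over all index pairs absorbs the exchange and leaves only the sign
  of \<open>\<kappa>\<close>.\<close>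

lemma Qc_antisymmetric:
  assumes sw: "\<And>a b. a \<in> {0,1} \<Longrightarrow> b \<in> {0,1} \<Longrightarrow> swap (\<kappa> a b) = (\<lambda>u v. - \<kappa> b a u v)"
  shows "Phi (Qc \<kappa>) (cnj z) = - Phi (Qc \<kappa>) z"
proof -
  have "swap (lift a (liftb b (\<kappa> a b))) = (\<lambda>u v. - liftb a (lift b (\<kappa> b a)) u v)"
    and "swap (liftb b (lift a (\<kappa> a b))) = (\<lambda>u v. - lift b (liftb a (\<kappa> b a)) u v)" if "a \<in> {0,1}" "b \<in> {0,1}" for a b
    using that by (simp_all only: swap_lift swap_liftb sw lift_uminus liftb_uminus I lift(1) Inv_liftb)
  then have t: "lift a (liftb b (\<kappa> a b)) v u = - liftb a (lift b (\<kappa> b a)) u v"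
    "liftb b (lift a (\<kappa> a b)) v u = - lift b (liftb a (\<kappa> b a)) u v" if "a \<in> {0,1}" "b \<in> {0,1}" for a b u v
    using that by (auto simp: swap_def fun_eq_iff)
  have "swap (Qc \<kappa>) = (\<lambda>u v. (-1) * Qc \<kappa> u v)"
  proof (intro ext)
    fix u v
    have "(\<Sum>a\<in>{0,1}. \<Sum>b\<in>{0,1}. lift a (liftb b (\<kappa> a b)) v u + liftb b (lift a (\<kappa> a b)) v u)
      = (\<Sum>a\<in>{0,1}. \<Sum>b\<in>{0,1}. - liftb a (lift b (\<kappa> b a)) u v + - lift b (liftb a (\<kappa> b a)) u v)"
      by (intro sum.cong refl arg_cong2[of _ _ _ _ "(+)"] t)
    also have "\<dots> = - (\<Sum>a\<in>{0,1}. \<Sum>b\<in>{0,1}. lift a (liftb b (\<kappa> a b)) u v + liftb b (lift a (\<kappa> a b)) u v)"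
      by (subst sum.swap) (simp add: sum_negf[symmetric])
    finally show "swap (Qc \<kappa>) u v = (-1) * Qc \<kappa> u v" unfolding swap_def Qc_def by simp
  qed
  then show ?thesis using Phi_swap[OF Inv_Qc, of z] Phi_scale[OF Inv_Qc, of "-1" z] by simp
qed

end

lemma bchoice2: "\<forall>a\<in>A. \<forall>b\<in>B. \<exists>x. P a b x \<Longrightarrow> \<exists>k. \<forall>a\<in>A. \<forall>b\<in>B. P a b (k a b)"
  by metis

text \<open>Finiteness of \<open>gf_nn\<close> is stated separately because \<open>gf\<close> turns
  an infinite value into 0. The double sum over the four pole pairs is the iterated integral of the
  given partial fraction decomposition.\<close>

theorem mainTheorem13:
  fixes V :: "'v set" and E :: "('v \<times> 'v) list" and v0 v1 vz vn :: 'v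
    and g :: "complex \<Rightarrow> complex \<Rightarrow> complex \<Rightarrow> complex"
  assumes "finite V" and "v0 \<in> V" and "v1 \<in> V" and "vz \<in> V" and "distinct [v0, v1, vz]"
    and "vn \<notin> V" and "\<forall>e\<in>set E. fst e \<in> V \<and> snd e \<in> V"
    and "\<forall>z. z \<notin> {0,1} \<longrightarrow> gf_nn (insert vn V) ((vz, vn) # E) v0 v1 vn (embC z) < \<infinity>"
    and "real_analytic_on_C (\<lambda>z. gf (insert vn V) ((vz, vn) # E) v0 v1 vn (embC z)) (- {0,1})"
    and "classC 1 1 1 (\<lambda>x. gf (insert vn V) ((vz, vn) # E) v0 v1 vn x)"
    and "classC 1 1 1 (\<lambda>x. gf (insert vn V) ((vz, vn) # E) v0 v1 vn (e1 - x))"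
    and "\<forall>a\<in>{0,1}. \<forall>b\<in>{0,1}. g a b \<in> svP"
    and "\<forall>z. Im z \<noteq> 0 \<longrightarrow> gf_nn V E v0 v1 vz (embC z) < \<infinity> \<and>
           gfC V E v0 v1 vz z =
             (\<Sum>a\<in>{0,1}. \<Sum>b\<in>{0,1}. g a b z / ((z - a) * (cnj z - b) * (z - cnj z)))"
    and "gfC V E v0 v1 vz \<in> svB"
  shows "(\<forall>z. Im z \<noteq> 0 \<longrightarrow>
            gfC (insert vn V) ((vz, vn) # E) v0 v1 vn z =
              - 1 / (2 * (z - cnj z)) *
                (\<Sum>a\<in>{0,1}. \<Sum>b\<in>{0,1}.
                   prim_z a (prim_zb b (g a b)) z + prim_zb b (prim_z a (g a b)) z))
       \<and> gfC (insert vn V) ((vz, vn) # E) v0 v1 vn \<in> svB0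
       \<and> (\<forall>z. Im z \<noteq> 0 \<longrightarrow>
            pde_op (gfC (insert vn V) ((vz, vn) # E) v0 v1 vn) z = gfC V E v0 v1 vz z)
       \<and> (\<forall>F\<in>svB0. (\<forall>z. Im z \<noteq> 0 \<longrightarrow> pde_op F z = gfC V E v0 v1 vz z) \<longrightarrow>
            (\<forall>z. Im z \<noteq> 0 \<longrightarrow> F z = gfC (insert vn V) ((vz, vn) # E) v0 v1 vn z))"
proof -
  let ?V = "insert vn V" and ?E = "(vz, vn) # E"
  define f where "f z = gf V E v0 v1 vz (embC z)" for z
  define F where "F z = gf ?V ?E v0 v1 vn (embC z)" for z
  define H where "H z = (z - cnj z) * complex_of_real (F z)" for z
  have E: "\<forall>e\<in>set E. fst e \<in> V \<and> snd e \<in> V" by fact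
  have E': "\<forall>e\<in>set ?E. fst e \<in> ?V \<and> snd e \<in> ?V" using E assms(4) by auto
  have fC: "gfC V E v0 v1 vz z = of_real (f z)" and FC: "gfC ?V ?E v0 v1 vn z = of_real (F z)" for z
    by (simp_all add: gfC_def f_def F_def)
  have fcnj: "f (cnj z) = f z" and Fcnj: "F (cnj z) = F z" for z
    unfolding f_def F_def using gf_cnj[OF assms(1) E] gf_cnj[OF _ E'] assms(1) by auto

  have "\<exists>\<kappa>. \<forall>a\<in>{0,1}. \<forall>b\<in>{0,1}. Inv (\<kappa> a b) \<and> (\<forall>z. z \<notin> {0,1} \<longrightarrow> g a b z = Phi (\<kappa> a b) z)"
    using assms(12) unfolding svP_iff by (intro bchoice2)
  then obtain \<kappa> where "\<forall>a\<in>{0,1}. \<forall>b\<in>{0,1}. Inv (\<kappa> a b) \<and> (\<forall>z. z \<notin> {0,1} \<longrightarrow> g a b z = Phi (\<kappa> a b) z)" ..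
  then have \<kappa>: "\<And>a b. a \<in> {0,1} \<Longrightarrow> b \<in> {0,1} \<Longrightarrow> Inv (\<kappa> a b)"
    and g: "\<And>a b z. a \<in> {0,1} \<Longrightarrow> b \<in> {0,1} \<Longrightarrow> z \<notin> {0,1} \<Longrightarrow> g a b z = Phi (\<kappa> a b) z" by metis+
  have off: "z \<notin> {0,1}" "z - cnj z \<noteq> 0" if "Im z \<noteq> 0" for z using that by (auto simp: complex_eq_iff)
  have f_eq: "(\<Sum>a\<in>{0,1}. \<Sum>b\<in>{0,1}. Phi (\<kappa> a b) z / ((z - a) * (cnj z - b))) = (z - cnj z) * of_real (f z)" if z: "Im z \<noteq> 0" for z
  proof -
    have "of_real (f z) = (\<Sum>a\<in>{0,1}. \<Sum>b\<in>{0,1}. g a b z / ((z - a) * (cnj z - b) * (z - cnj z)))"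
      using assms(13) z by (simp flip: fC)
    also have "\<dots> = (\<Sum>a\<in>{0,1}. \<Sum>b\<in>{0,1}. Phi (\<kappa> a b) z / ((z - a) * (cnj z - b))) / (z - cnj z)"
      unfolding sum_divide_distrib by (intro sum.cong refl) (simp only: g[OF _ _ off(1)[OF z]] divide_divide_eq_left)
    finally show ?thesis using off(2)[OF z] by (simp add: field_simps)
  qed

  \<comment> \<open>The total function is antisymmetric because f takes equal values at z and
    \<open>cnj z\<close>. Conjugation also exchanges the poles \<open>a\<close> and
    \<open>b\<close>, and since the coefficients are determined by the function, antisymmetry
    descends to each pair.\<close>
  have sw: "swap (\<kappa> a b) = (\<lambda>u v. - \<kappa> b a u v)" if ab: "a \<in> {0,1}" "b \<in> {0,1}" for a b
  proof -
    define k where "k a b = (\<lambda>u v. \<kappa> a b u v + swap (\<kappa> b a) u v)" for a b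
    have "k b a = (\<lambda>u v. 0)"
    proof (rule Phi_poles_independent)
      show "Inv (k a b)" if "a \<in> {0,1}" "b \<in> {0,1}" for a b
        unfolding k_def by (intro Inv_add Inv_swap \<kappa> that)
      fix z :: complex assume z: "Im z \<noteq> 0"
      have P: "Phi (k a b) z = Phi (\<kappa> a b) z + Phi (\<kappa> b a) (cnj z)" if "a \<in> {0,1}" "b \<in> {0,1}" for a b
        unfolding k_def using that by (simp add: Phi_add Phi_swap Inv_swap \<kappa>)
      have "(\<Sum>a\<in>{0,1}. \<Sum>b\<in>{0,1}. Phi (k a b) z / ((z - a) * (cnj z - b)))
        = (\<Sum>a\<in>{0,1}. \<Sum>b\<in>{0,1}. Phi (\<kappa> a b) z / ((z - a) * (cnj z - b)))
          + (\<Sum>b\<in>{0,1}. \<Sum>a\<in>{0,1}. Phi (\<kappa> b a) (cnj z) / ((cnj z - b) * (cnj (cnj z) - a)))"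
        by (subst (3) sum.swap) (simp add: P add_divide_distrib mult.commute sum.distrib)
      also have "\<dots> = (z - cnj z) * of_real (f z) + (cnj z - cnj (cnj z)) * of_real (f (cnj z))"
        using f_eq[OF z] f_eq[of "cnj z"] z by simp
      also have "\<dots> = 0" by (simp add: fcnj algebra_simps)
      finally show "(\<Sum>a\<in>{0,1}. \<Sum>b\<in>{0,1}. Phi (k a b) z / ((z - a) * (cnj z - b))) = 0" .
    qed (use ab in auto)
    then have "\<kappa> b a u v + swap (\<kappa> a b) u v = 0" for u v unfolding k_def by meson
    then show ?thesis by (auto simp: fun_eq_iff add_eq_0_iff)
  qed

  define Q where "Q = Phi (Qc \<kappa>)"
  have IQ: "Inv (Qc \<kappa>)" by (rule Inv_Qc[OF \<kappa>])
  have Qanti: "Q (cnj z) = - Q z" for z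
    unfolding Q_def by (rule Qc_antisymmetric[OF \<kappa> sw])
  have wirtPhi: "\<exists>p q. has_wirt (Phi c) p q z" "\<exists>p s. has_wirt (wirt_dzb (Phi c)) p s z" if "Inv c" "z \<notin> {0,1}" for c z
    using Phi_has_wirt[OF that] Phi_second_wirt[OF that] by blast+
  have Qpde: "wirt_dz (wirt_dzb Q) z = - ((z - cnj z) * of_real (f z))" if z: "Im z \<noteq> 0" for z
  proof -
    obtain s where "has_wirt (wirt_dzb Q) (\<Sum>a\<in>{0,1}. \<Sum>b\<in>{0,1}. Phi (dz a (dzb b (Qc \<kappa>))) z / ((z - a) * (cnj z - b))) s z"
      using Phi_second_wirt[OF IQ off(1)[OF z]] unfolding Q_def by blast
    then have "wirt_dz (wirt_dzb Q) z = (\<Sum>a\<in>{0,1}. \<Sum>b\<in>{0,1}. Phi (dz a (dzb b (Qc \<kappa>))) z / ((z - a) * (cnj z - b)))"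
      by (rule has_wirt_imp)
    also have "\<dots> = (\<Sum>a\<in>{0,1}. \<Sum>b\<in>{0,1}. - (Phi (\<kappa> a b) z / ((z - a) * (cnj z - b))))"
    proof (intro sum.cong refl)
      fix a b :: complex assume ab: "a \<in> {0,1}" "b \<in> {0,1}"
      have "Phi (dz a (dzb b (Qc \<kappa>))) z = - Phi (\<kappa> a b) z"
        using Phi_scale[OF \<kappa>[OF ab], of "-1" z] by (subst dz_dzb_Qc[OF \<kappa> ab]) simp_all
      then show "Phi (dz a (dzb b (Qc \<kappa>))) z / ((z - a) * (cnj z - b)) = - (Phi (\<kappa> a b) z / ((z - a) * (cnj z - b)))" by simp
    qed
    also have "\<dots> = - ((z - cnj z) * of_real (f z))" unfolding f_eq[OF z, symmetric] by (simp only: sum_negf)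
    finally show ?thesis .
  qed

  \<comment> \<open>Poisson's equation at a point needs the source to be continuous there; this is
    read off from the closed form of f_G.\<close>
  have fcont: "isCont f z" if z: "Im z \<noteq> 0" for z
  proof -
    define S where "S w = (\<Sum>a\<in>{0,1}. \<Sum>b\<in>{0,1}. Phi (\<kappa> a b) w / ((w - a) * (cnj w - b)))" for w
    have "isCont S z"
      unfolding S_def
    proof (rule continuous_sum, rule continuous_sum)
      fix a b :: complex assume ab: "a \<in> {0,1}" "b \<in> {0,1}"
      show "isCont (\<lambda>w. Phi (\<kappa> a b) w / ((w - a) * (cnj w - b))) z"
        using ab off(1)[of "cnj z"] z
        by (intro continuous_divide Phi_isCont \<kappa>[OF ab] off(1)[OF z] continuous_intros) auto
    qed
    then have "isCont (\<lambda>w. Re (S w / (w - cnj w))) z"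
      by (intro isCont_Re continuous_divide continuous_intros off(2)[OF z])
    moreover have "\<forall>\<^sub>F w in nhds z. Re (S w / (w - cnj w)) = f w"
    proof -
      have "open {w. Im w \<noteq> 0}" by (intro open_Collect_neq continuous_intros)
      from eventually_nhds_in_open[OF this, of z] z have "\<forall>\<^sub>F w in nhds z. Im w \<noteq> 0" by simp
      then show ?thesis
      proof eventually_elim
        case (elim w)
        then show ?case unfolding S_def f_eq[OF elim] using off(2)[OF elim] by simp
      qed
    qed
    ultimately show ?thesis by (rule isCont_cong[THEN iffD1, rotated])
  qed
  have analytic: "\<exists>r>0. \<exists>c. psum c r z F" if "z \<notin> {0,1}" for z
    using assms(9) that unfolding real_analytic_on_C_def psum_def F_def by auto
  have wirtH: "\<exists>p q. has_wirt H p q z" "\<exists>p s. has_wirt (wirt_dzb H) p s z" if z: "z \<notin> {0,1}" for z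
  proof -
    obtain r c where "r > 0" "psum c r z F" using analytic[OF z] by blast
    from psum_wirt[OF this(2,1)] show "\<exists>p q. has_wirt H p q z" "\<exists>p s. has_wirt (wirt_dzb H) p s z"
      unfolding H_def[abs_def] by blast+
  qed
  have Hpde: "wirt_dz (wirt_dzb H) z = - ((z - cnj z) * of_real (f z))" if z: "Im z \<noteq> 0" for z
  proof -
    obtain r c where r: "r > 0" and c: "psum c r z F" using analytic[OF off(1)[OF z]] by blast
    have "f z = - (c 2 0 + c 0 2 + c 0 1 / Im z) / 2"
      unfolding f_def
      by (rule gf_append_edge_pde[OF assms(1-6) E z _ _ r])
        (use assms(8) off(1)[OF z] c fcont[OF z] in \<open>auto simp: F_def[abs_def] f_def[abs_def]\<close>)
    then have "c 0 1 + Im z * (c 2 0 + c 0 2) = - 2 * Im z * f z" using z by (simp add: field_simps)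
    moreover obtain s where "has_wirt (wirt_dzb H) (\<i> * of_real (c 0 1 + Im z * (c 2 0 + c 0 2))) s z"
      using psum_wirt(2)[OF c r] unfolding H_def[abs_def] by blast
    ultimately have "wirt_dz (wirt_dzb H) z = \<i> * of_real (- 2 * Im z * f z)" using has_wirt_imp(1) by metis
    also have "\<dots> = - ((z - cnj z) * of_real (f z))" by (simp add: complex_eq_iff)
    finally show ?thesis .
  qed
  have HQ: "H z = Q z" if "z \<notin> {0,1}" for z
  proof (rule antisymmetric_Poisson_unique[where H = H and G = Q and z = z])
    show "mild (- {0,1}) (1/4) H" unfolding H_def[abs_def] F_def by (rule classC_mild[OF assms(10,11)])
    show "mild (- {0,1}) (1/4) Q" unfolding Q_def by (rule Phi_mild[OF IQ]) simp
    show "H (cnj z) = - H z" for z by (simp add: H_def Fcnj algebra_simps)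
    show "Q (cnj z) = - Q z" for z by (rule Qanti)
    show "wirt_dz (wirt_dzb H) z = wirt_dz (wirt_dzb Q) z" if "Im z \<noteq> 0" for z
      using Hpde[OF that] Qpde[OF that] by simp
  qed (use wirtH wirtPhi[OF IQ] that in \<open>auto simp: Q_def\<close>)
  have FQ: "of_real (F z) = Q z / (z - cnj z)" if z: "Im z \<noteq> 0" for z
    using HQ[OF off(1)[OF z]] off(2)[OF z] by (simp add: H_def field_simps)

  have prims: "prim_z a (prim_zb b (g a b)) z = Phi (lift a (liftb b (\<kappa> a b))) z"
    "prim_zb b (prim_z a (g a b)) z = Phi (liftb b (lift a (\<kappa> a b))) z" if ab: "a \<in> {0,1}" "b \<in> {0,1}" for a b z
  proof -
    have "prim_zb b (g a b) = Phi (liftb b (\<kappa> a b))" by (rule prim_zb_Phi[OF ab(2) \<kappa>[OF ab] g[OF ab]])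
    then show "prim_z a (prim_zb b (g a b)) z = Phi (lift a (liftb b (\<kappa> a b))) z"
      using prim_z_Phi[OF ab(1) Inv_liftb[OF \<kappa>[OF ab] ab(2)]] by simp
    have "prim_z a (g a b) = Phi (lift a (\<kappa> a b))" by (rule prim_z_Phi[OF ab(1) \<kappa>[OF ab] g[OF ab]])
    then show "prim_zb b (prim_z a (g a b)) z = Phi (liftb b (lift a (\<kappa> a b))) z"
      using prim_zb_Phi[OF ab(2) lift(1)[OF \<kappa>[OF ab] ab(1)]] by simp
  qed
  have "gfC ?V ?E v0 v1 vn z = - 1 / (2 * (z - cnj z)) *
      (\<Sum>a\<in>{0,1}. \<Sum>b\<in>{0,1}. prim_z a (prim_zb b (g a b)) z + prim_zb b (prim_z a (g a b)) z)" if z: "Im z \<noteq> 0" for z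
  proof -
    have "Q z = (- 1 / 2) * (\<Sum>a\<in>{0,1}. \<Sum>b\<in>{0,1}. prim_z a (prim_zb b (g a b)) z + prim_zb b (prim_z a (g a b)) z)"
      unfolding Q_def
    proof (subst Phi_Qc[OF \<kappa>])
      show "(- 1 / 2) * (\<Sum>a\<in>{0,1}. \<Sum>b\<in>{0,1}. Phi (lift a (liftb b (\<kappa> a b))) z + Phi (liftb b (lift a (\<kappa> a b))) z)
        = (- 1 / 2) * (\<Sum>a\<in>{0,1}. \<Sum>b\<in>{0,1}. prim_z a (prim_zb b (g a b)) z + prim_zb b (prim_z a (g a b)) z)"
        by (intro arg_cong2[of _ _ _ _ times] sum.cong refl) (simp only: prims)
    qed
    then show ?thesis unfolding FC FQ[OF z] by simp
  qed
  moreover have "gfC ?V ?E v0 v1 vn \<in> svB0"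
    unfolding svB0_def mem_Collect_eq
  proof (intro bexI[of _ Q] conjI allI impI)
    show "Q \<in> svP" unfolding svP_iff Q_def using IQ by blast
  qed (simp_all add: Qanti FC FQ)
  moreover have "pde_op (gfC ?V ?E v0 v1 vn) z = gfC V E v0 v1 vz z" if z: "Im z \<noteq> 0" for z
  proof -
    have "(\<lambda>u. (u - cnj u) * gfC ?V ?E v0 v1 vn u) = H" by (simp add: FC H_def fun_eq_iff)
    then show ?thesis using Hpde[OF z] off(2)[OF z] by (simp add: pde_op_def fC)
  qed
  moreover have "F' z = gfC ?V ?E v0 v1 vn z"
    if F': "F' \<in> svB0" "\<forall>z. Im z \<noteq> 0 \<longrightarrow> pde_op F' z = gfC V E v0 v1 vz z" and z: "Im z \<noteq> 0" for F' z
  proof -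
    obtain c where c: "Inv c" and anti: "\<And>z. z \<notin> {0,1} \<Longrightarrow> Phi c (cnj z) = - Phi c z"
      and Fc: "\<And>z. Im z \<noteq> 0 \<Longrightarrow> F' z = Phi c z / (z - cnj z)"
    proof -
      obtain g' where g': "g' \<in> svP" "\<And>z. z \<notin> {0,1} \<Longrightarrow> g' (cnj z) = - g' z" "\<And>z. Im z \<noteq> 0 \<Longrightarrow> F' z = g' z / (z - cnj z)"
        using F'(1) unfolding svB0_def by blast
      obtain c where c: "Inv c" "\<And>z. z \<notin> {0,1} \<Longrightarrow> g' z = Phi c z" using g'(1) unfolding svP_iff by blast
      show thesis
      proof (rule that[OF c(1)])
        show "Phi c (cnj z) = - Phi c z" if "z \<notin> {0,1}" for z
          using g'(2)[OF that] c(2)[OF that] c(2)[OF cnj_notin_01[OF that]] by simp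
        show "F' z = Phi c z / (z - cnj z)" if "Im z \<noteq> 0" for z
          using g'(3)[OF that] c(2)[OF off(1)[OF that]] by simp
      qed
    qed
    have op: "open {w. Im w \<noteq> 0}" by (intro open_Collect_neq continuous_intros)
    have pde: "wirt_dz (wirt_dzb (Phi c)) z = - ((z - cnj z) * of_real (f z))" if z: "Im z \<noteq> 0" for z
    proof -
      let ?h = "\<lambda>u. (u - cnj u) * F' u"
      \<comment> \<open>\<open>F'\<close> is tied to \<open>Phi c\<close> only off the real axis.
        That set is open, so both derivatives may be computed there from \<open>Phi c\<close>; the
        real axis is covered afterwards by the regularity of \<open>Phi c\<close>.\<close>
      have 1: "wirt_dzb ?h w = wirt_dzb (Phi c) w" if w: "Im w \<noteq> 0" for w
      proof -
        have "has_wirt ?h (Phi (dz 0 c) w / w + Phi (dz 1 c) w / (w - 1)) (Phi (dzb 0 c) w / cnj w + Phi (dzb 1 c) w / (cnj w - 1)) w"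
          by (rule has_wirt_transform[OF Phi_has_wirt[OF c off(1)[OF w]] op]) (use w Fc off in auto)
        then show ?thesis using has_wirt_imp(2) Phi_wirt_dzb[OF c off(1)[OF w]] by simp
      qed
      obtain p s where ps: "has_wirt (wirt_dzb (Phi c)) p s z" using wirtPhi(2)[OF c off(1)[OF z]] by blast
      then have "has_wirt (wirt_dzb ?h) p s z"
        by (rule has_wirt_transform[OF _ op]) (use z 1 in auto)
      then have "wirt_dz (wirt_dzb ?h) z = wirt_dz (wirt_dzb (Phi c)) z" using has_wirt_imp(1) ps by metis
      moreover have "pde_op F' z = of_real (f z)" using F'(2) z by (simp add: fC)
      ultimately have "- (1 / (z - cnj z)) * wirt_dz (wirt_dzb (Phi c)) z = of_real (f z)" by (simp add: pde_op_def)
      then show ?thesis using off(2)[OF z] by (simp add: field_simps)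
    qed
    have "Phi c z = Q z"
    proof (rule antisymmetric_Poisson_unique[where H = "Phi c" and G = Q and z = z])
      show "mild (- {0,1}) (1/4) (Phi c)" "mild (- {0,1}) (1/4) Q" unfolding Q_def by (rule Phi_mild; simp add: c IQ)+
      show "wirt_dz (wirt_dzb (Phi c)) z = wirt_dz (wirt_dzb Q) z" if "Im z \<noteq> 0" for z
        using pde[OF that] Qpde[OF that] by simp
    qed (use wirtPhi[OF IQ] wirtPhi[OF c] off(1)[OF z] anti Qanti in \<open>auto simp: Q_def\<close>)
    then show ?thesis using Fc[OF z] FQ[OF z] by (simp add: FC)
  qed
  ultimately show ?thesis by blast
qed

end
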